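(* Assume the kernel $\gamma_\delta$ satisfies the kernel conditions (K) of the context and that $A$ is symmetric with $0<r\le A(\mathbf x,\mathbf y)\le R<\infty$ for $\mathbf x,\mathbf y\in\Omega\cup\Omega_\delta$. Let $f\in (S_\delta(\Omega))^\ast$, and let $u^\delta\in S_\delta(\Omega)$ be the weak solution of the nonlocal problem with right-hand side $f$ and zero boundary datum, i.e. $T_\delta[u^\delta,v]=\langle f,v\rangle$ for all $v\in S_\delta(\Omega)$. Then $$\|u^\delta\|_{S_\delta(\Omega)}\le \frac{\|f\|_{(S_\delta(\Omega))^\ast}}{r}.$$ If in addition $\|f\|_{(S_\delta(\Omega))^\ast}$ is uniformly bounded for all $\delta\in(0,\delta_0)$, and $A\in C(\overline{(\Omega\cup\Omega_\delta)^2})$ with $a(\mathbf x):=A(\mathbf x,\mathbf x)$, then $$\lim_{\delta\to0}\|u^\delta-u^0\|_{L^2(\Omega)}=0,$$ where $u^0\in H^1_0(\Omega)$ is the weak solution of $-\nabla\cdot(a\nabla u^0)=f$ in $\Omega$, $u^0=0$ on $\partial\Omega$.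
   Context: $\Omega\subset\mathbb R^d$ ($d\ge1$) is a bounded Lipschitz domain; $\Omega_\delta=\{\mathbf x\in\mathbb R^d\setminus\Omega:\mathrm{dist}(\mathbf x,\partial\Omega)<\delta\}$; $B_\delta(\mathbf x)=\{\mathbf y:|\mathbf y-\mathbf x|<\delta\}$. (K) $\gamma_\delta(|\mathbf x-\mathbf y|)=\frac1{\delta^{d+2}}\gamma_1\!\left(\frac{|\mathbf x-\mathbf y|}{\delta}\right)$, equal to $\frac{D_0}{\delta^{d+2-s}|\mathbf x-\mathbf y|^s}$ for $|\mathbf x-\mathbf y|<\delta$ and $0$ otherwise ($D_0>0$ a constant), where $\gamma_1$ is nonnegative, nonincreasing, has a singularity of order $s$ at the origin, $\mathrm{supp}(\gamma_1)\subset B_1(\mathbf 0)$ and $\int_{B_1(\mathbf 0)}\gamma_1(|\mathbf z|)|\mathbf z|^2d\mathbf z=d$. The diffusion coefficient $A\in L^\infty((\Omega\cup\Omega_\delta)^2)$ is a fixed (independent of $\delta$) real function, symmetric: $A(\mathbf x,\mathbf y)=A(\mathbf y,\mathbf x)$. Nonlocal energy space: $S_\delta(\Omega)=\{u\in L^2(\Omega\cup\Omega_\delta): \|u\|_{S_\delta(\Omega)}<\infty,\ u|_{\Omega_\delta}=0\}$, with $$\|u\|_{S_\delta(\Omega)}^2=\int_{\Omega\cup\Omega_\delta}\int_{\Omega\cup\Omega_\delta}\gamma_\delta(|\mathbf y-\mathbf x|)(u(\mathbf y)-u(\mathbf x))^2d\mathbf y\,d\mathbf x .$$ Bilinear form: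 $T_\delta[v,w]=\int_{\Omega\cup\Omega_\delta}\int_{\Omega\cup\Omega_\delta}A(\mathbf x,\mathbf y)\gamma_\delta(|\mathbf x-\mathbf y|)(v(\mathbf y)-v(\mathbf x))(w(\mathbf y)-w(\mathbf x))\,d\mathbf y\,d\mathbf x$. This is the weak form of $-\mathcal L^\delta[u]=f$ in $\Omega$, $u=0$ on $\Omega_\delta$, with $\mathcal L^\delta[u](\mathbf x)=2\int A(\mathbf x,\mathbf y)\gamma_\delta(|\mathbf x-\mathbf y|)(u(\mathbf y)-u(\mathbf x))\,d\mathbf y$. $(S_\delta(\Omega))^\ast$ is the dual with norm $\|f\|_{(S_\delta(\Omega))^\ast}=\sup_{0\ne v\in S_\delta(\Omega)}\langle f,v\rangle/\|v\|_{S_\delta(\Omega)}$, with $\langle f,v\rangle=(f,v)_{L^2(\Omega)}$ for $f\in L^2(\Omega)$. $\delta_0>0$ denotes a constant for which the (known) uniform nonlocal Poincaré inequality $\|v\|_{L^2(\Omega)}^2\le C\|v\|^2_{S_\delta(\Omega)}$ for $v\in S_\delta(\Omega)$ holds with one constant $C$ for all $0<\delta<\delta_0$; horizons satisfy $\delta\in(0,\delta_0)$. In the limit statement $f$ is one fixed datum, viewed as a functional on every $S_\delta(\Omega)$ (consistently on $C_0^\infty(\Omega)$) and on $H_0^1(\Omega)$ (functions extended by zero). *)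

theory Defs
  imports "HOL-Analysis.Analysis"
begin

section \<open>Domains\<close>

text \<open>
  A (nonempty, connected) bounded Lipschitz domain: near each boundary point it is the strict
  epigraph, in some unit direction \<open>e\<close>, of a Lipschitz function on the hyperplane orthogonal
  to \<open>e\<close>. For \<open>d = 1\<close> that hyperplane is \<open>{0}\<close>.
\<close>

definition bounded_Lipschitz_domain :: "'a::euclidean_space set \<Rightarrow> bool" where
  "bounded_Lipschitz_domain \<Omega> \<longleftrightarrow>
     open \<Omega> \<and> connected \<Omega> \<and> \<Omega> \<noteq> {} \<and> bounded \<Omega> \<and>
     (\<forall>p\<in>frontier \<Omega>. \<exists>e g L \<epsilon>. norm e = 1 \<and> 0 < \<epsilon> \<and> L-lipschitz_on {z. z \<bullet> e = 0} g \<and>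
        \<Omega> \<inter> ball p \<epsilon> = {x \<in> ball p \<epsilon>. g (x - (x \<bullet> e) *\<^sub>R e) < x \<bullet> e})"

definition collar :: "'a::euclidean_space set \<Rightarrow> real \<Rightarrow> 'a set" where
  "collar \<Omega> \<delta> = {x. x \<notin> \<Omega> \<and> infdist x (frontier \<Omega>) < \<delta>}"

definition extended_domain :: "'a::euclidean_space set \<Rightarrow> real \<Rightarrow> 'a set" where
  "extended_domain \<Omega> \<delta> = \<Omega> \<union> collar \<Omega> \<delta>"


section \<open>Lebesgue spaces\<close>

text \<open>
  Elements are represented by total functions; only their values almost everywhere
  on the underlying set matter.
\<close>

definition L2 :: "'a::euclidean_space set \<Rightarrow> ('a \<Rightarrow> 'b::euclidean_space) set" where
  "L2 D = {u. u \<in> borel_measurable (lebesgue_on D) \<and>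
              integrable (lebesgue_on D) (\<lambda>x. (norm (u x))\<^sup>2)}"

definition L2_norm :: "'a::euclidean_space set \<Rightarrow> ('a \<Rightarrow> 'b::euclidean_space) \<Rightarrow> real" where
  "L2_norm D u = sqrt (LINT x|lebesgue_on D. (norm (u x))\<^sup>2)"

definition Linf :: "'a::euclidean_space set \<Rightarrow> ('a \<Rightarrow> real) set" where
  "Linf D = {u. u \<in> borel_measurable (lebesgue_on D) \<and>
                (\<exists>M. AE x in lebesgue_on D. \<bar>u x\<bar> \<le> M)}"


section \<open>The nonlocal kernel\<close>

definition scaled_kernel :: "nat \<Rightarrow> (real \<Rightarrow> real) \<Rightarrow> real \<Rightarrow> real \<Rightarrow> real" where
  "scaled_kernel d \<gamma>1 \<delta> t = \<gamma>1 (t / \<delta>) / \<delta> ^ (d + 2)"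

text \<open>
  The kernel conditions; the type argument carries the dimension. Everything is required for
  positive distances only, since the value at distance \<open>0\<close> (where the kernel is singular) is
  immaterial. The inclusion of the support in the unit ball is read pointwise: the kernel
  vanishes at distances \<open>\<ge> 1\<close>. No range for \<open>s\<close> is imposed, but monotonicity forces \<open>0 \<le> s\<close>
  and integrability forces \<open>s < d + 2\<close>.
\<close>

definition kernel_conditions ::
  "'a::euclidean_space itself \<Rightarrow> real \<Rightarrow> real \<Rightarrow> (real \<Rightarrow> real) \<Rightarrow> bool" where
  "kernel_conditions _ D0 s \<gamma>1 \<longleftrightarrow>
     0 < D0 \<and>
     (\<forall>\<delta>>0. \<forall>t>0. scaled_kernel DIM('a) \<gamma>1 \<delta> t =
        (if t < \<delta> then D0 / (\<delta> powr (real DIM('a) + 2 - s) * t powr s) else 0)) \<and>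
     (\<forall>t>0. 0 \<le> \<gamma>1 t) \<and>
     antimono_on {0<..} \<gamma>1 \<and>
     (\<forall>t\<ge>1. \<gamma>1 t = 0) \<and>
     has_bochner_integral (lebesgue_on (ball (0::'a) 1))
       (\<lambda>z. \<gamma>1 (norm z) * (norm z)\<^sup>2) (real DIM('a))"


section \<open>The nonlocal problem\<close>

definition energy ::
  "'a::euclidean_space set \<Rightarrow> (real \<Rightarrow> real) \<Rightarrow> real \<Rightarrow> ('a \<Rightarrow> real) \<Rightarrow> ennreal" where
  "energy \<Omega> \<gamma>1 \<delta> u =
     (\<integral>\<^sup>+x. (\<integral>\<^sup>+y. ennreal (scaled_kernel DIM('a) \<gamma>1 \<delta> (norm (y - x)) * (u y - u x)\<^sup>2)
        \<partial>lebesgue_on (extended_domain \<Omega> \<delta>)) \<partial>lebesgue_on (extended_domain \<Omega> \<delta>))"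

definition S_norm ::
  "'a::euclidean_space set \<Rightarrow> (real \<Rightarrow> real) \<Rightarrow> real \<Rightarrow> ('a \<Rightarrow> real) \<Rightarrow> real" where
  "S_norm \<Omega> \<gamma>1 \<delta> u = sqrt (enn2real (energy \<Omega> \<gamma>1 \<delta> u))"

definition S_space ::
  "'a::euclidean_space set \<Rightarrow> (real \<Rightarrow> real) \<Rightarrow> real \<Rightarrow> ('a \<Rightarrow> real) set" where
  "S_space \<Omega> \<gamma>1 \<delta> =
     {u \<in> L2 (extended_domain \<Omega> \<delta>).
        energy \<Omega> \<gamma>1 \<delta> u < \<infinity> \<and> (AE x in lebesgue_on (collar \<Omega> \<delta>). u x = 0)}"

definition T_form ::
  "'a::euclidean_space set \<Rightarrow> (real \<Rightarrow> real) \<Rightarrow> ('a \<Rightarrow> 'a \<Rightarrow> real) \<Rightarrow> real \<Rightarrow>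
     ('a \<Rightarrow> real) \<Rightarrow> ('a \<Rightarrow> real) \<Rightarrow> real" where
  "T_form \<Omega> \<gamma>1 A \<delta> v w =
     (LINT x|lebesgue_on (extended_domain \<Omega> \<delta>). LINT y|lebesgue_on (extended_domain \<Omega> \<delta>).
        A x y * scaled_kernel DIM('a) \<gamma>1 \<delta> (norm (x - y)) * (v y - v x) * (w y - w x))"

text \<open>
  Bounded linear functionals on a function space \<open>V\<close> with (semi)norm \<open>N\<close>. Boundedness makes
  them insensitive to changes of the argument on null sets.
\<close>

definition bounded_functionals ::
  "('a \<Rightarrow> real) set \<Rightarrow> (('a \<Rightarrow> real) \<Rightarrow> real) \<Rightarrow> (('a \<Rightarrow> real) \<Rightarrow> real) set" where
  "bounded_functionals V N =
     {f. (\<forall>v\<in>V. \<forall>w\<in>V. f (\<lambda>x. v x + w x) = f v + f w) \<and>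
         (\<forall>c. \<forall>v\<in>V. f (\<lambda>x. c * v x) = c * f v) \<and>
         (\<exists>C. \<forall>v\<in>V. \<bar>f v\<bar> \<le> C * N v)}"

definition S_dual ::
  "'a::euclidean_space set \<Rightarrow> (real \<Rightarrow> real) \<Rightarrow> real \<Rightarrow> (('a \<Rightarrow> real) \<Rightarrow> real) set" where
  "S_dual \<Omega> \<gamma>1 \<delta> = bounded_functionals (S_space \<Omega> \<gamma>1 \<delta>) (S_norm \<Omega> \<gamma>1 \<delta>)"

definition S_dual_norm ::
  "'a::euclidean_space set \<Rightarrow> (real \<Rightarrow> real) \<Rightarrow> real \<Rightarrow> (('a \<Rightarrow> real) \<Rightarrow> real) \<Rightarrow> real" where
  "S_dual_norm \<Omega> \<gamma>1 \<delta> f =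
     (SUP v\<in>{v \<in> S_space \<Omega> \<gamma>1 \<delta>. \<not> (AE x in lebesgue_on (extended_domain \<Omega> \<delta>). v x = 0)}.
        f v / S_norm \<Omega> \<gamma>1 \<delta> v)"

definition nonlocal_weak_solution ::
  "'a::euclidean_space set \<Rightarrow> (real \<Rightarrow> real) \<Rightarrow> ('a \<Rightarrow> 'a \<Rightarrow> real) \<Rightarrow> real \<Rightarrow>
     (('a \<Rightarrow> real) \<Rightarrow> real) \<Rightarrow> ('a \<Rightarrow> real) \<Rightarrow> bool" where
  "nonlocal_weak_solution \<Omega> \<gamma>1 A \<delta> f u \<longleftrightarrow>
     u \<in> S_space \<Omega> \<gamma>1 \<delta> \<and> (\<forall>v\<in>S_space \<Omega> \<gamma>1 \<delta>. T_form \<Omega> \<gamma>1 A \<delta> u v = f v)"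

definition coefficient_conditions ::
  "'a::euclidean_space set \<Rightarrow> real \<Rightarrow> real \<Rightarrow> ('a \<Rightarrow> 'a \<Rightarrow> real) \<Rightarrow> real \<Rightarrow> bool" where
  "coefficient_conditions \<Omega> r R A \<delta> \<longleftrightarrow>
     (\<lambda>(x, y). A x y) \<in> Linf (extended_domain \<Omega> \<delta> \<times> extended_domain \<Omega> \<delta>) \<and>
     (\<forall>x\<in>extended_domain \<Omega> \<delta>. \<forall>y\<in>extended_domain \<Omega> \<delta>.
        A x y = A y x \<and> r \<le> A x y \<and> A x y \<le> R)"

text \<open>The property that characterizes an admissible bound \<open>\<delta>0\<close> for the horizon.\<close>

definition uniform_Poincare ::
  "'a::euclidean_space set \<Rightarrow> (real \<Rightarrow> real) \<Rightarrow> real \<Rightarrow> bool" where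
  "uniform_Poincare \<Omega> \<gamma>1 \<delta>0 \<longleftrightarrow>
     (\<exists>C. \<forall>\<delta>\<in>{0<..<\<delta>0}. \<forall>v\<in>S_space \<Omega> \<gamma>1 \<delta>. (L2_norm \<Omega> v)\<^sup>2 \<le> C * (S_norm \<Omega> \<gamma>1 \<delta> v)\<^sup>2)"


section \<open>The local problem\<close>

primrec Ck :: "nat \<Rightarrow> ('a::euclidean_space \<Rightarrow> real) \<Rightarrow> bool" where
  "Ck 0 f \<longleftrightarrow> continuous_on UNIV f"
| "Ck (Suc k) f \<longleftrightarrow> (\<forall>x. f differentiable (at x)) \<and>
     (\<forall>b\<in>Basis. Ck k (\<lambda>x. frechet_derivative f (at x) b))"

definition test_functions :: "'a::euclidean_space set \<Rightarrow> ('a \<Rightarrow> real) set" where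
  "test_functions \<Omega> =
     {\<phi>. (\<forall>k. Ck k \<phi>) \<and> compact (closure {x. \<phi> x \<noteq> 0}) \<and> closure {x. \<phi> x \<noteq> 0} \<subseteq> \<Omega>}"

definition is_weak_gradient ::
  "'a::euclidean_space set \<Rightarrow> ('a \<Rightarrow> real) \<Rightarrow> ('a \<Rightarrow> 'a) \<Rightarrow> bool" where
  "is_weak_gradient \<Omega> v G \<longleftrightarrow> v \<in> L2 \<Omega> \<and> G \<in> L2 \<Omega> \<and>
     (\<forall>\<phi>\<in>test_functions \<Omega>. \<forall>b\<in>Basis.
        (LINT x|lebesgue_on \<Omega>. v x * frechet_derivative \<phi> (at x) b) =
        - (LINT x|lebesgue_on \<Omega>. (G x \<bullet> b) * \<phi> x))"

definition H1 :: "'a::euclidean_space set \<Rightarrow> ('a \<Rightarrow> real) set" where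
  "H1 \<Omega> = {v. \<exists>G. is_weak_gradient \<Omega> v G}"

text \<open>The choice is immaterial: weak gradients are unique almost everywhere on \<open>\<Omega>\<close>.\<close>

definition weak_gradient :: "'a::euclidean_space set \<Rightarrow> ('a \<Rightarrow> real) \<Rightarrow> 'a \<Rightarrow> 'a" where
  "weak_gradient \<Omega> v = (SOME G. is_weak_gradient \<Omega> v G)"

definition H1_norm :: "'a::euclidean_space set \<Rightarrow> ('a \<Rightarrow> real) \<Rightarrow> real" where
  "H1_norm \<Omega> v = sqrt ((L2_norm \<Omega> v)\<^sup>2 + (L2_norm \<Omega> (weak_gradient \<Omega> v))\<^sup>2)"

definition H10 :: "'a::euclidean_space set \<Rightarrow> ('a \<Rightarrow> real) set" where
  "H10 \<Omega> = {v \<in> H1 \<Omega>. \<forall>\<epsilon>>0. \<exists>\<phi>\<in>test_functions \<Omega>. H1_norm \<Omega> (\<lambda>x. v x - \<phi> x) < \<epsilon>}"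

definition H10_dual :: "'a::euclidean_space set \<Rightarrow> (('a \<Rightarrow> real) \<Rightarrow> real) set" where
  "H10_dual \<Omega> = bounded_functionals (H10 \<Omega>) (H1_norm \<Omega>)"

definition local_weak_solution ::
  "'a::euclidean_space set \<Rightarrow> ('a \<Rightarrow> real) \<Rightarrow> (('a \<Rightarrow> real) \<Rightarrow> real) \<Rightarrow> ('a \<Rightarrow> real) \<Rightarrow> bool" where
  "local_weak_solution \<Omega> a f u \<longleftrightarrow> u \<in> H10 \<Omega> \<and>
     (\<forall>v\<in>H10 \<Omega>.
        (LINT x|lebesgue_on \<Omega>. a x * (weak_gradient \<Omega> u x \<bullet> weak_gradient \<Omega> v x)) = f v)"

text \<open>
  One datum, seen as a functional \<open>f \<delta>\<close> on each energy space and \<open>f0\<close> on \<open>H10 \<Omega>\<close>. These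
  have different domains, so \<open>one fixed datum\<close> means that they all agree on test functions
  (which, being total functions supported in \<open>\<Omega>\<close>, are already extended by zero).
\<close>

definition consistent_datum ::
  "'a::euclidean_space set \<Rightarrow> (real \<Rightarrow> real) \<Rightarrow> real \<Rightarrow>
     (real \<Rightarrow> ('a \<Rightarrow> real) \<Rightarrow> real) \<Rightarrow> (('a \<Rightarrow> real) \<Rightarrow> real) \<Rightarrow> bool" where
  "consistent_datum \<Omega> \<gamma>1 \<delta>0 f f0 \<longleftrightarrow>
     f0 \<in> H10_dual \<Omega> \<and>
     (\<forall>\<delta>\<in>{0<..<\<delta>0}. f \<delta> \<in> S_dual \<Omega> \<gamma>1 \<delta> \<and> (\<forall>\<phi>\<in>test_functions \<Omega>. f \<delta> \<phi> = f0 \<phi>))"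

end

theory Submission
  imports Defs
begin

text \<open>
  Stability is coercivity tested with the solution itself. The convergence proof avoids weak
  compactness: since \<open>T\<^sub>\<delta>\<close> is coercive, it suffices to bound, for a test function \<open>\<phi>\<close> close to
  \<open>u0\<close> in \<open>H\<^sup>1\<close>, the quantity
  \<open>T\<^sub>\<delta>[u\<^sub>\<delta> - \<phi>, u\<^sub>\<delta> - \<phi>] = f[u\<^sub>\<delta>] - 2 f[\<phi>] + T\<^sub>\<delta>[\<phi>, \<phi>]\<close>, and then to apply the nonlocal
  Poincare inequality. Taylor expansion of \<open>\<phi>\<close> and the second moments of the kernel show that
  \<open>T\<^sub>\<delta>[\<phi>, \<phi>]\<close> tends to the local form. The term \<open>f[u\<^sub>\<delta>]\<close>, where \<open>u\<^sub>\<delta>\<close> varies with \<open>\<delta>\<close>, is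
  treated by mollifying \<open>u\<^sub>\<delta>\<close> at scale \<open>\<delta>\<close> after pushing it into the domain with the help of the
  Lipschitz boundary. The energy controls both the error, which is \<open>O(\<delta>)\<close> in \<open>L\<^sup>2\<close>, and the
  gradient of the resulting test function \<open>w\<^sub>\<delta>\<close>. Moreover \<open>f\<close> is represented by the solution for
  one fixed horizon, which makes it continuous in \<open>L\<^sup>2\<close> up to a small multiple of the energy
  norm; hence \<open>f[u\<^sub>\<delta>]\<close> is close to \<open>f[w\<^sub>\<delta>]\<close>, an integral of \<open>a \<nabla>u0 \<bullet> \<nabla>w\<^sub>\<delta>\<close>, which the
  consistency of the form compares with \<open>T\<^sub>\<delta>[\<phi>, u\<^sub>\<delta>] = f[\<phi>]\<close>.
\<close>

section \<open>Square integrable functions\<close>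

text \<open>The obstacle is that nothing lives in a common space: the energy space changes with
  \<delta>, and the datum is a different functional for each horizon, tied to the others only on
  test functions. Two facts bridge the horizons. First, \<open>mod_sq v (n *\<^sub>R k)\<close> is
  at most n^2 times \<open>mod_sq v k\<close>, which exactly balances the scaling of the kernel.
  Hence the energy at one horizon controls the energy at every larger one up to a dimensional
  factor, and a family bounded at its own horizons is bounded at a fixed one. Second, smoothing
  inside the domain is bounded in energy and converges in L2. Each functional is the form against
  its own solution, so this already lets the values on test functions determine it on every function
  of finite energy. The smoothing has scale \<delta>/4 because all displacements then stay below
  \<delta>/2, where monotonicity bounds the kernel below through its profile at 1/2. In the expanded
  distance the three terms approach the same number with weights 1, -2 and 1, and this is what makes
  the distance small.\<close>

definition sqint :: "'b measure \<Rightarrow> ('b \<Rightarrow> 'c::euclidean_space) \<Rightarrow> bool" where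
  "sqint M f \<longleftrightarrow> f \<in> borel_measurable M \<and> integrable M (\<lambda>x. (norm (f x))\<^sup>2)"

text \<open>The Bochner integral of a non-integrable square defaults to 0, so this number is
  informative only together with \<open>sqint\<close>. Both notions are generic in the measure
  because they serve on \<open>lborel\<close>, on \<open>lebesgue_on\<close> and on the weighted
  space of increments.\<close>

definition l2norm :: "'b measure \<Rightarrow> ('b \<Rightarrow> 'c::euclidean_space) \<Rightarrow> real" where
  "l2norm M f = sqrt (LINT x|M. (norm (f x))\<^sup>2)"

lemma l2norm_nonneg [simp]: "0 \<le> l2norm M f"
  by (simp add: l2norm_def)

lemma l2norm_sq: "(l2norm M f)\<^sup>2 = (LINT x|M. (norm (f x))\<^sup>2)"
  by (simp add: l2norm_def)

lemma sqint_measurable: "sqint M f \<Longrightarrow> f \<in> borel_measurable M"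
  by (simp add: sqint_def)

lemma nn_integral_l2norm:
  assumes "sqint M f"
  shows "(\<integral>\<^sup>+x. ennreal ((norm (f x))\<^sup>2) \<partial>M) = ennreal ((l2norm M f)\<^sup>2)"
  using assms by (simp add: sqint_def l2norm_sq nn_integral_eq_integral)

lemma sqintI_nn:
  assumes "f \<in> borel_measurable M" "(\<integral>\<^sup>+x. ennreal ((norm (f x))\<^sup>2) \<partial>M) < \<infinity>"
  shows "sqint M f"
  using assms by (auto simp: sqint_def intro!: integrableI_nonneg)

text \<open>Estimates are carried out with nonnegative integrals, which exist without integrability;
  one finite bound then yields membership and norm together.\<close>

lemma l2norm_le_nn:
  assumes "f \<in> borel_measurable M" "(\<integral>\<^sup>+x. ennreal ((norm (f x))\<^sup>2) \<partial>M) \<le> ennreal c" "0 \<le> c"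
  shows "sqint M f" "(l2norm M f)\<^sup>2 \<le> c"
proof -
  show s: "sqint M f"
    using assms by (intro sqintI_nn) (auto intro: le_less_trans)
  show "(l2norm M f)\<^sup>2 \<le> c"
    using assms(2,3) nn_integral_l2norm[OF s] by simp
qed

lemma l2norm_enn2real:
  assumes "f \<in> borel_measurable M"
  shows "l2norm M f = sqrt (enn2real (\<integral>\<^sup>+x. ennreal ((norm (f x))\<^sup>2) \<partial>M))"
  using assms by (simp add: l2norm_def integral_eq_nn_integral)

lemma integrable_inner_sqint:
  assumes "sqint M f" "sqint M g"
  shows "integrable M (\<lambda>x. norm (f x) * norm (g x))" "integrable M (\<lambda>x. f x \<bullet> g x)"
proof -
  have [measurable]: "f \<in> borel_measurable M" "g \<in> borel_measurable M"
    using assms by (auto simp: sqint_def)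
  have i: "integrable M (\<lambda>x. (norm (f x))\<^sup>2 + (norm (g x))\<^sup>2)"
    using assms by (auto simp: sqint_def)
  have *: "a * b \<le> a\<^sup>2 + b\<^sup>2" if "0 \<le> a" "0 \<le> b" for a b :: real
  proof -
    have "2 * (a * b) \<le> a\<^sup>2 + b\<^sup>2" using sum_squares_bound[of a b] by (simp add: mult.assoc)
    moreover have "0 \<le> a * b" using that by simp
    ultimately show ?thesis by linarith
  qed
  show 1: "integrable M (\<lambda>x. norm (f x) * norm (g x))"
    by (rule Bochner_Integration.integrable_bound[OF i]) (auto intro!: AE_I2 * )
  show "integrable M (\<lambda>x. f x \<bullet> g x)"
    by (rule Bochner_Integration.integrable_bound[OF 1]) (auto intro!: AE_I2 Cauchy_Schwarz_ineq2)
qed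

text \<open>The bound is asked only almost everywhere because some coefficients, such as the defect
  between the density of the form and its diagonal approximation, are controlled only off a null set
  of the weighted measure.\<close>

lemma integrable_coeff_inner:
  assumes "sqint M f" "sqint M g" "B \<in> borel_measurable M" "AE x in M. \<bar>B x\<bar> \<le> (C::real)"
  shows "integrable M (\<lambda>x. B x * (f x \<bullet> g x))"
proof -
  have [measurable]: "f \<in> borel_measurable M" "g \<in> borel_measurable M" "B \<in> borel_measurable M"
    using assms by (auto simp: sqint_def)
  have i: "integrable M (\<lambda>x. C * (norm (f x) * norm (g x)))"
    using integrable_inner_sqint(1)[OF assms(1,2)] by auto
  show ?thesis
  proof (rule Bochner_Integration.integrable_bound[OF i])
    show "AE x in M. norm (B x * (f x \<bullet> g x)) \<le> norm (C * (norm (f x) * norm (g x)))"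
      using assms(4)
    proof eventually_elim
      case (elim x)
      have "\<bar>B x\<bar> * \<bar>f x \<bullet> g x\<bar> \<le> C * (norm (f x) * norm (g x))"
        using elim Cauchy_Schwarz_ineq2[of "f x" "g x"] by (intro mult_mono) auto
      also have "\<dots> \<le> norm (C * (norm (f x) * norm (g x)))" by simp
      finally show ?case by (simp add: abs_mult)
    qed
  qed simp
qed

lemma integral_norm_prod_le:
  fixes f g :: "'b \<Rightarrow> 'c::euclidean_space"
  assumes "sqint M f" "sqint M g"
  shows "(LINT x|M. norm (f x) * norm (g x)) \<le> l2norm M f * l2norm M g"
proof -
  have [measurable]: "f \<in> borel_measurable M" "g \<in> borel_measurable M"
    using assms by (auto simp: sqint_def)
  have i: "integrable M (\<lambda>x. norm (f x) * norm (g x))"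
    using integrable_inner_sqint(1)[OF assms] .
  have "ennreal ((LINT x|M. norm (f x) * norm (g x))\<^sup>2) = (\<integral>\<^sup>+x. ennreal (norm (f x)) * ennreal (norm (g x)) \<partial>M)\<^sup>2"
    using nn_integral_eq_integral[OF i] by (simp add: ennreal_mult ennreal_power integral_nonneg_AE)
  also have "\<dots> \<le> (\<integral>\<^sup>+x. (ennreal (norm (f x)))\<^sup>2 \<partial>M) * (\<integral>\<^sup>+x. (ennreal (norm (g x)))\<^sup>2 \<partial>M)"
    by (rule Cauchy_Schwarz_nn_integral) auto
  also have "\<dots> = ennreal ((l2norm M f * l2norm M g)\<^sup>2)"
    by (simp add: ennreal_power nn_integral_l2norm[OF assms(1)] nn_integral_l2norm[OF assms(2)] power_mult_distrib ennreal_mult)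
  finally have "(LINT x|M. norm (f x) * norm (g x))\<^sup>2 \<le> (l2norm M f * l2norm M g)\<^sup>2"
    by (simp add: ennreal_le_iff)
  then show ?thesis by (rule power2_le_imp_le) simp
qed

lemma integral_coeff_inner_le:
  assumes "sqint M f" "sqint M g" "B \<in> borel_measurable M" "AE x in M. \<bar>B x\<bar> \<le> (C::real)" "0 \<le> C"
  shows "\<bar>LINT x|M. B x * (f x \<bullet> g x)\<bar> \<le> C * (l2norm M f * l2norm M g)"
proof -
  have "\<bar>LINT x|M. B x * (f x \<bullet> g x)\<bar> \<le> (LINT x|M. \<bar>B x * (f x \<bullet> g x)\<bar>)"
    using integral_norm_bound[of M "\<lambda>x. B x * (f x \<bullet> g x)"] by simp
  also have "\<dots> \<le> (LINT x|M. C * (norm (f x) * norm (g x)))"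
  proof (rule integral_mono_AE)
    show "AE x in M. \<bar>B x * (f x \<bullet> g x)\<bar> \<le> C * (norm (f x) * norm (g x))"
      using assms(4)
    proof eventually_elim
      case (elim x)
      have "\<bar>B x\<bar> * \<bar>f x \<bullet> g x\<bar> \<le> C * (norm (f x) * norm (g x))"
        using elim Cauchy_Schwarz_ineq2[of "f x" "g x"] assms(5) by (intro mult_mono) auto
      then show ?case by (simp add: abs_mult)
    qed
  qed (use integrable_coeff_inner[OF assms(1-4)] integrable_inner_sqint(1)[OF assms(1,2)] in auto)
  also have "\<dots> \<le> C * (l2norm M f * l2norm M g)"
    using integral_norm_prod_le[OF assms(1,2)] assms(5) by (simp add: mult_left_mono)
  finally show ?thesis .
qed

lemma integral_inner_le:
  assumes "sqint M f" "sqint M g"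
  shows "\<bar>LINT x|M. f x \<bullet> g x\<bar> \<le> l2norm M f * l2norm M g"
  using integral_coeff_inner_le[OF assms, of "\<lambda>_. 1" 1] by simp

lemma sqint_cong_AE:
  assumes "sqint M f" "g \<in> borel_measurable M" "AE x in M. f x = g x"
  shows "sqint M g"
proof -
  have "integrable M (\<lambda>x. (norm (g x))\<^sup>2) \<longleftrightarrow> integrable M (\<lambda>x. (norm (f x))\<^sup>2)"
    using assms by (intro integrable_cong_AE) (auto simp: sqint_def elim: eventually_mono)
  with assms show ?thesis by (simp add: sqint_def)
qed

lemma l2norm_cong_AE:
  assumes "f \<in> borel_measurable M" "g \<in> borel_measurable M" "AE x in M. f x = g x"
  shows "l2norm M f = l2norm M g"
  unfolding l2norm_def using assms
  by (intro arg_cong[of _ _ sqrt] integral_cong_AE) (auto elim: eventually_mono)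

lemma sqint_scaleR:
  assumes "sqint M f"
  shows "sqint M (\<lambda>x. c *\<^sub>R f x)" "l2norm M (\<lambda>x. c *\<^sub>R f x) = \<bar>c\<bar> * l2norm M f"
  using assms by (auto simp: sqint_def l2norm_def power_mult_distrib real_sqrt_mult)

lemma sqint_cmult:
  fixes f :: "'b \<Rightarrow> real"
  assumes "sqint M f"
  shows "sqint M (\<lambda>x. c * f x)" "l2norm M (\<lambda>x. c * f x) = \<bar>c\<bar> * l2norm M f"
  using sqint_scaleR[OF assms, of c] by auto

lemma sqint_uminus:
  assumes "sqint M f"
  shows "sqint M (\<lambda>x. - f x)" "l2norm M (\<lambda>x. - f x) = l2norm M f"
  using assms by (auto simp: sqint_def l2norm_def)

lemma sqint_add:
  assumes "sqint M f" "sqint M g"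
  shows "sqint M (\<lambda>x. f x + g x)" "l2norm M (\<lambda>x. f x + g x) \<le> l2norm M f + l2norm M g"
proof -
  have [measurable]: "f \<in> borel_measurable M" "g \<in> borel_measurable M"
    using assms by (auto simp: sqint_def)
  have eq: "(norm (f x + g x))\<^sup>2 = (norm (f x))\<^sup>2 + 2 * (f x \<bullet> g x) + (norm (g x))\<^sup>2" for x
    by (simp add: power2_norm_eq_inner inner_simps inner_commute)
  have i: "integrable M (\<lambda>x. (norm (f x))\<^sup>2)" "integrable M (\<lambda>x. (norm (g x))\<^sup>2)" "integrable M (\<lambda>x. f x \<bullet> g x)"
    using assms integrable_inner_sqint(2)[OF assms] by (auto simp: sqint_def)
  show "sqint M (\<lambda>x. f x + g x)"
    using i unfolding sqint_def eq by auto
  have "(l2norm M (\<lambda>x. f x + g x))\<^sup>2 = (l2norm M f)\<^sup>2 + 2 * (LINT x|M. f x \<bullet> g x) + (l2norm M g)\<^sup>2"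
    unfolding l2norm_sq eq using i by simp
  also have "\<dots> \<le> (l2norm M f)\<^sup>2 + 2 * (l2norm M f * l2norm M g) + (l2norm M g)\<^sup>2"
    using integral_inner_le[OF assms] by linarith
  also have "\<dots> = (l2norm M f + l2norm M g)\<^sup>2" by (simp add: power2_sum)
  finally show "l2norm M (\<lambda>x. f x + g x) \<le> l2norm M f + l2norm M g"
    by (rule power2_le_imp_le) simp
qed

lemma sqint_diff:
  assumes "sqint M f" "sqint M g"
  shows "sqint M (\<lambda>x. f x - g x)" "l2norm M (\<lambda>x. f x - g x) \<le> l2norm M f + l2norm M g"
  using sqint_add[OF assms(1) sqint_uminus(1)[OF assms(2)]] sqint_uminus(2)[OF assms(2)] by auto

lemma l2norm_minus_commute: "l2norm M (\<lambda>x. f x - g x) = l2norm M (\<lambda>x. g x - f x)"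
  by (simp add: l2norm_def norm_minus_commute)

lemma sqint_zero [simp]: "sqint M (\<lambda>x. 0)" "l2norm M (\<lambda>x. 0) = 0"
  by (auto simp: sqint_def l2norm_def)

lemma sqint_sum:
  assumes "finite I" "\<And>i. i \<in> I \<Longrightarrow> sqint M (f i)"
  shows "sqint M (\<lambda>x. \<Sum>i\<in>I. f i x)" "l2norm M (\<lambda>x. \<Sum>i\<in>I. f i x) \<le> (\<Sum>i\<in>I. l2norm M (f i))"
proof -
  have "sqint M (\<lambda>x. \<Sum>i\<in>I. f i x) \<and> l2norm M (\<lambda>x. \<Sum>i\<in>I. f i x) \<le> (\<Sum>i\<in>I. l2norm M (f i))"
    using assms
  proof (induction I rule: finite_induct)
    case (insert i I)
    then have IH: "sqint M (\<lambda>x. \<Sum>i\<in>I. f i x)" "l2norm M (\<lambda>x. \<Sum>i\<in>I. f i x) \<le> (\<Sum>i\<in>I. l2norm M (f i))"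
      by auto
    have fi: "sqint M (f i)" using insert by auto
    show ?case using sqint_add[OF fi IH(1)] IH(2) insert.hyps by auto
  qed auto
  then show "sqint M (\<lambda>x. \<Sum>i\<in>I. f i x)" "l2norm M (\<lambda>x. \<Sum>i\<in>I. f i x) \<le> (\<Sum>i\<in>I. l2norm M (f i))"
    by auto
qed

lemma sqint_coeff:
  fixes B :: "'b \<Rightarrow> real"
  assumes "sqint M f" "B \<in> borel_measurable M" "AE x in M. \<bar>B x\<bar> \<le> C"
  shows "sqint M (\<lambda>x. B x *\<^sub>R f x)"
proof -
  have [measurable]: "f \<in> borel_measurable M" "B \<in> borel_measurable M"
    using assms by (auto simp: sqint_def)
  have i: "integrable M (\<lambda>x. C\<^sup>2 * (norm (f x))\<^sup>2)"
    using assms by (auto simp: sqint_def)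
  have "integrable M (\<lambda>x. (norm (B x *\<^sub>R f x))\<^sup>2)"
  proof (rule Bochner_Integration.integrable_bound[OF i])
    show "AE x in M. norm ((norm (B x *\<^sub>R f x))\<^sup>2) \<le> norm (C\<^sup>2 * (norm (f x))\<^sup>2)"
      using assms(3)
    proof eventually_elim
      case (elim x)
      then have "(B x)\<^sup>2 \<le> C\<^sup>2" by (simp add: abs_le_square_iff[symmetric])
      then show ?case by (simp add: power_mult_distrib mult_right_mono)
    qed
  qed simp
  then show ?thesis by (simp add: sqint_def)
qed

lemma l2norm_eq_0_AE:
  assumes "sqint M f" "l2norm M f = 0"
  shows "AE x in M. f x = 0"
  using assms integral_nonneg_eq_0_iff_AE[of M "\<lambda>x. (norm (f x))\<^sup>2"] by (auto simp: sqint_def l2norm_def)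


section \<open>Smooth functions with compact support\<close>

abbreviation pd :: "'a::euclidean_space \<Rightarrow> ('a \<Rightarrow> real) \<Rightarrow> 'a \<Rightarrow> real" where
  "pd b f x \<equiv> frechet_derivative f (at x) b"

text \<open>The recursion mentions only partial derivatives at the lower order, while the product
  rule in \<open>Ck_mult\<close> needs the function itself at that order.\<close>

lemma Ck_mono: "Ck (Suc k) f \<Longrightarrow> Ck k f"
proof (induction k arbitrary: f)
  case 0
  then show ?case
    by (auto intro!: continuous_at_imp_continuous_on differentiable_imp_continuous_within)
next
  case (Suc k)
  have "Ck k (pd b f)" if "b \<in> Basis" for b
    using Suc.prems that Ck.simps(2)[of "Suc k" f] by (intro Suc.IH) blast
  moreover have "\<forall>x. f differentiable (at x)" using Suc.prems by simp
  ultimately show ?case by (subst Ck.simps) blast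
qed

lemma Ck_continuous:
  assumes "Ck k f"
  shows "continuous_on UNIV f"
proof (cases k)
  case (Suc n)
  then have "f differentiable (at x)" for x using assms by simp
  then show ?thesis by (simp add: continuous_at_imp_continuous_on differentiable_imp_continuous_within)
qed (use assms in simp)

lemma differentiable_has_derivative:
  "f differentiable (at x) \<Longrightarrow> (f has_derivative frechet_derivative f (at x)) (at x)"
  using frechet_derivative_works by blast

lemma pd_eq:
  assumes "(f has_derivative D) (at x)"
  shows "pd b f x = D b"
  using frechet_derivative_at[OF assms] by simp

lemma has_derivative_pd:
  assumes "f differentiable (at x)"
  shows "(f has_derivative (\<lambda>h. \<Sum>b\<in>Basis. (h \<bullet> b) * pd b f x)) (at x)"
proof -
  have d: "(f has_derivative frechet_derivative f (at x)) (at x)"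
    using assms frechet_derivative_works by blast
  have l: "linear (frechet_derivative f (at x))" using assms linear_frechet_derivative by blast
  have "frechet_derivative f (at x) = (\<lambda>h. \<Sum>b\<in>Basis. (h \<bullet> b) * pd b f x)"
  proof
    fix h
    have "frechet_derivative f (at x) h = frechet_derivative f (at x) (\<Sum>b\<in>Basis. (h \<bullet> b) *\<^sub>R b)"
      by (simp add: euclidean_representation)
    then show "frechet_derivative f (at x) h = (\<Sum>b\<in>Basis. (h \<bullet> b) * pd b f x)"
      using l by (simp add: linear_sum linear_scale)
  qed
  with d show ?thesis by simp
qed

lemma Ck_const: "Ck k (\<lambda>x. c)"
proof (induction k arbitrary: c)
  case (Suc k)
  have "pd b (\<lambda>x::'a. c) = (\<lambda>x. 0)" for b
    by (rule ext, rule pd_eq[THEN trans, of _ "\<lambda>_. 0"]) auto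
  with Suc show ?case by (simp add: differentiable_const)
qed simp

lemma Ck_bounded_linear:
  assumes "bounded_linear f"
  shows "Ck k f"
proof (cases k)
  case (Suc n)
  have "pd b f = (\<lambda>x. f b)" for b
    by (rule ext, rule pd_eq) (use assms bounded_linear_imp_has_derivative in auto)
  then show ?thesis using Suc Ck_const assms bounded_linear_imp_differentiable by auto
qed (use assms linear_continuous_on in auto)

lemma Ck_add:
  assumes "Ck k f" "Ck k g"
  shows "Ck k (\<lambda>x. f x + g x)"
  using assms
proof (induction k arbitrary: f g)
  case (Suc k)
  have "pd b (\<lambda>x. f x + g x) = (\<lambda>x. pd b f x + pd b g x)" for b
    by (rule ext, rule pd_eq) (use Suc.prems in \<open>auto intro!: has_derivative_add differentiable_has_derivative\<close>)
  with Suc show ?case by (simp add: differentiable_add)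
qed (auto intro: continuous_on_add)

lemma pd_mult:
  assumes "f differentiable (at x)" "g differentiable (at x)"
  shows "pd b (\<lambda>x. f x * g x) x = f x * pd b g x + pd b f x * g x"
  by (rule pd_eq) (intro has_derivative_mult differentiable_has_derivative assms)

lemma Ck_mult:
  assumes "Ck k f" "Ck k g"
  shows "Ck k (\<lambda>x. f x * g x)"
  using assms
proof (induction k arbitrary: f g)
  case (Suc k)
  have "pd b (\<lambda>x. f x * g x) = (\<lambda>x. f x * pd b g x + pd b f x * g x)" for b
    using Suc.prems by (intro ext pd_mult) auto
  moreover have "Ck k f" "Ck k g" using Suc.prems Ck_mono by blast+
  ultimately show ?case using Suc by (simp add: Ck_add differentiable_mult)
qed (auto intro: continuous_on_mult)

lemma pd_affine:
  assumes "f differentiable (at (c *\<^sub>R (x - a)))"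
  shows "pd b (\<lambda>x. f (c *\<^sub>R (x - a))) x = c * pd b f (c *\<^sub>R (x - a))"
proof -
  have "((\<lambda>x. f (c *\<^sub>R (x - a))) has_derivative (\<lambda>h. frechet_derivative f (at (c *\<^sub>R (x - a))) (c *\<^sub>R h))) (at x)"
    by (rule has_derivative_compose[of "\<lambda>x. c *\<^sub>R (x - a)" "\<lambda>h. c *\<^sub>R h",
          OF _ differentiable_has_derivative[OF assms]])
      (auto intro!: derivative_eq_intros simp: algebra_simps)
  from pd_eq[OF this] show ?thesis
    using linear_frechet_derivative[OF assms] by (simp add: linear_scale)
qed

lemma Ck_affine:
  assumes "Ck k f"
  shows "Ck k (\<lambda>x. f (c *\<^sub>R (x - a)))"
  using assms
proof (induction k arbitrary: f)
  case 0
  then show ?case by (auto intro!: continuous_on_compose2[of UNIV f] continuous_intros)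
next
  case (Suc k)
  have "pd b (\<lambda>x. f (c *\<^sub>R (x - a))) = (\<lambda>x. c * pd b f (c *\<^sub>R (x - a)))" for b
    using Suc.prems by (intro ext pd_affine) auto
  moreover have "(\<lambda>x. f (c *\<^sub>R (x - a))) differentiable (at x)" for x
    using Suc.prems by (intro differentiable_compose[of f "\<lambda>x. c *\<^sub>R (x - a)"]) (auto intro!: derivative_intros)
  moreover have "Ck k (\<lambda>x. c * pd b f (c *\<^sub>R (x - a)))" if "b \<in> Basis" for b
    using Suc.prems that by (intro Ck_mult Ck_const Suc.IH[of "pd b f"]) auto
  ultimately show ?case by simp
qed

text \<open>Through the Stone-Weierstrass theorem this lets a merely continuous diagonal coefficient
  be replaced by a smooth one.\<close>

lemma Ck_real_polynomial:
  assumes "real_polynomial_function p"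
  shows "Ck k p"
  using assms by induction (auto intro: Ck_const Ck_bounded_linear Ck_add Ck_mult)

lemma lborel_shift:
  fixes f :: "'a::euclidean_space \<Rightarrow> 'b::{banach, second_countable_topology}"
  assumes [measurable]: "f \<in> borel_measurable borel"
  shows "(LINT x|lborel. f (x + a)) = (LINT x|lborel. f x)"
    and "integrable lborel (\<lambda>x. f (x + a)) \<longleftrightarrow> integrable lborel f"
proof -
  have d: "distr lborel borel ((+) a) = lborel" by (rule lborel_distr_plus)
  have "(LINT x|distr lborel borel ((+) a). f x) = (LINT x|lborel. f (a + x))"
    by (rule integral_distr) auto
  then show "(LINT x|lborel. f (x + a)) = (LINT x|lborel. f x)" by (simp add: d add.commute)
  have "integrable (distr lborel borel ((+) a)) f \<longleftrightarrow> integrable lborel (\<lambda>x. f (a + x))"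
    by (rule integrable_distr_eq) auto
  then show "integrable lborel (\<lambda>x. f (x + a)) \<longleftrightarrow> integrable lborel f" by (simp add: d add.commute)
qed

lemma nn_integral_shift:
  fixes f :: "'a::euclidean_space \<Rightarrow> ennreal"
  assumes [measurable]: "f \<in> borel_measurable borel"
  shows "(\<integral>\<^sup>+x. f (x + a) \<partial>lborel) = (\<integral>\<^sup>+x. f x \<partial>lborel)"
proof -
  have "(\<integral>\<^sup>+x. f x \<partial>distr lborel borel ((+) a)) = (\<integral>\<^sup>+x. f (a + x) \<partial>lborel)"
    by (rule nn_integral_distr) auto
  then show ?thesis by (simp add: lborel_distr_plus add.commute)
qed

section \<open>Test functions: supports, Taylor expansion, integration by parts\<close>

lemma test_functionsD:
  assumes "\<phi> \<in> test_functions \<Omega>"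
  shows "Ck k \<phi>" "\<phi> differentiable (at x)" "continuous_on UNIV \<phi>" "\<phi> \<in> borel_measurable borel"
    "\<phi> \<in> test_functions UNIV"
proof -
  show *: "Ck k \<phi>" for k using assms by (simp add: test_functions_def)
  show "\<phi> differentiable (at x)" using *[of "Suc 0"] by simp
  show "continuous_on UNIV \<phi>" using *[of 0] by simp
  then show "\<phi> \<in> borel_measurable borel" by (rule borel_measurable_continuous_onI)
  show "\<phi> \<in> test_functions UNIV" using assms by (simp add: test_functions_def)
qed

lemma test_functions_support:
  assumes "\<phi> \<in> test_functions \<Omega>"
  obtains K where "compact K" "K \<subseteq> \<Omega>" "\<And>x. x \<notin> K \<Longrightarrow> \<phi> x = 0"
  using assms closure_subset[of "{x. \<phi> x \<noteq> 0}"]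
  by (auto simp: test_functions_def intro!: that[of "closure {x. \<phi> x \<noteq> 0}"])

lemma test_functionsI:
  assumes "\<And>k. Ck k \<phi>" "compact K" "K \<subseteq> \<Omega>" "\<And>x. x \<notin> K \<Longrightarrow> \<phi> x = 0"
  shows "\<phi> \<in> test_functions \<Omega>"
proof -
  have "closure {x. \<phi> x \<noteq> 0} \<subseteq> K"
    using assms(2,4) by (intro closure_minimal) (auto dest: compact_imp_closed)
  moreover from this have "compact (closure {x. \<phi> x \<noteq> 0})"
    using assms(2) by (metis closed_closure compact_Int_closed inf.absorb_iff2)
  ultimately show ?thesis using assms by (auto simp: test_functions_def)
qed

lemma test_functions_ball:
  assumes "\<phi> \<in> test_functions \<Omega>"
  obtains \<rho> where "0 < \<rho>" "\<And>x. \<rho> \<le> norm x \<Longrightarrow> \<phi> x = 0"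
proof -
  obtain K where K: "compact K" "\<And>x. x \<notin> K \<Longrightarrow> \<phi> x = 0" using test_functions_support[OF assms] by metis
  then obtain B where B: "0 < B" "\<And>x. x \<in> K \<Longrightarrow> norm x \<le> B" using compact_imp_bounded bounded_pos by metis
  show ?thesis by (rule that[of "B + 1"]) (use B K in fastforce)+
qed

text \<open>Off its support the function vanishes on an open set, so the derivative vanishes there
  too and the same compact set serves.\<close>

lemma test_functions_pd:
  assumes "\<phi> \<in> test_functions \<Omega>" "b \<in> Basis"
  shows "pd b \<phi> \<in> test_functions \<Omega>"
proof -
  obtain K where K: "compact K" "K \<subseteq> \<Omega>" "\<And>x. x \<notin> K \<Longrightarrow> \<phi> x = 0"
    using test_functions_support[OF assms(1)] by metis
  show ?thesis
  proof (rule test_functionsI[OF _ K(1,2)])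
    show "Ck k (pd b \<phi>)" for k using test_functionsD(1)[OF assms(1), of "Suc k"] assms(2) by simp
    fix x assume x: "x \<notin> K"
    have o: "open (- K)" using K(1) by (simp add: compact_imp_closed open_Compl)
    have "(\<phi> has_derivative (\<lambda>h. 0)) (at x)"
    proof (rule has_derivative_transform_within_open[of "\<lambda>x. 0" _ x UNIV "- K"])
      show "((\<lambda>x. 0) has_derivative (\<lambda>h. 0)) (at x)" by simp
    qed (use o x K(3) in auto)
    then show "pd b \<phi> x = 0" by (rule pd_eq)
  qed
qed

lemma test_functions_Ck_mult:
  assumes "\<phi> \<in> test_functions \<Omega>" "\<And>k. Ck k f"
  shows "(\<lambda>x. f x * \<phi> x) \<in> test_functions \<Omega>"
proof -
  obtain K where K: "compact K" "K \<subseteq> \<Omega>" "\<And>x. x \<notin> K \<Longrightarrow> \<phi> x = 0"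
    using test_functions_support[OF assms(1)] by metis
  show ?thesis by (rule test_functionsI[OF Ck_mult K(1,2)]) (use assms K in \<open>auto simp: test_functions_def\<close>)
qed

lemma test_functions_add:
  assumes "\<phi> \<in> test_functions \<Omega>" "\<psi> \<in> test_functions \<Omega>"
  shows "(\<lambda>x. \<phi> x + \<psi> x) \<in> test_functions \<Omega>"
proof -
  obtain K where K: "compact K" "K \<subseteq> \<Omega>" "\<And>x. x \<notin> K \<Longrightarrow> \<phi> x = 0"
    using test_functions_support[OF assms(1)] by metis
  obtain L where L: "compact L" "L \<subseteq> \<Omega>" "\<And>x. x \<notin> L \<Longrightarrow> \<psi> x = 0"
    using test_functions_support[OF assms(2)] by metis
  show ?thesis
    by (rule test_functionsI[OF Ck_add compact_Un[OF K(1) L(1)]]) (use assms K L in \<open>auto simp: test_functions_def\<close>)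
qed

lemma test_functions_scale: "\<phi> \<in> test_functions \<Omega> \<Longrightarrow> (\<lambda>x. c * \<phi> x) \<in> test_functions \<Omega>"
  by (rule test_functions_Ck_mult) (auto intro: Ck_const)

lemma test_functions_zero: "(\<lambda>x. 0) \<in> test_functions \<Omega>"
  by (rule test_functionsI[of _ "{}"]) (auto intro: Ck_const)

lemma test_functions_sum:
  assumes "finite I" "\<And>i. i \<in> I \<Longrightarrow> f i \<in> test_functions \<Omega>"
  shows "(\<lambda>x. \<Sum>i\<in>I. f i x) \<in> test_functions \<Omega>"
  using assms by (induction I rule: finite_induct) (auto intro: test_functions_add test_functions_zero)

lemma test_functions_bounded:
  assumes "\<phi> \<in> test_functions \<Omega>"
  obtains C where "0 < C" "\<And>x. \<bar>\<phi> x\<bar> \<le> C"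
proof -
  obtain K where K: "compact K" "\<And>x. x \<notin> K \<Longrightarrow> \<phi> x = 0" using test_functions_support[OF assms] by metis
  have "compact (\<phi> ` K)"
    using K(1) test_functionsD(3)[OF assms] by (meson compact_continuous_image continuous_on_subset subset_UNIV)
  then obtain B where B: "0 < B" "\<And>y. y \<in> \<phi> ` K \<Longrightarrow> norm y \<le> B" using compact_imp_bounded bounded_pos by metis
  show ?thesis
  proof (rule that[OF B(1)])
    show "\<bar>\<phi> x\<bar> \<le> B" for x using B K(2)[of x] by (cases "x \<in> K") auto
  qed
qed

lemma integrable_bounded_support:
  fixes f :: "'a::euclidean_space \<Rightarrow> real"
  assumes "f \<in> borel_measurable borel" "\<And>x. \<bar>f x\<bar> \<le> C" "\<And>x. \<rho> \<le> norm x \<Longrightarrow> f x = 0"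
  shows "integrable lborel f"
proof (rule integrableI_bounded_set[where A="cball 0 \<rho>" and B=C])
  show "emeasure lborel (cball 0 \<rho> :: 'a set) < \<infinity>"
    by (rule emeasure_bounded_finite) simp
  show "AE x in lborel. x \<notin> cball 0 \<rho> \<longrightarrow> f x = 0" using assms(3) by auto
qed (use assms in auto)

lemma test_functions_integrable:
  assumes "\<phi> \<in> test_functions \<Omega>"
  shows "integrable lborel \<phi>" "sqint lborel \<phi>"
proof -
  obtain C where C: "0 < C" "\<And>x. \<bar>\<phi> x\<bar> \<le> C" using test_functions_bounded[OF assms] by blast
  obtain \<rho> where \<rho>: "0 < \<rho>" "\<And>x. \<rho> \<le> norm x \<Longrightarrow> \<phi> x = 0" using test_functions_ball[OF assms] by blast
  note m[measurable] = test_functionsD(4)[OF assms]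
  show "integrable lborel \<phi>" by (rule integrable_bounded_support[OF m C(2) \<rho>(2)])
  have "integrable lborel (\<lambda>x. (norm (\<phi> x))\<^sup>2)"
    by (rule integrable_bounded_support[where C="C\<^sup>2" and \<rho>=\<rho>]) (use C \<rho> in \<open>auto simp: abs_le_square_iff[symmetric]\<close>)
  then show "sqint lborel \<phi>" by (simp add: sqint_def)
qed

lemma test_functions_mvt:
  assumes "\<phi> \<in> test_functions \<Omega>"
  obtains t where "0 \<le> t" "t \<le> 1" "\<phi> (x + h) - \<phi> x = (\<Sum>b\<in>Basis. (h \<bullet> b) * pd b \<phi> (x + t *\<^sub>R h))"
proof -
  have "\<exists>t\<in>{0..1}. \<phi> (x + 1 *\<^sub>R h) - \<phi> (x + 0 *\<^sub>R h) = (\<lambda>s. \<Sum>b\<in>Basis. (s *\<^sub>R h \<bullet> b) * pd b \<phi> (x + t *\<^sub>R h)) (1 - 0)"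
  proof (rule mvt_very_simple)
    fix t :: real
    have 1: "((\<lambda>t. x + t *\<^sub>R h) has_derivative (\<lambda>s. s *\<^sub>R h)) (at t within {0..1})"
      by (auto intro!: derivative_eq_intros)
    show "((\<lambda>t. \<phi> (x + t *\<^sub>R h)) has_derivative (\<lambda>s. \<Sum>b\<in>Basis. (s *\<^sub>R h \<bullet> b) * pd b \<phi> (x + t *\<^sub>R h))) (at t within {0..1})"
      by (rule has_derivative_compose[OF 1 has_derivative_pd[OF test_functionsD(2)[OF assms]]])
  qed simp
  then show ?thesis using that by auto
qed

lemma test_functions_lipschitz:
  assumes "\<phi> \<in> test_functions \<Omega>"
  obtains C where "0 < C" "\<And>x h. \<bar>\<phi> (x + h) - \<phi> x\<bar> \<le> C * norm h"
proof -
  have "\<exists>C>0. \<forall>x. \<bar>pd b \<phi> x\<bar> \<le> C" if "b \<in> Basis" for b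
    using test_functions_bounded[OF test_functions_pd[OF assms that]] by metis
  then obtain C where C: "\<And>b. b \<in> Basis \<Longrightarrow> 0 < C b" "\<And>b x. b \<in> Basis \<Longrightarrow> \<bar>pd b \<phi> x\<bar> \<le> C b" by metis
  show ?thesis
  proof (rule that[of "\<Sum>b\<in>Basis. C b"])
    show "0 < (\<Sum>b\<in>Basis. C b)" using C by (auto intro!: sum_pos)
    fix x h
    obtain t where t: "\<phi> (x + h) - \<phi> x = (\<Sum>b\<in>Basis. (h \<bullet> b) * pd b \<phi> (x + t *\<^sub>R h))"
      using test_functions_mvt[OF assms] by metis
    have "\<bar>(h \<bullet> b) * pd b \<phi> (x + t *\<^sub>R h)\<bar> \<le> C b * norm h" if "b \<in> Basis" for b
      unfolding abs_mult mult.commute[of "C b"]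
      using C(2)[OF that] Basis_le_norm[OF that, of h] by (intro mult_mono) auto
    then have "\<bar>\<phi> (x + h) - \<phi> x\<bar> \<le> (\<Sum>b\<in>Basis. C b * norm h)"
      unfolding t by (intro order.trans[OF sum_abs] sum_mono)
    then show "\<bar>\<phi> (x + h) - \<phi> x\<bar> \<le> (\<Sum>b\<in>Basis. C b) * norm h" by (simp add: sum_distrib_right)
  qed
qed

text \<open>The mean value theorem moves the derivative to an intermediate point; the Lipschitz
  bound for the partial derivatives, themselves test functions, makes the remainder quadratic with a
  constant uniform in \<open>x\<close>.\<close>

lemma test_functions_taylor:
  assumes "\<phi> \<in> test_functions \<Omega>"
  obtains C where "0 < C" "\<And>x h. \<bar>\<phi> (x + h) - \<phi> x - (\<Sum>b\<in>Basis. (h \<bullet> b) * pd b \<phi> x)\<bar> \<le> C * (norm h)\<^sup>2"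
proof -
  have "\<exists>C>0. \<forall>x h. \<bar>pd b \<phi> (x + h) - pd b \<phi> x\<bar> \<le> C * norm h" if "b \<in> Basis" for b
    using test_functions_lipschitz[OF test_functions_pd[OF assms that]] by metis
  then obtain C where C: "\<And>b. b \<in> Basis \<Longrightarrow> 0 < C b"
    "\<And>b x h. b \<in> Basis \<Longrightarrow> \<bar>pd b \<phi> (x + h) - pd b \<phi> x\<bar> \<le> C b * norm h" by metis
  show ?thesis
  proof (rule that[of "\<Sum>b\<in>Basis. C b"])
    show "0 < (\<Sum>b\<in>Basis. C b)" using C by (auto intro!: sum_pos)
    fix x h
    obtain t where t: "0 \<le> t" "t \<le> 1" "\<phi> (x + h) - \<phi> x = (\<Sum>b\<in>Basis. (h \<bullet> b) * pd b \<phi> (x + t *\<^sub>R h))"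
      using test_functions_mvt[OF assms] by metis
    have eq: "\<phi> (x + h) - \<phi> x - (\<Sum>b\<in>Basis. (h \<bullet> b) * pd b \<phi> x)
        = (\<Sum>b\<in>Basis. (h \<bullet> b) * (pd b \<phi> (x + t *\<^sub>R h) - pd b \<phi> x))"
      unfolding t by (simp add: sum_subtractf right_diff_distrib)
    have "\<bar>(h \<bullet> b) * (pd b \<phi> (x + t *\<^sub>R h) - pd b \<phi> x)\<bar> \<le> C b * (norm h)\<^sup>2" if b: "b \<in> Basis" for b
    proof -
      have "\<bar>pd b \<phi> (x + t *\<^sub>R h) - pd b \<phi> x\<bar> \<le> C b * norm (t *\<^sub>R h)" by (rule C(2)[OF b])
      also have "\<dots> \<le> C b * norm h" using t C(1)[OF b] by (simp add: mult_left_le_one_le)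
      finally have "\<bar>h \<bullet> b\<bar> * \<bar>pd b \<phi> (x + t *\<^sub>R h) - pd b \<phi> x\<bar> \<le> norm h * (C b * norm h)"
        using Basis_le_norm[OF b, of h] by (intro mult_mono) auto
      then show ?thesis unfolding abs_mult power2_eq_square by (simp only: mult_ac)
    qed
    then show "\<bar>\<phi> (x + h) - \<phi> x - (\<Sum>b\<in>Basis. (h \<bullet> b) * pd b \<phi> x)\<bar> \<le> (\<Sum>b\<in>Basis. C b) * (norm h)\<^sup>2"
      unfolding eq sum_distrib_right by (intro order.trans[OF sum_abs] sum_mono)
  qed
qed

text \<open>Translation invariance kills the integral of
  \<open>\<phi> (x + t *\<^sub>R b) - \<phi> x\<close>, so the Taylor remainder alone bounds t times
  the wanted integral by a multiple of t^2; divide by t and let t tend to 0.\<close>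

lemma integral_pd_eq_0:
  assumes "\<phi> \<in> test_functions \<Omega>" "b \<in> Basis"
  shows "(LINT x|lborel. pd b \<phi> x) = 0"
proof -
  obtain C where C: "0 < C" "\<And>x h. \<bar>\<phi> (x + h) - \<phi> x - (\<Sum>b\<in>Basis. (h \<bullet> b) * pd b \<phi> x)\<bar> \<le> C * (norm h)\<^sup>2"
    using test_functions_taylor[OF assms(1)] by blast
  obtain \<rho> where \<rho>: "0 < \<rho>" "\<And>x. \<rho> \<le> norm x \<Longrightarrow> \<phi> x = 0" using test_functions_ball[OF assms(1)] by blast
  obtain \<rho>' where \<rho>': "0 < \<rho>'" "\<And>x. \<rho>' \<le> norm x \<Longrightarrow> pd b \<phi> x = 0"
    using test_functions_ball[OF test_functions_pd[OF assms]] by blast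
  \<comment> \<open>The extra 1 covers the shift: for t at most 1 and \<open>x\<close> outside this
    ball, neither \<open>x\<close> nor the shifted point meets the supports.\<close>
  define U where "U = cball (0::'a) (\<rho> + \<rho>' + 1)"
  define V where "V = measure lborel U"
  have iU: "integrable lborel (indicator U :: 'a \<Rightarrow> real)"
    unfolding U_def by (rule integrable_real_indicator) (simp, rule emeasure_bounded_finite, simp)
  note i\<phi> = test_functions_integrable(1)[OF assms(1)]
  note ipd = test_functions_integrable(1)[OF test_functions_pd[OF assms]]
  have bnd: "\<bar>LINT x|lborel. pd b \<phi> x\<bar> \<le> C * V * t" if t: "0 < t" "t \<le> 1" for t
  proof -
    have ish: "integrable lborel (\<lambda>x. \<phi> (x + t *\<^sub>R b))"
      using i\<phi> lborel_shift(2)[of \<phi> "t *\<^sub>R b"] test_functionsD(4)[OF assms(1)] by simp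
    have ei: "(LINT x|lborel. \<phi> (x + t *\<^sub>R b) - \<phi> x - t * pd b \<phi> x) = - t * (LINT x|lborel. pd b \<phi> x)"
      using i\<phi> ipd ish lborel_shift(1)[of \<phi> "t *\<^sub>R b"] test_functionsD(4)[OF assms(1)] by simp
    have "\<bar>\<phi> (x + t *\<^sub>R b) - \<phi> x - t * pd b \<phi> x\<bar> \<le> C * t\<^sup>2 * indicator U x" for x
    proof (cases "x \<in> U")
      case True
      have "(\<Sum>c\<in>Basis. (t *\<^sub>R b \<bullet> c) * pd c \<phi> x) = t * pd b \<phi> x"
        using assms(2) by (simp add: inner_Basis if_distrib[of "\<lambda>z. z * _"] if_distrib[of "\<lambda>z. _ * z"] sum.delta' cong: if_cong)
      with C(2)[of x "t *\<^sub>R b"] True assms(2) t show ?thesis by simp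
    next
      case False
      then have n: "\<rho> + \<rho>' + 1 < norm x" by (simp add: U_def)
      have "norm x \<le> norm (x + t *\<^sub>R b) + norm (t *\<^sub>R b)"
        using norm_triangle_ineq4[of "x + t *\<^sub>R b" "t *\<^sub>R b"] by simp
      then have "\<rho> \<le> norm (x + t *\<^sub>R b)" using n t assms(2) \<rho>'(1) by simp
      with n \<rho> \<rho>' show ?thesis using False by simp
    qed
    then have "\<bar>LINT x|lborel. \<phi> (x + t *\<^sub>R b) - \<phi> x - t * pd b \<phi> x\<bar> \<le> (LINT x|lborel. C * t\<^sup>2 * indicator U x)"
      using i\<phi> ipd ish iU by (intro order.trans[OF integral_abs_bound] integral_mono) auto
    then have "t * \<bar>LINT x|lborel. pd b \<phi> x\<bar> \<le> C * t\<^sup>2 * V"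
      unfolding ei using t by (simp add: abs_mult V_def U_def)
    then show ?thesis using t by (simp add: power2_eq_square mult_ac)
  qed
  have "\<bar>LINT x|lborel. pd b \<phi> x\<bar> \<le> 0"
  proof (rule tendsto_lowerbound)
    show "((\<lambda>t. C * V * t) \<longlongrightarrow> 0) (at_right 0)" by (auto intro!: tendsto_eq_intros)
    show "\<forall>\<^sub>F t in at_right 0. \<bar>LINT x|lborel. pd b \<phi> x\<bar> \<le> C * V * t"
      unfolding eventually_at_right_field by (intro exI[of _ 1]) (use bnd in auto)
  qed simp
  then show ?thesis by simp
qed

text \<open>Only one factor has compact support; the product inherits it, and
  \<open>integral_pd_eq_0\<close> applies to the product.\<close>

lemma integral_pd_by_parts:
  assumes "\<phi> \<in> test_functions \<Omega>" "b \<in> Basis" "\<And>k. Ck k f"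
  shows "(LINT x|lborel. f x * pd b \<phi> x) = - (LINT x|lborel. pd b f x * \<phi> x)"
proof -
  have t: "(\<lambda>x. f x * \<phi> x) \<in> test_functions \<Omega>" by (rule test_functions_Ck_mult) (use assms in auto)
  have Cpd: "Ck k (pd b f)" for k using assms(3)[of "Suc k"] assms(2) by simp
  have fd: "f differentiable (at x)" for x using assms(3)[of "Suc 0"] by simp
  have i1: "integrable lborel (\<lambda>x. f x * pd b \<phi> x)"
    by (rule test_functions_integrable[OF test_functions_Ck_mult[OF test_functions_pd[OF assms(1,2)]]]) (use assms in auto)
  have i2: "integrable lborel (\<lambda>x. pd b f x * \<phi> x)"
    by (rule test_functions_integrable[OF test_functions_Ck_mult[OF assms(1) Cpd]])
  have "0 = (LINT x|lborel. pd b (\<lambda>x. f x * \<phi> x) x)" using integral_pd_eq_0[OF t assms(2)] by simp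
  also have "\<dots> = (LINT x|lborel. f x * pd b \<phi> x + pd b f x * \<phi> x)"
    by (intro Bochner_Integration.integral_cong pd_mult fd test_functionsD(2)[OF assms(1)] refl)
  also have "\<dots> = (LINT x|lborel. f x * pd b \<phi> x) + (LINT x|lborel. pd b f x * \<phi> x)"
    using i1 i2 by simp
  finally show ?thesis by simp
qed

text \<open>The classical exp(-1/t) times powers of 1/t. The span of this family is closed under
  differentiation, which turns smoothness of the bump into one induction.\<close>

definition flat :: "nat \<Rightarrow> real \<Rightarrow> real" where
  "flat k t = (if 0 < t then exp (- inverse t) * inverse t ^ k else 0)"

lemma flat_tendsto_0: "(flat k \<longlongrightarrow> 0) (at 0)"
proof (rule filterlim_split_at)
  show "(flat k \<longlongrightarrow> 0) (at_left 0)"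
    by (rule tendsto_eventually) (auto simp: flat_def eventually_at_left_field intro!: exI[of _ "-1"])
  have "((\<lambda>x::real. x ^ k / exp x) \<longlongrightarrow> 0) at_top" by (rule tendsto_power_div_exp_0)
  then have "((\<lambda>t. inverse t ^ k / exp (inverse t)) \<longlongrightarrow> (0::real)) (at_right 0)"
    by (rule filterlim_compose[OF _ filterlim_inverse_at_top_right])
  then show "(flat k \<longlongrightarrow> 0) (at_right 0)"
    by (rule Lim_transform_eventually)
      (auto simp: flat_def exp_minus field_simps eventually_at_right_field intro!: exI[of _ 1])
qed

lemma flat_deriv: "(flat k has_real_derivative (flat (k + 2) t - k * flat (k + 1) t)) (at t)"
proof -
  consider "t > 0" | "t < 0" | "t = 0" by linarith
  then show ?thesis
  proof cases
    case 1
    have p: "((\<lambda>t. inverse t ^ k) has_real_derivative (- real k * inverse t ^ (k + 1))) (at t)"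
    proof (induction k)
      case (Suc k)
      have "((\<lambda>t. inverse t * inverse t ^ k) has_real_derivative
          (- (inverse t * inverse t)) * inverse t ^ k + (- real k * inverse t ^ (k + 1)) * inverse t) (at t)"
        by (rule DERIV_mult[OF _ Suc]) (use 1 in \<open>auto intro!: derivative_eq_intros simp: power2_eq_square\<close>)
      then show ?case by (simp add: algebra_simps)
    qed simp
    have e: "((\<lambda>t. exp (- inverse t)) has_real_derivative exp (- inverse t) * (inverse t * inverse t)) (at t)"
      using 1 by (auto intro!: derivative_eq_intros simp: power2_eq_square)
    have "((\<lambda>t. exp (- inverse t) * inverse t ^ k) has_real_derivative (flat (k + 2) t - k * flat (k + 1) t)) (at t)"
      using DERIV_mult[OF e p] 1 by (simp add: flat_def algebra_simps)
    then show ?thesis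
      by (rule has_field_derivative_transform_within_open[where S="{0<..}"]) (use 1 in \<open>auto simp: flat_def\<close>)
  next
    case 2
    have "((\<lambda>t. 0) has_real_derivative (flat (k + 2) t - k * flat (k + 1) t)) (at t)"
      using 2 by (auto simp: flat_def)
    then show ?thesis
      by (rule has_field_derivative_transform_within_open[where S="{..<0}"]) (use 2 in \<open>auto simp: flat_def\<close>)
  next
    case 3
    \<comment> \<open>At 0 the difference quotient of one member is literally the next member, so
      its limit is \<open>flat_tendsto_0\<close>.\<close>
    have "(flat k (0 + h) - flat k 0) / h = flat (k + 1) h" for h by (simp add: flat_def field_simps)
    moreover have "flat (k + 2) 0 - k * flat (k + 1) 0 = 0" by (simp add: flat_def)
    ultimately show ?thesis
      using flat_tendsto_0[of "k + 1"] unfolding 3 DERIV_def by (simp only:)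
  qed
qed

text \<open>The induction is over all \<open>k\<close> at once since differentiation raises the
  index. The argument \<open>1 - x \<bullet> x\<close> is positive exactly on the open unit
  ball.\<close>

lemma Ck_flat: "Ck n (\<lambda>x::'a::euclidean_space. flat k (1 - x \<bullet> x))"
proof (induction n arbitrary: k)
  case 0
  have "isCont (flat k) t" for t using flat_deriv by (rule DERIV_isCont)
  then have c: "continuous_on UNIV (flat k)" by (simp add: continuous_at_imp_continuous_on)
  have "continuous_on UNIV (\<lambda>x::'a. 1 - x \<bullet> x)" by (intro continuous_intros)
  from continuous_on_compose2[OF c this] show ?case by simp
next
  case (Suc n)
  have der: "((\<lambda>x::'a. flat k (1 - x \<bullet> x)) has_derivative
      (\<lambda>h. (flat (k + 2) (1 - x \<bullet> x) - k * flat (k + 1) (1 - x \<bullet> x)) * (- 2 * (x \<bullet> h)))) (at x)" for x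
  proof -
    have 1: "((\<lambda>x. 1 - x \<bullet> x) has_derivative (\<lambda>h. - 2 * (x \<bullet> h))) (at x)"
      by (auto intro!: derivative_eq_intros simp: inner_commute)
    show ?thesis
      by (rule has_derivative_compose[OF 1 flat_deriv[unfolded has_field_derivative_def]])
  qed
  have pd: "pd b (\<lambda>x::'a. flat k (1 - x \<bullet> x)) =
      (\<lambda>x. (flat (k + 2) (1 - x \<bullet> x) + - real k * flat (k + 1) (1 - x \<bullet> x)) * (- 2 * (x \<bullet> b)))" for b
    by (rule ext, subst pd_eq[OF der]) simp
  have l: "Ck n (\<lambda>x::'a. x \<bullet> b)" for b by (rule Ck_bounded_linear) (rule bounded_linear_inner_left)
  show ?case unfolding Ck.simps pd
    by (intro conjI allI ballI Ck_mult Ck_add Suc.IH Ck_const l) (use der differentiable_def in blast)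
qed

lemma exists_bump:
  obtains \<rho> :: "'a::euclidean_space \<Rightarrow> real"
  where "\<And>k. Ck k \<rho>" "\<And>x. 0 \<le> \<rho> x" "\<And>x. 1 \<le> norm x \<Longrightarrow> \<rho> x = 0" "(LINT x|lborel. \<rho> x) = 1"
    "\<rho> \<in> test_functions UNIV"
proof -
  define f where "f = (\<lambda>x::'a. flat 0 (1 - x \<bullet> x))"
  have 1: "Ck k f" for k unfolding f_def by (rule Ck_flat)
  have nn: "0 \<le> f x" for x by (simp add: f_def flat_def)
  have z: "f x = 0" if "1 \<le> norm x" for x
  proof -
    have "1 \<le> x \<bullet> x" using that one_le_power[OF that, of 2] by (simp only: dot_square_norm)
    then show ?thesis by (simp add: f_def flat_def)
  qed
  have pos: "0 < f x" if "norm x < 1" for x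
  proof -
    have "x \<bullet> x < 1" using that by (simp add: dot_square_norm abs_square_less_1)
    then show ?thesis by (simp add: f_def flat_def)
  qed
  have tf: "f \<in> test_functions UNIV"
    by (rule test_functionsI[where K="cball 0 1"]) (use 1 z in auto)
  have i: "integrable lborel f" by (rule test_functions_integrable[OF tf])
  define Z where "Z = (LINT x|lborel. f x)"
  \<comment> \<open>Normalising is possible because \<open>f\<close> is positive on the open unit
    ball, a set of positive measure.\<close>
  have "Z \<noteq> 0"
  proof
    assume "Z = 0"
    then have "AE x in lborel. f x = 0"
      using integral_nonneg_eq_0_iff_AE[OF i] nn by (simp add: Z_def)
    then have "AE x in lborel. x \<notin> ball (0::'a) 1" by eventually_elim (use pos in force)
    then have "emeasure lborel (ball (0::'a) 1) = 0"
      by (subst (asm) AE_iff_measurable[of "ball 0 1"]) auto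
    then show False using content_ball_pos[of 1 "0::'a"] by (simp add: measure_def)
  qed
  moreover have "0 \<le> Z" unfolding Z_def by (rule integral_nonneg_AE) (use nn in auto)
  ultimately have Z: "0 < Z" by simp
  show ?thesis
  proof (rule that[of "\<lambda>x. (1 / Z) * f x"])
    show "Ck k (\<lambda>x. (1 / Z) * f x)" for k by (intro Ck_mult Ck_const 1)
    show "(LINT x|lborel. (1 / Z) * f x) = 1" using Z by (simp add: Z_def)
    show "(\<lambda>x. (1 / Z) * f x) \<in> test_functions UNIV" by (rule test_functions_scale[OF tf])
  qed (use nn z Z in auto)
qed

section \<open>Symmetries of Lebesgue measure\<close>

lemma nn_integral_scale:
  fixes f :: "'a::euclidean_space \<Rightarrow> ennreal"
  assumes [measurable]: "f \<in> borel_measurable borel" and c: "c \<noteq> 0"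
  shows "(\<integral>\<^sup>+x. f x \<partial>lborel) = ennreal (\<bar>c\<bar> ^ DIM('a)) * (\<integral>\<^sup>+x. f (c *\<^sub>R x) \<partial>lborel)"
proof -
  have "(\<integral>\<^sup>+x. f x \<partial>lborel) = (\<integral>\<^sup>+x. f x \<partial>density (distr lborel borel (\<lambda>x. 0 + c *\<^sub>R x)) (\<lambda>_. ennreal (\<bar>c\<bar> ^ DIM('a))))"
    using lborel_affine[OF c, of "0::'a"] by simp
  also have "\<dots> = (\<integral>\<^sup>+x. ennreal (\<bar>c\<bar> ^ DIM('a)) * f x \<partial>distr lborel borel (\<lambda>x. 0 + c *\<^sub>R x))"
    by (rule nn_integral_density) auto
  also have "\<dots> = (\<integral>\<^sup>+x. ennreal (\<bar>c\<bar> ^ DIM('a)) * f (c *\<^sub>R x) \<partial>lborel)"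
    by (subst nn_integral_distr) auto
  also have "\<dots> = ennreal (\<bar>c\<bar> ^ DIM('a)) * (\<integral>\<^sup>+x. f (c *\<^sub>R x) \<partial>lborel)"
    by (rule nn_integral_cmult) auto
  finally show ?thesis .
qed

text \<open>Used on the second moments of a radial kernel: reflecting one coordinate kills the mixed
  moments.\<close>

definition reflect :: "'a::euclidean_space \<Rightarrow> 'a \<Rightarrow> 'a" where
  "reflect b x = x - (2 * (x \<bullet> b)) *\<^sub>R b"

text \<open>The isometry that exchanges the coordinates along \<open>b\<close> and \<open>c\<close>,
  and the identity for \<open>b = c\<close>. It makes the pure second moments of a radial kernel
  equal.\<close>

definition coord_swap :: "'a::euclidean_space \<Rightarrow> 'a \<Rightarrow> 'a \<Rightarrow> 'a" where
  "coord_swap b c x = x + (x \<bullet> c - x \<bullet> b) *\<^sub>R (b - c)"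

lemma reflect_inner:
  assumes "b \<in> Basis" "j \<in> Basis"
  shows "reflect b x \<bullet> j = (if j = b then - (x \<bullet> j) else x \<bullet> j)"
  using assms by (auto simp: reflect_def inner_simps inner_Basis)

lemma coord_swap_inner:
  assumes "b \<in> Basis" "c \<in> Basis" "j \<in> Basis"
  shows "coord_swap b c x \<bullet> j = x \<bullet> (if j = b then c else if j = c then b else j)"
  using assms by (auto simp: coord_swap_def inner_simps inner_Basis)

lemma norm_reflect:
  assumes "b \<in> Basis"
  shows "norm (reflect b x) = norm x"
proof -
  have "reflect b x \<bullet> reflect b x = x \<bullet> x - 4 * (x \<bullet> b) * (x \<bullet> b) + 4 * (x \<bullet> b) * (x \<bullet> b) * (b \<bullet> b)"
    unfolding reflect_def by (simp add: inner_diff_left inner_diff_right inner_commute[of b x] right_diff_distrib)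
  then show ?thesis using assms by (simp add: norm_eq inner_Basis)
qed

lemma norm_coord_swap:
  assumes "b \<in> Basis" "c \<in> Basis"
  shows "norm (coord_swap b c x) = norm x"
proof (cases "b = c")
  case False
  define u where "u = x \<bullet> c - x \<bullet> b"
  have bc: "b \<bullet> b = 1" "c \<bullet> c = 1" "b \<bullet> c = 0" "c \<bullet> b = 0"
    using assms False by (auto simp: inner_Basis)
  have "coord_swap b c x \<bullet> coord_swap b c x = x \<bullet> x + 2 * (u * (x \<bullet> (b - c))) + u * (u * ((b - c) \<bullet> (b - c)))"
    unfolding coord_swap_def u_def[symmetric]
    by (simp add: inner_add_left inner_add_right inner_commute[of "b - c" x] distrib_left)
  also have "x \<bullet> (b - c) = - u" by (simp add: u_def inner_diff_right)
  also have "(b - c) \<bullet> (b - c) = 2" by (simp add: inner_diff_left inner_diff_right bc)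
  finally show ?thesis by (simp add: norm_eq)
qed (simp add: coord_swap_def)

lemma distr_reflect:
  assumes b: "b \<in> (Basis::'a::euclidean_space set)"
  shows "distr lborel borel (reflect b) = lborel"
proof -
  define c :: "'a \<Rightarrow> real" where "c j = (if j = b then -1 else 1)" for j
  have T: "0 + (\<Sum>j\<in>Basis. (c j * (x \<bullet> j)) *\<^sub>R j) = reflect b x" for x
  proof (rule euclidean_eqI)
    fix i :: 'a assume i: "i \<in> Basis"
    have "(\<Sum>j\<in>Basis. (c j * (x \<bullet> j)) *\<^sub>R j) \<bullet> i = c i * (x \<bullet> i)"
      by (rule inner_sum_left_Basis[OF i])
    then show "(0 + (\<Sum>j\<in>Basis. (c j * (x \<bullet> j)) *\<^sub>R j)) \<bullet> i = reflect b x \<bullet> i"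
      using b i by (simp add: reflect_inner c_def)
  qed
  have "lborel = density (distr lborel borel (\<lambda>x. 0 + (\<Sum>j\<in>Basis. (c j * (x \<bullet> j)) *\<^sub>R j))) (\<lambda>_. (\<Prod>j\<in>Basis. \<bar>c j\<bar>))"
    by (rule lborel_affine_euclidean) (simp add: c_def)
  moreover have "(\<Prod>j\<in>Basis. \<bar>c j\<bar>) = 1" by (rule prod.neutral) (simp add: c_def)
  ultimately show ?thesis unfolding T by (simp add: density_1)
qed

text \<open>The map is not diagonal, so invariance is checked on boxes: the preimage of a box is the
  box with permuted corners, and permuting the side lengths leaves their product unchanged.\<close>

lemma distr_coord_swap:
  assumes b: "b \<in> (Basis::'a::euclidean_space set)" and c: "c \<in> Basis"
  shows "distr lborel borel (coord_swap b c) = lborel"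
proof (rule lborel_eqI[symmetric])
  define \<sigma> where "\<sigma> j = (if j = b then c else if j = c then b else j)" for j
  have \<sigma>: "\<sigma> (\<sigma> j) = j" "j \<in> Basis \<Longrightarrow> \<sigma> j \<in> Basis" for j
    using b c by (auto simp: \<sigma>_def)
  have sw: "coord_swap b c x \<bullet> j = x \<bullet> \<sigma> j" if "j \<in> Basis" for x j
    using coord_swap_inner[OF b c that] by (simp add: \<sigma>_def)
  have m[measurable]: "coord_swap b c \<in> borel \<rightarrow>\<^sub>M borel"
    unfolding coord_swap_def by (intro borel_measurable_continuous_onI continuous_intros)
  fix l u :: 'a assume le: "\<And>j. j \<in> Basis \<Longrightarrow> l \<bullet> j \<le> u \<bullet> j"
  have "x \<in> coord_swap b c -` box l u \<longleftrightarrow> x \<in> box (coord_swap b c l) (coord_swap b c u)" for x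
  proof -
    have "x \<in> coord_swap b c -` box l u \<longleftrightarrow> (\<forall>j\<in>Basis. l \<bullet> j < x \<bullet> \<sigma> j \<and> x \<bullet> \<sigma> j < u \<bullet> j)"
      by (simp add: mem_box sw)
    also have "\<dots> \<longleftrightarrow> (\<forall>j\<in>Basis. l \<bullet> \<sigma> j < x \<bullet> j \<and> x \<bullet> j < u \<bullet> \<sigma> j)"
      using \<sigma> by metis
    also have "\<dots> \<longleftrightarrow> x \<in> box (coord_swap b c l) (coord_swap b c u)"
      by (simp add: mem_box sw)
    finally show ?thesis .
  qed
  then have eq: "coord_swap b c -` box l u = box (coord_swap b c l) (coord_swap b c u)" by blast
  have "emeasure (distr lborel borel (coord_swap b c)) (box l u) = emeasure lborel (box (coord_swap b c l) (coord_swap b c u))"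
    by (simp add: emeasure_distr eq)
  also have "\<dots> = (\<Prod>j\<in>Basis. (coord_swap b c u - coord_swap b c l) \<bullet> j)"
    by (rule emeasure_lborel_box) (simp add: sw le \<sigma>)
  also have "(\<Prod>j\<in>Basis. (coord_swap b c u - coord_swap b c l) \<bullet> j) = (\<Prod>j\<in>Basis. (u - l) \<bullet> \<sigma> j)"
    by (rule prod.cong) (auto simp: sw inner_diff_left)
  also have "\<dots> = (\<Prod>j\<in>Basis. (u - l) \<bullet> j)"
    by (rule prod.reindex_bij_witness[where i=\<sigma> and j=\<sigma>]) (auto simp: \<sigma>)
  finally show "emeasure (distr lborel borel (coord_swap b c)) (box l u) = (\<Prod>j\<in>Basis. (u - l) \<bullet> j)" .
qed simp


section \<open>Continuity of translation in the mean square\<close>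

lemma sqint_shift:
  fixes g :: "'a::euclidean_space \<Rightarrow> real"
  assumes "sqint lborel g"
  shows "sqint lborel (\<lambda>x. g (x + k))" "l2norm lborel (\<lambda>x. g (x + k)) = l2norm lborel g"
proof -
  have [measurable]: "g \<in> borel_measurable borel" using sqint_measurable[OF assms] by simp
  have "integrable lborel (\<lambda>x. (norm (g (x + k)))\<^sup>2)"
    using lborel_shift(2)[of "\<lambda>x. (norm (g x))\<^sup>2" k] assms by (simp add: sqint_def)
  then show "sqint lborel (\<lambda>x. g (x + k))" by (simp add: sqint_def)
  show "l2norm lborel (\<lambda>x. g (x + k)) = l2norm lborel g"
    using lborel_shift(1)[of "\<lambda>x. (norm (g x))\<^sup>2" k] by (simp add: l2norm_def)
qed

text \<open>Isolated as a class of functions so that closure under sums, multiples and L2 limits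
  reduces the general case to indicators of bounded sets.\<close>

definition transl_cont :: "('a::euclidean_space \<Rightarrow> real) \<Rightarrow> bool" where
  "transl_cont g \<longleftrightarrow> sqint lborel g \<and>
     (\<forall>e>0. \<exists>d>0. \<forall>k. norm k < d \<longrightarrow> l2norm lborel (\<lambda>x. g (x + k) - g x) \<le> e)"

lemma transl_contD:
  assumes "transl_cont g"
  shows "sqint lborel g"
    and "0 < e \<Longrightarrow> \<exists>d>0. \<forall>k. norm k < d \<longrightarrow> l2norm lborel (\<lambda>x. g (x + k) - g x) \<le> e"
  using assms unfolding transl_cont_def by blast+

text \<open>Translation is an isometry of L2, so the error of the approximation after the shift is
  as small as before it, and three thirds add up.\<close>

lemma transl_cont_approx:
  assumes "sqint lborel g" "\<And>e. 0 < e \<Longrightarrow> \<exists>f. transl_cont f \<and> l2norm lborel (\<lambda>x. f x - g x) \<le> e"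
  shows "transl_cont g"
  unfolding transl_cont_def
proof (intro conjI allI impI assms(1))
  fix e :: real assume "0 < e"
  then obtain f where f: "transl_cont f" "l2norm lborel (\<lambda>x. f x - g x) \<le> e / 3"
    using assms(2)[of "e / 3"] by auto
  then obtain d where d: "0 < d" "\<And>k. norm k < d \<Longrightarrow> l2norm lborel (\<lambda>x. f (x + k) - f x) \<le> e / 3"
    using transl_contD(2)[OF f(1), of "e / 3"] \<open>0 < e\<close> by auto
  note sf = transl_contD(1)[OF f(1)]
  have sfg: "sqint lborel (\<lambda>x. f x - g x)" by (rule sqint_diff(1)[OF sf assms(1)])
  show "\<exists>d>0. \<forall>k. norm k < d \<longrightarrow> l2norm lborel (\<lambda>x. g (x + k) - g x) \<le> e"
  proof (intro exI[of _ d] conjI d(1) allI impI)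
    fix k :: 'a assume k: "norm k < d"
    have s1: "sqint lborel (\<lambda>x. f (x + k) - g (x + k))" using sqint_shift(1)[OF sfg] .
    have s2: "sqint lborel (\<lambda>x. f (x + k) - f x)" by (rule sqint_diff(1)[OF sqint_shift(1)[OF sf] sf])
    have "l2norm lborel (\<lambda>x. g (x + k) - g x) = l2norm lborel (\<lambda>x. (f (x + k) - f x) - ((f (x + k) - g (x + k)) - (f x - g x)))"
      by (simp add: algebra_simps)
    also have "\<dots> \<le> l2norm lborel (\<lambda>x. f (x + k) - f x) + l2norm lborel (\<lambda>x. (f (x + k) - g (x + k)) - (f x - g x))"
      by (rule sqint_diff(2)[OF s2 sqint_diff(1)[OF s1 sfg]])
    also have "\<dots> \<le> l2norm lborel (\<lambda>x. f (x + k) - f x) + (l2norm lborel (\<lambda>x. f (x + k) - g (x + k)) + l2norm lborel (\<lambda>x. f x - g x))"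
      using sqint_diff(2)[OF s1 sfg] by simp
    also have "\<dots> \<le> e" using d(2)[OF k] f(2) sqint_shift(2)[OF sfg, of k] by simp
    finally show "l2norm lborel (\<lambda>x. g (x + k) - g x) \<le> e" .
  qed
qed

text \<open>Regularity squeezes the set between a compact \<open>T\<close> and an open
  \<open>U\<close> whose difference is small. A shift shorter than the distance from
  \<open>T\<close> to the complement of \<open>U\<close> changes the indicator only where
  \<open>x\<close> or \<open>x + k\<close> lies in that difference.\<close>

lemma transl_cont_indicator:
  fixes A :: "'a::euclidean_space set"
  assumes A: "A \<in> sets borel" "bounded A"
  shows "transl_cont (indicator A)"
proof -
  have fA: "emeasure lborel A < \<infinity>" by (rule emeasure_bounded_finite[OF A(2)])
  have "(\<lambda>x. (norm (indicator A x :: real))\<^sup>2) = indicator A" by (auto simp: indicator_def)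
  then have "integrable lborel (\<lambda>x. (norm (indicator A x :: real))\<^sup>2)"
    using A(1) fA by (simp add: integrable_real_indicator)
  then have s: "sqint lborel (indicator A :: 'a \<Rightarrow> real)" using A(1) by (simp add: sqint_def)
  show ?thesis
    unfolding transl_cont_def
  proof (intro conjI allI impI s)
    fix e :: real assume e: "0 < e"
    \<comment> \<open>Both halves of \<open>W\<close> cost \<open>e'\<close>, and \<open>W\<close>
      enters twice, at \<open>x\<close> and at \<open>x + k\<close>; four copies make
      \<open>e\<^sup>2\<close>.\<close>
    define e' where "e' = e\<^sup>2 / 4"
    have e': "0 < e'" using e by (simp add: e'_def)
    obtain U where U: "open U" "A \<subseteq> U" "emeasure lborel (U - A) < e'"
      by (rule outer_regular_lborel[OF A(1) e'])
    obtain T where T: "closed T" "T \<subseteq> A" "emeasure lebesgue (A - T) < ennreal e'"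
      by (rule sets_lebesgue_inner_closed[of A e']) (use A(1) e' in auto)
    have cT: "compact T" using T(1,2) A(2) by (meson bounded_subset compact_eq_bounded_closed)
    obtain d where d: "0 < d" "(\<Union>x\<in>T. ball x d) \<subseteq> U"
      by (rule compact_subset_open_imp_ball_epsilon_subset[OF cT U(1)]) (use U(2) T(2) in auto)
    define W where "W = U - T"
    have [measurable]: "W \<in> sets borel" "A \<in> sets borel" using U T A by (auto simp: W_def)
    have "emeasure lborel W \<le> emeasure lborel (U - A) + emeasure lborel (A - T)"
    proof -
      have "W = (U - A) \<union> (A - T)" using U T by (auto simp: W_def)
      then show ?thesis using U T A by (auto intro!: emeasure_subadditive)
    qed
    also have "\<dots> \<le> ennreal e' + ennreal e'"
      using U(3) T A by (intro add_mono less_imp_le) auto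
    finally have W: "emeasure lborel W \<le> ennreal (2 * e')" using e' by (simp flip: ennreal_plus)
    show "\<exists>d>0. \<forall>k. norm k < d \<longrightarrow> l2norm lborel (\<lambda>x. indicator A (x + k) - indicator A x :: real) \<le> e"
    proof (intro exI[of _ d] conjI d(1) allI impI)
      fix k :: 'a assume k: "norm k < d"
      have pt: "(norm (indicator A (x + k) - indicator A x :: real))\<^sup>2 \<le> indicator W (x + k) + indicator W x" for x
      proof -
        have "x + k \<in> ball x d" "x \<in> ball (x + k) d" using k by (auto simp: dist_norm)
        then have "x \<in> T \<Longrightarrow> x + k \<in> U" "x + k \<in> T \<Longrightarrow> x \<in> U"
          using d(2) by blast+
        then have "(x \<in> A \<and> x + k \<notin> A) \<or> (x \<notin> A \<and> x + k \<in> A) \<Longrightarrow> x + k \<in> W \<or> x \<in> W"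
          using U(2) T(2) unfolding W_def by blast
        then show ?thesis
          by (cases "x \<in> A"; cases "x + k \<in> A"; cases "x \<in> W"; cases "x + k \<in> W") simp_all
      qed
      have "(\<integral>\<^sup>+x. ennreal ((norm (indicator A (x + k) - indicator A x :: real))\<^sup>2) \<partial>lborel)
          \<le> (\<integral>\<^sup>+x. indicator W (x + k) + indicator W x \<partial>lborel)"
      proof (rule nn_integral_mono)
        fix x
        have "ennreal ((norm (indicator A (x + k) - indicator A x :: real))\<^sup>2) \<le> ennreal (indicator W (x + k) + indicator W x)"
          by (rule ennreal_leI[OF pt])
        then show "ennreal ((norm (indicator A (x + k) - indicator A x :: real))\<^sup>2) \<le> indicator W (x + k) + indicator W x"
          by (simp add: ennreal_plus ennreal_indicator)
      qed
      also have "\<dots> = (\<integral>\<^sup>+x. indicator W (x + k) \<partial>lborel) + (\<integral>\<^sup>+x. indicator W x \<partial>lborel)"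
        by (rule nn_integral_add) auto
      also have "\<dots> = emeasure lborel W + emeasure lborel W"
        by (subst nn_integral_shift[of "indicator W"]) auto
      also have "\<dots> \<le> ennreal (e\<^sup>2)"
        using add_mono[OF W W] e' by (simp add: e'_def flip: ennreal_plus)
      finally have le: "(\<integral>\<^sup>+x. ennreal ((norm (indicator A (x + k) - indicator A x :: real))\<^sup>2) \<partial>lborel) \<le> ennreal (e\<^sup>2)" .
      have "(\<lambda>x. indicator A (x + k) - indicator A x :: real) \<in> borel_measurable lborel" by measurable
      from l2norm_le_nn(2)[OF this le]
      have "(l2norm lborel (\<lambda>x. indicator A (x + k) - indicator A x :: real))\<^sup>2 \<le> e\<^sup>2" by simp
      then show "l2norm lborel (\<lambda>x. indicator A (x + k) - indicator A x :: real) \<le> e"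
        by (rule power2_le_imp_le) (use e in simp)
    qed
  qed
qed

lemma transl_cont_add:
  assumes "transl_cont f" "transl_cont g"
  shows "transl_cont (\<lambda>x. f x + g x)"
proof -
  note s = transl_contD(1)[OF assms(1)] transl_contD(1)[OF assms(2)]
  show ?thesis unfolding transl_cont_def
  proof (intro conjI allI impI sqint_add(1)[OF s])
    fix e :: real assume "0 < e"
    then obtain d d' where d: "0 < d" "\<And>k. norm k < d \<Longrightarrow> l2norm lborel (\<lambda>x. f (x + k) - f x) \<le> e / 2"
      "0 < d'" "\<And>k. norm k < d' \<Longrightarrow> l2norm lborel (\<lambda>x. g (x + k) - g x) \<le> e / 2"
      using transl_contD(2)[OF assms(1), of "e / 2"] transl_contD(2)[OF assms(2), of "e / 2"] by fastforce
    show "\<exists>d>0. \<forall>k. norm k < d \<longrightarrow> l2norm lborel (\<lambda>x. f (x + k) + g (x + k) - (f x + g x)) \<le> e"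
    proof (intro exI[of _ "min d d'"] conjI allI impI)
      fix k :: 'a assume k: "norm k < min d d'"
      have "l2norm lborel (\<lambda>x. (f (x + k) - f x) + (g (x + k) - g x)) \<le> e / 2 + e / 2"
        using d(2)[of k] d(4)[of k] k
          sqint_add(2)[OF sqint_diff(1)[OF sqint_shift(1)[OF s(1), of k] s(1)] sqint_diff(1)[OF sqint_shift(1)[OF s(2), of k] s(2)]]
        by simp
      then show "l2norm lborel (\<lambda>x. f (x + k) + g (x + k) - (f x + g x)) \<le> e" by (simp add: algebra_simps)
    qed (use d in auto)
  qed
qed

lemma transl_cont_cmult:
  assumes "transl_cont f"
  shows "transl_cont (\<lambda>x. c * f x)"
proof -
  note s = transl_contD(1)[OF assms]
  show ?thesis unfolding transl_cont_def
  proof (intro conjI allI impI sqint_cmult(1)[OF s])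
    fix e :: real assume "0 < e"
    then have "0 < e / (\<bar>c\<bar> + 1)" by simp
    then obtain d where d: "0 < d" "\<And>k. norm k < d \<Longrightarrow> l2norm lborel (\<lambda>x. f (x + k) - f x) \<le> e / (\<bar>c\<bar> + 1)"
      using transl_contD(2)[OF assms] by blast
    show "\<exists>d>0. \<forall>k. norm k < d \<longrightarrow> l2norm lborel (\<lambda>x. c * f (x + k) - c * f x) \<le> e"
    proof (intro exI[of _ d] conjI allI impI d(1))
      fix k :: 'a assume k: "norm k < d"
      have "l2norm lborel (\<lambda>x. c * (f (x + k) - f x)) = \<bar>c\<bar> * l2norm lborel (\<lambda>x. f (x + k) - f x)"
        by (rule sqint_cmult(2)[OF sqint_diff(1)[OF sqint_shift(1)[OF s] s]])
      also have "\<dots> \<le> (\<bar>c\<bar> + 1) * (e / (\<bar>c\<bar> + 1))" using d(2)[OF k] by (intro mult_mono) auto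
      also have "\<dots> = e" by simp
      finally show "l2norm lborel (\<lambda>x. c * f (x + k) - c * f x) \<le> e" by (simp add: algebra_simps)
    qed
  qed
qed

lemma transl_cont_sum:
  assumes "finite I" "\<And>i. i \<in> I \<Longrightarrow> transl_cont (f i)"
  shows "transl_cont (\<lambda>x. \<Sum>i\<in>I. f i x)"
  using assms
proof (induction I rule: finite_induct)
  case empty
  then show ?case by (auto simp: transl_cont_def intro!: exI[of _ 1])
qed (auto intro: transl_cont_add)

text \<open>Simple functions dominated by \<open>2 * norm (g x)\<close> converge in L2 by dominated
  convergence, and \<open>transl_cont_approx\<close> passes to the limit.\<close>

lemma transl_cont:
  fixes g :: "'a::euclidean_space \<Rightarrow> real"
  assumes g: "sqint lborel g" and S: "bounded S" "\<And>x. x \<notin> S \<Longrightarrow> g x = 0"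
  shows "transl_cont g"
proof -
  have m[measurable]: "g \<in> borel_measurable borel" using sqint_measurable[OF g] by simp
  have "g \<in> borel_measurable lborel" by simp
  from borel_measurable_implies_sequence_metric[OF this, of 0]
  obtain F where F: "\<And>i. simple_function lborel (F i)" "\<And>x. (\<lambda>i. F i x) \<longlonglongrightarrow> g x" "\<And>i x. norm (F i x) \<le> 2 * norm (g x)"
    by auto
  have Fm[measurable]: "F i \<in> borel_measurable borel" for i using borel_measurable_simple_function[OF F(1)[of i]] by simp
  have tF: "transl_cont (F i)" for i
  proof -
    have fin: "finite (range (F i))" using simple_functionD(1)[OF F(1)[of i]] by simp
    have "transl_cont (\<lambda>x. \<Sum>y\<in>range (F i) - {0}. y * indicator (F i -` {y}) x)"
    proof (intro transl_cont_sum transl_cont_cmult transl_cont_indicator)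
      \<comment> \<open>The domination of \<open>F i\<close> by \<open>g\<close> forces the nonzero
        level sets into \<open>S\<close>, so their indicators are those of bounded sets.\<close>
      fix y assume y: "y \<in> range (F i) - {0}"
      show "F i -` {y} \<in> sets borel" using measurable_sets[OF Fm[of i], of "{y}"] by simp
      have "F i -` {y} \<subseteq> S"
      proof
        fix x assume "x \<in> F i -` {y}"
        then show "x \<in> S" using y F(3)[of i x] S(2)[of x] by force
      qed
      then show "bounded (F i -` {y})" using S(1) bounded_subset by blast
    qed (use fin in auto)
    moreover have "(\<Sum>y\<in>range (F i) - {0}. y * indicator (F i -` {y}) x) = F i x" for x
    proof -
      have "(\<Sum>y\<in>range (F i) - {0}. y * indicator (F i -` {y}) x) = (\<Sum>y\<in>range (F i) - {0}. if y = F i x then y else 0)"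
        by (rule sum.cong) (auto simp: indicator_def)
      also have "\<dots> = (if F i x \<in> range (F i) - {0} then F i x else 0)"
        using fin by (intro sum.delta) auto
      also have "\<dots> = F i x" by auto
      finally show ?thesis .
    qed
    ultimately show ?thesis by simp
  qed
  have i9: "integrable lborel (\<lambda>x. 9 * (norm (g x))\<^sup>2)" using g by (simp add: sqint_def)
  have "(\<lambda>i. LINT x|lborel. (norm (F i x - g x))\<^sup>2) \<longlonglongrightarrow> (LINT x|(lborel::'a measure). (0::real))"
  proof (rule Bochner_Integration.integral_dominated_convergence[where s="\<lambda>i x. (norm (F i x - g x))\<^sup>2" and f="\<lambda>x. 0" and M=lborel and w="\<lambda>x. 9 * (norm (g x))\<^sup>2"])
    show "AE x in lborel. (\<lambda>i. (norm (F i x - g x))\<^sup>2) \<longlonglongrightarrow> 0"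
    proof (rule AE_I2)
      fix x
      have "(\<lambda>i. (norm (F i x - g x))\<^sup>2) \<longlonglongrightarrow> (norm (g x - g x))\<^sup>2" by (intro tendsto_intros F(2))
      then show "(\<lambda>i. (norm (F i x - g x))\<^sup>2) \<longlonglongrightarrow> 0" by simp
    qed
    show "AE x in lborel. norm ((norm (F i x - g x))\<^sup>2) \<le> 9 * (norm (g x))\<^sup>2" for i
    proof (rule AE_I2)
      fix x
      have "norm (F i x - g x) \<le> 3 * norm (g x)"
        using norm_triangle_ineq4[of "F i x" "g x"] F(3)[of i x] by simp
      then have "(norm (F i x - g x))\<^sup>2 \<le> (3 * norm (g x))\<^sup>2" by (rule power_mono) simp
      then show "norm ((norm (F i x - g x))\<^sup>2) \<le> 9 * (norm (g x))\<^sup>2" by (simp add: power_mult_distrib)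
    qed
  qed (use i9 in auto)
  then have L: "(\<lambda>i. l2norm lborel (\<lambda>x. F i x - g x)) \<longlonglongrightarrow> 0"
    using tendsto_real_sqrt[of "\<lambda>i. LINT x|lborel. (norm (F i x - g x))\<^sup>2" 0] by (simp add: l2norm_def)
  have lim: "\<exists>i. l2norm lborel (\<lambda>x. F i x - g x) \<le> e" if e: "0 < e" for e
  proof -
    obtain N where "\<forall>n\<ge>N. l2norm lborel (\<lambda>x. F n x - g x) < e"
      using order_tendstoD(2)[OF L e] unfolding eventually_sequentially by blast
    then show ?thesis by (intro exI[of _ N]) (simp add: less_imp_le)
  qed
  show ?thesis by (rule transl_cont_approx[OF g]) (use tF lim in blast)
qed


section \<open>The kernel\<close>

text \<open>The kernel as a function of the displacement. The conditions say nothing about the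
  profile at 0, so the value there is set to 0; this keeps the kernel nonnegative and measurable,
  and increments vanish at that displacement anyway.\<close>

definition ker :: "(real \<Rightarrow> real) \<Rightarrow> real \<Rightarrow> 'a::euclidean_space \<Rightarrow> real" where
  "ker \<gamma>1 \<delta> h = (if h = 0 then 0 else scaled_kernel DIM('a) \<gamma>1 \<delta> (norm h))"

lemma ker_eq: "h \<noteq> 0 \<Longrightarrow> ker \<gamma>1 \<delta> (h::'a::euclidean_space) = \<gamma>1 (norm h / \<delta>) / \<delta> ^ (DIM('a) + 2)"
  by (simp add: ker_def scaled_kernel_def)

section \<open>Bounds and moments of the kernel\<close>

context
  fixes D0 s :: real and \<gamma>1 :: "real \<Rightarrow> real" and ty :: "'a::euclidean_space itself"
  assumes K: "kernel_conditions ty D0 s \<gamma>1"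
begin

text \<open>The scaling identity at horizon 1 identifies the profile as a truncated power. Its
  positivity at 1/2 is the lower bound on which the smoothing estimates rest.\<close>

lemma kernel_profile:
  shows "0 < t \<Longrightarrow> 0 \<le> \<gamma>1 t" "1 \<le> t \<Longrightarrow> \<gamma>1 t = 0" "0 < t \<Longrightarrow> t \<le> t' \<Longrightarrow> \<gamma>1 t' \<le> \<gamma>1 t" "0 < \<gamma>1 (1/2)"
    "0 < t \<Longrightarrow> \<gamma>1 t = (if t < 1 then D0 / t powr s else 0)"
proof -
  show "0 < t \<Longrightarrow> 0 \<le> \<gamma>1 t" "1 \<le> t \<Longrightarrow> \<gamma>1 t = 0"
    using K by (auto simp: kernel_conditions_def)
  show "0 < t \<Longrightarrow> t \<le> t' \<Longrightarrow> \<gamma>1 t' \<le> \<gamma>1 t"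
    using K by (auto simp: kernel_conditions_def monotone_on_def)
  have 1: "scaled_kernel DIM('a) \<gamma>1 1 t = (if t < 1 then D0 / (1 powr (real DIM('a) + 2 - s) * t powr s) else 0)" if "0 < t" for t
    using K that unfolding kernel_conditions_def by (metis zero_less_one)
  then show 2: "0 < t \<Longrightarrow> \<gamma>1 t = (if t < 1 then D0 / t powr s else 0)" for t
    by (simp add: scaled_kernel_def)
  show "0 < \<gamma>1 (1/2)" using K by (subst 2) (auto simp: kernel_conditions_def)
qed

lemma ker_nonneg: "0 < \<delta> \<Longrightarrow> 0 \<le> ker \<gamma>1 \<delta> (h::'a)"
  by (cases "h = 0") (auto simp: ker_eq intro!: divide_nonneg_pos kernel_profile(1), simp add: ker_def)

lemma ker_eq_0: "0 < \<delta> \<Longrightarrow> \<delta> \<le> norm h \<Longrightarrow> ker \<gamma>1 \<delta> (h::'a) = 0"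
  by (simp add: ker_def scaled_kernel_def kernel_profile(2))

lemma ker_measurable [measurable]:
  assumes "0 < \<delta>"
  shows "(ker \<gamma>1 \<delta> :: 'a \<Rightarrow> real) \<in> borel_measurable borel"
proof -
  have eq: "ker \<gamma>1 \<delta> = (\<lambda>h::'a. if h = 0 then 0 else (if norm h / \<delta> < 1 then D0 / (norm h / \<delta>) powr s else 0) / \<delta> ^ (DIM('a) + 2))"
    using assms kernel_profile(5) by (auto simp: ker_def scaled_kernel_def fun_eq_iff)
  show ?thesis unfolding eq by measurable
qed

text \<open>Within half the horizon the rescaled distance is at most 1/2, and the profile is
  nonincreasing. This is how the energy will dominate convolutions with short-range
  functions.\<close>

lemma ker_ge:
  assumes "0 < \<delta>" "(h::'a) \<noteq> 0" "norm h \<le> \<delta> / 2"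
  shows "\<gamma>1 (1/2) / \<delta> ^ (DIM('a) + 2) \<le> ker \<gamma>1 \<delta> h"
proof -
  have "\<gamma>1 (1/2) \<le> \<gamma>1 (norm h / \<delta>)"
    using assms by (intro kernel_profile(3)) (auto simp: field_simps)
  then show ?thesis using assms by (simp add: ker_eq divide_right_mono)
qed

lemma ker_le:
  assumes "0 < \<delta>" "0 < \<eta>" "\<eta> \<le> norm (h::'a)"
  shows "ker \<gamma>1 \<delta> h \<le> \<gamma>1 (\<eta> / \<delta>) / \<delta> ^ (DIM('a) + 2)"
proof -
  have "\<gamma>1 (norm h / \<delta>) \<le> \<gamma>1 (\<eta> / \<delta>)"
    using assms by (intro kernel_profile(3)) (auto simp: divide_right_mono)
  moreover have "h \<noteq> 0" using assms by auto
  ultimately show ?thesis using assms by (subst ker_eq) (auto intro!: divide_right_mono)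
qed

text \<open>At the larger horizon the same displacement has a smaller rescaled distance, hence a
  larger profile; only the normalising powers work the other way, and they differ by at most the
  stated factor.\<close>

lemma ker_comparison:
  assumes "0 < \<delta>" "\<delta> \<le> \<eta>" "\<eta> \<le> 2 * \<delta>"
  shows "ker \<gamma>1 \<delta> (h::'a) \<le> 2 ^ (DIM('a) + 2) * ker \<gamma>1 \<eta> h"
proof (cases "h = 0")
  case False
  have "\<gamma>1 (norm h / \<delta>) \<le> \<gamma>1 (norm h / \<eta>)"
    using assms False by (intro kernel_profile(3)) (auto simp: frac_le)
  moreover have "\<eta> ^ (DIM('a) + 2) \<le> (2 * \<delta>) ^ (DIM('a) + 2)" using assms by (intro power_mono) auto
  moreover have "0 \<le> \<gamma>1 (norm h / \<delta>)" using assms False by (intro kernel_profile) auto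
  ultimately have "\<gamma>1 (norm h / \<delta>) * \<eta> ^ (DIM('a) + 2) \<le> \<gamma>1 (norm h / \<eta>) * (2 * \<delta>) ^ (DIM('a) + 2)"
    using assms by (intro mult_mono) auto
  then have "\<gamma>1 (norm h / \<delta>) / \<delta> ^ (DIM('a) + 2) \<le> 2 ^ (DIM('a) + 2) * (\<gamma>1 (norm h / \<eta>) / \<eta> ^ (DIM('a) + 2))"
    using assms unfolding power_mult_distrib by (simp add: divide_simps mult_ac)
  then show ?thesis using False by (simp add: ker_eq)
qed (simp add: ker_def)

lemma ker_scale:
  assumes "0 < \<delta>" "0 < c"
  shows "ker \<gamma>1 (c * \<delta>) (c *\<^sub>R h :: 'a) = ker \<gamma>1 \<delta> h / c ^ (DIM('a) + 2)"
  using assms by (cases "h = 0") (auto simp: ker_def scaled_kernel_def power_mult_distrib)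

text \<open>The normalisation is given at horizon 1. Under the dilation by \<delta> the Jacobian
  \<delta>^d, the kernel factor \<delta>^-(d+2) and the square \<delta>^2 cancel.\<close>

lemma ker_second_moment:
  assumes \<delta>: "0 < \<delta>"
  shows "(\<integral>\<^sup>+h. ennreal (ker \<gamma>1 \<delta> (h::'a) * (norm h)\<^sup>2) \<partial>lborel) = ennreal (real DIM('a))"
    "integrable lborel (\<lambda>h::'a. ker \<gamma>1 \<delta> h * (norm h)\<^sup>2)"
    "(LINT h|lborel. ker \<gamma>1 \<delta> (h::'a) * (norm h)\<^sup>2) = real DIM('a)"
proof -
  note [measurable] = ker_measurable[OF \<delta>] ker_measurable[of 1]
  have hb: "has_bochner_integral (lebesgue_on (ball (0::'a) 1)) (\<lambda>z. \<gamma>1 (norm z) * (norm z)\<^sup>2) (real DIM('a))"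
    using K by (simp add: kernel_conditions_def)
  have "ennreal (real DIM('a)) = (\<integral>\<^sup>+z. ennreal (\<gamma>1 (norm z) * (norm z)\<^sup>2) \<partial>lebesgue_on (ball (0::'a) 1))"
  proof -
    have "0 \<le> \<gamma>1 (norm z) * (norm z)\<^sup>2" for z :: 'a
      by (cases "z = 0") (auto intro!: mult_nonneg_nonneg kernel_profile)
    then show ?thesis using nn_integral_eq_integral[of "lebesgue_on (ball (0::'a) 1)" "\<lambda>z. \<gamma>1 (norm z) * (norm z)\<^sup>2"] hb
      by (simp add: has_bochner_integral_iff)
  qed
  also have "\<dots> = (\<integral>\<^sup>+z. ennreal (\<gamma>1 (norm z) * (norm z)\<^sup>2) * indicator (ball (0::'a) 1) z \<partial>lebesgue)"
    by (rule nn_integral_restrict_space) auto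
  also have "\<dots> = (\<integral>\<^sup>+z. ennreal (ker \<gamma>1 1 (z::'a) * (norm z)\<^sup>2) \<partial>lborel)"
    unfolding nn_integral_completion
    by (intro nn_integral_cong) (auto simp: ker_def scaled_kernel_def kernel_profile indicator_def)
  also have "\<dots> = (\<integral>\<^sup>+h. ennreal (ker \<gamma>1 \<delta> (h::'a) * (norm h)\<^sup>2) \<partial>lborel)"
  proof -
    have "(\<integral>\<^sup>+h. ennreal (ker \<gamma>1 \<delta> (h::'a) * (norm h)\<^sup>2) \<partial>lborel)
       = ennreal (\<bar>\<delta>\<bar> ^ DIM('a)) * (\<integral>\<^sup>+h. ennreal (ker \<gamma>1 \<delta> (\<delta> *\<^sub>R h::'a) * (norm (\<delta> *\<^sub>R h))\<^sup>2) \<partial>lborel)"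
      using \<delta> by (intro nn_integral_scale) auto
    also have "\<dots> = (\<integral>\<^sup>+h. ennreal (\<bar>\<delta>\<bar> ^ DIM('a)) * ennreal (ker \<gamma>1 \<delta> (\<delta> *\<^sub>R h::'a) * (norm (\<delta> *\<^sub>R h))\<^sup>2) \<partial>lborel)"
      by (rule nn_integral_cmult[symmetric]) auto
    also have "\<dots> = (\<integral>\<^sup>+z. ennreal (ker \<gamma>1 1 (z::'a) * (norm z)\<^sup>2) \<partial>lborel)"
    proof (rule nn_integral_cong)
      fix x :: 'a
      have "\<delta> ^ DIM('a) * (ker \<gamma>1 \<delta> (\<delta> *\<^sub>R x) * (norm (\<delta> *\<^sub>R x))\<^sup>2)
          = (\<delta> ^ (DIM('a) + 2) * ker \<gamma>1 \<delta> (\<delta> *\<^sub>R x)) * (norm x)\<^sup>2"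
        using \<delta> by (simp add: power_mult_distrib power_add power2_eq_square mult_ac)
      also have "\<delta> ^ (DIM('a) + 2) * ker \<gamma>1 \<delta> (\<delta> *\<^sub>R x) = ker \<gamma>1 1 x"
        using ker_scale[of 1 \<delta> x] \<delta> by simp
      finally show "ennreal (\<bar>\<delta>\<bar> ^ DIM('a)) * ennreal (ker \<gamma>1 \<delta> (\<delta> *\<^sub>R x) * (norm (\<delta> *\<^sub>R x))\<^sup>2)
          = ennreal (ker \<gamma>1 1 x * (norm x)\<^sup>2)"
        using \<delta> by (simp flip: ennreal_mult')
    qed
    finally show ?thesis by simp
  qed
  finally show 1: "(\<integral>\<^sup>+h. ennreal (ker \<gamma>1 \<delta> (h::'a) * (norm h)\<^sup>2) \<partial>lborel) = ennreal (real DIM('a))" by simp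
  have nn: "0 \<le> ker \<gamma>1 \<delta> (h::'a) * (norm h)\<^sup>2" for h using ker_nonneg[OF \<delta>] by simp
  show 2: "integrable lborel (\<lambda>h::'a. ker \<gamma>1 \<delta> h * (norm h)\<^sup>2)"
    using 1 nn by (intro integrableI_nonneg) auto
  show "(LINT h|lborel. ker \<gamma>1 \<delta> (h::'a) * (norm h)\<^sup>2) = real DIM('a)"
    using nn_integral_eq_integral[OF 2] 1 nn by (simp add: integral_nonneg_AE)
qed

text \<open>A reflection changes the sign of the mixed moments, so they vanish. Coordinate exchanges
  make the pure ones equal; they add up to the dimension, so each is 1. Hence the local limit has
  exactly the diagonal of \<open>A\<close> as its coefficient.\<close>

lemma ker_mixed_moments:
  assumes \<delta>: "0 < \<delta>" and b: "b \<in> Basis" and c: "c \<in> Basis"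
  shows "integrable lborel (\<lambda>h::'a. ker \<gamma>1 \<delta> h * ((h \<bullet> b) * (h \<bullet> c)))"
    "(LINT h|lborel. ker \<gamma>1 \<delta> (h::'a) * ((h \<bullet> b) * (h \<bullet> c))) = (if b = c then 1 else 0)"
proof -
  note [measurable] = ker_measurable[OF \<delta>]
  have int: "integrable lborel (\<lambda>h::'a. ker \<gamma>1 \<delta> h * ((h \<bullet> b) * (h \<bullet> c)))" if "b \<in> Basis" "c \<in> Basis" for b c
  proof (rule Bochner_Integration.integrable_bound[OF ker_second_moment(2)[OF \<delta>]])
    show "AE h in lborel. norm (ker \<gamma>1 \<delta> (h::'a) * ((h \<bullet> b) * (h \<bullet> c))) \<le> norm (ker \<gamma>1 \<delta> h * (norm h)\<^sup>2)"
      using Basis_le_norm[OF that(1)] Basis_le_norm[OF that(2)] ker_nonneg[OF \<delta>]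
      by (auto simp: abs_mult power2_eq_square intro!: mult_left_mono mult_mono)
  qed simp
  show "integrable lborel (\<lambda>h::'a. ker \<gamma>1 \<delta> h * ((h \<bullet> b) * (h \<bullet> c)))" by (rule int[OF b c])
  have ker_norm: "ker \<gamma>1 \<delta> x = ker \<gamma>1 \<delta> y" if "norm x = norm y" for x y :: 'a
    using that by (auto simp: ker_def)
  show "(LINT h|lborel. ker \<gamma>1 \<delta> (h::'a) * ((h \<bullet> b) * (h \<bullet> c))) = (if b = c then 1 else 0)"
  proof (cases "b = c")
    case False
    have [measurable]: "reflect b \<in> borel \<rightarrow>\<^sub>M borel"
      unfolding reflect_def by (intro borel_measurable_continuous_onI continuous_intros)
    have "(LINT h|lborel. ker \<gamma>1 \<delta> (h::'a) * ((h \<bullet> b) * (h \<bullet> c)))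
        = (LINT h|distr lborel borel (reflect b). ker \<gamma>1 \<delta> (h::'a) * ((h \<bullet> b) * (h \<bullet> c)))"
      by (simp add: distr_reflect[OF b])
    also have "\<dots> = (LINT h|lborel. ker \<gamma>1 \<delta> (reflect b h) * ((reflect b h \<bullet> b) * (reflect b h \<bullet> c)))"
      by (rule integral_distr) auto
    also have "\<dots> = (LINT h|lborel. - (ker \<gamma>1 \<delta> h * ((h \<bullet> b) * (h \<bullet> c))))"
      using False by (simp add: reflect_inner[OF b] b c ker_norm[OF norm_reflect[OF b]])
    finally show ?thesis using False by simp
  next
    case True
    have eq: "(LINT h|lborel. ker \<gamma>1 \<delta> (h::'a) * ((h \<bullet> j) * (h \<bullet> j))) = (LINT h|lborel. ker \<gamma>1 \<delta> (h::'a) * ((h \<bullet> b) * (h \<bullet> b)))"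
      if j: "j \<in> Basis" for j
    proof -
      have [measurable]: "coord_swap b j \<in> borel \<rightarrow>\<^sub>M borel"
        unfolding coord_swap_def by (intro borel_measurable_continuous_onI continuous_intros)
      have "(LINT h|lborel. ker \<gamma>1 \<delta> (h::'a) * ((h \<bullet> b) * (h \<bullet> b)))
          = (LINT h|distr lborel borel (coord_swap b j). ker \<gamma>1 \<delta> (h::'a) * ((h \<bullet> b) * (h \<bullet> b)))"
        by (simp add: distr_coord_swap[OF b j])
      also have "\<dots> = (LINT h|lborel. ker \<gamma>1 \<delta> (coord_swap b j h) * ((coord_swap b j h \<bullet> b) * (coord_swap b j h \<bullet> b)))"
        by (rule integral_distr) auto
      finally show ?thesis
        by (simp add: coord_swap_inner[OF b j] b ker_norm[OF norm_coord_swap[OF b j]])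
    qed
    have "real DIM('a) = (LINT h|lborel. ker \<gamma>1 \<delta> (h::'a) * (norm h)\<^sup>2)" using ker_second_moment(3)[OF \<delta>] by simp
    also have "\<dots> = (LINT h|lborel. (\<Sum>j\<in>Basis. ker \<gamma>1 \<delta> (h::'a) * ((h \<bullet> j) * (h \<bullet> j))))"
    proof (rule arg_cong[where f="integral\<^sup>L lborel"], rule ext)
      fix h :: 'a
      have "(norm h)\<^sup>2 = (\<Sum>j\<in>Basis. (h \<bullet> j) * (h \<bullet> j))"
        using euclidean_inner[of h h] by (simp add: dot_square_norm)
      then show "ker \<gamma>1 \<delta> h * (norm h)\<^sup>2 = (\<Sum>j\<in>Basis. ker \<gamma>1 \<delta> h * ((h \<bullet> j) * (h \<bullet> j)))"
        by (simp add: sum_distrib_left)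
    qed
    also have "\<dots> = (\<Sum>j\<in>Basis. (LINT h|lborel. ker \<gamma>1 \<delta> (h::'a) * ((h \<bullet> j) * (h \<bullet> j))))"
      by (rule Bochner_Integration.integral_sum) (use int in auto)
    also have "\<dots> = real DIM('a) * (LINT h|lborel. ker \<gamma>1 \<delta> (h::'a) * ((h \<bullet> b) * (h \<bullet> b)))"
      using eq by simp
    finally show ?thesis using True by simp
  qed
qed

end

section \<open>The energy\<close>

text \<open>
  On functions that vanish outside the domain the energy is an integral over the whole space;
  in the coordinates \<open>(x, y - x)\<close> it is the squared norm of the increment in a weighted
  \<open>L\<^sup>2\<close> space.
\<close>

definition kmeas :: "(real \<Rightarrow> real) \<Rightarrow> real \<Rightarrow> ('a::euclidean_space \<times> 'a) measure" where
  "kmeas \<gamma>1 \<delta> = density (lborel \<Otimes>\<^sub>M lborel) (\<lambda>p. ennreal (ker \<gamma>1 \<delta> (snd p)))"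

definition incr :: "('a::euclidean_space \<Rightarrow> real) \<Rightarrow> 'a \<times> 'a \<Rightarrow> real" where
  "incr v p = v (fst p + snd p) - v (fst p)"

text \<open>The squared L2 modulus of continuity at a single displacement. Comparisons of energies
  are proved for fixed \<open>h\<close> and then integrated against the kernel.\<close>

definition mod_sq :: "('a::euclidean_space \<Rightarrow> real) \<Rightarrow> 'a \<Rightarrow> ennreal" where
  "mod_sq v h = (\<integral>\<^sup>+x. ennreal ((v (x + h) - v x)\<^sup>2) \<partial>lborel)"

definition En :: "(real \<Rightarrow> real) \<Rightarrow> real \<Rightarrow> ('a::euclidean_space \<Rightarrow> real) \<Rightarrow> ennreal" where
  "En \<gamma>1 \<delta> v = (\<integral>\<^sup>+h. ennreal (ker \<gamma>1 \<delta> h) * mod_sq v h \<partial>lborel)"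

text \<open>Real-valued, hence 0 by default when the increment is not square integrable; this is why
  its uses carry the hypothesis that \<open>En\<close> is finite.\<close>

abbreviation Sn :: "(real \<Rightarrow> real) \<Rightarrow> real \<Rightarrow> ('a::euclidean_space \<Rightarrow> real) \<Rightarrow> real" where
  "Sn \<gamma>1 \<delta> v \<equiv> l2norm (kmeas \<gamma>1 \<delta>) (incr v)"

lemma sets_kmeas [measurable_cong]: "sets (kmeas \<gamma>1 \<delta>) = sets (borel \<Otimes>\<^sub>M borel)"
  unfolding kmeas_def by (simp cong: sets_pair_measure_cong)

lemma incr_measurable [measurable]:
  assumes [measurable]: "v \<in> borel_measurable borel"
  shows "incr v \<in> borel_measurable (borel \<Otimes>\<^sub>M borel)"
  unfolding incr_def by measurable

lemma incr_simps:
  "incr (\<lambda>x. u x + w x) = (\<lambda>p. incr u p + incr w p)"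
  "incr (\<lambda>x. u x - w x) = (\<lambda>p. incr u p - incr w p)"
  "incr (\<lambda>x. c * u x) = (\<lambda>p. c * incr u p)"
  "incr (\<lambda>x. \<Sum>i\<in>I. f i x) = (\<lambda>p. \<Sum>i\<in>I. incr (f i) p)"
  by (auto simp: incr_def fun_eq_iff algebra_simps sum_subtractf)

lemma mod_sq_measurable [measurable]:
  assumes [measurable]: "v \<in> borel_measurable borel"
  shows "mod_sq v \<in> borel_measurable borel"
  unfolding mod_sq_def by measurable

lemma mod_sq_0: "mod_sq v 0 = 0"
  by (simp add: mod_sq_def)

text \<open>The long increment telescopes into n short ones. The inequality between the square of a
  sum and n times the sum of squares, with translation invariance for each summand, gives n times
  n.\<close>

lemma mod_sq_mult:
  fixes v :: "'a::euclidean_space \<Rightarrow> real"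
  assumes v[measurable]: "v \<in> borel_measurable borel"
  shows "mod_sq v (real n *\<^sub>R k) \<le> ennreal ((real n)\<^sup>2) * mod_sq v k"
proof -
  have pt: "(v (x + real n *\<^sub>R k) - v x)\<^sup>2 \<le> (\<Sum>i<n. real n * (v (x + real i *\<^sub>R k + k) - v (x + real i *\<^sub>R k))\<^sup>2)" for x
  proof -
    have "v (x + real n *\<^sub>R k) - v x = (\<Sum>i<n. v (x + real (Suc i) *\<^sub>R k) - v (x + real i *\<^sub>R k))"
      by (subst sum_lessThan_telescope) simp
    also have "\<dots> = (\<Sum>i<n. v (x + real i *\<^sub>R k + k) - v (x + real i *\<^sub>R k))"
      by (rule sum.cong) (simp_all add: algebra_simps)
    finally have "(v (x + real n *\<^sub>R k) - v x)\<^sup>2 \<le> (\<Sum>i<n. (v (x + real i *\<^sub>R k + k) - v (x + real i *\<^sub>R k))\<^sup>2) * real (card {..<n})"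
      using sum_squared_le_sum_of_squares[of "\<lambda>i. v (x + real i *\<^sub>R k + k) - v (x + real i *\<^sub>R k)" "{..<n}"] by simp
    then show ?thesis by (simp add: sum_distrib_left mult.commute)
  qed
  have "mod_sq v (real n *\<^sub>R k) \<le> (\<integral>\<^sup>+x. (\<Sum>i<n. ennreal (real n) * ennreal ((v (x + real i *\<^sub>R k + k) - v (x + real i *\<^sub>R k))\<^sup>2)) \<partial>lborel)"
    unfolding mod_sq_def
  proof (rule nn_integral_mono)
    fix x
    have "ennreal ((v (x + real n *\<^sub>R k) - v x)\<^sup>2) \<le> ennreal (\<Sum>i<n. real n * (v (x + real i *\<^sub>R k + k) - v (x + real i *\<^sub>R k))\<^sup>2)"
      by (rule ennreal_leI[OF pt])
    also have "\<dots> = (\<Sum>i<n. ennreal (real n) * ennreal ((v (x + real i *\<^sub>R k + k) - v (x + real i *\<^sub>R k))\<^sup>2))"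
      by (subst sum_ennreal[symmetric]) (auto simp: ennreal_mult)
    finally show "ennreal ((v (x + real n *\<^sub>R k) - v x)\<^sup>2) \<le> (\<Sum>i<n. ennreal (real n) * ennreal ((v (x + real i *\<^sub>R k + k) - v (x + real i *\<^sub>R k))\<^sup>2))" .
  qed
  also have "\<dots> = (\<Sum>i<n. (\<integral>\<^sup>+x. ennreal (real n) * ennreal ((v (x + real i *\<^sub>R k + k) - v (x + real i *\<^sub>R k))\<^sup>2) \<partial>lborel))"
    by (rule nn_integral_sum) measurable
  also have "\<dots> = (\<Sum>i<n. ennreal (real n) * mod_sq v k)"
  proof (rule sum.cong[OF refl])
    fix i
    have "(\<integral>\<^sup>+x. ennreal (real n) * ennreal ((v (x + real i *\<^sub>R k + k) - v (x + real i *\<^sub>R k))\<^sup>2) \<partial>lborel)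
       = (\<integral>\<^sup>+x. ennreal (real n) * ennreal ((v (x + k) - v x)\<^sup>2) \<partial>lborel)"
      by (rule nn_integral_shift[of "\<lambda>x. ennreal (real n) * ennreal ((v (x + k) - v x)\<^sup>2)"]) measurable
    also have "\<dots> = ennreal (real n) * mod_sq v k"
      unfolding mod_sq_def by (rule nn_integral_cmult) measurable
    finally show "(\<integral>\<^sup>+x. ennreal (real n) * ennreal ((v (x + real i *\<^sub>R k + k) - v (x + real i *\<^sub>R k))\<^sup>2) \<partial>lborel) = ennreal (real n) * mod_sq v k" .
  qed
  also have "\<dots> = ennreal ((real n)\<^sup>2) * mod_sq v k"
    by (simp add: power2_eq_square ennreal_mult mult.assoc ennreal_of_nat_eq_real_of_nat)
  finally show ?thesis .
qed

lemma mod_sq_le_norm: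
  fixes v :: "'a::euclidean_space \<Rightarrow> real"
  assumes "sqint lborel v"
  shows "mod_sq v h \<le> ennreal (4 * (l2norm lborel v)\<^sup>2)"
proof -
  have s: "sqint lborel (\<lambda>x. v (x + h) - v x)" by (rule sqint_diff(1)[OF sqint_shift(1)[OF assms] assms])
  have "l2norm lborel (\<lambda>x. v (x + h) - v x) \<le> 2 * l2norm lborel v"
    using sqint_diff(2)[OF sqint_shift(1)[OF assms, of h] assms] sqint_shift(2)[OF assms, of h] by simp
  then have "(l2norm lborel (\<lambda>x. v (x + h) - v x))\<^sup>2 \<le> (2 * l2norm lborel v)\<^sup>2"
    by (rule power_mono) simp
  then show ?thesis
    using nn_integral_l2norm[OF s] by (simp add: mod_sq_def power_mult_distrib ennreal_leI)
qed

section \<open>The energy and its dependence on the horizon\<close>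

context
  fixes D0 s :: real and \<gamma>1 :: "real \<Rightarrow> real" and ty :: "'a::euclidean_space itself"
  assumes K: "kernel_conditions ty D0 s \<gamma>1"
begin

lemmas ker_meas = ker_measurable[OF K]

lemma nn_integral_kmeas:
  fixes f :: "'a \<times> 'a \<Rightarrow> ennreal"
  assumes \<delta>: "0 < \<delta>" and f[measurable]: "f \<in> borel_measurable (borel \<Otimes>\<^sub>M borel)"
  shows "(\<integral>\<^sup>+p. f p \<partial>kmeas \<gamma>1 \<delta>) = (\<integral>\<^sup>+h. ennreal (ker \<gamma>1 \<delta> h) * (\<integral>\<^sup>+x. f (x, h) \<partial>lborel) \<partial>lborel)"
proof -
  note [measurable] = ker_meas[OF \<delta>]
  have "(\<integral>\<^sup>+p. f p \<partial>kmeas \<gamma>1 \<delta>) = (\<integral>\<^sup>+p. ennreal (ker \<gamma>1 \<delta> (snd p)) * f p \<partial>(lborel \<Otimes>\<^sub>M lborel))"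
    unfolding kmeas_def by (rule nn_integral_density) measurable
  also have "\<dots> = (\<integral>\<^sup>+h. (\<integral>\<^sup>+x. ennreal (ker \<gamma>1 \<delta> (snd (x, h))) * f (x, h) \<partial>lborel) \<partial>lborel)"
    by (rule lborel_pair.nn_integral_snd[symmetric]) measurable
  also have "\<dots> = (\<integral>\<^sup>+h. ennreal (ker \<gamma>1 \<delta> h) * (\<integral>\<^sup>+x. f (x, h) \<partial>lborel) \<partial>lborel)"
    by (intro nn_integral_cong) (simp add: nn_integral_cmult)
  finally show ?thesis .
qed

lemma nn_integral_incr:
  fixes v :: "'a \<Rightarrow> real"
  assumes \<delta>: "0 < \<delta>" and [measurable]: "v \<in> borel_measurable borel"
  shows "(\<integral>\<^sup>+p. ennreal ((norm (incr v p))\<^sup>2) \<partial>kmeas \<gamma>1 \<delta>) = En \<gamma>1 \<delta> v"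
proof -
  have "(\<integral>\<^sup>+p. ennreal ((norm (incr v p))\<^sup>2) \<partial>kmeas \<gamma>1 \<delta>)
     = (\<integral>\<^sup>+h. ennreal (ker \<gamma>1 \<delta> h) * (\<integral>\<^sup>+x. ennreal ((norm (incr v (x, h)))\<^sup>2) \<partial>lborel) \<partial>lborel)"
    by (rule nn_integral_kmeas[OF \<delta>]) measurable
  then show ?thesis by (simp add: En_def mod_sq_def incr_def)
qed

lemma sqint_incr_iff:
  fixes v :: "'a \<Rightarrow> real"
  assumes \<delta>: "0 < \<delta>" and v[measurable]: "v \<in> borel_measurable borel"
  shows "sqint (kmeas \<gamma>1 \<delta>) (incr v) \<longleftrightarrow> En \<gamma>1 \<delta> v < \<infinity>"
proof
  assume "sqint (kmeas \<gamma>1 \<delta>) (incr v)"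
  from nn_integral_l2norm[OF this] show "En \<gamma>1 \<delta> v < \<infinity>" unfolding nn_integral_incr[OF \<delta> v] by simp
next
  assume E: "En \<gamma>1 \<delta> v < \<infinity>"
  show "sqint (kmeas \<gamma>1 \<delta>) (incr v)"
    by (rule sqintI_nn) (measurable, use E nn_integral_incr[OF \<delta> v] in simp)
qed

lemma Sn_sq:
  fixes v :: "'a \<Rightarrow> real"
  assumes \<delta>: "0 < \<delta>" and v: "v \<in> borel_measurable borel" and "En \<gamma>1 \<delta> v < \<infinity>"
  shows "ennreal ((Sn \<gamma>1 \<delta> v)\<^sup>2) = En \<gamma>1 \<delta> v"
  using nn_integral_l2norm[OF sqint_incr_iff[OF \<delta> v, THEN iffD2, OF assms(3)]] nn_integral_incr[OF \<delta> v] by simp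

lemma Sn_sq_le:
  fixes v :: "'a \<Rightarrow> real"
  assumes \<delta>: "0 < \<delta>" and v: "v \<in> borel_measurable borel" and E: "En \<gamma>1 \<delta> v \<le> ennreal c" and "0 \<le> c"
  shows "En \<gamma>1 \<delta> v < \<infinity>" "(Sn \<gamma>1 \<delta> v)\<^sup>2 \<le> c"
proof -
  show f: "En \<gamma>1 \<delta> v < \<infinity>" using E by (rule le_less_trans) simp
  show "(Sn \<gamma>1 \<delta> v)\<^sup>2 \<le> c" using Sn_sq[OF \<delta> v f] E \<open>0 \<le> c\<close> by (metis ennreal_le_iff)
qed

text \<open>A term quadratic in the displacement costs its coefficient times the second moment of
  the kernel, which is the dimension at every horizon. This makes the bounds for cutoffs and test
  functions uniform.\<close>

lemma En_quadratic:
  fixes v w :: "'a \<Rightarrow> real"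
  assumes \<delta>: "0 < \<delta>" and [measurable]: "w \<in> borel_measurable borel"
    and le: "\<And>h. mod_sq v h \<le> ennreal a * mod_sq w h + ennreal (c * (norm h)\<^sup>2)" and c: "0 \<le> c"
  shows "En \<gamma>1 \<delta> v \<le> ennreal a * En \<gamma>1 \<delta> w + ennreal (c * real DIM('a))"
proof -
  note [measurable] = ker_meas[OF \<delta>]
  have "En \<gamma>1 \<delta> v \<le> (\<integral>\<^sup>+h. ennreal a * (ennreal (ker \<gamma>1 \<delta> (h::'a)) * mod_sq w h)
      + ennreal c * ennreal (ker \<gamma>1 \<delta> h * (norm h)\<^sup>2) \<partial>lborel)"
    unfolding En_def
  proof (rule nn_integral_mono)
    fix h :: 'a
    have "ennreal (ker \<gamma>1 \<delta> h) * mod_sq v h \<le> ennreal (ker \<gamma>1 \<delta> h) * (ennreal a * mod_sq w h + ennreal (c * (norm h)\<^sup>2))"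
      by (rule mult_left_mono[OF le]) simp
    also have "\<dots> = ennreal a * (ennreal (ker \<gamma>1 \<delta> h) * mod_sq w h) + ennreal (ker \<gamma>1 \<delta> h) * ennreal (c * (norm h)\<^sup>2)"
      by (simp add: distrib_left mult_ac)
    also have "ennreal (ker \<gamma>1 \<delta> h) * ennreal (c * (norm h)\<^sup>2) = ennreal c * ennreal (ker \<gamma>1 \<delta> h * (norm h)\<^sup>2)"
      using c ker_nonneg[OF K \<delta>, of h] by (simp add: mult_ac flip: ennreal_mult)
    finally show "ennreal (ker \<gamma>1 \<delta> h) * mod_sq v h
        \<le> ennreal a * (ennreal (ker \<gamma>1 \<delta> h) * mod_sq w h) + ennreal c * ennreal (ker \<gamma>1 \<delta> h * (norm h)\<^sup>2)" .
  qed
  also have "\<dots> = (\<integral>\<^sup>+h. ennreal a * (ennreal (ker \<gamma>1 \<delta> (h::'a)) * mod_sq w h) \<partial>lborel)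
      + (\<integral>\<^sup>+h. ennreal c * ennreal (ker \<gamma>1 \<delta> (h::'a) * (norm h)\<^sup>2) \<partial>lborel)"
    by (rule nn_integral_add) measurable
  also have "\<dots> = ennreal a * En \<gamma>1 \<delta> w + ennreal c * ennreal (real DIM('a))"
    unfolding En_def ker_second_moment(1)[OF K \<delta>, symmetric]
    by (intro arg_cong2[where f="(+)"] nn_integral_cmult) measurable
  finally show ?thesis using c by (simp add: ennreal_mult)
qed

text \<open>Substituting n times the displacement, the Jacobian n^d, the kernel factor n^-(d+2) and
  the n^2 of \<open>mod_sq_mult\<close> cancel exactly.\<close>

lemma En_scale:
  fixes v :: "'a \<Rightarrow> real"
  assumes \<delta>: "0 < \<delta>" and v[measurable]: "v \<in> borel_measurable borel" and n: "0 < n"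
  shows "En \<gamma>1 (real n * \<delta>) v \<le> En \<gamma>1 \<delta> v"
proof -
  have n\<delta>: "0 < real n * \<delta>" using \<delta> n by simp
  note [measurable] = ker_meas[OF \<delta>] ker_meas[OF n\<delta>]
  have "En \<gamma>1 (real n * \<delta>) v = ennreal (\<bar>real n\<bar> ^ DIM('a)) *
      (\<integral>\<^sup>+k. ennreal (ker \<gamma>1 (real n * \<delta>) (real n *\<^sub>R k)) * mod_sq v (real n *\<^sub>R k) \<partial>lborel)"
    unfolding En_def using n by (intro nn_integral_scale) auto
  also have "\<dots> = (\<integral>\<^sup>+k. ennreal (\<bar>real n\<bar> ^ DIM('a)) * (ennreal (ker \<gamma>1 (real n * \<delta>) (real n *\<^sub>R k)) * mod_sq v (real n *\<^sub>R k)) \<partial>lborel)"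
    by (rule nn_integral_cmult[symmetric]) measurable
  also have "\<dots> \<le> (\<integral>\<^sup>+k. ennreal (ker \<gamma>1 \<delta> k) * mod_sq v k \<partial>lborel)"
  proof (rule nn_integral_mono)
    fix k :: 'a
    have "ennreal (\<bar>real n\<bar> ^ DIM('a)) * (ennreal (ker \<gamma>1 (real n * \<delta>) (real n *\<^sub>R k)) * mod_sq v (real n *\<^sub>R k))
      \<le> ennreal (\<bar>real n\<bar> ^ DIM('a)) * (ennreal (ker \<gamma>1 \<delta> k / real n ^ (DIM('a) + 2)) * (ennreal ((real n)\<^sup>2) * mod_sq v k))"
      using ker_scale[OF K \<delta>, of "real n" k] n mod_sq_mult[OF v, of n k]
      by (intro mult_left_mono mult_mono) auto
    also have "\<dots> = ennreal (real n ^ DIM('a) * (ker \<gamma>1 \<delta> k / real n ^ (DIM('a) + 2)) * (real n)\<^sup>2) * mod_sq v k"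
    proof -
      have a: "0 \<le> real n ^ DIM('a)" and b: "0 \<le> (real n)\<^sup>2" and c: "0 \<le> ker \<gamma>1 \<delta> k / real n ^ (DIM('a) + 2)"
        using ker_nonneg[OF K \<delta>, of k] by simp_all
      show ?thesis
        unfolding ennreal_mult[OF mult_nonneg_nonneg[OF a c] b] ennreal_mult[OF a c] by (simp only: abs_of_nat mult.assoc)
    qed
    also have "real n ^ DIM('a) * (ker \<gamma>1 \<delta> k / real n ^ (DIM('a) + 2)) * (real n)\<^sup>2 = ker \<gamma>1 \<delta> k"
      using n by (simp add: power_add power2_eq_square)
    finally show "ennreal (\<bar>real n\<bar> ^ DIM('a)) * (ennreal (ker \<gamma>1 (real n * \<delta>) (real n *\<^sub>R k)) * mod_sq v (real n *\<^sub>R k))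
      \<le> ennreal (ker \<gamma>1 \<delta> k) * mod_sq v k" .
  qed
  finally show ?thesis unfolding En_def .
qed

text \<open>\<open>En_scale\<close> reaches integer multiples of the horizon only; the remaining
  ratio, at most 2, is paid for by \<open>ker_comparison\<close>.\<close>

lemma En_larger_horizon:
  fixes v :: "'a \<Rightarrow> real"
  assumes \<delta>: "0 < \<delta>" "\<delta> \<le> \<delta>1" and v[measurable]: "v \<in> borel_measurable borel"
  shows "En \<gamma>1 \<delta>1 v \<le> ennreal (2 ^ (DIM('a) + 2)) * En \<gamma>1 \<delta> v"
proof -
  \<comment> \<open>Rounding up places \<open>real n * \<delta>\<close> between
    \<open>\<delta>1\<close> and \<open>2 * \<delta>1\<close>, the range of
    \<open>ker_comparison\<close>.\<close>
  define n where "n = nat \<lceil>\<delta>1 / \<delta>\<rceil>"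
  have q: "1 \<le> \<delta>1 / \<delta>" using \<delta> by simp
  have n1: "\<delta>1 / \<delta> \<le> real n" unfolding n_def by (rule real_nat_ceiling_ge)
  have "real_of_int \<lceil>\<delta>1 / \<delta>\<rceil> < \<delta>1 / \<delta> + 1" by linarith
  moreover have "real n = real_of_int \<lceil>\<delta>1 / \<delta>\<rceil>"
    using q by (simp add: n_def)
  ultimately have n2: "real n \<le> 2 * (\<delta>1 / \<delta>)" using q by linarith
  have n0: "0 < n" using n1 q by (cases n) auto
  have nd: "\<delta>1 \<le> real n * \<delta>" "real n * \<delta> \<le> 2 * \<delta>1" using n1 n2 \<delta> by (auto simp: field_simps)
  have \<delta>1: "0 < \<delta>1" and n\<delta>: "0 < real n * \<delta>" using \<delta> n0 by auto
  note [measurable] = ker_meas[OF n\<delta>]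
  have "En \<gamma>1 \<delta>1 v \<le> (\<integral>\<^sup>+h. ennreal (2 ^ (DIM('a) + 2)) * (ennreal (ker \<gamma>1 (real n * \<delta>) (h::'a)) * mod_sq v h) \<partial>lborel)"
    unfolding En_def
  proof (rule nn_integral_mono)
    fix h :: 'a
    have "ennreal (ker \<gamma>1 \<delta>1 h) \<le> ennreal (2 ^ (DIM('a) + 2) * ker \<gamma>1 (real n * \<delta>) h)"
      by (rule ennreal_leI[OF ker_comparison[OF K \<delta>1 nd]])
    also have "\<dots> = ennreal (2 ^ (DIM('a) + 2)) * ennreal (ker \<gamma>1 (real n * \<delta>) h)"
      by (rule ennreal_mult'') (rule ker_nonneg[OF K n\<delta>])
    finally have "ennreal (ker \<gamma>1 \<delta>1 h) * mod_sq v h \<le> (ennreal (2 ^ (DIM('a) + 2)) * ennreal (ker \<gamma>1 (real n * \<delta>) h)) * mod_sq v h"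
      by (rule mult_right_mono) simp
    then show "ennreal (ker \<gamma>1 \<delta>1 h) * mod_sq v h \<le> ennreal (2 ^ (DIM('a) + 2)) * (ennreal (ker \<gamma>1 (real n * \<delta>) h) * mod_sq v h)"
      by (simp only: mult.assoc)
  qed
  also have "\<dots> = ennreal (2 ^ (DIM('a) + 2)) * En \<gamma>1 (real n * \<delta>) v"
    unfolding En_def by (rule nn_integral_cmult) measurable
  also have "\<dots> \<le> ennreal (2 ^ (DIM('a) + 2)) * En \<gamma>1 \<delta> v"
    by (rule mult_left_mono[OF En_scale[OF \<delta>(1) v n0]]) simp
  finally show ?thesis .
qed

lemma Sn_larger_horizon:
  fixes v :: "'a \<Rightarrow> real"
  assumes \<delta>: "0 < \<delta>" "\<delta> \<le> \<delta>1" and v: "v \<in> borel_measurable borel" and f: "En \<gamma>1 \<delta> v < \<infinity>"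
  shows "En \<gamma>1 \<delta>1 v < \<infinity>" "(Sn \<gamma>1 \<delta>1 v)\<^sup>2 \<le> 2 ^ (DIM('a) + 2) * (Sn \<gamma>1 \<delta> v)\<^sup>2"
proof -
  have \<delta>1: "0 < \<delta>1" using \<delta> by simp
  have "En \<gamma>1 \<delta>1 v \<le> ennreal (2 ^ (DIM('a) + 2)) * ennreal ((Sn \<gamma>1 \<delta> v)\<^sup>2)"
    using En_larger_horizon[OF \<delta> v] Sn_sq[OF \<delta>(1) v f] by simp
  also have "\<dots> = ennreal (2 ^ (DIM('a) + 2) * (Sn \<gamma>1 \<delta> v)\<^sup>2)" by (rule ennreal_mult'[symmetric]) simp
  finally have le: "En \<gamma>1 \<delta>1 v \<le> ennreal (2 ^ (DIM('a) + 2) * (Sn \<gamma>1 \<delta> v)\<^sup>2)" .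
  show "En \<gamma>1 \<delta>1 v < \<infinity>" by (rule Sn_sq_le(1)[OF \<delta>1 v le]) simp
  show "(Sn \<gamma>1 \<delta>1 v)\<^sup>2 \<le> 2 ^ (DIM('a) + 2) * (Sn \<gamma>1 \<delta> v)\<^sup>2" by (rule Sn_sq_le(2)[OF \<delta>1 v le]) simp
qed

text \<open>Leibniz rule for increments: one part carries the increment of \<open>v\<close>, the
  other that of the cutoff, which is linear in \<open>h\<close> and therefore contributes only the
  L2 norm of \<open>v\<close>.\<close>

lemma mod_sq_cutoff:
  fixes v \<theta> :: "'a \<Rightarrow> real"
  assumes v: "sqint lborel v" and \<theta>: "\<theta> \<in> borel_measurable borel" "\<And>x. \<bar>\<theta> x\<bar> \<le> 1" "\<And>x h. \<bar>\<theta> (x + h) - \<theta> x\<bar> \<le> L * norm h"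
  shows "mod_sq (\<lambda>x. \<theta> x * v x) h \<le> ennreal 2 * mod_sq v h + ennreal ((2 * L\<^sup>2 * (l2norm lborel v)\<^sup>2) * (norm h)\<^sup>2)"
proof -
  have v'[measurable]: "v \<in> borel_measurable borel" using sqint_measurable[OF v] by simp
  have pt: "(\<theta> (x + h) * v (x + h) - \<theta> x * v x)\<^sup>2 \<le> 2 * (v (x + h) - v x)\<^sup>2 + (2 * L\<^sup>2 * (norm h)\<^sup>2) * (norm (v x))\<^sup>2" for x
  proof -
    define a where "a = \<theta> (x + h) * (v (x + h) - v x)"
    define b where "b = (\<theta> (x + h) - \<theta> x) * v x"
    have "\<theta> (x + h) * v (x + h) - \<theta> x * v x = a + b" by (simp add: a_def b_def algebra_simps)
    moreover have "(a + b)\<^sup>2 \<le> 2 * a\<^sup>2 + 2 * b\<^sup>2"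
      using sum_squares_bound[of a b] by (simp add: power2_sum)
    moreover have "a\<^sup>2 \<le> (v (x + h) - v x)\<^sup>2"
    proof -
      have "\<bar>a\<bar> \<le> 1 * \<bar>v (x + h) - v x\<bar>" unfolding a_def abs_mult by (rule mult_right_mono[OF \<theta>(2)]) simp
      then show ?thesis by (simp add: abs_le_square_iff)
    qed
    moreover have "b\<^sup>2 \<le> (L * norm h * \<bar>v x\<bar>)\<^sup>2"
    proof -
      have "\<bar>b\<bar> \<le> L * norm h * \<bar>v x\<bar>" unfolding b_def abs_mult by (rule mult_right_mono[OF \<theta>(3)]) simp
      from power_mono[OF this, of 2] show ?thesis by simp
    qed
    moreover have "(L * norm h * \<bar>v x\<bar>)\<^sup>2 = L\<^sup>2 * (norm h)\<^sup>2 * (norm (v x))\<^sup>2" by (simp add: power_mult_distrib)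
    ultimately show ?thesis by (simp only:)
  qed
  have "mod_sq (\<lambda>x. \<theta> x * v x) h \<le> (\<integral>\<^sup>+x. ennreal 2 * ennreal ((v (x + h) - v x)\<^sup>2) + ennreal (2 * L\<^sup>2 * (norm h)\<^sup>2) * ennreal ((norm (v x))\<^sup>2) \<partial>lborel)"
    unfolding mod_sq_def
  proof (rule nn_integral_mono)
    fix x
    have "ennreal ((\<theta> (x + h) * v (x + h) - \<theta> x * v x)\<^sup>2) \<le> ennreal (2 * (v (x + h) - v x)\<^sup>2 + (2 * L\<^sup>2 * (norm h)\<^sup>2) * (norm (v x))\<^sup>2)"
      by (rule ennreal_leI[OF pt])
    also have "\<dots> = ennreal 2 * ennreal ((v (x + h) - v x)\<^sup>2) + ennreal (2 * L\<^sup>2 * (norm h)\<^sup>2) * ennreal ((norm (v x))\<^sup>2)"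
      by (subst ennreal_plus) (simp_all add: ennreal_mult del: norm_power ennreal_numeral)
    finally show "ennreal ((\<theta> (x + h) * v (x + h) - \<theta> x * v x)\<^sup>2) \<le> ennreal 2 * ennreal ((v (x + h) - v x)\<^sup>2) + ennreal (2 * L\<^sup>2 * (norm h)\<^sup>2) * ennreal ((norm (v x))\<^sup>2)" .
  qed
  also have "\<dots> = (\<integral>\<^sup>+x. ennreal 2 * ennreal ((v (x + h) - v x)\<^sup>2) \<partial>lborel) + (\<integral>\<^sup>+x. ennreal (2 * L\<^sup>2 * (norm h)\<^sup>2) * ennreal ((norm (v x))\<^sup>2) \<partial>lborel)"
    by (rule nn_integral_add) measurable
  also have "(\<integral>\<^sup>+x. ennreal 2 * ennreal ((v (x + h) - v x)\<^sup>2) \<partial>lborel) = ennreal 2 * mod_sq v h"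
    unfolding mod_sq_def by (rule nn_integral_cmult) measurable
  also have "(\<integral>\<^sup>+x. ennreal (2 * L\<^sup>2 * (norm h)\<^sup>2) * ennreal ((norm (v x))\<^sup>2) \<partial>lborel) = ennreal (2 * L\<^sup>2 * (norm h)\<^sup>2) * ennreal ((l2norm lborel v)\<^sup>2)"
    unfolding nn_integral_l2norm[OF v, symmetric] by (rule nn_integral_cmult) measurable
  also have "\<dots> = ennreal ((2 * L\<^sup>2 * (l2norm lborel v)\<^sup>2) * (norm h)\<^sup>2)"
    by (subst ennreal_mult[symmetric]) (simp_all add: mult_ac)
  finally show ?thesis .
qed

text \<open>Increments are at most L times the displacement and differ from 0 only when one of the
  two points lies in a fixed ball; hence the constant can be chosen before the horizon.\<close>

lemma En_test_function:
  fixes \<phi> :: "'a \<Rightarrow> real"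
  assumes "\<phi> \<in> test_functions \<Omega>"
  obtains C where "0 \<le> C" "\<And>\<delta>. 0 < \<delta> \<Longrightarrow> En \<gamma>1 \<delta> \<phi> \<le> ennreal C"
proof -
  obtain L where L: "0 < L" "\<And>x h. \<bar>\<phi> (x + h) - \<phi> x\<bar> \<le> L * norm h" using test_functions_lipschitz[OF assms] by blast
  obtain \<rho> where \<rho>: "0 < \<rho>" "\<And>x. \<rho> \<le> norm x \<Longrightarrow> \<phi> x = 0" using test_functions_ball[OF assms] by blast
  define U where "U = cball (0::'a) \<rho>"
  define V where "V = measure lborel U"
  have U[measurable]: "U \<in> sets borel" by (simp add: U_def)
  have eU: "emeasure lborel U = ennreal V"
    unfolding V_def U_def using emeasure_bounded_finite[of "cball (0::'a) \<rho>"] by (intro emeasure_eq_ennreal_measure) simp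
  have V: "0 \<le> V" by (simp add: V_def)
  \<comment> \<open>The vanishing first summand only brings the bound into the shape of
    \<open>En_quadratic\<close>.\<close>
  have "mod_sq \<phi> h \<le> ennreal 0 * mod_sq (\<lambda>_. 0) h + ennreal ((2 * L\<^sup>2 * V) * (norm h)\<^sup>2)" for h
  proof -
    have pt: "(\<phi> (x + h) - \<phi> x)\<^sup>2 \<le> (L * norm h)\<^sup>2 * (indicator U (x + h) + indicator U x)" for x
    proof (cases "x \<in> U \<or> x + h \<in> U")
      case True
      have "(\<phi> (x + h) - \<phi> x)\<^sup>2 \<le> (L * norm h)\<^sup>2" using power_mono[OF L(2)[of x h], of 2] by simp
      also have "\<dots> \<le> (L * norm h)\<^sup>2 * (indicator U (x + h) + indicator U x)"
        using True by (cases "x \<in> U"; cases "x + h \<in> U") simp_all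
      finally show ?thesis .
    next
      case False
      then have "\<phi> (x + h) = 0" "\<phi> x = 0" using \<rho>(2)[of x] \<rho>(2)[of "x + h"] by (auto simp: U_def)
      then show ?thesis by simp
    qed
    have "mod_sq \<phi> h \<le> (\<integral>\<^sup>+x. ennreal ((L * norm h)\<^sup>2) * (indicator U (x + h) + indicator U x) \<partial>lborel)"
      unfolding mod_sq_def
    proof (rule nn_integral_mono)
      fix x
      have "ennreal ((\<phi> (x + h) - \<phi> x)\<^sup>2) \<le> ennreal ((L * norm h)\<^sup>2 * (indicator U (x + h) + indicator U x))"
        by (rule ennreal_leI[OF pt])
      also have "\<dots> = ennreal ((L * norm h)\<^sup>2) * (indicator U (x + h) + indicator U x)"
        by (subst ennreal_mult) (simp_all add: ennreal_plus ennreal_indicator)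
      finally show "ennreal ((\<phi> (x + h) - \<phi> x)\<^sup>2) \<le> ennreal ((L * norm h)\<^sup>2) * (indicator U (x + h) + indicator U x)" .
    qed
    also have "\<dots> = ennreal ((L * norm h)\<^sup>2) * (\<integral>\<^sup>+x. indicator U (x + h) + indicator U x \<partial>lborel)"
      by (rule nn_integral_cmult) measurable
    also have "(\<integral>\<^sup>+x. indicator U (x + h) + indicator U x \<partial>lborel) = (\<integral>\<^sup>+x. indicator U (x + h) \<partial>lborel) + (\<integral>\<^sup>+x. indicator U x \<partial>lborel)"
      by (rule nn_integral_add) measurable
    also have "(\<integral>\<^sup>+x. indicator U (x + h) \<partial>lborel) = (\<integral>\<^sup>+x. indicator U x \<partial>lborel)"
      by (rule nn_integral_shift[of "indicator U"]) measurable
    also have "(\<integral>\<^sup>+x. indicator U x \<partial>lborel) = ennreal V" using U by (simp add: eU)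
    also have "ennreal ((L * norm h)\<^sup>2) * (ennreal V + ennreal V) = ennreal ((2 * L\<^sup>2 * V) * (norm h)\<^sup>2)"
      using V by (subst ennreal_plus[symmetric], simp, simp, subst ennreal_mult[symmetric]) (simp_all add: power_mult_distrib algebra_simps)
    finally show ?thesis by simp
  qed
  note * = this
  have m0: "(\<lambda>_. 0) \<in> borel_measurable (borel :: 'a measure)" by simp
  show ?thesis
  proof (rule that[of "(2 * L\<^sup>2 * V) * real DIM('a)"])
    show "En \<gamma>1 \<delta> \<phi> \<le> ennreal ((2 * L\<^sup>2 * V) * real DIM('a))" if \<delta>: "0 < \<delta>" for \<delta>
      using En_quadratic[OF \<delta> m0 *] V by simp
  qed (use V in simp)
qed

text \<open>
  Near the diagonal the increment of the fixed first argument is small in the weighted space;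
  away from it the kernel is bounded.
\<close>

lemma form_small_in_L2:
  fixes v :: "'a \<Rightarrow> real"
  assumes \<delta>: "0 < \<delta>" and v[measurable]: "v \<in> borel_measurable borel" and fv: "En \<gamma>1 \<delta> v < \<infinity>"
    and M: "0 \<le> M" and e: "0 < e"
  obtains C where "0 \<le> C"
    "\<And>B z. B \<in> borel_measurable (borel \<Otimes>\<^sub>M borel) \<Longrightarrow> AE p in kmeas \<gamma>1 \<delta>. \<bar>B p\<bar> \<le> M \<Longrightarrow>
      sqint lborel z \<Longrightarrow> En \<gamma>1 \<delta> z < \<infinity> \<Longrightarrow>
      \<bar>LINT p|kmeas \<gamma>1 \<delta>. B p * (incr v p * incr z p)\<bar> \<le> e * Sn \<gamma>1 \<delta> z + C * l2norm lborel z"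
proof -
  define \<mu> where "\<mu> = (kmeas \<gamma>1 \<delta> :: ('a \<times> 'a) measure)"
  have [measurable_cong]: "sets \<mu> = sets (borel \<Otimes>\<^sub>M borel)" unfolding \<mu>_def by (rule sets_kmeas)
  have sv: "sqint \<mu> (incr v)" unfolding \<mu>_def using sqint_incr_iff[OF \<delta> v] fv by simp
  \<comment> \<open>The part of the increment of \<open>v\<close> near the diagonal. It tends to 0
    pointwise, on the diagonal because the increment is 0 there, so dominated convergence makes its
    weighted norm small.\<close>
  define N where "N n p = (if norm (snd p) < 1 / real (Suc n) then incr v p else 0)" for n and p :: "'a \<times> 'a"
  have N[measurable]: "N n \<in> borel_measurable (borel \<Otimes>\<^sub>M borel)" for n unfolding N_def by measurable
  have "(\<lambda>n. LINT p|\<mu>. (norm (N n p))\<^sup>2) \<longlonglongrightarrow> (LINT p|\<mu>. (0::real))"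
  proof (rule Bochner_Integration.integral_dominated_convergence[where w="\<lambda>p. (norm (incr v p))\<^sup>2"])
    show "integrable \<mu> (\<lambda>p. (norm (incr v p))\<^sup>2)" using sv by (simp add: sqint_def)
    show "AE p in \<mu>. (\<lambda>n. (norm (N n p))\<^sup>2) \<longlonglongrightarrow> 0"
    proof (rule AE_I2)
      fix p :: "'a \<times> 'a"
      have "\<forall>\<^sub>F n in sequentially. (norm (N n p))\<^sup>2 = 0"
      proof (cases "snd p = 0")
        case True
        then show ?thesis by (simp add: N_def incr_def)
      next
        case False
        then obtain n0 where n0: "1 / real (Suc n0) < norm (snd p)" using nat_approx_posE[of "norm (snd p)"] by auto
        have "N n p = 0" if "n0 \<le> n" for n
        proof -
          have "1 / real (Suc n) \<le> 1 / real (Suc n0)" using that by (simp add: frac_le)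
          then show ?thesis using n0 by (simp add: N_def)
        qed
        then show ?thesis unfolding eventually_sequentially by (intro exI[of _ n0]) simp
      qed
      then show "(\<lambda>n. (norm (N n p))\<^sup>2) \<longlonglongrightarrow> 0" by (rule tendsto_eventually)
    qed
    show "AE p in \<mu>. norm ((norm (N n p))\<^sup>2) \<le> (norm (incr v p))\<^sup>2" for n
      by (rule AE_I2) (simp add: N_def)
  qed measurable
  then have L: "(\<lambda>n. LINT p|\<mu>. (norm (N n p))\<^sup>2) \<longlonglongrightarrow> 0" by simp
  \<comment> \<open>Adding 1 avoids a division by zero when \<open>M\<close> is 0; the same device
    recurs below.\<close>
  have e': "0 < (e / (M + 1))\<^sup>2" using e M by simp
  obtain n where "\<forall>k\<ge>n. (LINT p|\<mu>. (norm (N k p))\<^sup>2) < (e / (M + 1))\<^sup>2"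
    using order_tendstoD(2)[OF L e'] unfolding eventually_sequentially by blast
  then have "(l2norm \<mu> (N n))\<^sup>2 \<le> (e / (M + 1))\<^sup>2" by (simp add: l2norm_sq less_imp_le)
  then have "l2norm \<mu> (N n) \<le> e / (M + 1)" by (rule power2_le_imp_le) (use e M in simp)
  then have Mn: "M * l2norm \<mu> (N n) \<le> e"
  proof -
    assume "l2norm \<mu> (N n) \<le> e / (M + 1)"
    then have "M * l2norm \<mu> (N n) \<le> (M + 1) * (e / (M + 1))" using M e by (intro mult_mono) auto
    then show ?thesis using M by simp
  qed
  have sN: "sqint \<mu> (N n)"
  proof -
    have "sqint \<mu> (\<lambda>p. (if norm (snd p) < 1 / real (Suc n) then 1 else 0) *\<^sub>R incr v p)"
    proof (rule sqint_coeff[OF sv, where C=1])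
      show "(\<lambda>p. if norm (snd p) < 1 / real (Suc n) then 1 else 0) \<in> borel_measurable \<mu>" by measurable
    qed simp
    then show ?thesis by (rule sqint_cong_AE) (measurable, simp add: N_def)
  qed
  define \<eta> where "\<eta> = 1 / real (Suc n)"
  have \<eta>: "0 < \<eta>" by (simp add: \<eta>_def)
  define \<kappa> where "\<kappa> = \<gamma>1 (\<eta> / \<delta>) / \<delta> ^ (DIM('a) + 2)"
  have \<kappa>: "0 \<le> \<kappa>" unfolding \<kappa>_def using kernel_profile(1)[OF K, of "\<eta> / \<delta>"] \<eta> \<delta> by simp
  define U where "U = ball (0::'a) \<delta>"
  define V where "V = measure lborel U"
  have eU: "emeasure lborel U = ennreal V"
    unfolding V_def U_def using emeasure_bounded_finite[of "ball (0::'a) \<delta>"] by (intro emeasure_eq_ennreal_measure) simp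
  have V: "0 \<le> V" by (simp add: V_def)
  have [measurable]: "U \<in> sets borel" by (simp add: U_def)
  note [measurable] = ker_meas[OF \<delta>]
  show ?thesis
  \<comment> \<open>Here \<open>\<kappa>\<close> bounds the kernel at distance at least
    \<open>\<eta>\<close>, \<open>V\<close> is the volume of the ball in which it lives, and 4 comes
    from \<open>mod_sq_le_norm\<close>.\<close>
  proof (rule that[of "M * Sn \<gamma>1 \<delta> v * sqrt (4 * \<kappa> * V)"])
    show "0 \<le> M * Sn \<gamma>1 \<delta> v * sqrt (4 * \<kappa> * V)" using M \<kappa> V by simp
    fix B :: "'a \<times> 'a \<Rightarrow> real" and z :: "'a \<Rightarrow> real"
    assume B[measurable]: "B \<in> borel_measurable (borel \<Otimes>\<^sub>M borel)" and BM: "AE p in kmeas \<gamma>1 \<delta>. \<bar>B p\<bar> \<le> M"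
      and z: "sqint lborel z" and fz: "En \<gamma>1 \<delta> z < \<infinity>"
    have z'[measurable]: "z \<in> borel_measurable borel" using sqint_measurable[OF z] by simp
    have sz: "sqint \<mu> (incr z)" unfolding \<mu>_def using sqint_incr_iff[OF \<delta> z'] fz by simp
    define Z where "Z p = (if norm (snd p) < \<eta> then 0 else incr z p)" for p
    have [measurable]: "Z \<in> borel_measurable (borel \<Otimes>\<^sub>M borel)" unfolding Z_def by measurable
    have Zle: "(\<integral>\<^sup>+p. ennreal ((norm (Z p))\<^sup>2) \<partial>\<mu>) \<le> ennreal (4 * \<kappa> * V * (l2norm lborel z)\<^sup>2)"
    proof -
      have "(\<integral>\<^sup>+p. ennreal ((norm (Z p))\<^sup>2) \<partial>\<mu>) = (\<integral>\<^sup>+h. ennreal (ker \<gamma>1 \<delta> h) * (\<integral>\<^sup>+x. ennreal ((norm (Z (x, h)))\<^sup>2) \<partial>lborel) \<partial>lborel)"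
        unfolding \<mu>_def by (rule nn_integral_kmeas[OF \<delta>]) measurable
      also have "\<dots> \<le> (\<integral>\<^sup>+h. ennreal (\<kappa> * (4 * (l2norm lborel z)\<^sup>2)) * indicator U h \<partial>lborel)"
      proof (rule nn_integral_mono)
        fix h :: 'a
        consider "norm h < \<eta>" | "\<delta> \<le> norm h" | "\<eta> \<le> norm h" "norm h < \<delta>" by linarith
        then show "ennreal (ker \<gamma>1 \<delta> h) * (\<integral>\<^sup>+x. ennreal ((norm (Z (x, h)))\<^sup>2) \<partial>lborel)
            \<le> ennreal (\<kappa> * (4 * (l2norm lborel z)\<^sup>2)) * indicator U h"
        proof cases
          case 1
          then show ?thesis by (simp add: Z_def)
        next
          case 2
          then show ?thesis using ker_eq_0[OF K \<delta>, of h] by simp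
        next
          case 3
          have "(\<integral>\<^sup>+x. ennreal ((norm (Z (x, h)))\<^sup>2) \<partial>lborel) = mod_sq z h"
            using 3 by (simp add: Z_def mod_sq_def incr_def)
          then have "ennreal (ker \<gamma>1 \<delta> h) * (\<integral>\<^sup>+x. ennreal ((norm (Z (x, h)))\<^sup>2) \<partial>lborel) \<le> ennreal \<kappa> * ennreal (4 * (l2norm lborel z)\<^sup>2)"
            using mod_sq_le_norm[OF z, of h] ker_le[OF K \<delta> \<eta> 3(1)] unfolding \<kappa>_def
            by (intro mult_mono) (auto intro: ennreal_leI)
          also have "\<dots> = ennreal (\<kappa> * (4 * (l2norm lborel z)\<^sup>2))" using \<kappa> by (intro ennreal_mult[symmetric]) simp_all
          finally show ?thesis using 3 by (simp add: U_def)
        qed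
      qed
      also have "\<dots> = ennreal (\<kappa> * (4 * (l2norm lborel z)\<^sup>2)) * emeasure lborel U"
        by (subst nn_integral_cmult_indicator) simp_all
      also have "\<dots> = ennreal (4 * \<kappa> * V * (l2norm lborel z)\<^sup>2)"
        unfolding eU using \<kappa> V by (subst ennreal_mult[symmetric]) (simp_all add: mult_ac)
      finally show ?thesis .
    qed
    have mZ: "Z \<in> borel_measurable \<mu>" by measurable
    have C0: "0 \<le> 4 * \<kappa> * V * (l2norm lborel z)\<^sup>2" using \<kappa> V by simp
    note sZ = l2norm_le_nn(1)[OF mZ Zle C0]
    have "(l2norm \<mu> Z)\<^sup>2 \<le> (sqrt (4 * \<kappa> * V) * l2norm lborel z)\<^sup>2"
      using l2norm_le_nn(2)[OF mZ Zle C0] \<kappa> V by (simp add: power_mult_distrib)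
    then have lZ: "l2norm \<mu> Z \<le> sqrt (4 * \<kappa> * V) * l2norm lborel z"
      by (rule power2_le_imp_le) (use \<kappa> V in simp)
    have mB: "B \<in> borel_measurable \<mu>" by measurable
    have BM': "AE p in \<mu>. \<bar>B p\<bar> \<le> M" using BM unfolding \<mu>_def .
    have i1: "integrable \<mu> (\<lambda>p. B p * (N n p \<bullet> incr z p))" by (rule integrable_coeff_inner[OF sN sz mB BM'])
    have i2: "integrable \<mu> (\<lambda>p. B p * (incr v p \<bullet> Z p))" by (rule integrable_coeff_inner[OF sv sZ mB BM'])
    have eq: "B p * (incr v p * incr z p) = B p * (N n p \<bullet> incr z p) + B p * (incr v p \<bullet> Z p)" for p
      by (simp add: N_def Z_def \<eta>_def)
    have "\<bar>LINT p|\<mu>. B p * (incr v p * incr z p)\<bar> \<le> \<bar>LINT p|\<mu>. B p * (N n p \<bullet> incr z p)\<bar> + \<bar>LINT p|\<mu>. B p * (incr v p \<bullet> Z p)\<bar>"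
      unfolding eq using i1 i2 by (subst Bochner_Integration.integral_add) auto
    also have "\<dots> \<le> M * (l2norm \<mu> (N n) * l2norm \<mu> (incr z)) + M * (l2norm \<mu> (incr v) * l2norm \<mu> Z)"
      by (rule add_mono[OF integral_coeff_inner_le[OF sN sz mB BM' M] integral_coeff_inner_le[OF sv sZ mB BM' M]])
    also have "\<dots> \<le> e * l2norm \<mu> (incr z) + M * (l2norm \<mu> (incr v) * (sqrt (4 * \<kappa> * V) * l2norm lborel z))"
    proof (rule add_mono)
      show "M * (l2norm \<mu> (N n) * l2norm \<mu> (incr z)) \<le> e * l2norm \<mu> (incr z)"
        using mult_right_mono[OF Mn l2norm_nonneg[of \<mu> "incr z"]] by (simp only: mult.assoc)
      show "M * (l2norm \<mu> (incr v) * l2norm \<mu> Z) \<le> M * (l2norm \<mu> (incr v) * (sqrt (4 * \<kappa> * V) * l2norm lborel z))"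
        by (intro mult_left_mono lZ M l2norm_nonneg)
    qed
    finally show "\<bar>LINT p|kmeas \<gamma>1 \<delta>. B p * (incr v p * incr z p)\<bar> \<le> e * Sn \<gamma>1 \<delta> z + M * Sn \<gamma>1 \<delta> v * sqrt (4 * \<kappa> * V) * l2norm lborel z"
      unfolding \<mu>_def by (simp only: mult.assoc)
  qed
qed

end

section \<open>Convolution\<close>

definition conv :: "('a::euclidean_space \<Rightarrow> real) \<Rightarrow> ('a \<Rightarrow> real) \<Rightarrow> 'a \<Rightarrow> real" where
  "conv \<kappa> g x = (LINT z|lborel. \<kappa> (x - z) * g z)"

lemma distr_reflect_shift: "distr lborel borel (\<lambda>k. x - k) = (lborel :: 'a::euclidean_space measure)"
proof -
  have "(lborel :: 'a measure) = density (distr lborel borel (\<lambda>k. x + (- 1) *\<^sub>R k)) (\<lambda>_. ennreal (\<bar>- 1\<bar> ^ DIM('a)))"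
    by (rule lborel_affine) simp
  then show ?thesis by (simp add: density_1)
qed

lemma lborel_reflect_shift:
  fixes f :: "'a::euclidean_space \<Rightarrow> real"
  assumes [measurable]: "f \<in> borel_measurable borel"
  shows "(LINT k|lborel. f (x - k)) = (LINT k|lborel. f k)"
    and "integrable lborel (\<lambda>k. f (x - k)) \<longleftrightarrow> integrable lborel f"
proof -
  have "(LINT k|distr lborel borel (\<lambda>k. x - k). f k) = (LINT k|lborel. f (x - k))"
    by (rule integral_distr) measurable
  then show "(LINT k|lborel. f (x - k)) = (LINT k|lborel. f k)" by (simp add: distr_reflect_shift)
  have "integrable (distr lborel borel (\<lambda>k. x - k)) f \<longleftrightarrow> integrable lborel (\<lambda>k. f (x - k))"
    by (rule integrable_distr_eq) measurable
  then show "integrable lborel (\<lambda>k. f (x - k)) \<longleftrightarrow> integrable lborel f" by (simp add: distr_reflect_shift)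
qed

lemma sqint_reflect_shift:
  fixes g :: "'a::euclidean_space \<Rightarrow> real"
  assumes "sqint lborel g"
  shows "sqint lborel (\<lambda>k. g (x - k))"
proof -
  have [measurable]: "g \<in> borel_measurable borel" using sqint_measurable[OF assms] by simp
  have "integrable lborel (\<lambda>k. (norm (g (x - k)))\<^sup>2)"
    using lborel_reflect_shift(2)[of "\<lambda>k. (norm (g k))\<^sup>2" x] assms by (simp add: sqint_def)
  then show ?thesis by (simp add: sqint_def)
qed

lemma sqint_integrable_bounded:
  fixes g :: "'a::euclidean_space \<Rightarrow> real"
  assumes "sqint lborel g" "bounded U" "\<And>x. x \<notin> U \<Longrightarrow> g x = 0"
  shows "integrable lborel g"
proof -
  obtain \<rho> where \<rho>: "\<And>x. x \<in> U \<Longrightarrow> norm x \<le> \<rho>" using assms(2) unfolding bounded_iff by blast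
  have "integrable lborel (indicator (cball 0 \<rho>) :: 'a \<Rightarrow> real)"
    by (rule integrable_real_indicator) (simp, rule emeasure_bounded_finite, simp)
  moreover have "(\<lambda>x. (norm (indicator (cball 0 \<rho>) x :: real))\<^sup>2) = indicator (cball 0 \<rho> :: 'a set)"
    by (auto simp: indicator_def)
  ultimately have "integrable lborel (\<lambda>x::'a. (norm (indicator (cball 0 \<rho>) x :: real))\<^sup>2)" by simp
  then have "sqint lborel (indicator (cball 0 \<rho>) :: 'a \<Rightarrow> real)"
    by (simp add: sqint_def borel_measurable_indicator)
  from integrable_inner_sqint(2)[OF this assms(1)]
  have "integrable lborel (\<lambda>x. indicator (cball 0 \<rho>) x * g x)" by simp
  moreover have "indicator (cball 0 \<rho>) x * g x = g x" for x
    using \<rho>[of x] assms(3)[of x] by (cases "x \<in> U") auto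
  ultimately show ?thesis by simp
qed

lemma conv_measurable [measurable]:
  assumes [measurable]: "\<kappa> \<in> borel_measurable borel" "g \<in> borel_measurable borel"
  shows "conv \<kappa> g \<in> borel_measurable borel"
  unfolding conv_def[abs_def] by measurable

lemma conv_integrable:
  fixes \<kappa> g :: "'a::euclidean_space \<Rightarrow> real"
  assumes "sqint lborel \<kappa>" "sqint lborel g"
  shows "integrable lborel (\<lambda>z. \<kappa> (x - z) * g z)" "integrable lborel (\<lambda>k. \<kappa> k * g (x - k))"
  using integrable_inner_sqint(2)[OF sqint_reflect_shift[OF assms(1)] assms(2), of x]
    integrable_inner_sqint(2)[OF assms(1) sqint_reflect_shift[OF assms(2)], of x] by simp_all

lemma conv_commute:
  assumes "sqint lborel \<kappa>" "sqint lborel g"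
  shows "conv \<kappa> g x = (LINT k|lborel. \<kappa> k * g (x - k))"
proof -
  have [measurable]: "\<kappa> \<in> borel_measurable borel" "g \<in> borel_measurable borel"
    using assms by (auto dest: sqint_measurable)
  show ?thesis
    unfolding conv_def using lborel_reflect_shift(1)[of "\<lambda>k. \<kappa> k * g (x - k)" x] by simp
qed

lemma conv_diff_right:
  assumes "sqint lborel \<kappa>" "sqint lborel f" "sqint lborel g"
  shows "conv \<kappa> (\<lambda>x. f x - g x) x = conv \<kappa> f x - conv \<kappa> g x"
  unfolding conv_def right_diff_distrib
  by (rule Bochner_Integration.integral_diff) (rule conv_integrable[OF assms(1,2)], rule conv_integrable[OF assms(1,3)])

lemma conv_shift:
  assumes "sqint lborel \<kappa>" "sqint lborel g"
  shows "conv \<kappa> g (x + h) = conv \<kappa> (\<lambda>y. g (y + h)) x"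
  unfolding conv_commute[OF assms] conv_commute[OF assms(1) sqint_shift(1)[OF assms(2)]]
  by (simp add: algebra_simps)

text \<open>The Taylor remainder of \<open>\<kappa>\<close> is quadratic uniformly in the base
  point, so it can be integrated directly against the absolute value of \<open>g\<close>.\<close>

lemma conv_has_derivative:
  fixes \<kappa> :: "'a::euclidean_space \<Rightarrow> real"
  assumes \<kappa>: "\<kappa> \<in> test_functions UNIV" and g: "sqint lborel g" "integrable lborel g"
  shows "(conv \<kappa> g has_derivative (\<lambda>h. \<Sum>b\<in>Basis. (h \<bullet> b) * conv (pd b \<kappa>) g x)) (at x)"
proof -
  obtain C where C: "0 < C" "\<And>x h. \<bar>\<kappa> (x + h) - \<kappa> x - (\<Sum>b\<in>Basis. (h \<bullet> b) * pd b \<kappa> x)\<bar> \<le> C * (norm h)\<^sup>2"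
    using test_functions_taylor[OF \<kappa>] by blast
  note s\<kappa> = test_functions_integrable(2)[OF \<kappa>]
  have spd: "sqint lborel (pd b \<kappa>)" if "b \<in> Basis" for b
    using test_functions_integrable(2)[OF test_functions_pd[OF \<kappa> that]] .
  define G where "G = (LINT z|lborel. \<bar>g z\<bar>)"
  have bnd: "\<bar>conv \<kappa> g y - conv \<kappa> g x - (\<Sum>b\<in>Basis. ((y - x) \<bullet> b) * conv (pd b \<kappa>) g x)\<bar> \<le> C * G * (norm (y - x))\<^sup>2" for y
  proof -
    let ?r = "\<lambda>z. \<kappa> (y - z) * g z - \<kappa> (x - z) * g z - (\<Sum>b\<in>Basis. ((y - x) \<bullet> b) * (pd b \<kappa> (x - z) * g z))"
    have i0: "integrable lborel (\<lambda>z. \<kappa> (y - z) * g z)" "integrable lborel (\<lambda>z. \<kappa> (x - z) * g z)"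
      by (rule conv_integrable[OF s\<kappa> g(1)])+
    have ib: "integrable lborel (\<lambda>z. ((y - x) \<bullet> b) * (pd b \<kappa> (x - z) * g z))" if "b \<in> Basis" for b
      using conv_integrable(1)[OF spd[OF that] g(1)] by simp
    have i2: "integrable lborel (\<lambda>z. \<Sum>b\<in>Basis. ((y - x) \<bullet> b) * (pd b \<kappa> (x - z) * g z))"
      by (rule Bochner_Integration.integrable_sum[OF ib])
    have ir: "integrable lborel ?r" by (intro Bochner_Integration.integrable_diff i0 i2)
    have "conv \<kappa> g y - conv \<kappa> g x - (\<Sum>b\<in>Basis. ((y - x) \<bullet> b) * conv (pd b \<kappa>) g x) = (LINT z|lborel. ?r z)"
    proof -
      have "(LINT z|lborel. (\<Sum>b\<in>Basis. ((y - x) \<bullet> b) * (pd b \<kappa> (x - z) * g z)))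
          = (\<Sum>b\<in>Basis. (LINT z|lborel. ((y - x) \<bullet> b) * (pd b \<kappa> (x - z) * g z)))"
        by (rule Bochner_Integration.integral_sum[OF ib])
      then show ?thesis
        unfolding conv_def Bochner_Integration.integral_diff[OF Bochner_Integration.integrable_diff[OF i0] i2]
          Bochner_Integration.integral_diff[OF i0] by simp
    qed
    moreover have "\<bar>LINT z|lborel. ?r z\<bar> \<le> (LINT z|lborel. C * (norm (y - x))\<^sup>2 * \<bar>g z\<bar>)"
    proof (rule order.trans[OF integral_abs_bound], rule integral_mono)
      show "integrable lborel (\<lambda>z. \<bar>?r z\<bar>)" using ir by (rule integrable_abs)
      show "integrable lborel (\<lambda>z. C * (norm (y - x))\<^sup>2 * \<bar>g z\<bar>)" using g(2) by simp
      fix z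
      have "?r z = (\<kappa> ((x - z) + (y - x)) - \<kappa> (x - z) - (\<Sum>b\<in>Basis. ((y - x) \<bullet> b) * pd b \<kappa> (x - z))) * g z"
        by (simp add: left_diff_distrib sum_distrib_right mult.assoc)
      also have "\<bar>\<dots>\<bar> \<le> C * (norm (y - x))\<^sup>2 * \<bar>g z\<bar>"
        unfolding abs_mult by (rule mult_right_mono[OF C(2)]) simp
      finally show "\<bar>?r z\<bar> \<le> C * (norm (y - x))\<^sup>2 * \<bar>g z\<bar>" .
    qed
    ultimately show ?thesis by (simp add: G_def mult_ac)
  qed
  show ?thesis
  proof (rule has_derivativeI_sandwich[where e=1 and H="\<lambda>y. C * G * norm (y - x)"])
    show "bounded_linear (\<lambda>h. \<Sum>b\<in>Basis. (h \<bullet> b) * conv (pd b \<kappa>) g x)"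
      by (intro bounded_linear_sum bounded_linear_mult_left[THEN bounded_linear_compose] bounded_linear_inner_left)
    have "((\<lambda>y. C * G * norm (y - x)) \<longlongrightarrow> C * G * norm (x - x)) (at x)"
      by (intro tendsto_intros)
    then show "((\<lambda>y. C * G * norm (y - x)) \<longlongrightarrow> 0) (at x)" by simp
    fix y assume "y \<noteq> x"
    then show "norm (conv \<kappa> g y - conv \<kappa> g x - (\<Sum>b\<in>Basis. ((y - x) \<bullet> b) * conv (pd b \<kappa>) g x)) / norm (y - x)
        \<le> C * G * norm (y - x)"
      using bnd[of y] by (simp add: divide_le_eq power2_eq_square mult.assoc)
  qed simp
qed

lemma pd_conv:
  assumes "\<kappa> \<in> test_functions UNIV" "sqint lborel g" "integrable lborel g" "b \<in> Basis"
  shows "pd b (conv \<kappa> g) = conv (pd b \<kappa>) g"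
proof
  fix x
  have "pd b (conv \<kappa> g) x = (\<Sum>c\<in>Basis. (b \<bullet> c) * conv (pd c \<kappa>) g x)"
    by (rule pd_eq[OF conv_has_derivative[OF assms(1-3)]])
  also have "\<dots> = (\<Sum>c\<in>Basis. if b = c then conv (pd c \<kappa>) g x else 0)"
    by (rule sum.cong) (use assms(4) in \<open>auto simp: inner_Basis\<close>)
  also have "\<dots> = conv (pd b \<kappa>) g x" using assms(4) by (subst sum.delta') auto
  finally show "pd b (conv \<kappa> g) x = conv (pd b \<kappa>) g x" .
qed

text \<open>All derivatives fall on the smooth factor, so the induction runs over
  \<open>\<kappa>\<close> with \<open>g\<close> fixed.\<close>

lemma Ck_conv:
  assumes "\<kappa> \<in> test_functions UNIV" "sqint lborel g" "integrable lborel g"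
  shows "Ck k (conv \<kappa> g)"
  using assms(1)
proof (induction k arbitrary: \<kappa>)
  case 0
  show ?case
    using has_derivative_continuous[OF conv_has_derivative[OF 0 assms(2,3)]]
    by (simp add: continuous_at_imp_continuous_on)
next
  case (Suc k)
  have "conv \<kappa> g differentiable (at x)" for x
    using conv_has_derivative[OF Suc.prems assms(2,3)] unfolding differentiable_def by blast
  moreover have "Ck k (pd b (conv \<kappa> g))" if "b \<in> Basis" for b
    unfolding pd_conv[OF Suc.prems assms(2,3) that]
    by (rule Suc.IH[OF test_functions_pd[OF Suc.prems that]])
  ultimately show ?case by simp
qed

text \<open>Split the weight into two square roots, apply Cauchy-Schwarz in \<open>k\<close>, then
  exchange the integrals. \<open>F\<close> is left general: translates of \<open>g\<close> give the
  Young inequality, increments of \<open>g\<close> give the approximation estimates.\<close>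

lemma weighted_schur:
  fixes \<kappa> :: "'a::euclidean_space \<Rightarrow> real" and F :: "'a \<Rightarrow> 'a \<Rightarrow> real"
  assumes [measurable]: "\<kappa> \<in> borel_measurable borel" "(\<lambda>p. F (fst p) (snd p)) \<in> borel_measurable (borel \<Otimes>\<^sub>M borel)"
    and G: "\<And>x. ennreal \<bar>G x\<bar> \<le> (\<integral>\<^sup>+k. ennreal (\<bar>\<kappa> k\<bar> * \<bar>F x k\<bar>) \<partial>lborel)"
  shows "(\<integral>\<^sup>+x. ennreal ((G x)\<^sup>2) \<partial>lborel)
    \<le> (\<integral>\<^sup>+k. ennreal \<bar>\<kappa> k\<bar> \<partial>lborel) * (\<integral>\<^sup>+k. ennreal \<bar>\<kappa> k\<bar> * (\<integral>\<^sup>+x. ennreal ((F x k)\<^sup>2) \<partial>lborel) \<partial>lborel)"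
proof -
  have F2[measurable]: "(\<lambda>p. ennreal ((F (fst p) (snd p))\<^sup>2)) \<in> borel_measurable (borel \<Otimes>\<^sub>M borel)" by measurable
  have [measurable]: "F x \<in> borel_measurable borel" for x
    using measurable_compose[OF measurable_Pair1'[of x borel borel] assms(2)] by simp
  have [measurable]: "(\<lambda>x. F x k) \<in> borel_measurable borel" for k
    using measurable_compose[OF measurable_Pair2'[of k borel borel] assms(2)] by simp
  have "(\<integral>\<^sup>+x. ennreal ((G x)\<^sup>2) \<partial>lborel)
      \<le> (\<integral>\<^sup>+x. (\<integral>\<^sup>+k. ennreal \<bar>\<kappa> k\<bar> \<partial>lborel) * (\<integral>\<^sup>+k. ennreal \<bar>\<kappa> k\<bar> * ennreal ((F x k)\<^sup>2) \<partial>lborel) \<partial>lborel)"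
  proof (rule nn_integral_mono)
    fix x
    have "ennreal ((G x)\<^sup>2) = (ennreal \<bar>G x\<bar>)\<^sup>2" by (simp add: ennreal_power)
    also have "\<dots> \<le> (\<integral>\<^sup>+k. ennreal (\<bar>\<kappa> k\<bar> * \<bar>F x k\<bar>) \<partial>lborel)\<^sup>2"
      by (rule power_mono[OF G]) simp
    also have "(\<integral>\<^sup>+k. ennreal (\<bar>\<kappa> k\<bar> * \<bar>F x k\<bar>) \<partial>lborel)
        = (\<integral>\<^sup>+k. ennreal (sqrt \<bar>\<kappa> k\<bar>) * ennreal (sqrt \<bar>\<kappa> k\<bar> * \<bar>F x k\<bar>) \<partial>lborel)"
      by (intro nn_integral_cong) (simp add: ennreal_mult[symmetric] mult.assoc[symmetric])
    also have "(\<dots>)\<^sup>2 \<le> (\<integral>\<^sup>+k. (ennreal (sqrt \<bar>\<kappa> k\<bar>))\<^sup>2 \<partial>lborel) * (\<integral>\<^sup>+k. (ennreal (sqrt \<bar>\<kappa> k\<bar> * \<bar>F x k\<bar>))\<^sup>2 \<partial>lborel)"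
      by (rule Cauchy_Schwarz_nn_integral) measurable
    also have "\<dots> = (\<integral>\<^sup>+k. ennreal \<bar>\<kappa> k\<bar> \<partial>lborel) * (\<integral>\<^sup>+k. ennreal \<bar>\<kappa> k\<bar> * ennreal ((F x k)\<^sup>2) \<partial>lborel)"
      by (simp add: ennreal_power power_mult_distrib ennreal_mult)
    finally show "ennreal ((G x)\<^sup>2) \<le> (\<integral>\<^sup>+k. ennreal \<bar>\<kappa> k\<bar> \<partial>lborel) * (\<integral>\<^sup>+k. ennreal \<bar>\<kappa> k\<bar> * ennreal ((F x k)\<^sup>2) \<partial>lborel)" .
  qed
  also have "\<dots> = (\<integral>\<^sup>+k. ennreal \<bar>\<kappa> k\<bar> \<partial>lborel) * (\<integral>\<^sup>+x. (\<integral>\<^sup>+k. ennreal \<bar>\<kappa> k\<bar> * ennreal ((F x k)\<^sup>2) \<partial>lborel) \<partial>lborel)"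
    by (rule nn_integral_cmult) measurable
  also have "(\<integral>\<^sup>+x. (\<integral>\<^sup>+k. ennreal \<bar>\<kappa> k\<bar> * ennreal ((F x k)\<^sup>2) \<partial>lborel) \<partial>lborel)
      = (\<integral>\<^sup>+k. (\<integral>\<^sup>+x. ennreal \<bar>\<kappa> k\<bar> * ennreal ((F x k)\<^sup>2) \<partial>lborel) \<partial>lborel)"
    by (rule lborel_pair.Fubini'[symmetric]) measurable
  also have "\<dots> = (\<integral>\<^sup>+k. ennreal \<bar>\<kappa> k\<bar> * (\<integral>\<^sup>+x. ennreal ((F x k)\<^sup>2) \<partial>lborel) \<partial>lborel)"
    by (intro nn_integral_cong nn_integral_cmult) measurable
  finally show ?thesis .
qed

lemma abs_integral_le_nn:
  fixes f :: "'b \<Rightarrow> real"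
  assumes "integrable M f"
  shows "ennreal \<bar>integral\<^sup>L M f\<bar> \<le> (\<integral>\<^sup>+x. ennreal \<bar>f x\<bar> \<partial>M)"
proof -
  have "ennreal \<bar>integral\<^sup>L M f\<bar> \<le> ennreal (LINT x|M. \<bar>f x\<bar>)"
    by (rule ennreal_leI[OF integral_abs_bound])
  also have "\<dots> = (\<integral>\<^sup>+x. ennreal \<bar>f x\<bar> \<partial>M)"
    by (rule nn_integral_eq_integral[symmetric]) (use assms in auto)
  finally show ?thesis .
qed

lemma mod_sq_eq_backward:
  fixes g :: "'a::euclidean_space \<Rightarrow> real"
  assumes [measurable]: "g \<in> borel_measurable borel"
  shows "(\<integral>\<^sup>+x. ennreal ((g (x - k) - g x)\<^sup>2) \<partial>lborel) = mod_sq g k"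
proof -
  have "(\<integral>\<^sup>+x. ennreal ((g (x - k) - g x)\<^sup>2) \<partial>lborel) = (\<integral>\<^sup>+x. ennreal ((g (x + k - k) - g (x + k))\<^sup>2) \<partial>lborel)"
    by (rule nn_integral_shift[symmetric]) measurable
  also have "\<dots> = mod_sq g k" unfolding mod_sq_def by (simp add: power2_commute)
  finally show ?thesis .
qed

text \<open>The difference is the integral of \<open>\<kappa> k\<close> times a backward increment
  of \<open>g\<close>. The total mass of \<open>\<kappa>\<close> is left arbitrary so that one
  estimate covers mollifiers, of mass 1, and their derivatives, of mass 0.\<close>

lemma conv_diff_bound:
  fixes \<kappa> :: "'a::euclidean_space \<Rightarrow> real"
  assumes \<kappa>: "\<kappa> \<in> test_functions UNIV" and g: "sqint lborel g"
  shows "(\<integral>\<^sup>+x. ennreal ((conv \<kappa> g x - (LINT k|lborel. \<kappa> k) * g x)\<^sup>2) \<partial>lborel)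
    \<le> (\<integral>\<^sup>+k. ennreal \<bar>\<kappa> k\<bar> \<partial>lborel) * (\<integral>\<^sup>+k. ennreal \<bar>\<kappa> k\<bar> * mod_sq g k \<partial>lborel)"
proof -
  note s\<kappa> = test_functions_integrable[OF \<kappa>]
  have m[measurable]: "\<kappa> \<in> borel_measurable borel" "g \<in> borel_measurable borel"
    using s\<kappa>(2) g by (auto dest: sqint_measurable)
  have "(\<integral>\<^sup>+x. ennreal ((conv \<kappa> g x - (LINT k|lborel. \<kappa> k) * g x)\<^sup>2) \<partial>lborel)
    \<le> (\<integral>\<^sup>+k. ennreal \<bar>\<kappa> k\<bar> \<partial>lborel) * (\<integral>\<^sup>+k. ennreal \<bar>\<kappa> k\<bar> * (\<integral>\<^sup>+x. ennreal ((g (x - k) - g x)\<^sup>2) \<partial>lborel) \<partial>lborel)"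
  proof (rule weighted_schur)
    fix x
    have i1: "integrable lborel (\<lambda>k. \<kappa> k * g (x - k))" by (rule conv_integrable(2)[OF s\<kappa>(2) g])
    have i2: "integrable lborel (\<lambda>k. \<kappa> k * g x)" using s\<kappa>(1) by simp
    have i3: "integrable lborel (\<lambda>k. \<kappa> k * (g (x - k) - g x))"
      using Bochner_Integration.integrable_diff[OF i1 i2] by (simp add: right_diff_distrib)
    have "conv \<kappa> g x - (LINT k|lborel. \<kappa> k) * g x = (LINT k|lborel. \<kappa> k * (g (x - k) - g x))"
      unfolding conv_commute[OF s\<kappa>(2) g] right_diff_distrib Bochner_Integration.integral_diff[OF i1 i2] by simp
    then show "ennreal \<bar>conv \<kappa> g x - (LINT k|lborel. \<kappa> k) * g x\<bar> \<le> (\<integral>\<^sup>+k. ennreal (\<bar>\<kappa> k\<bar> * \<bar>g (x - k) - g x\<bar>) \<partial>lborel)"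
      using abs_integral_le_nn[OF i3] by (simp add: abs_mult)
  qed measurable
  then show ?thesis by (simp only: mod_sq_eq_backward[OF m(2)])
qed

lemma conv_young:
  fixes \<kappa> :: "'a::euclidean_space \<Rightarrow> real"
  assumes \<kappa>: "\<kappa> \<in> test_functions UNIV" "(\<integral>\<^sup>+k. ennreal \<bar>\<kappa> k\<bar> \<partial>lborel) \<le> 1" and g: "sqint lborel g"
  shows "(\<integral>\<^sup>+x. ennreal ((conv \<kappa> g x)\<^sup>2) \<partial>lborel) \<le> (\<integral>\<^sup>+x. ennreal ((g x)\<^sup>2) \<partial>lborel)"
proof -
  note s\<kappa> = test_functions_integrable[OF \<kappa>(1)]
  have m[measurable]: "\<kappa> \<in> borel_measurable borel" "g \<in> borel_measurable borel"
    using s\<kappa>(2) g by (auto dest: sqint_measurable)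
  let ?N = "\<integral>\<^sup>+k. ennreal \<bar>\<kappa> k\<bar> \<partial>lborel" and ?G = "\<integral>\<^sup>+x. ennreal ((g x)\<^sup>2) \<partial>lborel"
  have sh: "(\<integral>\<^sup>+x. ennreal ((g (x - k))\<^sup>2) \<partial>lborel) = ?G" for k
    using nn_integral_shift[of "\<lambda>x. ennreal ((g x)\<^sup>2)" "- k"] by simp
  have "(\<integral>\<^sup>+x. ennreal ((conv \<kappa> g x)\<^sup>2) \<partial>lborel)
    \<le> ?N * (\<integral>\<^sup>+k. ennreal \<bar>\<kappa> k\<bar> * (\<integral>\<^sup>+x. ennreal ((g (x - k))\<^sup>2) \<partial>lborel) \<partial>lborel)"
  proof (rule weighted_schur)
    fix x
    show "ennreal \<bar>conv \<kappa> g x\<bar> \<le> (\<integral>\<^sup>+k. ennreal (\<bar>\<kappa> k\<bar> * \<bar>g (x - k)\<bar>) \<partial>lborel)"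
      using abs_integral_le_nn[OF conv_integrable(2)[OF s\<kappa>(2) g]]
      unfolding conv_commute[OF s\<kappa>(2) g] by (simp add: abs_mult)
  qed measurable
  also have "(\<integral>\<^sup>+k. ennreal \<bar>\<kappa> k\<bar> * (\<integral>\<^sup>+x. ennreal ((g (x - k))\<^sup>2) \<partial>lborel) \<partial>lborel) = ?N * ?G"
    unfolding sh by (rule nn_integral_multc) measurable
  also have "?N * (?N * ?G) \<le> 1 * (1 * ?G)" by (intro mult_mono \<kappa>(2)) auto
  finally show ?thesis by simp
qed

lemma conv_l2norm:
  fixes \<kappa> :: "'a::euclidean_space \<Rightarrow> real"
  assumes \<kappa>: "\<kappa> \<in> test_functions UNIV" "(\<integral>\<^sup>+k. ennreal \<bar>\<kappa> k\<bar> \<partial>lborel) \<le> 1" and g: "sqint lborel g"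
  shows "sqint lborel (conv \<kappa> g)"
proof -
  have [measurable]: "\<kappa> \<in> borel_measurable borel" "g \<in> borel_measurable borel"
    using test_functionsD(4)[OF \<kappa>(1)] g by (auto dest: sqint_measurable)
  have mc: "conv \<kappa> g \<in> borel_measurable lborel" by measurable
  have "(\<integral>\<^sup>+x. ennreal ((norm (conv \<kappa> g x))\<^sup>2) \<partial>lborel) \<le> ennreal ((l2norm lborel g)\<^sup>2)"
    using conv_young[OF \<kappa> g] nn_integral_l2norm[OF g] by simp
  from l2norm_le_nn(1)[OF mc this] show ?thesis by simp
qed

text \<open>Convolution commutes with translation, so the increment of the convolution is the
  convolution of the increment, to which the Young inequality applies.\<close>

lemma mod_sq_conv:
  fixes \<kappa> :: "'a::euclidean_space \<Rightarrow> real"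
  assumes \<kappa>: "\<kappa> \<in> test_functions UNIV" "(\<integral>\<^sup>+k. ennreal \<bar>\<kappa> k\<bar> \<partial>lborel) \<le> 1" and g: "sqint lborel g"
  shows "mod_sq (conv \<kappa> g) h \<le> mod_sq g h"
proof -
  note s\<kappa> = test_functions_integrable(2)[OF \<kappa>(1)]
  have "conv \<kappa> g (x + h) - conv \<kappa> g x = conv \<kappa> (\<lambda>y. g (y + h) - g y) x" for x
    by (simp add: conv_shift[OF s\<kappa> g] conv_diff_right[OF s\<kappa> sqint_shift(1)[OF g] g])
  then show ?thesis
    unfolding mod_sq_def using conv_young[OF \<kappa> sqint_diff(1)[OF sqint_shift(1)[OF g] g], of h] by simp
qed

text \<open>The qualitative counterpart of the energy estimate: smallness of the translates on the
  support of \<open>\<kappa>\<close> replaces finite energy.\<close>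

lemma conv_approx_translation:
  fixes \<kappa> :: "'a::euclidean_space \<Rightarrow> real"
  assumes \<kappa>: "\<kappa> \<in> test_functions UNIV" "(\<integral>\<^sup>+k. ennreal \<bar>\<kappa> k\<bar> \<partial>lborel) \<le> 1" "(LINT k|lborel. \<kappa> k) = 1"
    and g: "sqint lborel g" and e: "0 \<le> e" and sm: "\<And>k. \<kappa> k \<noteq> 0 \<Longrightarrow> l2norm lborel (\<lambda>x. g (x + k) - g x) \<le> e"
  shows "l2norm lborel (\<lambda>x. conv \<kappa> g x - g x) \<le> e"
proof -
  have [measurable]: "\<kappa> \<in> borel_measurable borel" "g \<in> borel_measurable borel"
    using test_functionsD(4)[OF \<kappa>(1)] g by (auto dest: sqint_measurable)
  let ?N = "\<integral>\<^sup>+k. ennreal \<bar>\<kappa> k\<bar> \<partial>lborel"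
  have "(\<integral>\<^sup>+k. ennreal \<bar>\<kappa> k\<bar> * mod_sq g k \<partial>lborel) \<le> (\<integral>\<^sup>+k. ennreal \<bar>\<kappa> k\<bar> * ennreal (e\<^sup>2) \<partial>lborel)"
  proof (rule nn_integral_mono)
    fix k
    show "ennreal \<bar>\<kappa> k\<bar> * mod_sq g k \<le> ennreal \<bar>\<kappa> k\<bar> * ennreal (e\<^sup>2)"
    proof (cases "\<kappa> k = 0")
      case False
      have "mod_sq g k = ennreal ((l2norm lborel (\<lambda>x. g (x + k) - g x))\<^sup>2)"
        using nn_integral_l2norm[OF sqint_diff(1)[OF sqint_shift(1)[OF g, of k] g]] by (simp add: mod_sq_def)
      also have "\<dots> \<le> ennreal (e\<^sup>2)" by (intro ennreal_leI power_mono sm False) simp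
      finally show ?thesis by (rule mult_left_mono) simp
    qed simp
  qed
  also have "\<dots> = ?N * ennreal (e\<^sup>2)" by (rule nn_integral_multc) measurable
  finally have "(\<integral>\<^sup>+k. ennreal \<bar>\<kappa> k\<bar> * mod_sq g k \<partial>lborel) \<le> ?N * ennreal (e\<^sup>2)" .
  then have "?N * (\<integral>\<^sup>+k. ennreal \<bar>\<kappa> k\<bar> * mod_sq g k \<partial>lborel) \<le> ?N * (?N * ennreal (e\<^sup>2))"
    by (rule mult_left_mono) simp
  also have "?N * (?N * ennreal (e\<^sup>2)) \<le> 1 * (1 * ennreal (e\<^sup>2))" by (intro mult_mono \<kappa>(2)) auto
  finally have bd: "?N * (\<integral>\<^sup>+k. ennreal \<bar>\<kappa> k\<bar> * mod_sq g k \<partial>lborel) \<le> ennreal (e\<^sup>2)" by simp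
  have "(\<integral>\<^sup>+x. ennreal ((norm (conv \<kappa> g x - g x))\<^sup>2) \<partial>lborel) \<le> ?N * (\<integral>\<^sup>+k. ennreal \<bar>\<kappa> k\<bar> * mod_sq g k \<partial>lborel)"
    using conv_diff_bound[OF \<kappa>(1) g] \<kappa>(3) by simp
  also note bd
  finally have le: "(\<integral>\<^sup>+x. ennreal ((norm (conv \<kappa> g x - g x))\<^sup>2) \<partial>lborel) \<le> ennreal (e\<^sup>2)" by simp
  have "(\<lambda>x. conv \<kappa> g x - g x) \<in> borel_measurable lborel" by measurable
  from l2norm_le_nn(2)[OF this le] have "(l2norm lborel (\<lambda>x. conv \<kappa> g x - g x))\<^sup>2 \<le> e\<^sup>2" by simp
  then show ?thesis by (rule power2_le_imp_le) (rule e)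
qed

text \<open>Once a multiple of the kernel dominates the weight, the weighted integral of the modulus
  of continuity is at most that multiple of the energy. The power of \<delta> gained later is hidden
  in \<open>m\<close>.\<close>

lemma conv_approx_energy:
  fixes \<kappa> :: "'a::euclidean_space \<Rightarrow> real" and ty :: "'a itself"
  assumes K: "kernel_conditions ty D0 s \<gamma>1" and \<delta>: "0 < \<delta>"
    and \<kappa>: "\<kappa> \<in> test_functions UNIV" "(\<integral>\<^sup>+k. ennreal \<bar>\<kappa> k\<bar> \<partial>lborel) \<le> ennreal N" "0 \<le> N"
      "\<And>k. k \<noteq> 0 \<Longrightarrow> \<bar>\<kappa> k\<bar> \<le> m * ker \<gamma>1 \<delta> k" "0 \<le> m"
    and g: "sqint lborel g" "En \<gamma>1 \<delta> g < \<infinity>"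
  shows "sqint lborel (\<lambda>x. conv \<kappa> g x - (LINT k|lborel. \<kappa> k) * g x)"
    and "(l2norm lborel (\<lambda>x. conv \<kappa> g x - (LINT k|lborel. \<kappa> k) * g x))\<^sup>2 \<le> N * m * (Sn \<gamma>1 \<delta> g)\<^sup>2"
proof -
  have [measurable]: "\<kappa> \<in> borel_measurable borel" and g'[measurable]: "g \<in> borel_measurable borel"
    using test_functionsD(4)[OF \<kappa>(1)] g by (auto dest: sqint_measurable)
  note [measurable] = ker_measurable[OF K \<delta>]
  have "(\<integral>\<^sup>+k. ennreal \<bar>\<kappa> k\<bar> * mod_sq g k \<partial>lborel) \<le> (\<integral>\<^sup>+k. ennreal m * (ennreal (ker \<gamma>1 \<delta> k) * mod_sq g k) \<partial>lborel)"
  proof (rule nn_integral_mono)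
    fix k :: 'a
    show "ennreal \<bar>\<kappa> k\<bar> * mod_sq g k \<le> ennreal m * (ennreal (ker \<gamma>1 \<delta> k) * mod_sq g k)"
    \<comment> \<open>The kernel is 0 at the origin and dominates nothing there, but the modulus of
      continuity is 0 as well.\<close>
    proof (cases "k = 0")
      case False
      have "ennreal \<bar>\<kappa> k\<bar> \<le> ennreal (m * ker \<gamma>1 \<delta> k)" by (rule ennreal_leI[OF \<kappa>(4)[OF False]])
      also have "\<dots> = ennreal m * ennreal (ker \<gamma>1 \<delta> k)" using ker_nonneg[OF K \<delta>] \<kappa>(5) by (intro ennreal_mult) auto
      finally have "ennreal \<bar>\<kappa> k\<bar> * mod_sq g k \<le> (ennreal m * ennreal (ker \<gamma>1 \<delta> k)) * mod_sq g k"
        by (rule mult_right_mono) simp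
      then show ?thesis by (simp only: mult.assoc)
    qed (simp add: mod_sq_0)
  qed
  also have "\<dots> = ennreal m * En \<gamma>1 \<delta> g" unfolding En_def by (rule nn_integral_cmult) measurable
  also have "\<dots> = ennreal (m * (Sn \<gamma>1 \<delta> g)\<^sup>2)"
    unfolding Sn_sq[OF K \<delta> g' g(2), symmetric] using \<kappa>(5) by (intro ennreal_mult[symmetric]) auto
  finally have 1: "(\<integral>\<^sup>+k. ennreal \<bar>\<kappa> k\<bar> * mod_sq g k \<partial>lborel) \<le> ennreal (m * (Sn \<gamma>1 \<delta> g)\<^sup>2)" .
  have "(\<integral>\<^sup>+x. ennreal ((norm (conv \<kappa> g x - (LINT k|lborel. \<kappa> k) * g x))\<^sup>2) \<partial>lborel)
      \<le> (\<integral>\<^sup>+k. ennreal \<bar>\<kappa> k\<bar> \<partial>lborel) * (\<integral>\<^sup>+k. ennreal \<bar>\<kappa> k\<bar> * mod_sq g k \<partial>lborel)"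
    using conv_diff_bound[OF \<kappa>(1) g(1)] by simp
  also have "\<dots> \<le> ennreal N * ennreal (m * (Sn \<gamma>1 \<delta> g)\<^sup>2)" by (rule mult_mono[OF \<kappa>(2) 1]) auto
  also have "\<dots> = ennreal (N * (m * (Sn \<gamma>1 \<delta> g)\<^sup>2))" using \<kappa>(3,5) by (intro ennreal_mult[symmetric]) auto
  finally have le: "(\<integral>\<^sup>+x. ennreal ((norm (conv \<kappa> g x - (LINT k|lborel. \<kappa> k) * g x))\<^sup>2) \<partial>lborel) \<le> ennreal (N * (m * (Sn \<gamma>1 \<delta> g)\<^sup>2))" .
  have mm: "(\<lambda>x. conv \<kappa> g x - (LINT k|lborel. \<kappa> k) * g x) \<in> borel_measurable lborel" by measurable
  have nn: "0 \<le> N * (m * (Sn \<gamma>1 \<delta> g)\<^sup>2)" using \<kappa>(3,5) by simp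
  show "sqint lborel (\<lambda>x. conv \<kappa> g x - (LINT k|lborel. \<kappa> k) * g x)" by (rule l2norm_le_nn(1)[OF mm le nn])
  show "(l2norm lborel (\<lambda>x. conv \<kappa> g x - (LINT k|lborel. \<kappa> k) * g x))\<^sup>2 \<le> N * m * (Sn \<gamma>1 \<delta> g)\<^sup>2"
    using l2norm_le_nn(2)[OF mm le nn] by (simp only: mult.assoc)
qed

section \<open>Smoothing inside a Lipschitz domain\<close>

text \<open>At an interior point any unit vector will do; at a boundary point the axis of the
  Lipschitz chart is taken. Points of the closure are treated so that compactness yields a finite
  cover.\<close>

lemma inward_cone:
  fixes \<Omega> :: "'a::euclidean_space set"
  assumes dom: "bounded_Lipschitz_domain \<Omega>" and p: "p \<in> closure \<Omega>"
  shows "\<exists>\<epsilon> e c t0. 0 < \<epsilon> \<and> norm e = 1 \<and> 0 < c \<and> c \<le> 1 \<and> 0 < t0 \<and>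
    (\<forall>x\<in>\<Omega> \<inter> ball p \<epsilon>. \<forall>t. 0 < t \<longrightarrow> t < t0 \<longrightarrow> ball (x + t *\<^sub>R e) (c * t) \<subseteq> \<Omega>)"
proof (cases "p \<in> \<Omega>")
  case True
  have "open \<Omega>" using dom by (simp add: bounded_Lipschitz_domain_def)
  then obtain r where r: "0 < r" "ball p r \<subseteq> \<Omega>" using True open_contains_ball by blast
  obtain e :: 'a where e: "e \<in> Basis" using nonempty_Basis by blast
  have "ball (x + t *\<^sub>R e) (1 * t) \<subseteq> \<Omega>" if "x \<in> \<Omega> \<inter> ball p (r / 2)" "0 < t" "t < r / 4" for x t
  proof
    fix y assume "y \<in> ball (x + t *\<^sub>R e) (1 * t)"
    then have 1: "dist (x + t *\<^sub>R e) y < t" by simp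
    have 2: "dist p x < r / 2" using that(1) by simp
    have 3: "dist x (x + t *\<^sub>R e) = t" using e that(2) by (simp add: dist_norm)
    have "dist p y \<le> dist p x + dist x (x + t *\<^sub>R e) + dist (x + t *\<^sub>R e) y"
      using dist_triangle[of p y x] dist_triangle[of x y "x + t *\<^sub>R e"] by linarith
    then have "dist p y < r" using 1 2 3 that(3) by linarith
    then show "y \<in> \<Omega>" using r(2) by auto
  qed
  then show ?thesis
    using r(1) e by (intro exI[of _ "r / 2"] exI[of _ e] exI[of _ 1] exI[of _ "r / 4"]) auto
next
  case False
  have o: "open \<Omega>" using dom by (simp add: bounded_Lipschitz_domain_def)
  have "p \<in> frontier \<Omega>" using p False o by (simp add: frontier_def interior_open)
  moreover have "\<forall>p\<in>frontier \<Omega>. \<exists>e g L \<epsilon>. norm e = 1 \<and> 0 < \<epsilon> \<and> L-lipschitz_on {z. z \<bullet> e = 0} g \<and>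
        \<Omega> \<inter> ball p \<epsilon> = {x \<in> ball p \<epsilon>. g (x - (x \<bullet> e) *\<^sub>R e) < x \<bullet> e}"
    using dom unfolding bounded_Lipschitz_domain_def by (elim conjE) assumption
  ultimately have "\<exists>e g L \<epsilon>. norm e = 1 \<and> 0 < \<epsilon> \<and> L-lipschitz_on {z. z \<bullet> e = 0} g \<and>
        \<Omega> \<inter> ball p \<epsilon> = {x \<in> ball p \<epsilon>. g (x - (x \<bullet> e) *\<^sub>R e) < x \<bullet> e}"
    by (rule bspec[rotated])
  then obtain e g L \<epsilon> where e: "norm e = 1" and \<epsilon>: "0 < \<epsilon>" and g: "L-lipschitz_on {z. z \<bullet> e = 0} g"
    and eq: "\<Omega> \<inter> ball p \<epsilon> = {x \<in> ball p \<epsilon>. g (x - (x \<bullet> e) *\<^sub>R e) < x \<bullet> e}"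
    by (elim exE conjE) (rule that; assumption)
  have L: "0 \<le> L" using lipschitz_on_nonneg[OF g] .
  have ee: "e \<bullet> e = 1" using e by (simp add: dot_square_norm)
  \<comment> \<open>Chosen so that \<open>c + L * c = 1\<close>: a perturbation shorter than c t
    lowers the height by at most c t and raises the graph by at most L c t, together no more than
    the gain t along \<open>e\<close>.\<close>
  define c where "c = 1 / (1 + L)"
  have c: "0 < c" "c \<le> 1" "c + L * c = 1" using L by (auto simp: c_def field_simps)
  \<comment> \<open>With \<open>x\<close> within half the chart radius and t below a quarter of it,
    the points reached are closer than 2 t to \<open>x\<close> and remain in the chart.\<close>
  have "ball (x + t *\<^sub>R e) (c * t) \<subseteq> \<Omega>" if x: "x \<in> \<Omega> \<inter> ball p (\<epsilon> / 2)" and t: "0 < t" "t < \<epsilon> / 4" for x t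
  proof
    fix y assume "y \<in> ball (x + t *\<^sub>R e) (c * t)"
    then have d: "dist (x + t *\<^sub>R e) y < c * t" by simp
    define k where "k = y - (x + t *\<^sub>R e)"
    have k: "norm k < c * t" using d by (simp add: k_def dist_norm norm_minus_commute)
    have y: "y = x + t *\<^sub>R e + k" by (simp add: k_def)
    have ct: "c * t \<le> t" using c t by simp
    have "dist x (x + t *\<^sub>R e) = t" using e t by (simp add: dist_norm)
    moreover have "dist p x < \<epsilon> / 2" using x by simp
    moreover have "dist p y \<le> dist p x + dist x (x + t *\<^sub>R e) + dist (x + t *\<^sub>R e) y"
      using dist_triangle[of p y x] dist_triangle[of x y "x + t *\<^sub>R e"] by linarith
    ultimately have "dist p y < \<epsilon>" using d ct t by linarith
    then have yb: "y \<in> ball p \<epsilon>" by simp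
    have xb: "x \<in> \<Omega> \<inter> ball p \<epsilon>" using x \<epsilon> by auto
    then have gx: "g (x - (x \<bullet> e) *\<^sub>R e) < x \<bullet> e" using eq by blast
    have ye: "y \<bullet> e = x \<bullet> e + t + k \<bullet> e" by (simp add: y inner_add_left ee)
    have "\<bar>k \<bullet> e\<bar> \<le> norm k" using Cauchy_Schwarz_ineq2[of k e] e by simp
    then have ke: "- (c * t) \<le> k \<bullet> e" using k by linarith
    have y': "y - (y \<bullet> e) *\<^sub>R e = (x - (x \<bullet> e) *\<^sub>R e) + (k - (k \<bullet> e) *\<^sub>R e)"
      unfolding ye by (simp add: y scaleR_add_left)
    have k': "norm (k - (k \<bullet> e) *\<^sub>R e) \<le> norm k"
    proof -
      have "(norm (k - (k \<bullet> e) *\<^sub>R e))\<^sup>2 = (norm k)\<^sup>2 - (k \<bullet> e)\<^sup>2"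
        unfolding power2_norm_eq_inner by (simp add: inner_diff_left inner_diff_right ee inner_commute power2_eq_square)
      then have "(norm (k - (k \<bullet> e) *\<^sub>R e))\<^sup>2 \<le> (norm k)\<^sup>2" by simp
      then show ?thesis by (rule power2_le_imp_le) simp
    qed
    have "dist (g (y - (y \<bullet> e) *\<^sub>R e)) (g (x - (x \<bullet> e) *\<^sub>R e)) \<le> L * dist (y - (y \<bullet> e) *\<^sub>R e) (x - (x \<bullet> e) *\<^sub>R e)"
      by (rule lipschitz_onD[OF g]) (simp_all add: inner_diff_left ee)
    also have "dist (y - (y \<bullet> e) *\<^sub>R e) (x - (x \<bullet> e) *\<^sub>R e) = norm (k - (k \<bullet> e) *\<^sub>R e)"
      unfolding y' by (simp add: dist_norm)
    also have "L * \<dots> \<le> L * (c * t)" using k' k L by (intro mult_left_mono) auto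
    finally have "g (y - (y \<bullet> e) *\<^sub>R e) \<le> g (x - (x \<bullet> e) *\<^sub>R e) + L * (c * t)"
      by (simp add: dist_real_def)
    moreover have "c * t + L * (c * t) = t"
    proof -
      have "c * t + L * (c * t) = (c + L * c) * t" by (simp add: algebra_simps)
      then show ?thesis using c(3) by simp
    qed
    ultimately have "g (y - (y \<bullet> e) *\<^sub>R e) < y \<bullet> e" using gx ke ye by linarith
    then show "y \<in> \<Omega>" using yb eq by blast
  qed
  then show ?thesis
    using \<epsilon> e c by (intro exI[of _ "\<epsilon> / 2"] exI[of _ e] exI[of _ c] exI[of _ "\<epsilon> / 4"]) auto
qed

text \<open>
  A partition of unity \<open>\<theta> p\<close> on the domain, with directions \<open>e p\<close> in which the support of
  \<open>\<theta> p\<close> can be pushed into the domain.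
\<close>

definition inward_partition ::
  "'a::euclidean_space set \<Rightarrow> 'a set \<Rightarrow> ('a \<Rightarrow> 'a) \<Rightarrow> real \<Rightarrow> real \<Rightarrow> ('a \<Rightarrow> 'a \<Rightarrow> real) \<Rightarrow> real \<Rightarrow> bool" where
  "inward_partition \<Omega> P e c t0 \<theta> L \<longleftrightarrow>
     finite P \<and> 0 < c \<and> c \<le> 1 \<and> 0 < t0 \<and>
     (\<forall>p\<in>P. norm (e p) = 1 \<and> \<theta> p \<in> borel_measurable borel \<and> (\<forall>x. \<bar>\<theta> p x\<bar> \<le> 1) \<and>
        (\<forall>x h. \<bar>\<theta> p (x + h) - \<theta> p x\<bar> \<le> L * norm h) \<and>
        (\<forall>x\<in>\<Omega>. \<forall>t. \<theta> p x \<noteq> 0 \<longrightarrow> 0 < t \<longrightarrow> t < t0 \<longrightarrow> ball (x + t *\<^sub>R e p) (c * t) \<subseteq> \<Omega>)) \<and>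
     (\<forall>x\<in>\<Omega>. (\<Sum>p\<in>P. \<theta> p x) = 1)"

text \<open>A Lipschitz partition is enough: its members multiply functions of finite energy, for
  which \<open>mod_sq_cutoff\<close> suffices, and smoothness is supplied by the mollifier
  afterwards.\<close>

lemma inward_partition_exists:
  fixes \<Omega> :: "'a::euclidean_space set"
  assumes dom: "bounded_Lipschitz_domain \<Omega>"
  shows "\<exists>P e c t0 \<theta> L. inward_partition \<Omega> P e c t0 \<theta> L"
proof -
  define Q where "Q p \<epsilon> e c t0 \<longleftrightarrow> 0 < \<epsilon> \<and> norm e = 1 \<and> 0 < c \<and> c \<le> 1 \<and> 0 < t0 \<and>
    (\<forall>x\<in>\<Omega> \<inter> ball p \<epsilon>. \<forall>t. 0 < t \<longrightarrow> t < t0 \<longrightarrow> ball (x + t *\<^sub>R e) (c * t) \<subseteq> \<Omega>)"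
    for p e :: 'a and \<epsilon> c t0 :: real
  have "\<forall>p\<in>closure \<Omega>. \<exists>\<epsilon> e c t0. Q p \<epsilon> e c t0"
    using inward_cone[OF dom] unfolding Q_def by blast
  then obtain \<epsilon> e c t0 where Q: "\<And>p. p \<in> closure \<Omega> \<Longrightarrow> Q p (\<epsilon> p) (e p) (c p) (t0 p)"
    by metis
  have cone: "0 < \<epsilon> p" "norm (e p) = 1" "0 < c p" "c p \<le> 1" "0 < t0 p"
    "x \<in> \<Omega> \<inter> ball p (\<epsilon> p) \<Longrightarrow> 0 < t \<Longrightarrow> t < t0 p \<Longrightarrow> ball (x + t *\<^sub>R e p) (c p * t) \<subseteq> \<Omega>"
    if "p \<in> closure \<Omega>" for p x t
    using Q[OF that] unfolding Q_def by blast+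
  have comp: "compact (closure \<Omega>)" and ne: "\<Omega> \<noteq> {}"
    using dom by (auto simp: bounded_Lipschitz_domain_def compact_closure)
  have "closure \<Omega> \<subseteq> (\<Union>p\<in>closure \<Omega>. ball p (\<epsilon> p))" using cone(1) by force
  then obtain P where P: "P \<subseteq> closure \<Omega>" "finite P" "closure \<Omega> \<subseteq> (\<Union>p\<in>P. ball p (\<epsilon> p))"
    using compactE_image[OF comp, of "closure \<Omega>" "\<lambda>p. ball p (\<epsilon> p)"] open_ball by metis
  have Pne: "P \<noteq> {}" using P(3) ne closure_subset by force
  define c' where "c' = Min (c ` P)"
  define t' where "t' = Min (t0 ` P)"
  have c': "0 < c'" "c' \<le> 1" "\<And>p. p \<in> P \<Longrightarrow> c' \<le> c p"
  proof -
    have fin: "finite (c ` P)" "c ` P \<noteq> {}" using P(2) Pne by auto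
    show "0 < c'" unfolding c'_def using Min_gr_iff[OF fin] cone(3) P(1) by auto
    show le: "c' \<le> c p" if "p \<in> P" for p unfolding c'_def using that P(2) by (intro Min_le) auto
    obtain p where "p \<in> P" using Pne by blast
    then show "c' \<le> 1" using le[of p] cone(4)[of p] P(1) by force
  qed
  have t': "0 < t'" "\<And>p. p \<in> P \<Longrightarrow> t' \<le> t0 p"
  proof -
    have fin: "finite (t0 ` P)" "t0 ` P \<noteq> {}" using P(2) Pne by auto
    show "0 < t'" unfolding t'_def using Min_gr_iff[OF fin] cone(5) P(1) by auto
    show "t' \<le> t0 p" if "p \<in> P" for p unfolding t'_def using that P(2) by (intro Min_le) auto
  qed
  \<comment> \<open>Distance hats: 1-Lipschitz and positive exactly on the ball around
    \<open>p\<close>.\<close>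
  define \<psi> where "\<psi> p x = max 0 (\<epsilon> p - dist p x)" for p x
  define S where "S x = (\<Sum>p\<in>P. \<psi> p x)" for x
  have \<psi>0: "0 \<le> \<psi> p x" for p x by (simp add: \<psi>_def)
  have cS: "continuous_on UNIV S" unfolding S_def \<psi>_def by (intro continuous_intros)
  have Spos: "0 < S x" if x: "x \<in> closure \<Omega>" for x
  proof -
    obtain p where p: "p \<in> P" "x \<in> ball p (\<epsilon> p)" using P(3) x by blast
    have "0 < \<psi> p x" using p(2) by (simp add: \<psi>_def)
    also have "\<psi> p x \<le> S x" unfolding S_def by (rule member_le_sum) (use p P(2) \<psi>0 in auto)
    finally show ?thesis .
  qed
  obtain x0 where x0: "x0 \<in> closure \<Omega>" "\<And>x. x \<in> closure \<Omega> \<Longrightarrow> S x0 \<le> S x"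
    using continuous_attains_inf[OF comp _ continuous_on_subset[OF cS]] ne closure_subset
    by (metis subset_UNIV subset_empty)
  define s0 where "s0 = S x0"
  have s0: "0 < s0" unfolding s0_def by (rule Spos[OF x0(1)])
  \<comment> \<open>Dividing by \<open>S\<close> itself would fail away from the closure, where the
    hats may all vanish. The minimum \<open>s0\<close> of \<open>S\<close> over the closure bounds
    the divisor from below and does not alter it on the domain, so the quotients still add up to 1
    there.\<close>
  define m where "m x = max (S x) s0" for x
  have m: "s0 \<le> m x" "0 < m x" "S x \<le> m x" for x using s0 by (auto simp: m_def)
  define \<theta> where "\<theta> p x = \<psi> p x / m x" for p x
  define n where "n = real (card P)"
  have \<psi>L: "\<bar>\<psi> p (x + h) - \<psi> p x\<bar> \<le> norm h" for p x h
  proof -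
    have "\<bar>dist p (x + h) - dist p x\<bar> \<le> norm h"
      using dist_triangle3[of p "x + h" x] dist_triangle3[of p x "x + h"] dist_triangle[of p "x + h" x] dist_triangle[of p x "x + h"]
      by (simp add: dist_norm)
    then show ?thesis unfolding \<psi>_def by linarith
  qed
  have SL: "\<bar>S (x + h) - S x\<bar> \<le> n * norm h" for x h
  proof -
    have "\<bar>S (x + h) - S x\<bar> = \<bar>\<Sum>p\<in>P. \<psi> p (x + h) - \<psi> p x\<bar>" by (simp add: S_def sum_subtractf)
    also have "\<dots> \<le> (\<Sum>p\<in>P. norm h)" by (rule order.trans[OF sum_abs sum_mono[OF \<psi>L]])
    finally show ?thesis by (simp add: n_def)
  qed
  have mL: "\<bar>m (x + h) - m x\<bar> \<le> n * norm h" for x h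
    using SL[of x h] unfolding m_def by linarith
  have \<psi>m: "\<psi> p x \<le> m x" if "p \<in> P" for p x
  proof -
    have "\<psi> p x \<le> S x" unfolding S_def by (rule member_le_sum) (use that P(2) \<psi>0 in auto)
    then show ?thesis using m(3)[of x] by simp
  qed
  have \<theta>L: "\<bar>\<theta> p (x + h) - \<theta> p x\<bar> \<le> ((1 + n) / s0) * norm h" if "p \<in> P" for p x h
  proof -
    have mm: "0 < m x" "0 < m (x + h)" using m by auto
    \<comment> \<open>A discrete quotient rule; since \<open>\<psi> p x / m x\<close> is at most 1,
      the two terms give the constants 1 and \<open>n\<close> over \<open>s0\<close>.\<close>
    have "\<theta> p (x + h) - \<theta> p x = (\<psi> p (x + h) - \<psi> p x) / m (x + h) + (\<psi> p x / m x) * ((m x - m (x + h)) / m (x + h))"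
      using mm by (simp add: \<theta>_def field_simps)
    also have "\<bar>\<dots>\<bar> \<le> \<bar>(\<psi> p (x + h) - \<psi> p x) / m (x + h)\<bar> + \<bar>(\<psi> p x / m x) * ((m x - m (x + h)) / m (x + h))\<bar>"
      by (rule abs_triangle_ineq)
    also have "\<dots> \<le> norm h / s0 + 1 * ((n * norm h) / s0)"
    proof (rule add_mono)
      show "\<bar>(\<psi> p (x + h) - \<psi> p x) / m (x + h)\<bar> \<le> norm h / s0"
        unfolding abs_divide using \<psi>L[of p x h] m[of "x + h"] s0 by (intro frac_le) auto
      show "\<bar>(\<psi> p x / m x) * ((m x - m (x + h)) / m (x + h))\<bar> \<le> 1 * ((n * norm h) / s0)"
        unfolding abs_mult
      proof (rule mult_mono)
        show "\<bar>\<psi> p x / m x\<bar> \<le> 1" using \<psi>m[OF that, of x] \<psi>0[of p x] mm by simp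
        show "\<bar>(m x - m (x + h)) / m (x + h)\<bar> \<le> n * norm h / s0"
          unfolding abs_divide using mL[of x h] m[of "x + h"] s0 by (intro frac_le) (auto simp: abs_minus_commute)
      qed auto
    qed
    also have "\<dots> = ((1 + n) / s0) * norm h" by (simp add: add_divide_distrib distrib_right)
    finally show ?thesis .
  qed
  have "inward_partition \<Omega> P e c' t' \<theta> ((1 + n) / s0)"
    unfolding inward_partition_def
  proof (intro conjI ballI allI impI P(2) c' t' \<theta>L)
    fix p assume p: "p \<in> P"
    then have pc: "p \<in> closure \<Omega>" using P(1) by blast
    show "norm (e p) = 1" by (rule cone(2)[OF pc])
    have "continuous_on UNIV m" unfolding m_def by (intro continuous_intros cS)
    moreover have "continuous_on UNIV (\<psi> p)" unfolding \<psi>_def by (intro continuous_intros)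
    ultimately have "continuous_on UNIV (\<theta> p)"
      unfolding \<theta>_def[abs_def] using m(2) by (intro continuous_on_divide) (auto simp: less_imp_neq[symmetric])
    then show "\<theta> p \<in> borel_measurable borel" by (rule borel_measurable_continuous_onI)
    show "\<bar>\<theta> p x\<bar> \<le> 1" for x using \<psi>m[OF p, of x] \<psi>0[of p x] m(2)[of x] by (simp add: \<theta>_def)
    fix x t assume x: "x \<in> \<Omega>" "\<theta> p x \<noteq> 0" and t: "0 < t" "t < t'"
    have "\<psi> p x \<noteq> 0" using x(2) by (auto simp: \<theta>_def)
    then have "dist p x < \<epsilon> p" by (auto simp: \<psi>_def max_def split: if_splits)
    then have "x \<in> \<Omega> \<inter> ball p (\<epsilon> p)" using x(1) by simp
    moreover have "t < t0 p" using t(2) t'(2)[OF p] by simp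
    ultimately have "ball (x + t *\<^sub>R e p) (c p * t) \<subseteq> \<Omega>" using cone(6)[OF pc] t(1) by blast
    moreover have "c' * t \<le> c p * t" using c'(3)[OF p] t(1) by (intro mult_right_mono) auto
    ultimately show "ball (x + t *\<^sub>R e p) (c' * t) \<subseteq> \<Omega>" using subset_ball by blast
  next
    fix x assume x: "x \<in> \<Omega>"
    then have xc: "x \<in> closure \<Omega>" using closure_subset by blast
    have "m x = S x" using x0(2)[OF xc] by (simp add: m_def s0_def)
    then show "(\<Sum>p\<in>P. \<theta> p x) = 1"
      using Spos[OF xc] by (simp add: \<theta>_def S_def flip: sum_divide_distrib)
  qed
  then show ?thesis by blast
qed

lemma nn_integral_rescale:
  fixes F :: "'a::euclidean_space \<Rightarrow> real"
  assumes F[measurable]: "F \<in> borel_measurable borel" and a: "0 < a"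
  shows "(\<integral>\<^sup>+k. ennreal \<bar>a ^ DIM('a) * F (a *\<^sub>R (k - w))\<bar> \<partial>lborel) = (\<integral>\<^sup>+k. ennreal \<bar>F k\<bar> \<partial>lborel)"
proof -
  have "(\<integral>\<^sup>+k. ennreal \<bar>F k\<bar> \<partial>lborel) = ennreal (\<bar>a\<bar> ^ DIM('a)) * (\<integral>\<^sup>+k. ennreal \<bar>F (a *\<^sub>R k)\<bar> \<partial>lborel)"
    by (rule nn_integral_scale) (use a in auto)
  also have "\<dots> = (\<integral>\<^sup>+k. ennreal (\<bar>a\<bar> ^ DIM('a)) * ennreal \<bar>F (a *\<^sub>R k)\<bar> \<partial>lborel)"
    by (rule nn_integral_cmult[symmetric]) measurable
  also have "\<dots> = (\<integral>\<^sup>+k. ennreal \<bar>a ^ DIM('a) * F (a *\<^sub>R k)\<bar> \<partial>lborel)"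
    using a by (intro nn_integral_cong) (simp add: abs_mult ennreal_mult')
  also have "\<dots> = (\<integral>\<^sup>+k. ennreal \<bar>a ^ DIM('a) * F (a *\<^sub>R (k + - w))\<bar> \<partial>lborel)"
    by (rule nn_integral_shift[symmetric]) measurable
  finally show ?thesis by simp
qed

text \<open>Fixed once by choice, so that bounds on it and on its derivatives are constants of the
  space alone.\<close>

definition bump :: "'a::euclidean_space \<Rightarrow> real" where
  "bump = (SOME \<rho>. \<rho> \<in> test_functions UNIV \<and> (\<forall>x. 0 \<le> \<rho> x) \<and> (\<forall>x. 1 \<le> norm x \<longrightarrow> \<rho> x = 0) \<and> (LINT x|lborel. \<rho> x) = 1)"

lemma bump:
  "(bump :: 'a::euclidean_space \<Rightarrow> real) \<in> test_functions UNIV" "0 \<le> bump (x::'a)" "1 \<le> norm (x::'a) \<Longrightarrow> bump x = 0"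
  "(LINT x|lborel. bump (x::'a)) = 1"
proof -
  have "\<exists>\<rho>::'a \<Rightarrow> real. \<rho> \<in> test_functions UNIV \<and> (\<forall>x. 0 \<le> \<rho> x) \<and> (\<forall>x. 1 \<le> norm x \<longrightarrow> \<rho> x = 0) \<and> (LINT x|lborel. \<rho> x) = 1"
    by (rule exists_bump) blast
  from someI_ex[OF this, folded bump_def] show "(bump :: 'a \<Rightarrow> real) \<in> test_functions UNIV" "0 \<le> bump (x::'a)"
    "1 \<le> norm (x::'a) \<Longrightarrow> bump x = 0" "(LINT x|lborel. bump (x::'a)) = 1" by blast+
qed

text \<open>\<open>a\<close> is the reciprocal of the radius. Convolution with it moves a function
  by \<open>w\<close> and averages it over that radius.\<close>

definition mollifier :: "real \<Rightarrow> 'a::euclidean_space \<Rightarrow> 'a \<Rightarrow> real" where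
  "mollifier a w k = a ^ DIM('a) * bump (a *\<^sub>R (k - w))"

lemma mollifier:
  fixes w :: "'a::euclidean_space"
  assumes a: "0 < a"
  shows "mollifier a w \<in> test_functions UNIV"
    "0 \<le> mollifier a w k" "1 / a \<le> norm (k - w) \<Longrightarrow> mollifier a w k = 0"
    "(\<integral>\<^sup>+k. ennreal \<bar>mollifier a w k\<bar> \<partial>lborel) = 1" "(LINT k|lborel. mollifier a w k) = 1"
    "pd b (mollifier a w) k = a ^ (DIM('a) + 1) * pd b bump (a *\<^sub>R (k - w))"
proof -
  have bm[measurable]: "(bump :: 'a \<Rightarrow> real) \<in> borel_measurable borel" by (rule test_functionsD(4)[OF bump(1)])
  have z: "bump (a *\<^sub>R (k - w)) = 0" if "1 / a \<le> norm (k - w)" for k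
  proof (rule bump(3))
    have "norm (a *\<^sub>R (k - w)) = a * norm (k - w)" using a by (simp only: norm_scaleR abs_of_pos)
    then show "1 \<le> norm (a *\<^sub>R (k - w))" using that a by (simp only: divide_le_eq mult.commute split: if_splits)
  qed
  show z': "1 / a \<le> norm (k - w) \<Longrightarrow> mollifier a w k = 0" for k unfolding mollifier_def using z by simp
  show nn: "0 \<le> mollifier a w k" for k unfolding mollifier_def using a by (intro mult_nonneg_nonneg bump(2)) simp
  have C: "Ck k (mollifier a w)" for k
    unfolding mollifier_def[abs_def] by (rule Ck_mult[OF Ck_const Ck_affine[OF test_functionsD(1)[OF bump(1)]]])
  show t: "mollifier a w \<in> test_functions UNIV"
  proof (rule test_functionsI[where K="cball w (1 / a)"])
    fix x assume "x \<notin> cball w (1 / a)"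
    then have "1 / a \<le> norm (x - w)" by (simp add: dist_norm norm_minus_commute)
    then show "mollifier a w x = 0" by (rule z')
  qed (use C in auto)
  have "(\<integral>\<^sup>+k. ennreal \<bar>mollifier a w k\<bar> \<partial>lborel) = (\<integral>\<^sup>+k. ennreal \<bar>bump (k::'a)\<bar> \<partial>lborel)"
    unfolding mollifier_def by (rule nn_integral_rescale[OF bm a])
  also have "\<dots> = (\<integral>\<^sup>+k. ennreal (bump (k::'a)) \<partial>lborel)" by (simp add: bump(2))
  also have "\<dots> = ennreal (LINT x|lborel. bump (x::'a))"
    by (rule nn_integral_eq_integral[OF test_functions_integrable(1)[OF bump(1)]]) (simp add: bump(2))
  finally show 1: "(\<integral>\<^sup>+k. ennreal \<bar>mollifier a w k\<bar> \<partial>lborel) = 1" by (simp add: bump(4))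
  have "ennreal (LINT k|lborel. mollifier a w k) = (\<integral>\<^sup>+k. ennreal (mollifier a w k) \<partial>lborel)"
    by (rule nn_integral_eq_integral[symmetric, OF test_functions_integrable(1)[OF t]]) (simp add: nn)
  also have "\<dots> = 1" using 1 by (simp add: nn)
  finally show "(LINT k|lborel. mollifier a w k) = 1" by (simp add: ennreal_eq_1)
  have "pd b (mollifier a w) k = a ^ DIM('a) * pd b (\<lambda>k. bump (a *\<^sub>R (k - w))) k + pd b (\<lambda>k. a ^ DIM('a)) k * bump (a *\<^sub>R (k - w))"
    unfolding mollifier_def[abs_def]
    by (rule pd_mult) (simp, use Ck_affine[OF test_functionsD(1)[OF bump(1)], of "Suc 0" a w] in simp)
  also have "pd b (\<lambda>k. a ^ DIM('a)) k = 0" by (rule pd_eq[where D="\<lambda>_. 0", simplified]) simp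
  also have "pd b (\<lambda>k. bump (a *\<^sub>R (k - w))) k = a * pd b bump (a *\<^sub>R (k - w))"
    by (rule pd_affine[OF test_functionsD(2)[OF bump(1)]])
  finally show "pd b (mollifier a w) k = a ^ (DIM('a) + 1) * pd b bump (a *\<^sub>R (k - w))" by simp
qed

text \<open>Each piece is pushed inward by t along its own direction and averaged over radius c t /
  2. This is half of what the cone allows, so that even the closure of the resulting support stays
  in the domain.\<close>

definition smooth_op ::
  "'a::euclidean_space set \<Rightarrow> ('a \<Rightarrow> 'a) \<Rightarrow> real \<Rightarrow> ('a \<Rightarrow> 'a \<Rightarrow> real) \<Rightarrow> real \<Rightarrow> ('a \<Rightarrow> real) \<Rightarrow> 'a \<Rightarrow> real" where
  "smooth_op P e c \<theta> t v x = (\<Sum>p\<in>P. conv (mollifier (2 / (c * t)) (t *\<^sub>R e p)) (\<lambda>x. \<theta> p x * v x) x)"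

lemma pd_sum:
  assumes "\<And>i. i \<in> I \<Longrightarrow> f i differentiable (at x)"
  shows "pd b (\<lambda>x. \<Sum>i\<in>I. f i x) x = (\<Sum>i\<in>I. pd b (f i) x)"
  by (rule pd_eq, rule has_derivative_sum) (rule differentiable_has_derivative[OF assms])

section \<open>Properties of the smoothing operator\<close>

context
  fixes \<Omega> P :: "'a::euclidean_space set" and e :: "'a \<Rightarrow> 'a" and c t0 L :: real and \<theta> :: "'a \<Rightarrow> 'a \<Rightarrow> real"
  assumes part: "inward_partition \<Omega> P e c t0 \<theta> L" and bdd: "bounded \<Omega>"
begin

lemma partition_facts:
  shows "finite P" "0 < c" "c \<le> 1" "0 < t0" "p \<in> P \<Longrightarrow> norm (e p) = 1"
    "p \<in> P \<Longrightarrow> \<theta> p \<in> borel_measurable borel" "p \<in> P \<Longrightarrow> \<bar>\<theta> p x\<bar> \<le> 1"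
    "p \<in> P \<Longrightarrow> \<bar>\<theta> p (x + h) - \<theta> p x\<bar> \<le> L * norm h"
    "p \<in> P \<Longrightarrow> x \<in> \<Omega> \<Longrightarrow> \<theta> p x \<noteq> 0 \<Longrightarrow> 0 < t \<Longrightarrow> t < t0 \<Longrightarrow> ball (x + t *\<^sub>R e p) (c * t) \<subseteq> \<Omega>"
    "x \<in> \<Omega> \<Longrightarrow> (\<Sum>p\<in>P. \<theta> p x) = 1"
  using part unfolding inward_partition_def by blast+

context
  fixes v :: "'a \<Rightarrow> real"
  assumes v: "sqint lborel v" and v0: "\<And>x. x \<notin> \<Omega> \<Longrightarrow> v x = 0"
begin

lemma piece_sqint:
  assumes "p \<in> P"
  shows "sqint lborel (\<lambda>x. \<theta> p x * v x)" "integrable lborel (\<lambda>x. \<theta> p x * v x)"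
proof -
  have m: "\<theta> p \<in> borel_measurable lborel" using partition_facts(6)[OF assms] by simp
  have "sqint lborel (\<lambda>x. \<theta> p x *\<^sub>R v x)"
    by (rule sqint_coeff[OF v m, where C=1]) (simp add: partition_facts(7)[OF assms])
  then show s: "sqint lborel (\<lambda>x. \<theta> p x * v x)" by simp
  show "integrable lborel (\<lambda>x. \<theta> p x * v x)"
    by (rule sqint_integrable_bounded[OF s bdd]) (simp add: v0)
qed

lemma sum_pieces: "(\<Sum>p\<in>P. \<theta> p x * v x) = v x"
proof (cases "x \<in> \<Omega>")
  case True
  then show ?thesis using partition_facts(10)[OF True] by (simp flip: sum_distrib_right)
qed (simp add: v0)

lemma smooth_op_test_function:
  assumes t: "0 < t" "t < t0"
  shows "smooth_op P e c \<theta> t v \<in> test_functions \<Omega>"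
proof -
  have a: "0 < 2 / (c * t)" using t partition_facts(2) by simp
  have "conv (mollifier (2 / (c * t)) (t *\<^sub>R e p)) (\<lambda>x. \<theta> p x * v x) \<in> test_functions \<Omega>" if p: "p \<in> P" for p
  proof -
    \<comment> \<open>The set reached by the moved and averaged piece. Points of its closure are
      within c t of a moved point, hence in the domain by the cone property.\<close>
    define S where "S = {y. \<exists>x\<in>\<Omega>. \<theta> p x \<noteq> 0 \<and> dist (x + t *\<^sub>R e p) y < c * t / 2}"
    have cl: "closure S \<subseteq> \<Omega>"
    proof
      fix y assume "y \<in> closure S"
      moreover have "0 < c * t / 2" using t partition_facts(2) by simp
      ultimately obtain y' where y': "y' \<in> S" "dist y' y < c * t / 2" using closure_approachable by blast
      then obtain x where x: "x \<in> \<Omega>" "\<theta> p x \<noteq> 0" "dist (x + t *\<^sub>R e p) y' < c * t / 2" unfolding S_def by blast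
      have "dist (x + t *\<^sub>R e p) y < c * t"
        using dist_triangle[of "x + t *\<^sub>R e p" y y'] x(3) y'(2) by linarith
      then show "y \<in> \<Omega>" using partition_facts(9)[OF p x(1,2) t] by auto
    qed
    have "compact (closure S)"
      using bounded_subset[OF bdd cl] by (simp add: compact_eq_bounded_closed)
    then show ?thesis
    proof (rule test_functionsI[OF Ck_conv[OF mollifier(1)[OF a] piece_sqint[OF p]] _ cl])
      fix y assume "y \<notin> closure S"
      then have yS: "y \<notin> S" using closure_subset by blast
      have "mollifier (2 / (c * t)) (t *\<^sub>R e p) (y - z) * (\<theta> p z * v z) = 0" for z
      proof (cases "z \<in> \<Omega> \<and> \<theta> p z \<noteq> 0")
        case True
        then have "c * t / 2 \<le> dist (z + t *\<^sub>R e p) y" using yS unfolding S_def by force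
        also have "dist (z + t *\<^sub>R e p) y = norm ((y - z) - t *\<^sub>R e p)"
          by (simp add: dist_norm norm_minus_commute algebra_simps)
        finally have "mollifier (2 / (c * t)) (t *\<^sub>R e p) (y - z) = 0"
          by (intro mollifier(3)[OF a]) simp
        then show ?thesis by simp
      qed (auto simp: v0)
      then have z: "(\<lambda>z. mollifier (2 / (c * t)) (t *\<^sub>R e p) (y - z) * (\<theta> p z * v z)) = (\<lambda>z. 0)" by (rule ext)
      show "conv (mollifier (2 / (c * t)) (t *\<^sub>R e p)) (\<lambda>x. \<theta> p x * v x) y = 0"
        unfolding conv_def z by (rule Bochner_Integration.integral_zero)
    qed
  qed
  then show ?thesis unfolding smooth_op_def[abs_def] by (rule test_functions_sum[OF partition_facts(1)])
qed

text \<open>The centre is at distance t and the radius is at most t / 2. For t = \<delta>/4 the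
  bound becomes \<delta>/2, the range of \<open>ker_ge\<close>.\<close>

lemma mollifier_support:
  assumes p: "p \<in> P" and t: "0 < t" and k: "mollifier (2 / (c * t)) (t *\<^sub>R e p) k \<noteq> 0"
  shows "norm k < 2 * t"
proof -
  have a: "0 < 2 / (c * t)" using t partition_facts(2) by simp
  have ct: "c * t \<le> t" using t partition_facts(2,3) by simp
  have "norm (k - t *\<^sub>R e p) < c * t / 2"
    using mollifier(3)[OF a, of k "t *\<^sub>R e p"] k by force
  moreover have "norm (t *\<^sub>R e p) = t" using partition_facts(5)[OF p] t by simp
  moreover have "norm k \<le> norm (k - t *\<^sub>R e p) + norm (t *\<^sub>R e p)"
    using norm_triangle_ineq[of "k - t *\<^sub>R e p" "t *\<^sub>R e p"] by simp
  ultimately show ?thesis using ct t by linarith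
qed

lemma smooth_op_diff_le:
  assumes t: "0 < t" and le: "\<And>p. p \<in> P \<Longrightarrow> l2norm lborel (\<lambda>x. conv (mollifier (2 / (c * t)) (t *\<^sub>R e p)) (\<lambda>x. \<theta> p x * v x) x - \<theta> p x * v x) \<le> C"
  shows "l2norm lborel (\<lambda>x. smooth_op P e c \<theta> t v x - v x) \<le> real (card P) * C"
proof -
  have a: "0 < 2 / (c * t)" using t partition_facts(2) by simp
  have "smooth_op P e c \<theta> t v x - v x = (\<Sum>p\<in>P. conv (mollifier (2 / (c * t)) (t *\<^sub>R e p)) (\<lambda>x. \<theta> p x * v x) x - \<theta> p x * v x)" for x
    unfolding smooth_op_def by (subst sum_pieces[of x, symmetric]) (simp add: sum_subtractf)
  then have "l2norm lborel (\<lambda>x. smooth_op P e c \<theta> t v x - v x)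
      \<le> (\<Sum>p\<in>P. l2norm lborel (\<lambda>x. conv (mollifier (2 / (c * t)) (t *\<^sub>R e p)) (\<lambda>x. \<theta> p x * v x) x - \<theta> p x * v x))"
    using sqint_sum(2)[OF partition_facts(1), of lborel "\<lambda>p x. conv (mollifier (2 / (c * t)) (t *\<^sub>R e p)) (\<lambda>x. \<theta> p x * v x) x - \<theta> p x * v x"]
      sqint_diff(1)[OF conv_l2norm[OF mollifier(1)[OF a] eq_refl[OF mollifier(4)[OF a]] piece_sqint(1)] piece_sqint(1)]
    by simp
  also have "\<dots> \<le> (\<Sum>p\<in>P. C)" by (rule sum_mono[OF le])
  finally show ?thesis by simp
qed

lemma smooth_op_tendsto:
  assumes \<epsilon>: "0 < \<epsilon>"
  shows "\<exists>\<tau>>0. \<forall>t. 0 < t \<longrightarrow> t < \<tau> \<longrightarrow> l2norm lborel (\<lambda>x. smooth_op P e c \<theta> t v x - v x) \<le> \<epsilon>"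
proof -
  define \<epsilon>' where "\<epsilon>' = \<epsilon> / (real (card P) + 1)"
  have \<epsilon>': "0 < \<epsilon>'" using \<epsilon> by (simp add: \<epsilon>'_def)
  have "\<exists>d>0. \<forall>k. norm k < d \<longrightarrow> l2norm lborel (\<lambda>x. \<theta> p (x + k) * v (x + k) - \<theta> p x * v x) \<le> \<epsilon>'" if p: "p \<in> P" for p
  proof -
    have "transl_cont (\<lambda>x. \<theta> p x * v x)" by (rule transl_cont[OF piece_sqint(1)[OF p] bdd]) (simp add: v0)
    from transl_contD(2)[OF this \<epsilon>'] show ?thesis .
  qed
  then obtain d where d: "\<And>p. p \<in> P \<Longrightarrow> 0 < d p"
    "\<And>p k. p \<in> P \<Longrightarrow> norm k < d p \<Longrightarrow> l2norm lborel (\<lambda>x. \<theta> p (x + k) * v (x + k) - \<theta> p x * v x) \<le> \<epsilon>'"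
    by metis
  \<comment> \<open>Halved because displacements can reach 2 t; the inserted 1 keeps the minimum
    meaningful for an empty \<open>P\<close>.\<close>
  define \<tau> where "\<tau> = Min (insert 1 (d ` P)) / 2"
  have fin: "finite (insert 1 (d ` P))" "insert 1 (d ` P) \<noteq> {}" using partition_facts(1) by auto
  have \<tau>: "0 < \<tau>" using Min_gr_iff[OF fin] d(1) by (auto simp: \<tau>_def)
  have \<tau>d: "2 * \<tau> \<le> d p" if "p \<in> P" for p using that fin by (auto simp: \<tau>_def intro!: Min_le)
  show ?thesis
  proof (intro exI[of _ \<tau>] conjI \<tau> allI impI)
    fix t :: real assume t: "0 < t" "t < \<tau>"
    have a: "0 < 2 / (c * t)" using t partition_facts(2) by simp
    have "l2norm lborel (\<lambda>x. smooth_op P e c \<theta> t v x - v x) \<le> real (card P) * \<epsilon>'"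
    proof (rule smooth_op_diff_le[OF t(1)])
      fix p assume p: "p \<in> P"
      show "l2norm lborel (\<lambda>x. conv (mollifier (2 / (c * t)) (t *\<^sub>R e p)) (\<lambda>x. \<theta> p x * v x) x - \<theta> p x * v x) \<le> \<epsilon>'"
      proof (rule conv_approx_translation[OF mollifier(1)[OF a] eq_refl[OF mollifier(4)[OF a]] mollifier(5)[OF a] piece_sqint(1)[OF p]])
        fix k assume "mollifier (2 / (c * t)) (t *\<^sub>R e p) k \<noteq> 0"
        then have "norm k < d p" using mollifier_support[OF p t(1)] \<tau>d[OF p] t(2) by force
        then show "l2norm lborel (\<lambda>x. \<theta> p (x + k) * v (x + k) - \<theta> p x * v x) \<le> \<epsilon>'" by (rule d(2)[OF p])
      qed (use \<epsilon>' in simp)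
    qed
    also have "\<dots> \<le> (real (card P) + 1) * \<epsilon>'" using \<epsilon>' by simp
    also have "\<dots> = \<epsilon>" unfolding \<epsilon>'_def by (simp add: add_pos_nonneg less_imp_neq[symmetric])
    finally show "l2norm lborel (\<lambda>x. smooth_op P e c \<theta> t v x - v x) \<le> \<epsilon>" .
  qed
qed

section \<open>Bounds of the smoothing operator by the energy\<close>

context
  fixes D0 s :: real and \<gamma>1 :: "real \<Rightarrow> real" and ty :: "'a itself" and \<delta> :: real
  assumes K: "kernel_conditions ty D0 s \<gamma>1" and \<delta>: "0 < \<delta>" and fin: "En \<gamma>1 \<delta> v < \<infinity>"
begin

lemma v_borel: "v \<in> borel_measurable borel"
  using sqint_measurable[OF v] by simp

abbreviation "energy_sq \<equiv> (Sn \<gamma>1 \<delta> v)\<^sup>2 + (l2norm lborel v)\<^sup>2"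

lemma quadratic_energy_le:
  assumes w: "w \<in> borel_measurable borel"
    and le: "\<And>h. mod_sq w h \<le> ennreal 2 * mod_sq v h + ennreal ((2 * L\<^sup>2 * (l2norm lborel v)\<^sup>2) * (norm h)\<^sup>2)"
  shows "En \<gamma>1 \<delta> w < \<infinity>" "(Sn \<gamma>1 \<delta> w)\<^sup>2 \<le> (2 + 2 * L\<^sup>2 * real DIM('a)) * energy_sq"
proof -
  have nn: "0 \<le> 2 * L\<^sup>2 * (l2norm lborel v)\<^sup>2" by simp
  have "En \<gamma>1 \<delta> w \<le> ennreal 2 * En \<gamma>1 \<delta> v + ennreal ((2 * L\<^sup>2 * (l2norm lborel v)\<^sup>2) * real DIM('a))"
    by (rule En_quadratic[OF K \<delta> v_borel le nn])
  also have "\<dots> = ennreal 2 * ennreal ((Sn \<gamma>1 \<delta> v)\<^sup>2) + ennreal ((2 * L\<^sup>2 * (l2norm lborel v)\<^sup>2) * real DIM('a))"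
    by (simp only: Sn_sq[OF K \<delta> v_borel fin])
  also have "\<dots> = ennreal (2 * (Sn \<gamma>1 \<delta> v)\<^sup>2 + (2 * L\<^sup>2 * (l2norm lborel v)\<^sup>2) * real DIM('a))"
    by (subst ennreal_mult[symmetric], simp, simp, rule ennreal_plus[symmetric]) simp_all
  also have "\<dots> \<le> ennreal ((2 + 2 * L\<^sup>2 * real DIM('a)) * energy_sq)"
  proof (rule ennreal_leI)
    have "0 \<le> 2 * L\<^sup>2 * real DIM('a) * (Sn \<gamma>1 \<delta> v)\<^sup>2 + 2 * (l2norm lborel v)\<^sup>2" by simp
    then show "2 * (Sn \<gamma>1 \<delta> v)\<^sup>2 + (2 * L\<^sup>2 * (l2norm lborel v)\<^sup>2) * real DIM('a) \<le> (2 + 2 * L\<^sup>2 * real DIM('a)) * energy_sq"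
      by (simp add: algebra_simps)
  qed
  finally have le: "En \<gamma>1 \<delta> w \<le> ennreal ((2 + 2 * L\<^sup>2 * real DIM('a)) * energy_sq)" .
  show "En \<gamma>1 \<delta> w < \<infinity>" by (rule Sn_sq_le(1)[OF K \<delta> w le]) simp
  show "(Sn \<gamma>1 \<delta> w)\<^sup>2 \<le> (2 + 2 * L\<^sup>2 * real DIM('a)) * energy_sq" by (rule Sn_sq_le(2)[OF K \<delta> w le]) simp
qed

lemma piece_energy:
  assumes "p \<in> P"
  shows "En \<gamma>1 \<delta> (\<lambda>x. \<theta> p x * v x) < \<infinity>"
    "(Sn \<gamma>1 \<delta> (\<lambda>x. \<theta> p x * v x))\<^sup>2 \<le> (2 + 2 * L\<^sup>2 * real DIM('a)) * energy_sq"
proof -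
  have m: "(\<lambda>x. \<theta> p x * v x) \<in> borel_measurable borel" using sqint_measurable[OF piece_sqint(1)[OF assms]] by simp
  note le = mod_sq_cutoff[OF K v partition_facts(6)[OF assms] partition_facts(7)[OF assms] partition_facts(8)[OF assms]]
  show "En \<gamma>1 \<delta> (\<lambda>x. \<theta> p x * v x) < \<infinity>" by (rule quadratic_energy_le(1)[OF m le])
  show "(Sn \<gamma>1 \<delta> (\<lambda>x. \<theta> p x * v x))\<^sup>2 \<le> (2 + 2 * L\<^sup>2 * real DIM('a)) * energy_sq" by (rule quadratic_energy_le(2)[OF m le])
qed

text \<open>Cutting off and then mollifying is controlled displacement by displacement, so the scale
  t and the horizon \<delta> need not be related. Both uses matter: shrinking t at a fixed horizon,
  and t tied to a different horizon.\<close>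

lemma smooth_op_energy:
  assumes t: "0 < t"
  shows "En \<gamma>1 \<delta> (smooth_op P e c \<theta> t v) < \<infinity>"
    "Sn \<gamma>1 \<delta> (smooth_op P e c \<theta> t v) \<le> real (card P) * sqrt ((2 + 2 * L\<^sup>2 * real DIM('a)) * energy_sq)"
proof -
  have a: "0 < 2 / (c * t)" using t partition_facts(2) by simp
  define f where "f p = conv (mollifier (2 / (c * t)) (t *\<^sub>R e p)) (\<lambda>x. \<theta> p x * v x)" for p
  have fm: "f p \<in> borel_measurable borel" if p: "p \<in> P" for p
    using sqint_measurable[OF conv_l2norm[OF mollifier(1)[OF a] eq_refl[OF mollifier(4)[OF a]] piece_sqint(1)[OF p]]]
    by (simp add: f_def)
  have fE: "En \<gamma>1 \<delta> (f p) < \<infinity>" "(Sn \<gamma>1 \<delta> (f p))\<^sup>2 \<le> (2 + 2 * L\<^sup>2 * real DIM('a)) * energy_sq" if p: "p \<in> P" for p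
  proof -
    have le: "mod_sq (f p) h \<le> ennreal 2 * mod_sq v h + ennreal ((2 * L\<^sup>2 * (l2norm lborel v)\<^sup>2) * (norm h)\<^sup>2)" for h
      unfolding f_def
      by (rule order.trans[OF mod_sq_conv[OF mollifier(1)[OF a] eq_refl[OF mollifier(4)[OF a]] piece_sqint(1)[OF p]]
          mod_sq_cutoff[OF K v partition_facts(6)[OF p] partition_facts(7)[OF p] partition_facts(8)[OF p]]])
    show "En \<gamma>1 \<delta> (f p) < \<infinity>" by (rule quadratic_energy_le(1)[OF fm[OF p] le])
    show "(Sn \<gamma>1 \<delta> (f p))\<^sup>2 \<le> (2 + 2 * L\<^sup>2 * real DIM('a)) * energy_sq" by (rule quadratic_energy_le(2)[OF fm[OF p] le])
  qed
  have fs: "sqint (kmeas \<gamma>1 \<delta>) (incr (f p))" if p: "p \<in> P" for p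
    using sqint_incr_iff[OF K \<delta> fm[OF p]] fE(1)[OF p] by simp
  have eq: "smooth_op P e c \<theta> t v = (\<lambda>x. \<Sum>p\<in>P. f p x)" by (simp add: smooth_op_def f_def fun_eq_iff)
  have m: "(\<lambda>x. \<Sum>p\<in>P. f p x) \<in> borel_measurable borel" by (rule borel_measurable_sum[OF fm])
  have s: "sqint (kmeas \<gamma>1 \<delta>) (incr (\<lambda>x. \<Sum>p\<in>P. f p x))"
    unfolding incr_simps(4) by (rule sqint_sum(1)[OF partition_facts(1) fs])
  then show "En \<gamma>1 \<delta> (smooth_op P e c \<theta> t v) < \<infinity>" unfolding eq using sqint_incr_iff[OF K \<delta> m] by simp
  have "Sn \<gamma>1 \<delta> (\<lambda>x. \<Sum>p\<in>P. f p x) \<le> (\<Sum>p\<in>P. Sn \<gamma>1 \<delta> (f p))"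
    unfolding incr_simps(4) by (rule sqint_sum(2)[OF partition_facts(1) fs])
  also have "\<dots> \<le> (\<Sum>p\<in>P. sqrt ((2 + 2 * L\<^sup>2 * real DIM('a)) * energy_sq))"
    by (intro sum_mono real_le_rsqrt fE(2))
  finally show "Sn \<gamma>1 \<delta> (smooth_op P e c \<theta> t v) \<le> real (card P) * sqrt ((2 + 2 * L\<^sup>2 * real DIM('a)) * energy_sq)"
    unfolding eq by simp
qed

text \<open>On the support, within half the horizon, \<open>ker_ge\<close> bounds the kernel below
  by a constant, which a multiple lifts above \<open>B\<close>. The function \<open>f\<close> is
  general because mollifiers and their derivatives are both needed.\<close>

lemma mollifier_le_kernel:
  assumes p: "p \<in> P" and t: "t = \<delta> / 4" and k: "k \<noteq> 0" and f: "\<bar>f k\<bar> \<le> B" "f k \<noteq> 0 \<Longrightarrow> norm k < 2 * t" and B: "0 \<le> B"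
  shows "\<bar>f k\<bar> \<le> (B * \<delta> ^ (DIM('a) + 2) / \<gamma>1 (1/2)) * ker \<gamma>1 \<delta> (k::'a)"
proof (cases "f k = 0")
  case True
  then show ?thesis using B ker_nonneg[OF K \<delta>, of k] kernel_profile(4)[OF K] \<delta> by simp
next
  case False
  then have "norm k \<le> \<delta> / 2" using f(2) t by simp
  from ker_ge[OF K \<delta> k this] have g: "\<gamma>1 (1/2) / \<delta> ^ (DIM('a) + 2) \<le> ker \<gamma>1 \<delta> k" .
  have "\<bar>f k\<bar> \<le> (B * \<delta> ^ (DIM('a) + 2) / \<gamma>1 (1/2)) * (\<gamma>1 (1/2) / \<delta> ^ (DIM('a) + 2))"
    using f(1) kernel_profile(4)[OF K] \<delta> by simp
  also have "\<dots> \<le> (B * \<delta> ^ (DIM('a) + 2) / \<gamma>1 (1/2)) * ker \<gamma>1 \<delta> k"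
    by (rule mult_left_mono[OF g]) (use B \<delta> kernel_profile(4)[OF K] in simp)
  finally show ?thesis .
qed

text \<open>A mollifier at scale \<delta> is dominated by \<delta>^2 times the kernel up to a
  constant, so \<open>conv_approx_energy\<close> yields the rate \<delta> after taking the
  root.\<close>

lemma smooth_op_approx:
  assumes B: "\<And>x::'a. bump x \<le> B"
  shows "l2norm lborel (\<lambda>x. smooth_op P e c \<theta> (\<delta> / 4) v x - v x)
    \<le> real (card P) * (\<delta> * sqrt ((8 / c) ^ DIM('a) * B / \<gamma>1 (1/2) * (2 + 2 * L\<^sup>2 * real DIM('a)) * energy_sq))"
proof (rule smooth_op_diff_le)
  show t: "0 < \<delta> / 4" using \<delta> by simp
  fix p assume p: "p \<in> P"
  define a where "a = 2 / (c * (\<delta> / 4))"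
  have a8: "a = 8 / (c * \<delta>)" by (simp add: a_def)
  have a: "0 < a" using \<delta> partition_facts(2) by (simp add: a8)
  have B0: "0 \<le> B" using B[of 0] bump(2)[of "0::'a"] by linarith
  define m where "m = a ^ DIM('a) * B * \<delta> ^ (DIM('a) + 2) / \<gamma>1 (1/2)"
  have m0: "0 \<le> m" using a B0 \<delta> kernel_profile(4)[OF K] by (simp add: m_def)
  \<comment> \<open>Since \<open>a\<close> is of order 1/\<delta>, the power
    \<open>a ^ DIM('a)\<close> against \<delta>^(d+2) leaves \<delta>^2.\<close>
  have m_eq: "m = (8 / c) ^ DIM('a) * B / \<gamma>1 (1/2) * \<delta>\<^sup>2"
    using \<delta> partition_facts(2) by (simp add: m_def a8 power_divide power_mult_distrib power_add power2_eq_square mult_ac)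
  have le: "\<bar>mollifier a ((\<delta> / 4) *\<^sub>R e p) k\<bar> \<le> m * ker \<gamma>1 \<delta> k" if k: "k \<noteq> 0" for k
    unfolding m_def
  proof (rule mollifier_le_kernel[OF p refl k])
    show "\<bar>mollifier a ((\<delta> / 4) *\<^sub>R e p) k\<bar> \<le> a ^ DIM('a) * B"
      using mollifier(2)[OF a, of "(\<delta> / 4) *\<^sub>R e p" k] B a unfolding mollifier_def by (simp add: mult_left_mono)
    show "norm k < 2 * (\<delta> / 4)" if "mollifier a ((\<delta> / 4) *\<^sub>R e p) k \<noteq> 0"
      using mollifier_support[OF p t] that unfolding a_def by blast
  qed (use a B0 in simp)
  have N: "(\<integral>\<^sup>+k. ennreal \<bar>mollifier a ((\<delta> / 4) *\<^sub>R e p) k\<bar> \<partial>lborel) \<le> ennreal 1"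
    by (simp add: mollifier(4)[OF a])
  have "(l2norm lborel (\<lambda>x. conv (mollifier a ((\<delta> / 4) *\<^sub>R e p)) (\<lambda>x. \<theta> p x * v x) x - \<theta> p x * v x))\<^sup>2
      \<le> 1 * m * (Sn \<gamma>1 \<delta> (\<lambda>x. \<theta> p x * v x))\<^sup>2"
    using conv_approx_energy(2)[OF K \<delta> mollifier(1)[OF a] N _ le m0 piece_sqint(1)[OF p] piece_energy(1)[OF p]]
    by (simp add: mollifier(5)[OF a])
  also have "\<dots> \<le> 1 * m * ((2 + 2 * L\<^sup>2 * real DIM('a)) * energy_sq)"
    by (rule mult_left_mono[OF piece_energy(2)[OF p]]) (use m0 in simp)
  also have "\<dots> = (\<delta> * sqrt ((8 / c) ^ DIM('a) * B / \<gamma>1 (1/2) * (2 + 2 * L\<^sup>2 * real DIM('a)) * energy_sq))\<^sup>2"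
  proof -
    have "0 \<le> (8 / c) ^ DIM('a) * B / \<gamma>1 (1/2) * (2 + 2 * L\<^sup>2 * real DIM('a)) * energy_sq"
      using partition_facts(2) B0 kernel_profile(4)[OF K] by simp
    then show ?thesis by (simp only: power_mult_distrib real_sqrt_pow2 m_eq) (simp only: mult_ac mult_1)
  qed
  finally show "l2norm lborel (\<lambda>x. conv (mollifier (2 / (c * (\<delta> / 4))) ((\<delta> / 4) *\<^sub>R e p)) (\<lambda>x. \<theta> p x * v x) x - \<theta> p x * v x)
      \<le> \<delta> * sqrt ((8 / c) ^ DIM('a) * B / \<gamma>1 (1/2) * (2 + 2 * L\<^sup>2 * real DIM('a)) * energy_sq)"
    unfolding a_def[symmetric]
    by (rule power2_le_imp_le) (use \<delta> partition_facts(2) B0 kernel_profile(4)[OF K] in simp)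
qed

text \<open>The derivative of a mollifier has total mass 0, so \<open>conv_approx_energy\<close>
  subtracts nothing and bounds the gradient itself by the energy.\<close>

lemma smooth_op_gradient:
  assumes b: "b \<in> Basis" and B: "\<And>x::'a. \<bar>pd b bump x\<bar> \<le> B"
    and N: "(\<integral>\<^sup>+x. ennreal \<bar>pd b bump (x::'a)\<bar> \<partial>lborel) \<le> ennreal N" "0 \<le> N"
  shows "l2norm lborel (pd b (smooth_op P e c \<theta> (\<delta> / 4) v))
    \<le> real (card P) * sqrt ((8 / c) ^ (DIM('a) + 2) * N * B / \<gamma>1 (1/2) * (2 + 2 * L\<^sup>2 * real DIM('a)) * energy_sq)"
proof -
  have t: "0 < \<delta> / 4" using \<delta> by simp
  define a where "a = 2 / (c * (\<delta> / 4))"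
  have a8: "a = 8 / (c * \<delta>)" by (simp add: a_def)
  have a: "0 < a" using \<delta> partition_facts(2) by (simp add: a8)
  have B0: "0 \<le> B" using B[of 0] by linarith
  define m where "m = a ^ (DIM('a) + 1) * B * \<delta> ^ (DIM('a) + 2) / \<gamma>1 (1/2)"
  have m0: "0 \<le> m" using a B0 \<delta> kernel_profile(4)[OF K] by (simp add: m_def)
  \<comment> \<open>The L1 norm of the derivative is of order 1/\<delta> and \<open>m\<close> is of
    order \<delta>; the product is free of \<delta>, so the gradient bound is uniform in the
    horizon.\<close>
  have m_eq: "a * N * m = (8 / c) ^ (DIM('a) + 2) * N * B / \<gamma>1 (1/2)"
    using \<delta> partition_facts(2) by (simp add: m_def a8 power_divide power_mult_distrib power_add power2_eq_square mult_ac)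
  define \<eta> where "\<eta> p = mollifier a ((\<delta> / 4) *\<^sub>R e p)" for p
  define f where "f p = conv (pd b (\<eta> p)) (\<lambda>x. \<theta> p x * v x)" for p
  have \<eta>: "\<eta> p \<in> test_functions UNIV" for p unfolding \<eta>_def by (rule mollifier(1)[OF a])
  note d\<eta> = test_functions_pd[OF \<eta> b]
  have f: "sqint lborel (f p)" "l2norm lborel (f p) \<le> sqrt ((8 / c) ^ (DIM('a) + 2) * N * B / \<gamma>1 (1/2) * (2 + 2 * L\<^sup>2 * real DIM('a)) * energy_sq)"
    if p: "p \<in> P" for p
  proof -
    have le: "\<bar>pd b (\<eta> p) k\<bar> \<le> m * ker \<gamma>1 \<delta> k" if k: "k \<noteq> 0" for k
      unfolding m_def
    proof (rule mollifier_le_kernel[OF p refl k])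
      show "\<bar>pd b (\<eta> p) k\<bar> \<le> a ^ (DIM('a) + 1) * B"
        unfolding \<eta>_def mollifier(6)[OF a] abs_mult using B a by (simp add: mult_left_mono)
      show "norm k < 2 * (\<delta> / 4)" if nz: "pd b (\<eta> p) k \<noteq> 0"
      proof (rule ccontr)
        assume "\<not> norm k < 2 * (\<delta> / 4)"
        then have nk: "\<delta> / 2 \<le> norm k" by simp
        \<comment> \<open>The radius is \<open>c * \<delta> / 8\<close>, which leaves room: the
          rescaled point is strictly outside the unit ball, where the bump vanishes on a
          neighbourhood and its derivative is 0.\<close>
        have ct: "1 / a < \<delta> / 4" using \<delta> partition_facts(2,3) by (simp add: a8 field_simps)
        have "norm ((\<delta> / 4) *\<^sub>R e p) = \<delta> / 4" using partition_facts(5)[OF p] \<delta> by simp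
        then have "1 / a < norm (k - (\<delta> / 4) *\<^sub>R e p)"
          using nk ct norm_triangle_ineq2[of k "(\<delta> / 4) *\<^sub>R e p"] by linarith
        then have "1 \<le> a * norm (k - (\<delta> / 4) *\<^sub>R e p)" "1 < a * norm (k - (\<delta> / 4) *\<^sub>R e p)"
          using a by (simp_all add: field_simps)
        then have n1: "1 < norm (a *\<^sub>R (k - (\<delta> / 4) *\<^sub>R e p))" using a by (simp only: norm_scaleR abs_of_pos)
        have "(bump has_derivative (\<lambda>h. 0)) (at (a *\<^sub>R (k - (\<delta> / 4) *\<^sub>R e p)))"
        proof (rule has_derivative_transform_within_open[of "\<lambda>x. 0" _ _ UNIV "- cball 0 1"])
          show "((\<lambda>x. 0) has_derivative (\<lambda>h. 0)) (at (a *\<^sub>R (k - (\<delta> / 4) *\<^sub>R e p)))" by simp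
          show "a *\<^sub>R (k - (\<delta> / 4) *\<^sub>R e p) \<in> - cball 0 1" using n1 by simp
          fix x :: 'a assume "x \<in> - cball 0 1"
          then show "0 = bump x" using bump(3)[of x] by simp
        qed (simp add: open_Compl)
        then have "pd b bump (a *\<^sub>R (k - (\<delta> / 4) *\<^sub>R e p)) = 0" by (rule pd_eq)
        then show False using nz unfolding \<eta>_def mollifier(6)[OF a] by simp
      qed
    qed (use a B0 in simp)
    have "(\<integral>\<^sup>+k. ennreal \<bar>pd b (\<eta> p) k\<bar> \<partial>lborel) = (\<integral>\<^sup>+k. ennreal \<bar>a ^ DIM('a) * (a * pd b bump (a *\<^sub>R (k - (\<delta> / 4) *\<^sub>R e p)))\<bar> \<partial>lborel)"
      unfolding \<eta>_def mollifier(6)[OF a] by (simp add: mult_ac)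
    also have "\<dots> = (\<integral>\<^sup>+k. ennreal \<bar>a * pd b bump (k::'a)\<bar> \<partial>lborel)"
      by (rule nn_integral_rescale[OF _ a, of "\<lambda>k. a * pd b bump k"])
        (use test_functionsD(4)[OF test_functions_pd[OF bump(1) b]] in measurable)
    also have "\<dots> = (\<integral>\<^sup>+k. ennreal a * ennreal \<bar>pd b bump (k::'a)\<bar> \<partial>lborel)"
      using a by (intro nn_integral_cong) (simp add: abs_mult ennreal_mult)
    also have "\<dots> = ennreal a * (\<integral>\<^sup>+k. ennreal \<bar>pd b bump (k::'a)\<bar> \<partial>lborel)"
      by (rule nn_integral_cmult) (use test_functionsD(4)[OF test_functions_pd[OF bump(1) b]] in measurable)
    also have "\<dots> \<le> ennreal a * ennreal N" by (rule mult_left_mono[OF N(1)]) simp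
    also have "\<dots> = ennreal (a * N)" using a N(2) by (intro ennreal_mult[symmetric]) auto
    finally have N': "(\<integral>\<^sup>+k. ennreal \<bar>pd b (\<eta> p) k\<bar> \<partial>lborel) \<le> ennreal (a * N)" .
    have aN: "0 \<le> a * N" using a N(2) by simp
    note ca = conv_approx_energy[OF K \<delta> d\<eta> N' aN le m0 piece_sqint(1)[OF p] piece_energy(1)[OF p],
        unfolded integral_pd_eq_0[OF \<eta> b] mult_zero_left diff_0_right, folded f_def]
    show "sqint lborel (f p)" using ca(1) by (simp add: f_def)
    have "(l2norm lborel (f p))\<^sup>2 \<le> a * N * m * (Sn \<gamma>1 \<delta> (\<lambda>x. \<theta> p x * v x))\<^sup>2" using ca(2) by (simp add: f_def)
    also have "\<dots> \<le> a * N * m * ((2 + 2 * L\<^sup>2 * real DIM('a)) * energy_sq)"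
      by (rule mult_left_mono[OF piece_energy(2)[OF p]]) (use m0 aN in simp)
    also have "\<dots> = (8 / c) ^ (DIM('a) + 2) * N * B / \<gamma>1 (1/2) * (2 + 2 * L\<^sup>2 * real DIM('a)) * energy_sq"
      unfolding m_eq by (simp only: mult.assoc)
    finally show "l2norm lborel (f p) \<le> sqrt ((8 / c) ^ (DIM('a) + 2) * N * B / \<gamma>1 (1/2) * (2 + 2 * L\<^sup>2 * real DIM('a)) * energy_sq)"
      by (rule real_le_rsqrt)
  qed
  have "pd b (smooth_op P e c \<theta> (\<delta> / 4) v) x = (\<Sum>p\<in>P. f p x)" for x
  proof -
    have "conv (\<eta> p) (\<lambda>x. \<theta> p x * v x) differentiable (at x)" if p: "p \<in> P" for p
      using Ck_conv[OF \<eta> piece_sqint[OF p], of "Suc 0" p] by simp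
    from pd_sum[OF this, of P "\<lambda>p. p" b]
    have "pd b (\<lambda>x. \<Sum>p\<in>P. conv (\<eta> p) (\<lambda>x. \<theta> p x * v x) x) x = (\<Sum>p\<in>P. pd b (conv (\<eta> p) (\<lambda>x. \<theta> p x * v x)) x)" by simp
    also have "\<dots> = (\<Sum>p\<in>P. f p x)"
      unfolding f_def by (rule sum.cong[OF refl], rule fun_cong[OF pd_conv[OF \<eta> piece_sqint b]])
    finally show ?thesis by (simp add: smooth_op_def[abs_def] \<eta>_def a_def)
  qed
  then have eq: "pd b (smooth_op P e c \<theta> (\<delta> / 4) v) = (\<lambda>x. \<Sum>p\<in>P. f p x)" by (rule ext)
  have "l2norm lborel (pd b (smooth_op P e c \<theta> (\<delta> / 4) v)) = l2norm lborel (\<lambda>x. \<Sum>p\<in>P. f p x)" by (simp only: eq)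
  also have "\<dots> \<le> (\<Sum>p\<in>P. l2norm lborel (f p))" by (rule sqint_sum(2)[OF partition_facts(1) f(1)])
  also have "\<dots> \<le> (\<Sum>p\<in>P. sqrt ((8 / c) ^ (DIM('a) + 2) * N * B / \<gamma>1 (1/2) * (2 + 2 * L\<^sup>2 * real DIM('a)) * energy_sq))"
    by (rule sum_mono[OF f(2)])
  finally show ?thesis by simp
qed

end

end

end

section \<open>Borel representatives\<close>

lemma AE_lebesgue_on:
  assumes "D \<in> sets borel"
  shows "(AE x in lebesgue_on D. Q x) \<longleftrightarrow> (AE x in lborel. x \<in> D \<longrightarrow> Q x)"
proof -
  have "D \<inter> space lebesgue \<in> sets lebesgue" using assms by simp
  from AE_restrict_space_iff[OF this] show ?thesis unfolding AE_completion_iff .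
qed

text \<open>Function spaces and forms are stated over \<open>lebesgue_on\<close>, while translation
  and Fubini arguments are run with Borel functions on \<open>lborel\<close>. The passage works by
  almost everywhere equality on \<open>D\<close> with a Borel function that vanishes
  outside.\<close>

lemma lebesgue_on_eq_lborel:
  fixes F f :: "'a::euclidean_space \<Rightarrow> real"
  assumes D: "D \<in> sets borel" and f: "f \<in> borel_measurable borel" and f0: "\<And>x. x \<notin> D \<Longrightarrow> f x = 0"
    and ae: "AE x in lborel. x \<in> D \<longrightarrow> F x = f x"
  shows "F \<in> borel_measurable (lebesgue_on D)" "(LINT x|lebesgue_on D. F x) = (LINT x|lborel. f x)"
    "integrable (lebesgue_on D) F \<longleftrightarrow> integrable lborel f"
proof -
  define F1 where "F1 x = (if x \<in> D then F x else 0)" for x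
  have fb: "f \<in> borel_measurable lborel" using f by simp
  note fl = fb measurable_completion[OF fb]
  have "AE x in lborel. f x = F1 x" using ae by eventually_elim (auto simp: F1_def f0)
  then have ae1: "AE x in lebesgue. f x = F1 x" by (rule AE_completion)
  then have F1: "F1 \<in> borel_measurable lebesgue" by (rule borel_measurable_AE[OF fl(2)])
  then show "F \<in> borel_measurable (lebesgue_on D)"
    unfolding F1_def[abs_def] by (rule borel_measurable_if_D)
  have eq: "(\<lambda>x. indicator D x *\<^sub>R F x) = F1" by (auto simp: F1_def fun_eq_iff)
  have D': "D \<inter> space lebesgue \<in> sets lebesgue" using D by simp
  have ae2: "AE x in lebesgue. F1 x = f x" using ae1 by eventually_elim simp
  show "(LINT x|lebesgue_on D. F x) = (LINT x|lborel. f x)"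
    unfolding integral_restrict_space[OF D'] eq
    by (rule trans[OF integral_cong_AE[OF F1 fl(2) ae2] integral_completion[OF fl(1)]])
  show "integrable (lebesgue_on D) F \<longleftrightarrow> integrable lborel f"
    unfolding integrable_restrict_space[OF D'] eq
    using integrable_cong_AE[OF F1 fl(2) ae2] integrable_completion[OF fl(1)] by simp
qed

lemma nn_integral_lebesgue_on_eq_lborel:
  fixes F f :: "'a::euclidean_space \<Rightarrow> ennreal"
  assumes D: "D \<in> sets borel" and f0: "\<And>x. x \<notin> D \<Longrightarrow> f x = 0"
    and ae: "AE x in lborel. x \<in> D \<longrightarrow> F x = f x"
  shows "(\<integral>\<^sup>+x. F x \<partial>lebesgue_on D) = (\<integral>\<^sup>+x. f x \<partial>lborel)"
proof -
  have D': "D \<inter> space lebesgue \<in> sets lebesgue" using D by simp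
  have "AE x in lborel. F x * indicator D x = f x"
    using ae by eventually_elim (auto simp: f0 indicator_def)
  then have "AE x in lebesgue. F x * indicator D x = f x" by (rule AE_completion)
  then have "(\<integral>\<^sup>+x. F x * indicator D x \<partial>lebesgue) = (\<integral>\<^sup>+x. f x \<partial>lebesgue)" by (rule nn_integral_cong_AE)
  then show ?thesis
    unfolding nn_integral_restrict_space[OF D'] by (simp only: nn_integral_completion)
qed

text \<open>The good representatives: Borel measurable and zero at every point outside the domain,
  so that increments can be formed on the whole space without exceptional sets.\<close>

definition L2_supported :: "'a::euclidean_space set \<Rightarrow> ('a \<Rightarrow> real) \<Rightarrow> bool" where
  "L2_supported \<Omega> v \<longleftrightarrow> sqint lborel v \<and> (\<forall>x. x \<notin> \<Omega> \<longrightarrow> v x = 0)"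

lemma L2_supportedD:
  assumes "L2_supported \<Omega> v"
  shows "sqint lborel v" "v \<in> borel_measurable borel" "\<And>x. x \<notin> \<Omega> \<Longrightarrow> v x = 0"
  using assms sqint_measurable[of lborel v] by (auto simp: L2_supported_def)

lemma L2_supported_diff:
  assumes "L2_supported \<Omega> v" "L2_supported \<Omega> w"
  shows "L2_supported \<Omega> (\<lambda>x. v x - w x)"
  using assms sqint_diff(1) by (auto simp: L2_supported_def)

lemma L2_eq_sqint: "L2 D = {u. sqint (lebesgue_on D) u}"
  by (simp add: L2_def sqint_def)

lemma L2_norm_eq: "L2_norm D u = l2norm (lebesgue_on D) u"
  by (simp add: L2_norm_def l2norm_def)

lemma lebesgue_on_representative:
  fixes u :: "'a::euclidean_space \<Rightarrow> real"
  assumes D: "D \<in> sets borel" and u: "sqint (lebesgue_on D) u"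
  obtains v where "L2_supported D v" "AE x in lborel. x \<in> D \<longrightarrow> u x = v x"
proof -
  have "D \<in> sets lebesgue" using D by simp
  then have "(\<lambda>x. if x \<in> D then u x else 0) \<in> borel_measurable lebesgue"
    using borel_measurable_if_I[OF sqint_measurable[OF u]] by blast
  then obtain g where g: "g \<in> borel_measurable lborel" "AE x in lborel. (if x \<in> D then u x else 0) = g x"
    using completion_ex_borel_measurable_real by blast
  define v where "v x = (if x \<in> D then g x else 0)" for x
  have vm: "v \<in> borel_measurable borel" unfolding v_def[abs_def] using g(1) D by (intro measurable_If_set) auto
  have ae: "AE x in lborel. x \<in> D \<longrightarrow> u x = v x" using g(2) by eventually_elim (auto simp: v_def)
  have ae2: "AE x in lborel. x \<in> D \<longrightarrow> (norm (u x))\<^sup>2 = (norm (v x))\<^sup>2" using ae by eventually_elim auto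
  have vm2: "(\<lambda>x. (norm (v x))\<^sup>2) \<in> borel_measurable borel" using vm by measurable
  have "integrable lborel (\<lambda>x. (norm (v x))\<^sup>2)"
    using lebesgue_on_eq_lborel(3)[OF D vm2 _ ae2] u by (simp add: sqint_def v_def)
  then have "L2_supported D v" using vm by (simp add: L2_supported_def sqint_def v_def)
  then show ?thesis using that ae by blast
qed

lemma l2norm_lebesgue_on:
  fixes u v :: "'a::euclidean_space \<Rightarrow> real"
  assumes D: "D \<in> sets borel" and v: "L2_supported D v" and ae: "AE x in lborel. x \<in> D \<longrightarrow> u x = v x"
  shows "sqint (lebesgue_on D) u" "l2norm (lebesgue_on D) u = l2norm lborel v"
proof -
  note v' = L2_supportedD[OF v]
  have ae2: "AE x in lborel. x \<in> D \<longrightarrow> (norm (u x))\<^sup>2 = (norm (v x))\<^sup>2" using ae by eventually_elim auto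
  have vm2: "(\<lambda>x. (norm (v x))\<^sup>2) \<in> borel_measurable borel" using v'(2) by measurable
  have v0: "(norm (v x))\<^sup>2 = 0" if "x \<notin> D" for x using v'(3)[OF that] by simp
  show "sqint (lebesgue_on D) u"
    unfolding sqint_def using lebesgue_on_eq_lborel(1)[OF D v'(2) v'(3) ae] lebesgue_on_eq_lborel(3)[OF D vm2 v0 ae2] v'(1)
    by (simp add: sqint_def)
  show "l2norm (lebesgue_on D) u = l2norm lborel v"
    unfolding l2norm_def using lebesgue_on_eq_lborel(2)[OF D vm2 v0 ae2] by simp
qed

lemma L2_norm_supported:
  assumes "D \<in> sets borel" "L2_supported D v"
  shows "L2_norm D v = l2norm lborel v"
  unfolding L2_norm_eq by (rule l2norm_lebesgue_on(2)[OF assms]) simp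

lemma extended_domain_eq:
  fixes \<Omega> :: "'a::euclidean_space set"
  shows "extended_domain \<Omega> \<delta> = \<Omega> \<union> {x. infdist x (frontier \<Omega>) < \<delta>}"
  by (auto simp: extended_domain_def collar_def)

section \<open>The energy space over an open set\<close>

context
  fixes \<Omega> :: "'a::euclidean_space set"
  assumes \<Omega>: "open \<Omega>"
begin

lemma open_extended_domain: "open (extended_domain \<Omega> \<delta>)"
  unfolding extended_domain_eq
  by (intro open_Un \<Omega> open_Collect_less continuous_intros)

lemma extended_domain_borel: "extended_domain \<Omega> \<delta> \<in> sets borel" "collar \<Omega> \<delta> \<in> sets borel"
proof -
  show "extended_domain \<Omega> \<delta> \<in> sets borel" using open_extended_domain by (rule borel_open)
  have "collar \<Omega> \<delta> = {x. infdist x (frontier \<Omega>) < \<delta>} - \<Omega>" by (auto simp: collar_def)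
  moreover have "open {x. infdist x (frontier \<Omega>) < \<delta>}" by (intro open_Collect_less continuous_intros)
  ultimately show "collar \<Omega> \<delta> \<in> sets borel" using \<Omega> by (simp add: sets.Diff)
qed

text \<open>A segment from inside to outside crosses the frontier, and the crossing point is closer
  than \<delta>. Thus the collar contains every outside point that the kernel couples with the
  domain.\<close>

lemma near_in_extended_domain:
  assumes x: "x \<in> \<Omega>" and d: "norm (y - x) < \<delta>"
  shows "y \<in> extended_domain \<Omega> \<delta>"
proof (cases "y \<in> \<Omega>")
  case False
  have "closed_segment x y \<inter> frontier \<Omega> \<noteq> {}"
  proof (rule connected_Int_frontier)
    show "connected (closed_segment x y)" by simp
    show "closed_segment x y \<inter> \<Omega> \<noteq> {}" using x by auto
    show "closed_segment x y - \<Omega> \<noteq> {}" using False by auto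
  qed
  then obtain z where z: "z \<in> closed_segment x y" "z \<in> frontier \<Omega>" by blast
  have "infdist y (frontier \<Omega>) \<le> dist y z" by (rule infdist_le[OF z(2)])
  also have "\<dots> \<le> dist x y" using dist_in_closed_segment[OF z(1)] by (simp add: dist_commute)
  also have "\<dots> < \<delta>" using d by (simp add: dist_norm norm_minus_commute)
  finally show ?thesis by (simp add: extended_domain_eq)
qed (simp add: extended_domain_eq)

context
  fixes D0 s :: real and \<gamma>1 :: "real \<Rightarrow> real" and ty :: "'a itself" and \<delta> :: real
  assumes K: "kernel_conditions ty D0 s \<gamma>1" and \<delta>: "0 < \<delta>"
begin

text \<open>If two points are within the horizon and one is outside the extended domain, neither is
  in the domain, so both increments are 0. Hence the double integrals extend to the whole space
  unchanged.\<close>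

lemma kernel_vanishes_outside:
  assumes v: "L2_supported \<Omega> v" and w: "L2_supported \<Omega> w"
    and xy: "x \<notin> extended_domain \<Omega> \<delta> \<or> y \<notin> extended_domain \<Omega> \<delta>"
  shows "ker \<gamma>1 \<delta> (y - x) * ((v y - v x) * (w y - w x)) = 0"
proof (cases "norm (y - x) < \<delta>")
  case True
  then have "x \<notin> \<Omega>" "y \<notin> \<Omega>"
    using xy near_in_extended_domain[of x y \<delta>] near_in_extended_domain[of y x \<delta>]
    by (auto simp: norm_minus_commute extended_domain_eq)
  then show ?thesis using L2_supportedD(3)[OF v] by simp
next
  case False
  then show ?thesis using ker_eq_0[OF K \<delta>, of "y - x"] by simp
qed

text \<open>On the diagonal both sides are 0 because of the increments, whatever value the profile
  has at 0.\<close>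

lemma scaled_kernel_eq_ker:
  fixes v w :: "'a \<Rightarrow> real"
  shows "scaled_kernel DIM('a) \<gamma>1 \<delta> (norm (y - x)) * ((v y - v x) * (w y - w x)) = ker \<gamma>1 \<delta> (y - x) * ((v y - v x) * (w y - w x))"
  by (cases "x = y") (auto simp: ker_def)

text \<open>The integrand is already 0 off the extended domain, so both integrals run over the whole
  space; the substitution y = x + h and an exchange of integrals put the displacement
  outermost.\<close>

lemma energy_eq_En:
  assumes v: "L2_supported \<Omega> v"
  shows "energy \<Omega> \<gamma>1 \<delta> v = En \<gamma>1 \<delta> v"
proof -
  note [measurable] = L2_supportedD(2)[OF v] ker_measurable[OF K \<delta>]
  let ?D = "extended_domain \<Omega> \<delta>"
  let ?f = "\<lambda>x y. ennreal (ker \<gamma>1 \<delta> (y - x) * ((v y - v x) * (v y - v x)))"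
  have z: "?f x y = 0" if "x \<notin> ?D \<or> y \<notin> ?D" for x y
    unfolding kernel_vanishes_outside[OF v v that] by simp
  have 1: "(\<integral>\<^sup>+y. ennreal (scaled_kernel DIM('a) \<gamma>1 \<delta> (norm (y - x)) * (v y - v x)\<^sup>2) \<partial>lebesgue_on ?D) = (\<integral>\<^sup>+y. ?f x y \<partial>lborel)" for x
    by (rule nn_integral_lebesgue_on_eq_lborel[OF extended_domain_borel(1)])
      (use z in blast, simp add: power2_eq_square scaled_kernel_eq_ker)
  have "energy \<Omega> \<gamma>1 \<delta> v = (\<integral>\<^sup>+x. (\<integral>\<^sup>+y. ?f x y \<partial>lborel) \<partial>lborel)"
    unfolding energy_def 1
    by (rule nn_integral_lebesgue_on_eq_lborel[OF extended_domain_borel(1)]) (simp_all add: z)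
  also have "\<dots> = (\<integral>\<^sup>+x. (\<integral>\<^sup>+h. ?f x (h + x) \<partial>lborel) \<partial>lborel)"
    by (intro nn_integral_cong nn_integral_shift[symmetric]) measurable
  also have "\<dots> = (\<integral>\<^sup>+x. (\<integral>\<^sup>+h. ennreal (ker \<gamma>1 \<delta> h) * ennreal ((v (x + h) - v x)\<^sup>2) \<partial>lborel) \<partial>lborel)"
    using ker_nonneg[OF K \<delta>] by (intro nn_integral_cong) (simp add: ennreal_mult power2_eq_square add.commute)
  also have "\<dots> = (\<integral>\<^sup>+h. (\<integral>\<^sup>+x. ennreal (ker \<gamma>1 \<delta> h) * ennreal ((v (x + h) - v x)\<^sup>2) \<partial>lborel) \<partial>lborel)"
    by (rule lborel_pair.Fubini'[symmetric]) measurable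
  also have "\<dots> = En \<gamma>1 \<delta> v"
    unfolding En_def mod_sq_def by (intro nn_integral_cong nn_integral_cmult) measurable
  finally show ?thesis .
qed

lemma energy_cong:
  assumes "AE x in lebesgue_on (extended_domain \<Omega> \<delta>). u x = v x"
  shows "energy \<Omega> \<gamma>1 \<delta> u = energy \<Omega> \<gamma>1 \<delta> v"
  unfolding energy_def
proof (rule nn_integral_cong_AE)
  show "AE x in lebesgue_on (extended_domain \<Omega> \<delta>).
      (\<integral>\<^sup>+y. ennreal (scaled_kernel DIM('a) \<gamma>1 \<delta> (norm (y - x)) * (u y - u x)\<^sup>2) \<partial>lebesgue_on (extended_domain \<Omega> \<delta>)) =
      (\<integral>\<^sup>+y. ennreal (scaled_kernel DIM('a) \<gamma>1 \<delta> (norm (y - x)) * (v y - v x)\<^sup>2) \<partial>lebesgue_on (extended_domain \<Omega> \<delta>))"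
    using assms
  proof eventually_elim
    case (elim x)
    show ?case
    proof (rule nn_integral_cong_AE)
      show "AE y in lebesgue_on (extended_domain \<Omega> \<delta>).
          ennreal (scaled_kernel DIM('a) \<gamma>1 \<delta> (norm (y - x)) * (u y - u x)\<^sup>2) =
          ennreal (scaled_kernel DIM('a) \<gamma>1 \<delta> (norm (y - x)) * (v y - v x)\<^sup>2)"
        using assms by eventually_elim (simp add: elim)
    qed
  qed
qed

lemma S_norm_eq_Sn:
  assumes v: "L2_supported \<Omega> v"
  shows "S_norm \<Omega> \<gamma>1 \<delta> v = Sn \<gamma>1 \<delta> v"
proof -
  note [measurable] = L2_supportedD(2)[OF v]
  have "incr v \<in> borel_measurable (kmeas \<gamma>1 \<delta>)" by measurable
  from l2norm_enn2real[OF this] show ?thesis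
    unfolding S_norm_def energy_eq_En[OF v] nn_integral_incr[OF K \<delta> L2_supportedD(2)[OF v]] by simp
qed

lemma S_space_iff:
  assumes v: "L2_supported \<Omega> v"
  shows "v \<in> S_space \<Omega> \<gamma>1 \<delta> \<longleftrightarrow> En \<gamma>1 \<delta> v < \<infinity>"
proof -
  have "L2_supported (extended_domain \<Omega> \<delta>) v" using v by (auto simp: L2_supported_def extended_domain_eq)
  then have "v \<in> L2 (extended_domain \<Omega> \<delta>)"
    using l2norm_lebesgue_on(1)[OF extended_domain_borel(1), of \<delta> v v] by (simp add: L2_eq_sqint)
  moreover have "AE x in lebesgue_on (collar \<Omega> \<delta>). v x = 0"
    unfolding AE_lebesgue_on[OF extended_domain_borel(2)]
    by (rule AE_I2) (simp add: L2_supportedD(3)[OF v] collar_def)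
  ultimately show ?thesis by (simp add: S_space_def energy_eq_En[OF v])
qed

text \<open>The zero condition on the collar holds only almost everywhere; resetting a Borel version
  to 0 outside the domain changes a null set and makes the condition exact.\<close>

lemma S_space_representative:
  assumes u: "u \<in> S_space \<Omega> \<gamma>1 \<delta>"
  obtains v where "L2_supported \<Omega> v" "En \<gamma>1 \<delta> v < \<infinity>" "v \<in> S_space \<Omega> \<gamma>1 \<delta>"
    "AE x in lebesgue_on (extended_domain \<Omega> \<delta>). u x = v x"
proof -
  have "sqint (lebesgue_on (extended_domain \<Omega> \<delta>)) u" using u by (simp add: S_space_def L2_eq_sqint)
  then obtain v where v: "L2_supported (extended_domain \<Omega> \<delta>) v" "AE x in lborel. x \<in> extended_domain \<Omega> \<delta> \<longrightarrow> u x = v x"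
    using lebesgue_on_representative[OF extended_domain_borel(1)] by blast
  define w where "w x = (if x \<in> \<Omega> then v x else 0)" for x
  have "AE x in lebesgue_on (collar \<Omega> \<delta>). u x = 0" using u by (simp add: S_space_def)
  then have col: "AE x in lborel. x \<in> collar \<Omega> \<delta> \<longrightarrow> u x = 0" unfolding AE_lebesgue_on[OF extended_domain_borel(2)] .
  have vw: "AE x in lborel. v x = w x" using v(2) col
  proof eventually_elim
    case (elim x)
    then show ?case using L2_supportedD(3)[OF v(1), of x] by (auto simp: w_def extended_domain_def)
  qed
  have wm: "w \<in> borel_measurable lborel" unfolding w_def[abs_def] using L2_supportedD(2)[OF v(1)] \<Omega> by (intro measurable_If_set) auto
  have "sqint lborel w" by (rule sqint_cong_AE[OF L2_supportedD(1)[OF v(1)] wm vw])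
  then have w: "L2_supported \<Omega> w" by (simp add: L2_supported_def w_def)
  have ae: "AE x in lebesgue_on (extended_domain \<Omega> \<delta>). u x = w x"
    unfolding AE_lebesgue_on[OF extended_domain_borel(1)] using v(2) vw by eventually_elim auto
  have "En \<gamma>1 \<delta> w < \<infinity>"
    using u energy_cong[OF ae] energy_eq_En[OF w] by (simp add: S_space_def)
  then show ?thesis using that w ae S_space_iff[OF w] by blast
qed

end

end

text \<open>Measurability is not assumed: Lebesgue measure is complete, so it passes from one
  function to the other, and if both fail to be measurable both integrals take the default value 0.
  The inner integrals of \<open>T_form\<close> require this generality.\<close>

lemma integral_lebesgue_on_cong_AE:
  fixes F G :: "'a::euclidean_space \<Rightarrow> real"
  assumes D: "D \<in> sets borel" and ae: "AE x in lebesgue_on D. F x = G x"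
  shows "(LINT x|lebesgue_on D. F x) = (LINT x|lebesgue_on D. G x)"
proof (cases "F \<in> borel_measurable (lebesgue_on D)")
  case True
  have D': "D \<in> sets lebesgue" using D by simp
  have "AE x in lebesgue. x \<in> D \<longrightarrow> F x = G x" by (rule AE_completion[OF ae[unfolded AE_lebesgue_on[OF D]]])
  then have "AE x in lebesgue. (if x \<in> D then F x else 0) = (if x \<in> D then G x else 0)" by eventually_elim simp
  then have "(\<lambda>x. if x \<in> D then G x else 0) \<in> borel_measurable lebesgue"
    by (rule borel_measurable_AE[OF borel_measurable_if_I[OF True D']])
  then have "G \<in> borel_measurable (lebesgue_on D)" by (rule borel_measurable_if_D)
  then show ?thesis using True ae by (intro integral_cong_AE)
next
  case F: False
  have "G \<notin> borel_measurable (lebesgue_on D)"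
  proof
    assume G: "G \<in> borel_measurable (lebesgue_on D)"
    have D': "D \<in> sets lebesgue" using D by simp
    have "AE x in lebesgue. x \<in> D \<longrightarrow> F x = G x" by (rule AE_completion[OF ae[unfolded AE_lebesgue_on[OF D]]])
    then have "AE x in lebesgue. (if x \<in> D then G x else 0) = (if x \<in> D then F x else 0)" by eventually_elim simp
    then have "(\<lambda>x. if x \<in> D then F x else 0) \<in> borel_measurable lebesgue"
      by (rule borel_measurable_AE[OF borel_measurable_if_I[OF G D']])
    then show False using F borel_measurable_if_D by blast
  qed
  then show ?thesis using F by (metis borel_measurable_integrable not_integrable_integral_eq)
qed

lemma T_form_cong:
  fixes \<Omega> :: "'a::euclidean_space set"
  assumes \<Omega>: "open \<Omega>" and ae: "AE x in lebesgue_on (extended_domain \<Omega> \<delta>). u x = v x"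
    "AE x in lebesgue_on (extended_domain \<Omega> \<delta>). w x = z x"
  shows "T_form \<Omega> \<gamma>1 A \<delta> u w = T_form \<Omega> \<gamma>1 A \<delta> v z"
  unfolding T_form_def
proof (rule integral_lebesgue_on_cong_AE[OF extended_domain_borel(1)[OF \<Omega>]])
  show "AE x in lebesgue_on (extended_domain \<Omega> \<delta>).
    (LINT y|lebesgue_on (extended_domain \<Omega> \<delta>). A x y * scaled_kernel DIM('a) \<gamma>1 \<delta> (norm (x - y)) * (u y - u x) * (w y - w x)) =
    (LINT y|lebesgue_on (extended_domain \<Omega> \<delta>). A x y * scaled_kernel DIM('a) \<gamma>1 \<delta> (norm (x - y)) * (v y - v x) * (z y - z x))"
    using ae
  proof eventually_elim
    case (elim x)
    show ?case
    proof (rule integral_lebesgue_on_cong_AE[OF extended_domain_borel(1)[OF \<Omega>]])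
      show "AE y in lebesgue_on (extended_domain \<Omega> \<delta>).
        A x y * scaled_kernel DIM('a) \<gamma>1 \<delta> (norm (x - y)) * (u y - u x) * (w y - w x) =
        A x y * scaled_kernel DIM('a) \<gamma>1 \<delta> (norm (x - y)) * (v y - v x) * (z y - z x)"
        using ae by eventually_elim (simp add: elim)
    qed
  qed
qed

text \<open>The coefficient is only Lebesgue measurable on the product, while the exchange of
  integrals is done with a Borel version. That version must keep the bounds and survive the change
  to the coordinates of base point and displacement.\<close>

lemma T_form_eq:
  fixes \<Omega> :: "'a::euclidean_space set" and ty :: "'a itself"
  assumes \<Omega>: "open \<Omega>" "\<Omega> \<noteq> {}" and K: "kernel_conditions ty D0 s \<gamma>1" and \<delta>: "0 < \<delta>"
    and A: "coefficient_conditions \<Omega> r R A \<delta>"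
  obtains B where "B \<in> borel_measurable (borel \<Otimes>\<^sub>M borel)" "\<And>p. r \<le> B p" "\<And>p. B p \<le> R"
    "AE p in kmeas \<gamma>1 \<delta>. fst p \<in> extended_domain \<Omega> \<delta> \<longrightarrow> fst p + snd p \<in> extended_domain \<Omega> \<delta> \<longrightarrow> B p = A (fst p) (fst p + snd p)"
    "\<And>v w. L2_supported \<Omega> v \<Longrightarrow> L2_supported \<Omega> w \<Longrightarrow> En \<gamma>1 \<delta> v < \<infinity> \<Longrightarrow> En \<gamma>1 \<delta> w < \<infinity> \<Longrightarrow>
      T_form \<Omega> \<gamma>1 A \<delta> v w = (LINT p|kmeas \<gamma>1 \<delta>. B p * (incr v p * incr w p))"
proof -
  let ?D = "extended_domain \<Omega> \<delta>"
  have D[measurable]: "?D \<in> sets borel" by (rule extended_domain_borel(1)[OF \<Omega>(1)])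
  note kb[measurable] = ker_measurable[OF K \<delta>]
  have AB: "r \<le> A x y" "A x y \<le> R" if "x \<in> ?D" "y \<in> ?D" for x y
    using A that unfolding coefficient_conditions_def by blast+
  have rR: "r \<le> R"
  proof -
    obtain x where "x \<in> \<Omega>" using \<Omega>(2) by blast
    then have "x \<in> ?D" by (simp add: extended_domain_eq)
    then show ?thesis using AB[of x x] by simp
  qed
  have "(\<lambda>(x, y). A x y) \<in> borel_measurable (lebesgue_on (?D \<times> ?D))"
    using A by (simp add: coefficient_conditions_def Linf_def)
  moreover have DD: "?D \<times> ?D \<in> sets lebesgue"
    using open_Times[OF open_extended_domain[OF \<Omega>(1)] open_extended_domain[OF \<Omega>(1)]] by (simp add: borel_open)
  ultimately have "(\<lambda>p. if p \<in> ?D \<times> ?D then (\<lambda>(x, y). A x y) p else 0) \<in> borel_measurable lebesgue"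
    by (rule borel_measurable_if_I)
  then obtain A' where A': "A' \<in> borel_measurable lborel"
    "AE p in lborel. (if p \<in> ?D \<times> ?D then (\<lambda>(x, y). A x y) p else 0) = A' p"
    using completion_ex_borel_measurable_real by blast
  obtain N where N: "{p \<in> space lborel. \<not> ((if p \<in> ?D \<times> ?D then (\<lambda>(x, y). A x y) p else 0) = A' p)} \<subseteq> N"
    "emeasure lborel N = 0" "N \<in> sets lborel"
    using A'(2) by (rule AE_E)
  have A'm[measurable]: "A' \<in> borel_measurable (borel \<Otimes>\<^sub>M borel)" using A'(1) by (simp add: borel_prod)
  have Nm[measurable]: "N \<in> sets (borel \<Otimes>\<^sub>M borel)" using N(3) by (simp only: sets_lborel borel_prod)
  have N0: "emeasure (lborel \<Otimes>\<^sub>M lborel) N = 0" using N(2) by (simp add: lborel_prod)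
  \<comment> \<open>Clamping makes the bounds hold at every point rather than off a null set, and
    changes nothing where the version already equals \<open>A\<close>.\<close>
  define A2 where "A2 p = max r (min R (A' p))" for p
  have A2[measurable]: "A2 \<in> borel_measurable (borel \<Otimes>\<^sub>M borel)" unfolding A2_def by measurable
  have A2b: "r \<le> A2 p" "A2 p \<le> R" for p using rR by (auto simp: A2_def)
  have A2eq: "A2 (x, y) = A x y" if "x \<in> ?D" "y \<in> ?D" "(x, y) \<notin> N" for x y
  proof -
    have "(x, y) \<notin> {p \<in> space lborel. \<not> ((if p \<in> ?D \<times> ?D then (\<lambda>(x, y). A x y) p else 0) = A' p)}"
      using N(1) that(3) by blast
    then have "A' (x, y) = A x y" using that(1,2) by simp
    then show ?thesis using AB[OF that(1,2)] by (simp add: A2_def)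
  qed
  define B where "B p = A2 (fst p, fst p + snd p)" for p
  have B[measurable]: "B \<in> borel_measurable (borel \<Otimes>\<^sub>M borel)" unfolding B_def by measurable
  have aeN: "AE x in lborel. AE y in lborel. (x, y) \<notin> N"
  proof -
    have "AE p in lborel \<Otimes>\<^sub>M lborel. p \<notin> N"
      using N0 Nm by (intro AE_not_in null_setsI) simp_all
    then show ?thesis by (rule lborel_pair.AE_pair)
  qed
  \<comment> \<open>The exceptional set is given in the coordinates (x, y). For almost every x its
    slice is null, and translation carries that slice to the displacements y - x.\<close>
  have aeN2: "AE p in lborel \<Otimes>\<^sub>M lborel. (fst p, fst p + snd p) \<notin> N"
  proof (rule lborel_pair.AE_pair_measure)
    show "{p \<in> space (lborel \<Otimes>\<^sub>M lborel). (fst p, fst p + snd p) \<notin> N} \<in> sets (lborel \<Otimes>\<^sub>M lborel)"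
      by measurable
    show "AE x in lborel. AE h in lborel. (fst (x, h), fst (x, h) + snd (x, h)) \<notin> N"
      using aeN
    proof eventually_elim
      case (elim x)
      have "AE y in distr lborel borel ((+) x). (x, y) \<notin> N" unfolding lborel_distr_plus by (rule elim)
      then show ?case by (subst (asm) AE_distr_iff) auto
    qed
  qed
  show ?thesis
  proof (rule that[OF B])
    show "r \<le> B p" "B p \<le> R" for p using A2b by (auto simp: B_def)
    show "AE p in kmeas \<gamma>1 \<delta>. fst p \<in> ?D \<longrightarrow> fst p + snd p \<in> ?D \<longrightarrow> B p = A (fst p) (fst p + snd p)"
    proof -
      have "AE p in lborel \<Otimes>\<^sub>M lborel. 0 < ennreal (ker \<gamma>1 \<delta> (snd p)) \<longrightarrow>
          fst p \<in> ?D \<longrightarrow> fst p + snd p \<in> ?D \<longrightarrow> B p = A (fst p) (fst p + snd p)"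
        using aeN2 by eventually_elim (simp add: B_def A2eq)
      then show ?thesis unfolding kmeas_def by (subst AE_density) measurable
    qed
    fix v w assume v: "L2_supported \<Omega> v" and w: "L2_supported \<Omega> w" and fv: "En \<gamma>1 \<delta> v < \<infinity>" and fw: "En \<gamma>1 \<delta> w < \<infinity>"
    note vb[measurable] = L2_supportedD(2)[OF v] and wb[measurable] = L2_supportedD(2)[OF w]
    let ?f = "\<lambda>x y. A2 (x, y) * (ker \<gamma>1 \<delta> (y - x) * ((v y - v x) * (w y - w x)))"
    have z: "?f x y = 0" if "x \<notin> ?D \<or> y \<notin> ?D" for x y
      using kernel_vanishes_outside[OF \<Omega>(1) K \<delta> v w that] by simp
    have pm: "(\<lambda>p. B p * (ker \<gamma>1 \<delta> (snd p) * (incr v p * incr w p))) \<in> borel_measurable (borel \<Otimes>\<^sub>M borel)" by measurable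
    have inner: "AE x in lborel. x \<in> ?D \<longrightarrow>
      (LINT y|lebesgue_on ?D. A x y * scaled_kernel DIM('a) \<gamma>1 \<delta> (norm (x - y)) * (v y - v x) * (w y - w x))
       = (LINT h|lborel. B (x, h) * (ker \<gamma>1 \<delta> h * (incr v (x, h) * incr w (x, h))))"
      using aeN
    proof eventually_elim
      case (elim x)
      show ?case
      proof
        assume x: "x \<in> ?D"
        have fm: "?f x \<in> borel_measurable borel" by measurable
        have "(LINT y|lebesgue_on ?D. A x y * scaled_kernel DIM('a) \<gamma>1 \<delta> (norm (x - y)) * (v y - v x) * (w y - w x)) = (LINT y|lborel. ?f x y)"
        proof (rule lebesgue_on_eq_lborel(2)[OF D fm])
          show "?f x y = 0" if "y \<notin> ?D" for y using z that by blast
          show "AE y in lborel. y \<in> ?D \<longrightarrow> A x y * scaled_kernel DIM('a) \<gamma>1 \<delta> (norm (x - y)) * (v y - v x) * (w y - w x) = ?f x y"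
            using elim
          proof eventually_elim
            case (elim y)
            have "A x y * scaled_kernel DIM('a) \<gamma>1 \<delta> (norm (x - y)) * (v y - v x) * (w y - w x)
                = A x y * (scaled_kernel DIM('a) \<gamma>1 \<delta> (norm (y - x)) * ((v y - v x) * (w y - w x)))"
              by (simp only: norm_minus_commute mult.assoc)
            also have "\<dots> = A x y * (ker \<gamma>1 \<delta> (y - x) * ((v y - v x) * (w y - w x)))"
              by (simp only: scaled_kernel_eq_ker[OF \<Omega>(1) K \<delta>])
            finally show ?case using A2eq[OF x _ elim] by simp
          qed
        qed
        also have "\<dots> = (LINT h|lborel. ?f x (h + x))"
          by (rule lborel_shift(1)[OF fm, symmetric])
        finally show "(LINT y|lebesgue_on ?D. A x y * scaled_kernel DIM('a) \<gamma>1 \<delta> (norm (x - y)) * (v y - v x) * (w y - w x))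
          = (LINT h|lborel. B (x, h) * (ker \<gamma>1 \<delta> h * (incr v (x, h) * incr w (x, h))))"
          by (simp add: B_def incr_def add.commute)
      qed
    qed
    have z2: "(LINT h|lborel. B (x, h) * (ker \<gamma>1 \<delta> h * (incr v (x, h) * incr w (x, h)))) = 0" if "x \<notin> ?D" for x
    proof -
      have "B (x, h) * (ker \<gamma>1 \<delta> h * (incr v (x, h) * incr w (x, h))) = 0" for h
        using z[of x "x + h"] that by (simp add: B_def incr_def)
      then show ?thesis by (simp only: Bochner_Integration.integral_zero)
    qed
    have gm: "(\<lambda>x. LINT h|lborel. B (x, h) * (ker \<gamma>1 \<delta> h * (incr v (x, h) * incr w (x, h)))) \<in> borel_measurable borel"
      by measurable
    have "T_form \<Omega> \<gamma>1 A \<delta> v w = (LINT x|lborel. (LINT h|lborel. B (x, h) * (ker \<gamma>1 \<delta> h * (incr v (x, h) * incr w (x, h)))))"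
      unfolding T_form_def by (rule lebesgue_on_eq_lborel(2)[OF D gm z2 inner])
    also have "\<dots> = (LINT p|(lborel \<Otimes>\<^sub>M lborel). B p * (ker \<gamma>1 \<delta> (snd p) * (incr v p * incr w p)))"
    proof -
      have sv: "sqint (kmeas \<gamma>1 \<delta>) (incr v)" "sqint (kmeas \<gamma>1 \<delta>) (incr w)"
        using sqint_incr_iff[OF K \<delta> vb] sqint_incr_iff[OF K \<delta> wb] fv fw by auto
      have "integrable (kmeas \<gamma>1 \<delta>) (\<lambda>p. B p * (incr v p \<bullet> incr w p))"
      proof (rule integrable_coeff_inner[OF sv])
        show "B \<in> borel_measurable (kmeas \<gamma>1 \<delta>)" by measurable
        show "AE p in kmeas \<gamma>1 \<delta>. \<bar>B p\<bar> \<le> \<bar>r\<bar> + \<bar>R\<bar>"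
        proof (rule AE_I2)
          fix p show "\<bar>B p\<bar> \<le> \<bar>r\<bar> + \<bar>R\<bar>" using A2b[of "(fst p, fst p + snd p)"] by (simp add: B_def)
        qed
      qed
      then have "integrable (lborel \<Otimes>\<^sub>M lborel) (\<lambda>p. ker \<gamma>1 \<delta> (snd p) *\<^sub>R (B p * (incr v p \<bullet> incr w p)))"
        unfolding kmeas_def using ker_nonneg[OF K \<delta>] by (subst (asm) integrable_density) auto
      then have i: "integrable (lborel \<Otimes>\<^sub>M lborel) (\<lambda>p. B p * (ker \<gamma>1 \<delta> (snd p) * (incr v p * incr w p)))"
        by (simp add: mult_ac)
      show ?thesis using lborel_pair.integral_fst'[OF i] by simp
    qed
    also have "\<dots> = (LINT p|kmeas \<gamma>1 \<delta>. B p * (incr v p * incr w p))"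
    proof -
      have "(LINT p|kmeas \<gamma>1 \<delta>. B p * (incr v p * incr w p)) = (LINT p|(lborel \<Otimes>\<^sub>M lborel). ker \<gamma>1 \<delta> (snd p) *\<^sub>R (B p * (incr v p * incr w p)))"
        unfolding kmeas_def by (rule integral_density) (use ker_nonneg[OF K \<delta>] in auto)
      then show ?thesis by (simp add: mult_ac)
    qed
    finally show "T_form \<Omega> \<gamma>1 A \<delta> v w = (LINT p|kmeas \<gamma>1 \<delta>. B p * (incr v p * incr w p))" .
  qed
qed

section \<open>Consistency of the nonlocal form\<close>

context
  fixes D0 s :: real and \<gamma>1 :: "real \<Rightarrow> real" and ty :: "'a::euclidean_space itself"
  assumes K: "kernel_conditions ty D0 s \<gamma>1"
begin

lemma AE_kmeas_near:
  assumes \<delta>: "0 < \<delta>"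
  shows "AE p in kmeas \<gamma>1 \<delta>. norm (snd p :: 'a) < \<delta>"
proof -
  note [measurable] = ker_measurable[OF K \<delta>]
  have "AE p in (lborel \<Otimes>\<^sub>M lborel :: ('a \<times> 'a) measure). 0 < ennreal (ker \<gamma>1 \<delta> (snd p)) \<longrightarrow> norm (snd p) < \<delta>"
  proof (rule AE_I2, rule impI, rule ccontr)
    fix p :: "'a \<times> 'a" assume "0 < ennreal (ker \<gamma>1 \<delta> (snd p))" "\<not> norm (snd p) < \<delta>"
    then show False using ker_eq_0[OF K \<delta>, of "snd p"] by simp
  qed
  then show ?thesis unfolding kmeas_def by (subst AE_density) measurable
qed

text \<open>The displacement contributes the second moment of the kernel and the base point the L2
  norm of \<open>F\<close>; both factors are finite.\<close>

lemma sqint_linear_increment: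
  fixes F :: "'a \<Rightarrow> real"
  assumes \<delta>: "0 < \<delta>" and F: "sqint lborel F" and b: "b \<in> Basis"
  shows "sqint (kmeas \<gamma>1 \<delta>) (\<lambda>p. (snd p \<bullet> b) * F (fst p))"
proof -
  have [measurable]: "F \<in> borel_measurable borel" using sqint_measurable[OF F] by simp
  note [measurable] = ker_measurable[OF K \<delta>]
  have "(\<integral>\<^sup>+p. ennreal ((norm ((snd p \<bullet> b) * F (fst p)))\<^sup>2) \<partial>kmeas \<gamma>1 \<delta>)
      = (\<integral>\<^sup>+h. ennreal (ker \<gamma>1 \<delta> h) * (\<integral>\<^sup>+x. ennreal ((norm ((snd (x, h) \<bullet> b) * F (fst (x, h))))\<^sup>2) \<partial>lborel) \<partial>lborel)"
    by (rule nn_integral_kmeas[OF K \<delta>]) measurable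
  also have "\<dots> \<le> (\<integral>\<^sup>+h. ennreal (ker \<gamma>1 \<delta> h * (norm h)\<^sup>2) * ennreal ((l2norm lborel F)\<^sup>2) \<partial>(lborel :: 'a measure))"
  proof (rule nn_integral_mono)
    fix h :: 'a
    have "(\<integral>\<^sup>+x. ennreal ((norm ((snd (x, h) \<bullet> b) * F (fst (x, h))))\<^sup>2) \<partial>lborel)
        \<le> (\<integral>\<^sup>+x. ennreal ((norm h)\<^sup>2) * ennreal ((norm (F x))\<^sup>2) \<partial>lborel)"
    proof (rule nn_integral_mono)
      fix x
      have "(h \<bullet> b)\<^sup>2 \<le> (norm h)\<^sup>2"
        using Basis_le_norm[OF b, of h] abs_le_square_iff[of "h \<bullet> b" "norm h"] by simp
      then have "(h \<bullet> b)\<^sup>2 * (norm (F x))\<^sup>2 \<le> (norm h)\<^sup>2 * (norm (F x))\<^sup>2" by (rule mult_right_mono) simp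
      then have "(norm ((h \<bullet> b) * F x))\<^sup>2 \<le> (norm h)\<^sup>2 * (norm (F x))\<^sup>2"
        by (simp add: power_mult_distrib)
      then show "ennreal ((norm ((snd (x, h) \<bullet> b) * F (fst (x, h))))\<^sup>2) \<le> ennreal ((norm h)\<^sup>2) * ennreal ((norm (F x))\<^sup>2)"
        by (subst ennreal_mult[symmetric]) (auto intro!: ennreal_leI)
    qed
    also have "\<dots> = ennreal ((norm h)\<^sup>2) * ennreal ((l2norm lborel F)\<^sup>2)"
      unfolding nn_integral_l2norm[OF F, symmetric] by (rule nn_integral_cmult) measurable
    finally have "ennreal (ker \<gamma>1 \<delta> h) * (\<integral>\<^sup>+x. ennreal ((norm ((snd (x, h) \<bullet> b) * F (fst (x, h))))\<^sup>2) \<partial>lborel)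
        \<le> ennreal (ker \<gamma>1 \<delta> h) * (ennreal ((norm h)\<^sup>2) * ennreal ((l2norm lborel F)\<^sup>2))"
      by (rule mult_left_mono) simp
    also have "\<dots> = ennreal (ker \<gamma>1 \<delta> h * (norm h)\<^sup>2) * ennreal ((l2norm lborel F)\<^sup>2)"
      using ker_nonneg[OF K \<delta>, of h] by (simp add: ennreal_mult mult.assoc)
    finally show "ennreal (ker \<gamma>1 \<delta> h) * (\<integral>\<^sup>+x. ennreal ((norm ((snd (x, h) \<bullet> b) * F (fst (x, h))))\<^sup>2) \<partial>lborel)
        \<le> ennreal (ker \<gamma>1 \<delta> h * (norm h)\<^sup>2) * ennreal ((l2norm lborel F)\<^sup>2)" .
  qed
  also have "\<dots> = (\<integral>\<^sup>+h. ennreal (ker \<gamma>1 \<delta> h * (norm h)\<^sup>2) \<partial>(lborel :: 'a measure)) * ennreal ((l2norm lborel F)\<^sup>2)"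
    by (rule nn_integral_multc) measurable
  also have "\<dots> < \<infinity>" unfolding ker_second_moment(1)[OF K \<delta>] by (simp add: ennreal_mult_less_top)
  finally show ?thesis by (intro sqintI_nn) measurable
qed

lemma integral_kmeas:
  fixes f :: "'a \<times> 'a \<Rightarrow> real"
  assumes \<delta>: "0 < \<delta>" and f: "f \<in> borel_measurable (borel \<Otimes>\<^sub>M borel)" and i: "integrable (kmeas \<gamma>1 \<delta>) f"
  shows "integrable lborel (\<lambda>h. LINT x|lborel. ker \<gamma>1 \<delta> h * f (x, h))"
    "(LINT p|kmeas \<gamma>1 \<delta>. f p) = (LINT h|lborel. (LINT x|lborel. ker \<gamma>1 \<delta> h * f (x, h)))"
proof -
  note [measurable] = ker_measurable[OF K \<delta>] f
  have "integrable (lborel \<Otimes>\<^sub>M lborel) (\<lambda>p. ker \<gamma>1 \<delta> (snd p) *\<^sub>R f p)"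
    using i unfolding kmeas_def using ker_nonneg[OF K \<delta>] by (subst (asm) integrable_density) auto
  then have i2: "integrable (lborel \<Otimes>\<^sub>M lborel) (case_prod (\<lambda>x h. ker \<gamma>1 \<delta> h * f (x, h)))"
    by (simp add: case_prod_unfold)
  have "(LINT p|kmeas \<gamma>1 \<delta>. f p) = (LINT p|(lborel \<Otimes>\<^sub>M lborel). ker \<gamma>1 \<delta> (snd p) *\<^sub>R f p)"
    unfolding kmeas_def by (rule integral_density) (use ker_nonneg[OF K \<delta>] in auto)
  also have "\<dots> = (LINT h|lborel. (LINT x|lborel. ker \<gamma>1 \<delta> h * f (x, h)))"
    using lborel_pair.integral_snd[OF i2] by (simp add: case_prod_unfold)
  finally show "(LINT p|kmeas \<gamma>1 \<delta>. f p) = (LINT h|lborel. (LINT x|lborel. ker \<gamma>1 \<delta> h * f (x, h)))" .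
  show "integrable lborel (\<lambda>h. LINT x|lborel. ker \<gamma>1 \<delta> h * f (x, h))"
    by (rule lborel_pair.integrable_snd[OF i2])
qed

lemma bounded_by_indicator:
  fixes \<rho> v :: "'a \<Rightarrow> real"
  assumes v: "sqint lborel v" and \<rho>: "\<rho> \<in> borel_measurable borel" "\<And>x. \<bar>\<rho> x\<bar> \<le> C * indicator (cball 0 q) x" and C: "0 \<le> C"
  shows "\<bar>LINT x|lborel. \<rho> x * v x\<bar> \<le> C * (l2norm lborel (indicator (cball (0::'a) q) :: 'a \<Rightarrow> real) * l2norm lborel v)"
proof -
  let ?I = "indicator (cball (0::'a) q) :: 'a \<Rightarrow> real"
  have i: "integrable lborel ?I" by (rule integrable_real_indicator) (simp, rule emeasure_bounded_finite, simp)
  have "(\<lambda>x. (norm (?I x))\<^sup>2) = ?I" by (auto simp: indicator_def)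
  then have sI: "sqint lborel ?I" using i by (simp add: sqint_def borel_measurable_indicator)
  have "\<bar>LINT x|lborel. \<rho> x * v x\<bar> \<le> (LINT x|lborel. C * (norm (?I x) * norm (v x)))"
  proof (rule order.trans[OF integral_abs_bound], rule integral_mono')
    show "integrable lborel (\<lambda>x. C * (norm (?I x) * norm (v x)))"
      using integrable_inner_sqint(1)[OF sI v] by simp
    fix x
    show "\<bar>\<rho> x * v x\<bar> \<le> C * (norm (?I x) * norm (v x))"
      using mult_right_mono[OF \<rho>(2)[of x], of "\<bar>v x\<bar>"] by (simp add: abs_mult mult.assoc)
    show "0 \<le> C * (norm (?I x) * norm (v x))" using C by simp
  qed
  also have "\<dots> \<le> C * (l2norm lborel ?I * l2norm lborel v)"
    using mult_left_mono[OF integral_norm_prod_le[OF sI v] C] by simp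
  finally show ?thesis .
qed

text \<open>
  Moving the increment from \<open>v\<close> to \<open>F\<close> and expanding \<open>F\<close> to first order, the second moments
  of the kernel produce a partial derivative.
\<close>

lemma linear_increment_form:
  fixes F :: "'a \<Rightarrow> real"
  assumes F: "F \<in> test_functions UNIV" and b: "b \<in> Basis"
  obtains C where "0 \<le> C" "\<And>\<delta> v. 0 < \<delta> \<Longrightarrow> \<delta> \<le> 1 \<Longrightarrow> sqint lborel v \<Longrightarrow> En \<gamma>1 \<delta> v < \<infinity> \<Longrightarrow>
    \<bar>(LINT p|kmeas \<gamma>1 \<delta>. ((snd p \<bullet> b) * F (fst p)) * incr v p) + (LINT x|lborel. pd b F x * v x)\<bar> \<le> C * \<delta> * l2norm lborel v"
proof -
  obtain C3 where C3: "0 < C3" "\<And>x h. \<bar>F (x + h) - F x - (\<Sum>c\<in>Basis. (h \<bullet> c) * pd c F x)\<bar> \<le> C3 * (norm h)\<^sup>2"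
    using test_functions_taylor[OF F] by blast
  obtain \<rho> where \<rho>: "0 < \<rho>" "\<And>x. \<rho> \<le> norm x \<Longrightarrow> F x = 0" using test_functions_ball[OF F] by blast
  have pd0: "pd c F x = 0" if "\<rho> < norm x" for c x
  proof -
    have "(F has_derivative (\<lambda>h. 0)) (at x)"
    proof (rule has_derivative_transform_within_open[of "\<lambda>x. 0" _ _ UNIV "- cball 0 \<rho>"])
      show "((\<lambda>x. 0) has_derivative (\<lambda>h. 0)) (at x)" by simp
      show "x \<in> - cball 0 \<rho>" using that by simp
      fix y :: 'a assume "y \<in> - cball 0 \<rho>"
      then show "0 = F y" using \<rho>(2)[of y] by simp
    qed (simp add: open_Compl)
    then show ?thesis by (rule pd_eq)
  qed
  \<comment> \<open>For displacements below 1 the Taylor remainder of \<open>F\<close> vanishes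
    outside radius \<open>\<rho> + 1\<close>, so one ball serves every horizon.\<close>
  define I where "I = l2norm lborel (indicator (cball (0::'a) (\<rho> + 1)) :: 'a \<Rightarrow> real)"
  have I: "0 \<le> I" by (simp add: I_def)
  note sF = test_functions_integrable(2)[OF F]
  have mF[measurable]: "F \<in> borel_measurable borel" by (rule test_functionsD(4)[OF F])
  note dF = test_functions_pd[OF F]
  note sdF = test_functions_integrable(2)[OF dF]
  have mdF: "pd c F \<in> borel_measurable borel" if "c \<in> Basis" for c by (rule test_functionsD(4)[OF dF[OF that]])
  show ?thesis
  proof (rule that[of "C3 * I * real DIM('a)"])
    show "0 \<le> C3 * I * real DIM('a)" using C3 I by simp
    fix \<delta> :: real and v :: "'a \<Rightarrow> real"
    assume \<delta>: "0 < \<delta>" "\<delta> \<le> 1" and v: "sqint lborel v" and fv: "En \<gamma>1 \<delta> v < \<infinity>"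
    have vm[measurable]: "v \<in> borel_measurable borel" using sqint_measurable[OF v] by simp
    note [measurable] = ker_measurable[OF K \<delta>(1)]
    have sv: "sqint (kmeas \<gamma>1 \<delta>) (incr v)" using sqint_incr_iff[OF K \<delta>(1) vm] fv by simp
    have iq: "integrable (kmeas \<gamma>1 \<delta>) (\<lambda>p. ((snd p \<bullet> b) * F (fst p)) * incr v p)"
      using integrable_inner_sqint(2)[OF sqint_linear_increment[OF \<delta>(1) sF b] sv] by simp
    have mq: "(\<lambda>p. ((snd p \<bullet> b) * F (fst p)) * incr v p) \<in> borel_measurable (borel \<Otimes>\<^sub>M borel)" by measurable
    define m where "m c = (LINT x|lborel. pd c F x * v x)" for c
    \<comment> \<open>The expansion is at \<open>- h\<close>, because moving the increment off
      \<open>v\<close> reverses the displacement; this is the source of the minus sign in the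
      limit.\<close>
    define rem where "rem h x = F (x + - h) - F x - (\<Sum>c\<in>Basis. (- h \<bullet> c) * pd c F x)" for h x
    have im: "integrable lborel (\<lambda>x. pd c F x * v x)" if "c \<in> Basis" for c
      using integrable_inner_sqint(2)[OF sdF[OF that] v] by simp
    have iFh: "integrable lborel (\<lambda>x. F (x + h) * v x)" for h
      using integrable_inner_sqint(2)[OF sqint_shift(1)[OF sF] v] by simp
    have iFv: "integrable lborel (\<lambda>x. F x * v x)" using iFh[of 0] by simp
    have iFs: "integrable lborel (\<lambda>x. F x * v (x + h))" for h
      using integrable_inner_sqint(2)[OF sF sqint_shift(1)[OF v]] by simp
    have isum: "integrable lborel (\<lambda>x. \<Sum>c\<in>Basis. (- h \<bullet> c) * (pd c F x * v x))" for h
      by (rule Bochner_Integration.integrable_sum) (use im in simp)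
    have rem_eq: "rem h x * v x = F (x + - h) * v x - F x * v x - (\<Sum>c\<in>Basis. (- h \<bullet> c) * (pd c F x * v x))" for h x
      unfolding rem_def by (simp add: left_diff_distrib sum_distrib_right mult.assoc)
    have inner: "(LINT x|lborel. ker \<gamma>1 \<delta> h * (((snd (x, h) \<bullet> b) * F (fst (x, h))) * incr v (x, h)))
        = ker \<gamma>1 \<delta> h * (h \<bullet> b) * (LINT x|lborel. rem h x * v x) - (\<Sum>c\<in>Basis. m c * (ker \<gamma>1 \<delta> h * ((h \<bullet> b) * (h \<bullet> c))))" for h :: 'a
    proof -
      \<comment> \<open>Discrete integration by parts: the translation is exact, and
        \<open>v\<close> is never differentiated.\<close>
      have "(LINT x|lborel. F x * v (x + h)) = (LINT x|lborel. F (x + - h) * v x)"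
        using lborel_shift(1)[of "\<lambda>x. F (x + - h) * v x" h] by simp
      then have "(LINT x|lborel. F x * (v (x + h) - v x)) = (LINT x|lborel. F (x + - h) * v x) - (LINT x|lborel. F x * v x)"
        unfolding right_diff_distrib by (subst Bochner_Integration.integral_diff[OF iFs iFv]) simp
      also have "\<dots> = (LINT x|lborel. rem h x * v x) + (LINT x|lborel. (\<Sum>c\<in>Basis. (- h \<bullet> c) * (pd c F x * v x)))"
        unfolding rem_eq
        by (subst Bochner_Integration.integral_diff[OF Bochner_Integration.integrable_diff[OF iFh iFv] isum],
            subst Bochner_Integration.integral_diff[OF iFh iFv]) simp
      also have "(LINT x|lborel. (\<Sum>c\<in>Basis. (- h \<bullet> c) * (pd c F x * v x))) = (\<Sum>c\<in>Basis. (- h \<bullet> c) * m c)"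
        unfolding m_def by (subst Bochner_Integration.integral_sum) (use im in auto)
      finally have e: "(LINT x|lborel. F x * (v (x + h) - v x)) = (LINT x|lborel. rem h x * v x) + (\<Sum>c\<in>Basis. (- h \<bullet> c) * m c)" .
      have "(LINT x|lborel. ker \<gamma>1 \<delta> h * (((snd (x, h) \<bullet> b) * F (fst (x, h))) * incr v (x, h)))
          = (LINT x|lborel. (ker \<gamma>1 \<delta> h * (h \<bullet> b)) * (F x * (v (x + h) - v x)))"
        by (simp add: incr_def mult.assoc)
      also have "\<dots> = (ker \<gamma>1 \<delta> h * (h \<bullet> b)) * (LINT x|lborel. F x * (v (x + h) - v x))"
        by (rule integral_mult_right_zero)
      also have "\<dots> = ker \<gamma>1 \<delta> h * (h \<bullet> b) * (LINT x|lborel. rem h x * v x) + (\<Sum>c\<in>Basis. - (m c * (ker \<gamma>1 \<delta> h * ((h \<bullet> b) * (h \<bullet> c)))))"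
        unfolding e distrib_left sum_distrib_left
        by (intro arg_cong2[where f="(+)"] refl sum.cong) (simp_all add: mult_ac)
      finally show ?thesis by (simp add: sum_negf)
    qed
    have im2: "integrable lborel (\<lambda>h. \<Sum>c\<in>Basis. m c * (ker \<gamma>1 \<delta> h * ((h \<bullet> b) * (h \<bullet> c))))"
      by (rule Bochner_Integration.integrable_sum) (use ker_mixed_moments(1)[OF K \<delta>(1) b] in simp)
    \<comment> \<open>The second moments form the identity matrix, so only the partial derivative
      along \<open>b\<close> survives.\<close>
    have sm: "(LINT h|lborel. (\<Sum>c\<in>Basis. m c * (ker \<gamma>1 \<delta> h * ((h \<bullet> b) * (h \<bullet> c))))) = m b"
    proof -
      have "(LINT h|lborel. (\<Sum>c\<in>Basis. m c * (ker \<gamma>1 \<delta> h * ((h \<bullet> b) * (h \<bullet> c)))))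
          = (\<Sum>c\<in>Basis. (LINT h|lborel. m c * (ker \<gamma>1 \<delta> h * ((h \<bullet> b) * (h \<bullet> c)))))"
        by (rule Bochner_Integration.integral_sum) (use ker_mixed_moments(1)[OF K \<delta>(1) b] in simp)
      also have "\<dots> = (\<Sum>c\<in>Basis. if b = c then m c else 0)"
        by (rule sum.cong) (simp_all add: ker_mixed_moments(2)[OF K \<delta>(1) b])
      also have "\<dots> = m b" using b by (subst sum.delta') auto
      finally show ?thesis .
    qed
    have igi: "integrable lborel (\<lambda>h. ker \<gamma>1 \<delta> h * (h \<bullet> b) * (LINT x|lborel. rem h x * v x) - (\<Sum>c\<in>Basis. m c * (ker \<gamma>1 \<delta> h * ((h \<bullet> b) * (h \<bullet> c)))))"
      using integral_kmeas(1)[OF \<delta>(1) mq iq] unfolding inner .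
    \<comment> \<open>Obtained by adding two functions already known to be integrable, rather than
      by estimating the remainder.\<close>
    have irem: "integrable lborel (\<lambda>h. ker \<gamma>1 \<delta> h * (h \<bullet> b) * (LINT x|lborel. rem h x * v x))"
      using Bochner_Integration.integrable_add[OF igi im2] by simp
    have A: "(LINT p|kmeas \<gamma>1 \<delta>. ((snd p \<bullet> b) * F (fst p)) * incr v p) + m b
        = (LINT h|lborel. ker \<gamma>1 \<delta> h * (h \<bullet> b) * (LINT x|lborel. rem h x * v x))"
      unfolding integral_kmeas(2)[OF \<delta>(1) mq iq] inner Bochner_Integration.integral_diff[OF irem im2] sm by simp
    have "\<bar>LINT h|lborel. ker \<gamma>1 \<delta> h * (h \<bullet> b) * (LINT x|lborel. rem h x * v x)\<bar>
        \<le> (LINT h|lborel. (C3 * I * l2norm lborel v * \<delta>) * (ker \<gamma>1 \<delta> (h::'a) * (norm h)\<^sup>2))"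
    proof (rule order.trans[OF integral_abs_bound], rule integral_mono)
      show "integrable lborel (\<lambda>h. \<bar>ker \<gamma>1 \<delta> h * (h \<bullet> b) * (LINT x|lborel. rem h x * v x)\<bar>)" using irem by (rule integrable_abs)
      show "integrable lborel (\<lambda>h. (C3 * I * l2norm lborel v * \<delta>) * (ker \<gamma>1 \<delta> (h::'a) * (norm h)\<^sup>2))"
        using ker_second_moment(2)[OF K \<delta>(1)] by simp
      fix h :: 'a
      show "\<bar>ker \<gamma>1 \<delta> h * (h \<bullet> b) * (LINT x|lborel. rem h x * v x)\<bar> \<le> (C3 * I * l2norm lborel v * \<delta>) * (ker \<gamma>1 \<delta> h * (norm h)\<^sup>2)"
      proof (cases "norm h < \<delta>")
        case True
        have rb: "\<bar>rem h x\<bar> \<le> (C3 * (norm h)\<^sup>2) * indicator (cball 0 (\<rho> + 1)) x" for x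
        proof (cases "norm x \<le> \<rho> + 1")
          case True
          then show ?thesis using C3(2)[of x "- h"] by (simp add: rem_def)
        next
          case False
          have "norm x \<le> norm (x + - h) + norm h" using norm_triangle_ineq[of "x + - h" h] by simp
          then have "\<rho> \<le> norm (x + - h)" using False True \<delta>(2) \<open>norm h < \<delta>\<close> by linarith
          then have "F (x + - h) = 0" by (rule \<rho>(2))
          moreover have "F x = 0" using False by (intro \<rho>(2)) simp
          moreover have "pd c F x = 0" for c using False by (intro pd0) simp
          ultimately show ?thesis using C3(1) by (simp add: rem_def)
        qed
        have mrem: "rem h \<in> borel_measurable borel"
          unfolding rem_def[abs_def]
          by (intro borel_measurable_diff borel_measurable_sum borel_measurable_times borel_measurable_const mdF mF measurable_compose[OF _ mF]) measurable
        have "\<bar>LINT x|lborel. rem h x * v x\<bar> \<le> (C3 * (norm h)\<^sup>2) * (I * l2norm lborel v)"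
          unfolding I_def by (rule bounded_by_indicator[OF v mrem rb]) (use C3 in simp)
        moreover have "\<bar>h \<bullet> b\<bar> \<le> \<delta>" using Basis_le_norm[OF b, of h] True by linarith
        ultimately have "\<bar>ker \<gamma>1 \<delta> h\<bar> * \<bar>h \<bullet> b\<bar> * \<bar>LINT x|lborel. rem h x * v x\<bar> \<le> ker \<gamma>1 \<delta> h * \<delta> * ((C3 * (norm h)\<^sup>2) * (I * l2norm lborel v))"
          using ker_nonneg[OF K \<delta>(1), of h] \<delta> by (intro mult_mono) auto
        then show ?thesis unfolding abs_mult by (simp only: mult_ac)
      next
        case False
        then show ?thesis using ker_eq_0[OF K \<delta>(1), of h] by simp
      qed
    qed
    also have "\<dots> = C3 * I * real DIM('a) * \<delta> * l2norm lborel v"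
      unfolding integral_mult_right_zero ker_second_moment(3)[OF K \<delta>(1)] by (simp only: mult_ac)
    finally show "\<bar>(LINT p|kmeas \<gamma>1 \<delta>. ((snd p \<bullet> b) * F (fst p)) * incr v p) + (LINT x|lborel. pd b F x * v x)\<bar>
        \<le> C3 * I * real DIM('a) * \<delta> * l2norm lborel v"
      unfolding A[unfolded m_def] .
  qed
qed

text \<open>Since \<open>v\<close> has only finite energy, every derivative must fall on
  \<open>\<phi>\<close> and \<open>\<beta>\<close>. A first-order expansion of \<open>\<phi>\<close>
  reduces the form to \<open>linear_increment_form\<close> for the functions
  \<open>\<beta> x * pd b \<phi> x\<close>; the second-order remainder has weighted norm
  O(\<delta>).\<close>

lemma form_consistency:
  fixes \<phi> \<beta> :: "'a \<Rightarrow> real"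
  assumes \<phi>: "\<phi> \<in> test_functions UNIV" and \<beta>: "\<And>k. Ck k \<beta>" and \<rho>: "0 < \<rho>" "\<And>x. \<rho> \<le> norm x \<Longrightarrow> \<phi> x = 0"
  obtains C where "0 \<le> C" "\<And>\<delta> v. 0 < \<delta> \<Longrightarrow> \<delta> \<le> 1 \<Longrightarrow> sqint lborel v \<Longrightarrow> En \<gamma>1 \<delta> v < \<infinity> \<Longrightarrow>
    \<bar>(LINT p|kmeas \<gamma>1 \<delta>. (indicator (cball 0 (\<rho> + 1)) (fst p) * \<beta> (fst p)) * (incr \<phi> p * incr v p))
      + (LINT x|lborel. (\<Sum>b\<in>Basis. pd b (\<lambda>x. \<beta> x * pd b \<phi> x) x) * v x)\<bar> \<le> C * \<delta> * (Sn \<gamma>1 \<delta> v + l2norm lborel v)"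
proof -
  obtain C2 where C2: "0 < C2" "\<And>x h. \<bar>\<phi> (x + h) - \<phi> x - (\<Sum>c\<in>Basis. (h \<bullet> c) * pd c \<phi> x)\<bar> \<le> C2 * (norm h)\<^sup>2"
    using test_functions_taylor[OF \<phi>] by blast
  define U where "U = cball (0::'a) (\<rho> + 1)"
  have U[measurable]: "U \<in> sets borel" by (simp add: U_def)
  define V where "V = measure lborel U"
  have eU: "emeasure lborel U = ennreal V"
    unfolding V_def U_def using emeasure_bounded_finite[of "cball (0::'a) (\<rho> + 1)"] by (intro emeasure_eq_ennreal_measure) simp
  have V: "0 \<le> V" by (simp add: V_def)
  have pd0: "pd c \<phi> x = 0" if "\<rho> < norm x" for c x
  proof -
    have "(\<phi> has_derivative (\<lambda>h. 0)) (at x)"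
    proof (rule has_derivative_transform_within_open[of "\<lambda>x. 0" _ _ UNIV "- cball 0 \<rho>"])
      show "((\<lambda>x. 0) has_derivative (\<lambda>h. 0)) (at x)" by simp
      show "x \<in> - cball 0 \<rho>" using that by simp
      fix y :: 'a assume "y \<in> - cball 0 \<rho>"
      then show "0 = \<phi> y" using \<rho>(2)[of y] by simp
    qed (simp add: open_Compl)
    then show ?thesis by (rule pd_eq)
  qed
  have c\<beta>: "continuous_on UNIV \<beta>" by (rule Ck_continuous[OF \<beta>[of 0]])
  have m\<beta>[measurable]: "\<beta> \<in> borel_measurable borel" by (rule borel_measurable_continuous_onI[OF c\<beta>])
  have "bounded (\<beta> ` U)"
    unfolding U_def by (intro compact_imp_bounded compact_continuous_image continuous_on_subset[OF c\<beta>]) auto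
  then obtain Cb where Cb: "0 < Cb" "\<And>x. x \<in> U \<Longrightarrow> \<bar>\<beta> x\<bar> \<le> Cb" unfolding bounded_pos by auto
  \<comment> \<open>A smooth \<open>\<beta>\<close> may be unbounded on the whole space; on
    \<open>U\<close> it is bounded. At horizons below 1 a nonzero increment of \<open>\<phi>\<close>
    forces the base point into \<open>U\<close>.\<close>
  define \<beta>U where "\<beta>U x = indicator U x * \<beta> x" for x
  have \<beta>U: "\<bar>\<beta>U x\<bar> \<le> Cb" for x using Cb by (cases "x \<in> U") (auto simp: \<beta>U_def)
  have m\<beta>U[measurable]: "\<beta>U \<in> borel_measurable borel" unfolding \<beta>U_def[abs_def] by measurable
  define F where "F b x = \<beta> x * pd b \<phi> x" for b x
  have F: "F b \<in> test_functions UNIV" if "b \<in> Basis" for b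
    unfolding F_def[abs_def] by (rule test_functions_Ck_mult[OF test_functions_pd[OF \<phi> that] \<beta>])
  have FU: "F b x = \<beta>U x * pd b \<phi> x" for b x
    using pd0[of x b] by (cases "x \<in> U") (auto simp: F_def \<beta>U_def U_def)
  have m\<phi>[measurable]: "\<phi> \<in> borel_measurable borel" by (rule test_functionsD(4)[OF \<phi>])
  have md\<phi>[measurable]: "pd c \<phi> \<in> borel_measurable borel" if "c \<in> Basis" for c by (rule test_functionsD(4)[OF test_functions_pd[OF \<phi> that]])
  define Q where "Q b C \<longleftrightarrow> 0 \<le> C \<and> (\<forall>\<delta> v. 0 < \<delta> \<longrightarrow> \<delta> \<le> 1 \<longrightarrow> sqint lborel v \<longrightarrow> En \<gamma>1 \<delta> v < \<infinity> \<longrightarrow>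
    \<bar>(LINT p|kmeas \<gamma>1 \<delta>. ((snd p \<bullet> b) * F b (fst p)) * incr v p) + (LINT x|lborel. pd b (F b) x * v x)\<bar> \<le> C * \<delta> * l2norm lborel v)"
    for b C
  have "\<forall>b\<in>Basis. \<exists>C. Q b C"
  proof
    fix b :: 'a assume b: "b \<in> Basis"
    show "\<exists>C. Q b C"
    proof (rule linear_increment_form[OF F[OF b] b])
      fix C :: real
      assume C: "0 \<le> C" and le: "\<And>\<delta> v. 0 < \<delta> \<Longrightarrow> \<delta> \<le> 1 \<Longrightarrow> sqint lborel v \<Longrightarrow> En \<gamma>1 \<delta> v < \<infinity> \<Longrightarrow>
        \<bar>(LINT p|kmeas \<gamma>1 \<delta>. ((snd p \<bullet> b) * F b (fst p)) * incr v p) + (LINT x|lborel. pd b (F b) x * v x)\<bar> \<le> C * \<delta> * l2norm lborel v"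
      show "\<exists>C. Q b C"
        unfolding Q_def by (rule exI[of _ C]) (intro conjI allI impI C le)
    qed
  qed
  from bchoice[OF this] obtain C1 where C1': "\<forall>b\<in>Basis. Q b (C1 b)" by blast
  have C1: "0 \<le> C1 b" "0 < \<delta> \<Longrightarrow> \<delta> \<le> 1 \<Longrightarrow> sqint lborel v \<Longrightarrow> En \<gamma>1 \<delta> v < \<infinity> \<Longrightarrow>
    \<bar>(LINT p|kmeas \<gamma>1 \<delta>. ((snd p \<bullet> b) * F b (fst p)) * incr v p) + (LINT x|lborel. pd b (F b) x * v x)\<bar> \<le> C1 b * \<delta> * l2norm lborel v"
    if b: "b \<in> Basis" for b \<delta> v
    using C1'[THEN bspec, OF b] unfolding Q_def by blast+
  define C4 where "C4 = Cb * (C2 * sqrt (V * real DIM('a)))"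
  define C5 where "C5 = (\<Sum>b\<in>Basis. C1 b)"
  have C45: "0 \<le> C4" "0 \<le> C5" using Cb C2 V C1(1) by (auto simp: C4_def C5_def intro!: sum_nonneg)
  show ?thesis
  proof (rule that[of "C4 + C5"])
    show "0 \<le> C4 + C5" using C45 by simp
    fix \<delta> :: real and v :: "'a \<Rightarrow> real"
    assume \<delta>: "0 < \<delta>" "\<delta> \<le> 1" and v: "sqint lborel v" and fv: "En \<gamma>1 \<delta> v < \<infinity>"
    have vm[measurable]: "v \<in> borel_measurable borel" using sqint_measurable[OF v] by simp
    note [measurable] = ker_measurable[OF K \<delta>(1)]
    let ?\<mu> = "kmeas \<gamma>1 \<delta> :: ('a \<times> 'a) measure"
    have sv: "sqint ?\<mu> (incr v)" using sqint_incr_iff[OF K \<delta>(1) vm] fv by simp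
    \<comment> \<open>Both cuts make the remainder square integrable and are harmless:
      \<open>\<beta>U\<close> ignores base points outside \<open>U\<close>, and the kernel ignores
      displacements of length \<delta> or more.\<close>
    define rem where "rem p = (if fst p \<in> U \<and> norm (snd p) < \<delta> then incr \<phi> p - (\<Sum>c\<in>Basis. (snd p \<bullet> c) * pd c \<phi> (fst p)) else 0)" for p
    have msum: "(\<lambda>p. \<Sum>c\<in>Basis. (snd p \<bullet> c) * pd c \<phi> (fst p)) \<in> borel_measurable (borel \<Otimes>\<^sub>M borel)"
      by (intro borel_measurable_sum borel_measurable_times measurable_compose[OF measurable_fst md\<phi>]) measurable
    have mrem: "rem \<in> borel_measurable (borel \<Otimes>\<^sub>M borel)"
    proof -
      have "(\<lambda>p. incr \<phi> p - (\<Sum>c\<in>Basis. (snd p \<bullet> c) * pd c \<phi> (fst p))) \<in> borel_measurable (borel \<Otimes>\<^sub>M borel)"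
        by (intro borel_measurable_diff msum) measurable
      moreover have "{p \<in> space (borel \<Otimes>\<^sub>M borel). fst p \<in> U \<and> norm (snd p :: 'a) < \<delta>} \<in> sets (borel \<Otimes>\<^sub>M borel)" by measurable
      ultimately show ?thesis unfolding rem_def[abs_def] by (intro measurable_If) auto
    qed
    have remb: "(norm (rem (x, h)))\<^sup>2 \<le> (C2 * \<delta>)\<^sup>2 * (norm h)\<^sup>2 * indicator U x" for x h
    proof (cases "x \<in> U \<and> norm h < \<delta>")
      case True
      have "\<bar>rem (x, h)\<bar> \<le> C2 * (norm h)\<^sup>2" using C2(2)[of x h] True by (simp add: rem_def incr_def)
      also have "\<dots> \<le> C2 * (\<delta> * norm h)" unfolding power2_eq_square using True C2(1) by (intro mult_left_mono mult_right_mono) auto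
      finally have "(norm (rem (x, h)))\<^sup>2 \<le> (C2 * (\<delta> * norm h))\<^sup>2" by (intro power_mono) auto
      then show ?thesis using True by (simp add: power_mult_distrib mult_ac)
    qed (auto simp: rem_def)
    have rle: "(\<integral>\<^sup>+p. ennreal ((norm (rem p))\<^sup>2) \<partial>?\<mu>) \<le> ennreal ((C2 * \<delta>)\<^sup>2 * (V * real DIM('a)))"
    proof -
      have "(\<integral>\<^sup>+p. ennreal ((norm (rem p))\<^sup>2) \<partial>?\<mu>) = (\<integral>\<^sup>+h. ennreal (ker \<gamma>1 \<delta> h) * (\<integral>\<^sup>+x. ennreal ((norm (rem (x, h)))\<^sup>2) \<partial>lborel) \<partial>lborel)"
        by (rule nn_integral_kmeas[OF K \<delta>(1)]) (use mrem in measurable)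
      also have "\<dots> \<le> (\<integral>\<^sup>+h. ennreal ((C2 * \<delta>)\<^sup>2 * V) * ennreal (ker \<gamma>1 \<delta> h * (norm h)\<^sup>2) \<partial>(lborel :: 'a measure))"
      proof (rule nn_integral_mono)
        fix h :: 'a
        have "(\<integral>\<^sup>+x. ennreal ((norm (rem (x, h)))\<^sup>2) \<partial>lborel) \<le> (\<integral>\<^sup>+x. ennreal ((C2 * \<delta>)\<^sup>2 * (norm h)\<^sup>2) * indicator U x \<partial>lborel)"
        proof (rule nn_integral_mono)
          fix x
          have "ennreal ((norm (rem (x, h)))\<^sup>2) \<le> ennreal ((C2 * \<delta>)\<^sup>2 * (norm h)\<^sup>2 * indicator U x)" by (rule ennreal_leI[OF remb])
          then show "ennreal ((norm (rem (x, h)))\<^sup>2) \<le> ennreal ((C2 * \<delta>)\<^sup>2 * (norm h)\<^sup>2) * indicator U x"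
            by (cases "x \<in> U") simp_all
        qed
        also have "\<dots> = ennreal ((C2 * \<delta>)\<^sup>2 * (norm h)\<^sup>2) * emeasure lborel U" by (rule nn_integral_cmult_indicator) simp
        finally have "ennreal (ker \<gamma>1 \<delta> h) * (\<integral>\<^sup>+x. ennreal ((norm (rem (x, h)))\<^sup>2) \<partial>lborel)
            \<le> ennreal (ker \<gamma>1 \<delta> h) * (ennreal ((C2 * \<delta>)\<^sup>2 * (norm h)\<^sup>2) * ennreal V)"
          unfolding eU by (rule mult_left_mono) simp
        also have "\<dots> = ennreal (ker \<gamma>1 \<delta> h * ((C2 * \<delta>)\<^sup>2 * (norm h)\<^sup>2 * V))"
          using ker_nonneg[OF K \<delta>(1), of h] V by (simp add: ennreal_mult)
        also have "ker \<gamma>1 \<delta> h * ((C2 * \<delta>)\<^sup>2 * (norm h)\<^sup>2 * V) = ((C2 * \<delta>)\<^sup>2 * V) * (ker \<gamma>1 \<delta> h * (norm h)\<^sup>2)"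
          by (simp only: mult_ac)
        also have "ennreal \<dots> = ennreal ((C2 * \<delta>)\<^sup>2 * V) * ennreal (ker \<gamma>1 \<delta> h * (norm h)\<^sup>2)"
          using ker_nonneg[OF K \<delta>(1), of h] V by (intro ennreal_mult) auto
        finally show "ennreal (ker \<gamma>1 \<delta> h) * (\<integral>\<^sup>+x. ennreal ((norm (rem (x, h)))\<^sup>2) \<partial>lborel)
            \<le> ennreal ((C2 * \<delta>)\<^sup>2 * V) * ennreal (ker \<gamma>1 \<delta> h * (norm h)\<^sup>2)" .
      qed
      also have "\<dots> = ennreal ((C2 * \<delta>)\<^sup>2 * V) * (\<integral>\<^sup>+h. ennreal (ker \<gamma>1 \<delta> h * (norm h)\<^sup>2) \<partial>(lborel :: 'a measure))"
        by (rule nn_integral_cmult) measurable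
      also have "\<dots> = ennreal ((C2 * \<delta>)\<^sup>2 * V * real DIM('a))"
        unfolding ker_second_moment(1)[OF K \<delta>(1)] using V by (intro ennreal_mult[symmetric]) auto
      finally show ?thesis by (simp only: mult.assoc)
    qed
    have mrem': "rem \<in> borel_measurable ?\<mu>" using mrem by measurable
    have nn: "0 \<le> (C2 * \<delta>)\<^sup>2 * (V * real DIM('a))" using V by simp
    note srem = l2norm_le_nn(1)[OF mrem' rle nn]
    have lrem: "l2norm ?\<mu> rem \<le> C2 * \<delta> * sqrt (V * real DIM('a))"
    proof (rule power2_le_imp_le)
      show "(l2norm ?\<mu> rem)\<^sup>2 \<le> (C2 * \<delta> * sqrt (V * real DIM('a)))\<^sup>2"
        unfolding power_mult_distrib[of "C2 * \<delta>"] using l2norm_le_nn(2)[OF mrem' rle nn] V by simp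
    qed (use C2 \<delta> V in simp)
    have m1: "(\<lambda>p. \<beta>U (fst p)) \<in> borel_measurable ?\<mu>" by measurable
    have b1: "AE p in ?\<mu>. \<bar>\<beta>U (fst p)\<bar> \<le> Cb" by (rule AE_I2) (rule \<beta>U)
    have i1: "integrable ?\<mu> (\<lambda>p. \<beta>U (fst p) * (rem p \<bullet> incr v p))" by (rule integrable_coeff_inner[OF srem sv m1 b1])
    have iq: "integrable ?\<mu> (\<lambda>p. ((snd p \<bullet> b) * F b (fst p)) * incr v p)" if b: "b \<in> Basis" for b
      using integrable_inner_sqint(2)[OF sqint_linear_increment[OF \<delta>(1) test_functions_integrable(2)[OF F[OF b]] b] sv] by simp
    have isq: "integrable ?\<mu> (\<lambda>p. \<Sum>b\<in>Basis. ((snd p \<bullet> b) * F b (fst p)) * incr v p)"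
      by (rule Bochner_Integration.integrable_sum[OF iq])
    have "(LINT p|?\<mu>. \<beta>U (fst p) * (incr \<phi> p * incr v p))
        = (LINT p|?\<mu>. \<beta>U (fst p) * (rem p \<bullet> incr v p) + (\<Sum>b\<in>Basis. ((snd p \<bullet> b) * F b (fst p)) * incr v p))"
    proof (rule integral_cong_AE)
      show "(\<lambda>p. \<beta>U (fst p) * (incr \<phi> p * incr v p)) \<in> borel_measurable ?\<mu>" by measurable
      show "(\<lambda>p. \<beta>U (fst p) * (rem p \<bullet> incr v p) + (\<Sum>b\<in>Basis. ((snd p \<bullet> b) * F b (fst p)) * incr v p)) \<in> borel_measurable ?\<mu>"
        by (intro borel_measurable_add borel_measurable_integrable[OF i1] borel_measurable_integrable[OF isq])
      show "AE p in ?\<mu>. \<beta>U (fst p) * (incr \<phi> p * incr v p) = \<beta>U (fst p) * (rem p \<bullet> incr v p) + (\<Sum>b\<in>Basis. ((snd p \<bullet> b) * F b (fst p)) * incr v p)"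
        using AE_kmeas_near[OF \<delta>(1)]
      proof eventually_elim
        case (elim p)
        have "(\<Sum>b\<in>Basis. ((snd p \<bullet> b) * F b (fst p)) * incr v p) = \<beta>U (fst p) * ((\<Sum>b\<in>Basis. (snd p \<bullet> b) * pd b \<phi> (fst p)) * incr v p)"
          unfolding FU sum_distrib_left sum_distrib_right by (rule sum.cong) (simp_all add: mult_ac)
        then show ?case using elim by (cases "fst p \<in> U") (simp_all add: rem_def \<beta>U_def algebra_simps)
      qed
    qed
    also have "\<dots> = (LINT p|?\<mu>. \<beta>U (fst p) * (rem p \<bullet> incr v p)) + (\<Sum>b\<in>Basis. (LINT p|?\<mu>. ((snd p \<bullet> b) * F b (fst p)) * incr v p))"
      unfolding Bochner_Integration.integral_add[OF i1 isq]
      by (subst Bochner_Integration.integral_sum[OF iq]) auto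
    finally have e1: "(LINT p|?\<mu>. \<beta>U (fst p) * (incr \<phi> p * incr v p)) =
      (LINT p|?\<mu>. \<beta>U (fst p) * (rem p \<bullet> incr v p)) + (\<Sum>b\<in>Basis. (LINT p|?\<mu>. ((snd p \<bullet> b) * F b (fst p)) * incr v p))" .
    have e2: "(LINT x|lborel. (\<Sum>b\<in>Basis. pd b (F b) x) * v x) = (\<Sum>b\<in>Basis. (LINT x|lborel. pd b (F b) x * v x))"
      unfolding sum_distrib_right
    proof (rule Bochner_Integration.integral_sum)
      fix b :: 'a assume b: "b \<in> Basis"
      show "integrable lborel (\<lambda>x. pd b (F b) x * v x)"
        using integrable_inner_sqint(2)[OF test_functions_integrable(2)[OF test_functions_pd[OF F[OF b] b]] v] by simp
    qed
    have "\<bar>(LINT p|?\<mu>. \<beta>U (fst p) * (incr \<phi> p * incr v p)) + (LINT x|lborel. (\<Sum>b\<in>Basis. pd b (F b) x) * v x)\<bar>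
        \<le> \<bar>LINT p|?\<mu>. \<beta>U (fst p) * (rem p \<bullet> incr v p)\<bar>
          + \<bar>\<Sum>b\<in>Basis. (LINT p|?\<mu>. ((snd p \<bullet> b) * F b (fst p)) * incr v p) + (LINT x|lborel. pd b (F b) x * v x)\<bar>"
      unfolding e1 e2 sum.distrib by linarith
    also have "\<dots> \<le> Cb * (l2norm ?\<mu> rem * Sn \<gamma>1 \<delta> v) + (\<Sum>b\<in>Basis. C1 b * \<delta> * l2norm lborel v)"
    proof (rule add_mono)
      show "\<bar>LINT p|?\<mu>. \<beta>U (fst p) * (rem p \<bullet> incr v p)\<bar> \<le> Cb * (l2norm ?\<mu> rem * Sn \<gamma>1 \<delta> v)"
        by (rule integral_coeff_inner_le[OF srem sv m1 b1]) (use Cb in simp)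
      show "\<bar>\<Sum>b\<in>Basis. (LINT p|?\<mu>. ((snd p \<bullet> b) * F b (fst p)) * incr v p) + (LINT x|lborel. pd b (F b) x * v x)\<bar> \<le> (\<Sum>b\<in>Basis. C1 b * \<delta> * l2norm lborel v)"
        by (rule order.trans[OF sum_abs sum_mono]) (rule C1(2)[OF _ \<delta> v fv])
    qed
    also have "\<dots> \<le> C4 * \<delta> * Sn \<gamma>1 \<delta> v + C5 * \<delta> * l2norm lborel v"
    proof (rule add_mono)
      have "Cb * (l2norm ?\<mu> rem * Sn \<gamma>1 \<delta> v) \<le> Cb * ((C2 * \<delta> * sqrt (V * real DIM('a))) * Sn \<gamma>1 \<delta> v)"
        by (intro mult_left_mono mult_right_mono lrem) (use Cb in auto)
      also have "\<dots> = C4 * \<delta> * Sn \<gamma>1 \<delta> v" unfolding C4_def by (simp only: mult_ac)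
      finally show "Cb * (l2norm ?\<mu> rem * Sn \<gamma>1 \<delta> v) \<le> C4 * \<delta> * Sn \<gamma>1 \<delta> v" .
      show "(\<Sum>b\<in>Basis. C1 b * \<delta> * l2norm lborel v) \<le> C5 * \<delta> * l2norm lborel v"
        unfolding C5_def by (simp add: sum_distrib_right)
    qed
    also have "\<dots> \<le> (C4 + C5) * \<delta> * (Sn \<gamma>1 \<delta> v + l2norm lborel v)"
    proof -
      have "0 \<le> C4 * \<delta> * l2norm lborel v + C5 * \<delta> * Sn \<gamma>1 \<delta> v" using C45 \<delta> by simp
      then show ?thesis by (simp add: algebra_simps)
    qed
    finally show "\<bar>(LINT p|?\<mu>. (indicator (cball 0 (\<rho> + 1)) (fst p) * \<beta> (fst p)) * (incr \<phi> p * incr v p))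
      + (LINT x|lborel. (\<Sum>b\<in>Basis. pd b (\<lambda>x. \<beta> x * pd b \<phi> x) x) * v x)\<bar> \<le> (C4 + C5) * \<delta> * (Sn \<gamma>1 \<delta> v + l2norm lborel v)"
      by (simp only: \<beta>U_def U_def F_def[abs_def])
  qed
qed

end

section \<open>Weak gradients\<close>

lemma test_function_supported:
  assumes "\<phi> \<in> test_functions \<Omega>"
  shows "L2_supported \<Omega> \<phi>" "x \<notin> \<Omega> \<Longrightarrow> \<phi> x = 0"
proof -
  obtain S where S: "S \<subseteq> \<Omega>" "\<And>x. x \<notin> S \<Longrightarrow> \<phi> x = 0" using test_functions_support[OF assms] by metis
  show z: "x \<notin> \<Omega> \<Longrightarrow> \<phi> x = 0" for x using S by blast
  show "L2_supported \<Omega> \<phi>" using test_functions_integrable(2)[OF assms] z by (simp add: L2_supported_def)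
qed

text \<open>Test \<open>g\<close> against its own smoothing \<open>w\<close>: orthogonality turns
  the pairing of \<open>g\<close> with \<open>w - g\<close> into minus the squared norm of
  \<open>g\<close>, while \<open>w - g\<close> has at most half the norm of
  \<open>g\<close>.\<close>

lemma fundamental_lemma:
  fixes \<Omega> :: "'a::euclidean_space set"
  assumes dom: "bounded_Lipschitz_domain \<Omega>" and g: "L2_supported \<Omega> g"
    and orth: "\<And>\<phi>. \<phi> \<in> test_functions \<Omega> \<Longrightarrow> (LINT x|lborel. g x * \<phi> x) = 0"
  shows "AE x in lborel. g x = 0"
proof -
  obtain P e c t0 \<theta> L where part: "inward_partition \<Omega> P e c t0 \<theta> L" using inward_partition_exists[OF dom] by blast
  have bdd: "bounded \<Omega>" using dom by (simp add: bounded_Lipschitz_domain_def)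
  note g' = L2_supportedD[OF g]
  have "l2norm lborel g = 0"
  proof (rule ccontr)
    assume "l2norm lborel g \<noteq> 0"
    then have N: "0 < l2norm lborel g" using l2norm_nonneg[of lborel g] by linarith
    obtain \<tau> where \<tau>: "0 < \<tau>" "\<And>t. 0 < t \<Longrightarrow> t < \<tau> \<Longrightarrow> l2norm lborel (\<lambda>x. smooth_op P e c \<theta> t g x - g x) \<le> l2norm lborel g / 2"
      using smooth_op_tendsto[OF part bdd g'(1,3), of "l2norm lborel g / 2"] N by auto
    have t0: "0 < t0" using partition_facts(4)[OF part bdd] .
    define t where "t = min \<tau> t0 / 2"
    have t: "0 < t" "t < \<tau>" "t < t0" using \<tau>(1) t0 by (auto simp: t_def)
    define w where "w = smooth_op P e c \<theta> t g"
    have w: "w \<in> test_functions \<Omega>" unfolding w_def by (rule smooth_op_test_function[OF part bdd g'(1,3) t(1,3)])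
    have sw: "sqint lborel w" by (rule test_functions_integrable(2)[OF w])
    have i: "integrable lborel (\<lambda>x. g x * w x)" "integrable lborel (\<lambda>x. g x * g x)"
      using integrable_inner_sqint(2)[OF g'(1) sw] integrable_inner_sqint(2)[OF g'(1) g'(1)] by simp_all
    have "(LINT x|lborel. g x \<bullet> (w x - g x)) = - (l2norm lborel g)\<^sup>2"
    proof -
      have "(LINT x|lborel. g x \<bullet> (w x - g x)) = (LINT x|lborel. g x * w x) - (LINT x|lborel. g x * g x)"
        using Bochner_Integration.integral_diff[OF i] by (simp add: right_diff_distrib)
      moreover have "(l2norm lborel g)\<^sup>2 = (LINT x|lborel. g x * g x)"
        unfolding l2norm_sq by (simp add: power2_eq_square)
      ultimately show ?thesis using orth[OF w] by simp
    qed
    then have "(l2norm lborel g)\<^sup>2 \<le> l2norm lborel g * l2norm lborel (\<lambda>x. w x - g x)"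
      using integral_inner_le[OF g'(1) sqint_diff(1)[OF sw g'(1)]] by simp
    also have "\<dots> \<le> l2norm lborel g * (l2norm lborel g / 2)"
      unfolding w_def by (rule mult_left_mono[OF \<tau>(2)[OF t(1,2)]]) simp
    finally have "(l2norm lborel g)\<^sup>2 \<le> (l2norm lborel g)\<^sup>2 / 2" by (simp add: power2_eq_square)
    moreover have "0 < (l2norm lborel g)\<^sup>2" using N by simp
    ultimately show False by linarith
  qed
  then show ?thesis by (rule l2norm_eq_0_AE[OF g'(1)])
qed

definition gradf :: "('a::euclidean_space \<Rightarrow> real) \<Rightarrow> 'a \<Rightarrow> 'a" where
  "gradf \<phi> x = (\<Sum>b\<in>Basis. pd b \<phi> x *\<^sub>R b)"

lemma gradf_inner: "b \<in> Basis \<Longrightarrow> gradf \<phi> x \<bullet> b = pd b \<phi> x"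
  unfolding gradf_def by (rule inner_sum_left_Basis)

lemma gradf_inner_gradf: "gradf \<phi> x \<bullet> gradf \<psi> x = (\<Sum>b\<in>Basis. pd b \<phi> x * pd b \<psi> x)"
  by (subst euclidean_inner) (simp add: gradf_inner)

lemma gradf_facts:
  fixes \<phi> :: "'a::euclidean_space \<Rightarrow> real"
  assumes "\<phi> \<in> test_functions \<Omega>"
  shows "gradf \<phi> \<in> borel_measurable borel" "sqint lborel (gradf \<phi>)" "x \<notin> \<Omega> \<Longrightarrow> gradf \<phi> x = 0"
    "l2norm lborel (gradf \<phi>) \<le> (\<Sum>b\<in>Basis. l2norm lborel (pd b \<phi>))"
proof -
  note d = test_functions_pd[OF assms]
  have s: "sqint lborel (\<lambda>x. pd b \<phi> x *\<^sub>R b)" "l2norm lborel (\<lambda>x. pd b \<phi> x *\<^sub>R b) = l2norm lborel (pd b \<phi>)" if "b \<in> Basis" for b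
    using test_functions_integrable(2)[OF d[OF that]] that by (auto simp: sqint_def l2norm_def)
  show sg: "sqint lborel (gradf \<phi>)" unfolding gradf_def[abs_def] by (rule sqint_sum(1)[OF finite_Basis s(1)])
  then show "gradf \<phi> \<in> borel_measurable borel" using sqint_measurable by fastforce
  show "gradf \<phi> x = 0" if "x \<notin> \<Omega>"
    unfolding gradf_def using test_function_supported(2)[OF d that] by (intro sum.neutral) simp
  have "l2norm lborel (gradf \<phi>) \<le> (\<Sum>b\<in>Basis. l2norm lborel (\<lambda>x. pd b \<phi> x *\<^sub>R b))"
    unfolding gradf_def[abs_def] by (rule sqint_sum(2)[OF finite_Basis s(1)])
  then show "l2norm lborel (gradf \<phi>) \<le> (\<Sum>b\<in>Basis. l2norm lborel (pd b \<phi>))" by (simp add: s(2))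
qed

lemma sqint_lebesgue_on_supported:
  fixes g :: "'a::euclidean_space \<Rightarrow> 'b::euclidean_space"
  assumes D: "D \<in> sets borel" and g: "sqint lborel g" and g0: "\<And>x. x \<notin> D \<Longrightarrow> g x = 0"
  shows "sqint (lebesgue_on D) g" "l2norm (lebesgue_on D) g = l2norm lborel g"
proof -
  have gm: "g \<in> borel_measurable lborel" by (rule sqint_measurable[OF g])
  then have m: "(\<lambda>x. (norm (g x))\<^sup>2) \<in> borel_measurable borel" by simp
  have "g \<in> borel_measurable (lebesgue_on D)" by (rule measurable_restrict_space1[OF measurable_completion[OF gm]])
  moreover have z: "(norm (g x))\<^sup>2 = 0" if "x \<notin> D" for x using g0[OF that] by simp
  have ae: "AE x in lborel. x \<in> D \<longrightarrow> (norm (g x))\<^sup>2 = (norm (g x))\<^sup>2" by simp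
  ultimately show "sqint (lebesgue_on D) g"
    using lebesgue_on_eq_lborel(3)[OF D m z ae] g by (simp add: sqint_def)
  show "l2norm (lebesgue_on D) g = l2norm lborel g"
    unfolding l2norm_def using lebesgue_on_eq_lborel(2)[OF D m z ae] by simp
qed

lemma is_weak_gradient_iff:
  "is_weak_gradient \<Omega> v G \<longleftrightarrow> sqint (lebesgue_on \<Omega>) v \<and> sqint (lebesgue_on \<Omega>) G \<and>
     (\<forall>\<phi>\<in>test_functions \<Omega>. \<forall>b\<in>Basis.
        (LINT x|lebesgue_on \<Omega>. v x * pd b \<phi> x) = - (LINT x|lebesgue_on \<Omega>. (G x \<bullet> b) * \<phi> x))"
  by (simp add: is_weak_gradient_def L2_eq_sqint)

section \<open>Weak gradients on the domain\<close>

context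
  fixes \<Omega> :: "'a::euclidean_space set"
  assumes dom: "bounded_Lipschitz_domain \<Omega>"
begin

lemma domain_facts: "open \<Omega>" "bounded \<Omega>" "\<Omega> \<noteq> {}" "\<Omega> \<in> sets borel"
  using dom by (auto simp: bounded_Lipschitz_domain_def)

lemma test_sqint:
  assumes "\<phi> \<in> test_functions \<Omega>"
  shows "sqint (lebesgue_on \<Omega>) \<phi>" "sqint (lebesgue_on \<Omega>) (gradf \<phi>)"
    "l2norm (lebesgue_on \<Omega>) \<phi> = l2norm lborel \<phi>" "l2norm (lebesgue_on \<Omega>) (gradf \<phi>) = l2norm lborel (gradf \<phi>)"
  using sqint_lebesgue_on_supported[OF domain_facts(4) test_functions_integrable(2)[OF assms] test_function_supported(2)[OF assms]]
    sqint_lebesgue_on_supported[OF domain_facts(4) gradf_facts(2)[OF assms] gradf_facts(3)[OF assms]] by blast+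

lemma test_weak_gradient:
  assumes \<phi>: "\<phi> \<in> test_functions \<Omega>"
  shows "is_weak_gradient \<Omega> \<phi> (gradf \<phi>)"
  unfolding is_weak_gradient_iff
proof (intro conjI ballI test_sqint[OF \<phi>])
  fix \<psi> and b :: 'a assume \<psi>: "\<psi> \<in> test_functions \<Omega>" and b: "b \<in> Basis"
  note d\<phi> = test_functions_pd[OF \<phi> b] and d\<psi> = test_functions_pd[OF \<psi> b]
  have m: "\<phi> \<in> borel_measurable borel" "\<psi> \<in> borel_measurable borel" "pd b \<phi> \<in> borel_measurable borel" "pd b \<psi> \<in> borel_measurable borel"
    using test_functionsD(4)[OF \<phi>] test_functionsD(4)[OF \<psi>] test_functionsD(4)[OF d\<phi>] test_functionsD(4)[OF d\<psi>] by blast+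
  have "(LINT x|lebesgue_on \<Omega>. \<phi> x * pd b \<psi> x) = (LINT x|lborel. \<phi> x * pd b \<psi> x)"
    by (rule lebesgue_on_eq_lborel(2)[OF domain_facts(4) borel_measurable_times[OF m(1,4)]])
      (simp_all add: test_function_supported(2)[OF \<phi>])
  also have "\<dots> = - (LINT x|lborel. pd b \<phi> x * \<psi> x)"
    by (rule integral_pd_by_parts[OF \<psi> b test_functionsD(1)[OF \<phi>]])
  also have "(LINT x|lborel. pd b \<phi> x * \<psi> x) = (LINT x|lebesgue_on \<Omega>. (gradf \<phi> x \<bullet> b) * \<psi> x)"
    unfolding gradf_inner[OF b]
    by (rule lebesgue_on_eq_lborel(2)[OF domain_facts(4) borel_measurable_times[OF m(3,2)], symmetric])
      (simp_all add: test_function_supported(2)[OF \<psi>])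
  finally show "(LINT x|lebesgue_on \<Omega>. \<phi> x * pd b \<psi> x) = - (LINT x|lebesgue_on \<Omega>. (gradf \<phi> x \<bullet> b) * \<psi> x)" .
qed

lemma sqint_inner_const:
  fixes G :: "'b \<Rightarrow> 'a"
  assumes G: "sqint M G" and b: "b \<in> Basis"
  shows "sqint M (\<lambda>x. G x \<bullet> b)"
proof -
  have [measurable]: "G \<in> borel_measurable M" by (rule sqint_measurable[OF G])
  have "integrable M (\<lambda>x. (norm (G x))\<^sup>2)" using G by (simp add: sqint_def)
  then have "integrable M (\<lambda>x. (norm (G x \<bullet> b))\<^sup>2)"
  proof (rule Bochner_Integration.integrable_bound)
    show "AE x in M. norm ((norm (G x \<bullet> b))\<^sup>2) \<le> norm ((norm (G x))\<^sup>2)"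
    proof (rule AE_I2)
      fix x
      have "(norm (G x \<bullet> b))\<^sup>2 \<le> (norm (G x))\<^sup>2" using Basis_le_norm[OF b, of "G x"] by (intro power_mono) auto
      then show "norm ((norm (G x \<bullet> b))\<^sup>2) \<le> norm ((norm (G x))\<^sup>2)" by simp
    qed
  qed measurable
  then show ?thesis by (simp add: sqint_def)
qed

lemma is_weak_gradient_diff:
  assumes v: "is_weak_gradient \<Omega> v G" and w: "is_weak_gradient \<Omega> w H"
  shows "is_weak_gradient \<Omega> (\<lambda>x. v x - w x) (\<lambda>x. G x - H x)"
proof -
  note v' = v[unfolded is_weak_gradient_iff] and w' = w[unfolded is_weak_gradient_iff]
  show ?thesis unfolding is_weak_gradient_iff
  proof (intro conjI ballI)
    show "sqint (lebesgue_on \<Omega>) (\<lambda>x. v x - w x)" "sqint (lebesgue_on \<Omega>) (\<lambda>x. G x - H x)"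
      using v' w' by (auto intro: sqint_diff(1))
    fix \<phi> and b :: 'a assume \<phi>: "\<phi> \<in> test_functions \<Omega>" and b: "b \<in> Basis"
    note s = test_sqint(1)[OF \<phi>] test_sqint(1)[OF test_functions_pd[OF \<phi> b]]
    have i1: "integrable (lebesgue_on \<Omega>) (\<lambda>x. v x * pd b \<phi> x)" "integrable (lebesgue_on \<Omega>) (\<lambda>x. w x * pd b \<phi> x)"
      using integrable_inner_sqint(2)[OF _ s(2), of v] integrable_inner_sqint(2)[OF _ s(2), of w] v' w' by simp_all
    have i2: "integrable (lebesgue_on \<Omega>) (\<lambda>x. (G x \<bullet> b) * \<phi> x)" "integrable (lebesgue_on \<Omega>) (\<lambda>x. (H x \<bullet> b) * \<phi> x)"
      using integrable_inner_sqint(2)[OF sqint_inner_const[OF _ b] s(1), of G] integrable_inner_sqint(2)[OF sqint_inner_const[OF _ b] s(1), of H] v' w' by simp_all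
    show "(LINT x|lebesgue_on \<Omega>. (v x - w x) * pd b \<phi> x) = - (LINT x|lebesgue_on \<Omega>. ((G x - H x) \<bullet> b) * \<phi> x)"
      unfolding left_diff_distrib inner_diff_left Bochner_Integration.integral_diff[OF i1] Bochner_Integration.integral_diff[OF i2]
      using v' w' \<phi> b by simp
  qed
qed

text \<open>The components of the difference are orthogonal to all test functions, so
  \<open>fundamental_lemma\<close> applies. This frees later arguments from the choice made in
  \<open>weak_gradient\<close>.\<close>

lemma weak_gradient_unique:
  assumes v: "is_weak_gradient \<Omega> v G" and w: "is_weak_gradient \<Omega> v H"
  shows "AE x in lebesgue_on \<Omega>. G x = H x"
proof -
  note d = is_weak_gradient_diff[OF v w, unfolded is_weak_gradient_iff]
  have "AE x in lebesgue_on \<Omega>. (G x - H x) \<bullet> b = 0" if b: "b \<in> Basis" for b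
  proof -
    obtain g where g: "L2_supported \<Omega> g" "AE x in lborel. x \<in> \<Omega> \<longrightarrow> (G x - H x) \<bullet> b = g x"
      using lebesgue_on_representative[OF domain_facts(4) sqint_inner_const[OF _ b], of "\<lambda>x. G x - H x"] d by blast
    have "AE x in lborel. g x = 0"
    proof (rule fundamental_lemma[OF dom g(1)])
      fix \<phi> assume \<phi>: "\<phi> \<in> test_functions \<Omega>"
      have m: "(\<lambda>x. g x * \<phi> x) \<in> borel_measurable borel"
        by (rule borel_measurable_times[OF L2_supportedD(2)[OF g(1)] test_functionsD(4)[OF \<phi>]])
      have "(LINT x|lborel. g x * \<phi> x) = (LINT x|lebesgue_on \<Omega>. ((G x - H x) \<bullet> b) * \<phi> x)"
      proof (rule lebesgue_on_eq_lborel(2)[OF domain_facts(4) m, symmetric])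
        show "AE x in lborel. x \<in> \<Omega> \<longrightarrow> (G x - H x) \<bullet> b * \<phi> x = g x * \<phi> x"
          using g(2) by eventually_elim simp
      qed (simp add: L2_supportedD(3)[OF g(1)])
      also have "\<dots> = 0" using d \<phi> b by force
      finally show "(LINT x|lborel. g x * \<phi> x) = 0" .
    qed
    then show ?thesis
      unfolding AE_lebesgue_on[OF domain_facts(4)] using g(2) by eventually_elim simp
  qed
  then have "AE x in lebesgue_on \<Omega>. \<forall>b\<in>Basis. (G x - H x) \<bullet> b = 0"
    by (subst AE_finite_all[OF finite_Basis]) blast
  then show ?thesis
  proof eventually_elim
    case (elim x)
    show ?case by (rule euclidean_eqI) (use elim in \<open>simp add: inner_diff_left\<close>)
  qed
qed

lemma weak_gradient_works:
  assumes "v \<in> H1 \<Omega>"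
  shows "is_weak_gradient \<Omega> v (weak_gradient \<Omega> v)"
proof -
  have "\<exists>G. is_weak_gradient \<Omega> v G" using assms by (simp add: H1_def)
  then show ?thesis unfolding weak_gradient_def by (rule someI_ex)
qed

lemma weak_gradient_norm:
  assumes "is_weak_gradient \<Omega> v G"
  shows "v \<in> H1 \<Omega>" "l2norm (lebesgue_on \<Omega>) (weak_gradient \<Omega> v) = l2norm (lebesgue_on \<Omega>) G"
    "AE x in lebesgue_on \<Omega>. weak_gradient \<Omega> v x = G x"
proof -
  show h: "v \<in> H1 \<Omega>" using assms by (auto simp: H1_def)
  note w = weak_gradient_works[OF h]
  show ae: "AE x in lebesgue_on \<Omega>. weak_gradient \<Omega> v x = G x" by (rule weak_gradient_unique[OF w assms])
  show "l2norm (lebesgue_on \<Omega>) (weak_gradient \<Omega> v) = l2norm (lebesgue_on \<Omega>) G"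
    by (rule l2norm_cong_AE[OF _ _ ae]) (use w assms in \<open>auto simp: is_weak_gradient_iff dest: sqint_measurable\<close>)
qed

lemma test_function_H10:
  assumes \<phi>: "\<phi> \<in> test_functions \<Omega>"
  shows "\<phi> \<in> H10 \<Omega>"
proof -
  have "is_weak_gradient \<Omega> (\<lambda>x. \<phi> x - \<phi> x) (\<lambda>x. gradf \<phi> x - gradf \<phi> x)"
    by (rule is_weak_gradient_diff[OF test_weak_gradient[OF \<phi>] test_weak_gradient[OF \<phi>]])
  from weak_gradient_norm(2)[OF this]
  have z: "H1_norm \<Omega> (\<lambda>x. \<phi> x - \<phi> x) = 0" by (simp add: H1_norm_def L2_norm_eq)
  have "\<forall>\<epsilon>>0. \<exists>\<psi>\<in>test_functions \<Omega>. H1_norm \<Omega> (\<lambda>x. \<phi> x - \<psi> x) < \<epsilon>"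
    by (intro allI impI bexI[OF _ \<phi>]) (simp only: z)
  then show ?thesis using weak_gradient_norm(1)[OF test_weak_gradient[OF \<phi>]] by (simp add: H10_def)
qed

text \<open>Extracts what the convergence proof needs, namely the equation against classical
  gradients of test functions and simultaneous approximation of \<open>u\<close> and
  \<open>G\<close>; the chosen weak gradients then disappear from view.\<close>

lemma local_weak_solution_test:
  assumes u: "local_weak_solution \<Omega> a f u"
  obtains G where "sqint (lebesgue_on \<Omega>) u" "sqint (lebesgue_on \<Omega>) G"
    "\<And>\<phi>. \<phi> \<in> test_functions \<Omega> \<Longrightarrow> (LINT x|lebesgue_on \<Omega>. a x * (G x \<bullet> gradf \<phi> x)) = f \<phi>"
    "\<And>\<epsilon>. 0 < \<epsilon> \<Longrightarrow> \<exists>\<phi>\<in>test_functions \<Omega>. l2norm (lebesgue_on \<Omega>) (\<lambda>x. u x - \<phi> x) < \<epsilon> \<and>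
        l2norm (lebesgue_on \<Omega>) (\<lambda>x. G x - gradf \<phi> x) < \<epsilon>"
proof -
  define G where "G = weak_gradient \<Omega> u"
  have uH: "u \<in> H1 \<Omega>" using u by (simp add: local_weak_solution_def H10_def)
  have G: "is_weak_gradient \<Omega> u G" unfolding G_def by (rule weak_gradient_works[OF uH])
  show ?thesis
  proof (rule that[of G])
    show "sqint (lebesgue_on \<Omega>) u" "sqint (lebesgue_on \<Omega>) G" using G by (auto simp: is_weak_gradient_iff)
    show "(LINT x|lebesgue_on \<Omega>. a x * (G x \<bullet> gradf \<phi> x)) = f \<phi>" if \<phi>: "\<phi> \<in> test_functions \<Omega>" for \<phi>
    proof -
      have "(LINT x|lebesgue_on \<Omega>. a x * (G x \<bullet> gradf \<phi> x)) = (LINT x|lebesgue_on \<Omega>. a x * (G x \<bullet> weak_gradient \<Omega> \<phi> x))"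
        by (rule integral_lebesgue_on_cong_AE[OF domain_facts(4)])
          (use weak_gradient_norm(3)[OF test_weak_gradient[OF \<phi>]] in eventually_elim, simp)
      also have "\<dots> = f \<phi>" using u test_function_H10[OF \<phi>] by (simp add: local_weak_solution_def G_def)
      finally show ?thesis .
    qed
    show "\<exists>\<phi>\<in>test_functions \<Omega>. l2norm (lebesgue_on \<Omega>) (\<lambda>x. u x - \<phi> x) < \<epsilon> \<and>
        l2norm (lebesgue_on \<Omega>) (\<lambda>x. G x - gradf \<phi> x) < \<epsilon>" if \<epsilon>: "0 < \<epsilon>" for \<epsilon>
    proof -
      obtain \<phi> where \<phi>: "\<phi> \<in> test_functions \<Omega>" "H1_norm \<Omega> (\<lambda>x. u x - \<phi> x) < \<epsilon>"
        using u \<epsilon> by (auto simp: local_weak_solution_def H10_def)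
      note d = weak_gradient_norm(2)[OF is_weak_gradient_diff[OF G test_weak_gradient[OF \<phi>(1)]]]
      define p where "p = l2norm (lebesgue_on \<Omega>) (\<lambda>x. u x - \<phi> x)"
      define q where "q = l2norm (lebesgue_on \<Omega>) (\<lambda>x. G x - gradf \<phi> x)"
      have pq: "0 \<le> p" "0 \<le> q" "sqrt (p\<^sup>2 + q\<^sup>2) < \<epsilon>"
        using \<phi>(2) d by (auto simp: p_def q_def H1_norm_def L2_norm_eq)
      have "p \<le> sqrt (p\<^sup>2 + q\<^sup>2)" "q \<le> sqrt (p\<^sup>2 + q\<^sup>2)" by (rule real_le_rsqrt, simp)+
      then have "p < \<epsilon>" "q < \<epsilon>" using pq(3) by linarith+
      then show ?thesis using \<phi>(1) unfolding p_def q_def by blast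
    qed
  qed
qed

end

section \<open>Stability and convergence\<close>

lemma bounded_extended_domain:
  fixes \<Omega> :: "'a::euclidean_space set"
  assumes "bounded \<Omega>" "\<Omega> \<noteq> {}"
  shows "bounded (extended_domain \<Omega> \<delta>)"
proof -
  \<comment> \<open>Essential because the distance to an empty set is 0 by convention, which would
    make the collar unbounded.\<close>
  have ne: "frontier \<Omega> \<noteq> {}" using assms by (metis frontier_eq_empty not_bounded_UNIV)
  have "bounded (frontier \<Omega>)" using bounded_subset[OF bounded_closure[OF assms(1)]] by (simp add: frontier_def)
  then obtain B where B: "\<And>z. z \<in> frontier \<Omega> \<Longrightarrow> norm z \<le> B" unfolding bounded_iff by blast
  have "norm x \<le> B + \<delta>" if x: "infdist x (frontier \<Omega>) < \<delta>" for x
  proof -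
    obtain z where z: "z \<in> frontier \<Omega>" "infdist x (frontier \<Omega>) = dist x z"
      using infdist_attains_inf[OF frontier_closed ne] by blast
    have "norm x \<le> norm z + dist x z" using norm_triangle_ineq[of z "x - z"] by (simp add: dist_norm)
    then show ?thesis using B[OF z(1)] z(2) x by simp
  qed
  then have "bounded {x. infdist x (frontier \<Omega>) < \<delta>}" unfolding bounded_iff by blast
  then show ?thesis using assms(1) by (simp add: extended_domain_eq)
qed

lemma S_norm_nonneg: "0 \<le> S_norm \<Omega> \<gamma>1 \<delta> v"
  by (simp add: S_norm_def)

section \<open>Coercivity, the dual norm and stability\<close>

context
  fixes \<Omega> :: "'a::euclidean_space set" and D0 s :: real and \<gamma>1 :: "real \<Rightarrow> real" and ty :: "'a itself"
  assumes dom: "bounded_Lipschitz_domain \<Omega>" and K: "kernel_conditions ty D0 s \<gamma>1"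
begin

text \<open>Packages the outcome of \<open>T_form_eq\<close> as one existence statement. The density
  is given in the coordinates of base point and displacement, with bounds at every point.\<close>

definition form_density where
  "form_density A r R \<delta> B \<longleftrightarrow> B \<in> borel_measurable (borel \<Otimes>\<^sub>M borel) \<and> (\<forall>p. r \<le> B p) \<and> (\<forall>p. B p \<le> R) \<and>
    (AE p in kmeas \<gamma>1 \<delta>. fst p \<in> extended_domain \<Omega> \<delta> \<longrightarrow> fst p + snd p \<in> extended_domain \<Omega> \<delta> \<longrightarrow> B p = A (fst p) (fst p + snd p)) \<and>
    (\<forall>v w. L2_supported \<Omega> v \<longrightarrow> L2_supported \<Omega> w \<longrightarrow> En \<gamma>1 \<delta> v < \<infinity> \<longrightarrow> En \<gamma>1 \<delta> w < \<infinity> \<longrightarrow>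
      T_form \<Omega> \<gamma>1 A \<delta> v w = (LINT p|kmeas \<gamma>1 \<delta>. B p * (incr v p * incr w p)))"

lemma form_densityD:
  assumes "form_density A r R \<delta> B"
  shows "B \<in> borel_measurable (borel \<Otimes>\<^sub>M borel)" "r \<le> B p" "B p \<le> R"
    "AE p in kmeas \<gamma>1 \<delta>. fst p \<in> extended_domain \<Omega> \<delta> \<longrightarrow> fst p + snd p \<in> extended_domain \<Omega> \<delta> \<longrightarrow> B p = A (fst p) (fst p + snd p)"
    "L2_supported \<Omega> v \<Longrightarrow> L2_supported \<Omega> w \<Longrightarrow> En \<gamma>1 \<delta> v < \<infinity> \<Longrightarrow> En \<gamma>1 \<delta> w < \<infinity> \<Longrightarrow>
      T_form \<Omega> \<gamma>1 A \<delta> v w = (LINT p|kmeas \<gamma>1 \<delta>. B p * (incr v p * incr w p))"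
  using assms unfolding form_density_def by blast+

lemma form_density_exists:
  assumes \<delta>: "0 < \<delta>" and A: "coefficient_conditions \<Omega> r R A \<delta>"
  shows "\<exists>B. form_density A r R \<delta> B"
proof (rule T_form_eq[OF domain_facts(1,3)[OF dom] K \<delta> A])
  fix B assume B: "B \<in> borel_measurable (borel \<Otimes>\<^sub>M borel)" "\<And>p. r \<le> B p" "\<And>p. B p \<le> R"
    "AE p in kmeas \<gamma>1 \<delta>. fst p \<in> extended_domain \<Omega> \<delta> \<longrightarrow> fst p + snd p \<in> extended_domain \<Omega> \<delta> \<longrightarrow> B p = A (fst p) (fst p + snd p)"
    "\<And>v w. L2_supported \<Omega> v \<Longrightarrow> L2_supported \<Omega> w \<Longrightarrow> En \<gamma>1 \<delta> v < \<infinity> \<Longrightarrow> En \<gamma>1 \<delta> w < \<infinity> \<Longrightarrow>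
      T_form \<Omega> \<gamma>1 A \<delta> v w = (LINT p|kmeas \<gamma>1 \<delta>. B p * (incr v p * incr w p))"
  show ?thesis unfolding form_density_def by (rule exI[of _ B]) (intro conjI allI impI B)
qed

lemma En_diff:
  assumes \<delta>: "0 < \<delta>" and v: "L2_supported \<Omega> v" "En \<gamma>1 \<delta> v < \<infinity>" and w: "L2_supported \<Omega> w" "En \<gamma>1 \<delta> w < \<infinity>"
  shows "En \<gamma>1 \<delta> (\<lambda>x. v x - w x) < \<infinity>" "Sn \<gamma>1 \<delta> (\<lambda>x. v x - w x) \<le> Sn \<gamma>1 \<delta> v + Sn \<gamma>1 \<delta> w"
proof -
  note vb = L2_supportedD(2)[OF v(1)] and wb = L2_supportedD(2)[OF w(1)]
  have s: "sqint (kmeas \<gamma>1 \<delta>) (incr v)" "sqint (kmeas \<gamma>1 \<delta>) (incr w)"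
    using sqint_incr_iff[OF K \<delta> vb] sqint_incr_iff[OF K \<delta> wb] v(2) w(2) by auto
  show "Sn \<gamma>1 \<delta> (\<lambda>x. v x - w x) \<le> Sn \<gamma>1 \<delta> v + Sn \<gamma>1 \<delta> w"
    unfolding incr_simps(2) by (rule sqint_diff(2)[OF s])
  have "sqint (kmeas \<gamma>1 \<delta>) (incr (\<lambda>x. v x - w x))" unfolding incr_simps(2) by (rule sqint_diff(1)[OF s])
  then show "En \<gamma>1 \<delta> (\<lambda>x. v x - w x) < \<infinity>" using sqint_incr_iff[OF K \<delta> borel_measurable_diff[OF vb wb]] by simp
qed

lemma test_function_energy:
  assumes "0 < \<delta>" "\<phi> \<in> test_functions \<Omega>"
  shows "En \<gamma>1 \<delta> \<phi> < \<infinity>" "\<phi> \<in> S_space \<Omega> \<gamma>1 \<delta>"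
proof -
  obtain C where "En \<gamma>1 \<delta> \<phi> \<le> ennreal C" using En_test_function[OF K assms(2)] assms(1) by metis
  then show "En \<gamma>1 \<delta> \<phi> < \<infinity>" by (rule le_less_trans) simp
  then show "\<phi> \<in> S_space \<Omega> \<gamma>1 \<delta>" using S_space_iff[OF domain_facts(1)[OF dom] K assms(1) test_function_supported(1)[OF assms(2)]] by simp
qed

lemma S_norm_cong:
  assumes \<delta>: "0 < \<delta>" and ae: "AE x in lebesgue_on (extended_domain \<Omega> \<delta>). u x = v x"
  shows "S_norm \<Omega> \<gamma>1 \<delta> u = S_norm \<Omega> \<gamma>1 \<delta> v"
  unfolding S_norm_def by (simp only: energy_cong[OF domain_facts(1)[OF dom] K \<delta> ae])

text \<open>Guarantees that the supremum defining the dual norm is over a nonempty set.\<close>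

lemma S_space_nontrivial:
  assumes \<delta>: "0 < \<delta>"
  obtains \<phi> where "\<phi> \<in> test_functions \<Omega>" "\<not> (AE x in lebesgue_on (extended_domain \<Omega> \<delta>). \<phi> x = 0)"
proof -
  obtain x0 where "x0 \<in> \<Omega>" using domain_facts(3)[OF dom] by blast
  then obtain q where q: "0 < q" "cball x0 q \<subseteq> \<Omega>" using domain_facts(1)[OF dom] open_contains_cball by blast
  define \<phi> where "\<phi> = mollifier (1 / q) x0"
  have a: "0 < 1 / q" using q by simp
  have t: "\<phi> \<in> test_functions \<Omega>"
  proof (rule test_functionsI[OF _ compact_cball q(2)])
    show "Ck k \<phi>" for k unfolding \<phi>_def by (rule test_functionsD(1)[OF mollifier(1)[OF a]])
    fix x assume "x \<notin> cball x0 q"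
    then show "\<phi> x = 0" unfolding \<phi>_def by (intro mollifier(3)[OF a]) (simp add: dist_norm norm_minus_commute)
  qed
  have "\<not> (AE x in lebesgue_on (extended_domain \<Omega> \<delta>). \<phi> x = 0)"
  proof
    assume "AE x in lebesgue_on (extended_domain \<Omega> \<delta>). \<phi> x = 0"
    then have "AE x in lborel. x \<in> extended_domain \<Omega> \<delta> \<longrightarrow> \<phi> x = 0"
      unfolding AE_lebesgue_on[OF extended_domain_borel(1)[OF domain_facts(1)[OF dom]]] .
    then have "AE x in lborel. \<phi> x = 0"
      by eventually_elim (use test_function_supported(2)[OF t] in \<open>auto simp: extended_domain_eq\<close>)
    then have "(LINT x|lborel. \<phi> x) = 0" by (rule integral_eq_zero_AE)
    then show False using mollifier(5)[OF a, of x0] by (simp add: \<phi>_def)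
  qed
  then show ?thesis using that t by blast
qed

text \<open>The quotients under the supremum are signed, so nonnegativity comes from comparing a
  test function with its negative. If the norm of \<open>v\<close> is 0, the quotient carries no
  information, and boundedness of the functional is used instead.\<close>

lemma S_dual_norm_bound:
  assumes \<delta>: "0 < \<delta>" and f: "f \<in> S_dual \<Omega> \<gamma>1 \<delta>"
  shows "0 \<le> S_dual_norm \<Omega> \<gamma>1 \<delta> f"
    "v \<in> S_space \<Omega> \<gamma>1 \<delta> \<Longrightarrow> f v \<le> S_dual_norm \<Omega> \<gamma>1 \<delta> f * S_norm \<Omega> \<gamma>1 \<delta> v"
proof -
  define X where "X = {v \<in> S_space \<Omega> \<gamma>1 \<delta>. \<not> (AE x in lebesgue_on (extended_domain \<Omega> \<delta>). v x = 0)}"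
  have fc: "f (\<lambda>x. c * v x) = c * f v" if "v \<in> S_space \<Omega> \<gamma>1 \<delta>" for c v
    using f that by (auto simp: S_dual_def bounded_functionals_def)
  have "\<exists>C. \<forall>v\<in>S_space \<Omega> \<gamma>1 \<delta>. \<bar>f v\<bar> \<le> C * S_norm \<Omega> \<gamma>1 \<delta> v"
    using f by (simp add: S_dual_def bounded_functionals_def)
  then obtain C where C': "\<forall>v\<in>S_space \<Omega> \<gamma>1 \<delta>. \<bar>f v\<bar> \<le> C * S_norm \<Omega> \<gamma>1 \<delta> v" ..
  note C = bspec[OF C']
  have le: "f v / S_norm \<Omega> \<gamma>1 \<delta> v \<le> \<bar>C\<bar>" if "v \<in> S_space \<Omega> \<gamma>1 \<delta>" for v
  proof (cases "S_norm \<Omega> \<gamma>1 \<delta> v = 0")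
    case False
    then have p: "0 < S_norm \<Omega> \<gamma>1 \<delta> v" using S_norm_nonneg[of \<Omega> \<gamma>1 \<delta> v] by linarith
    have "f v \<le> C * S_norm \<Omega> \<gamma>1 \<delta> v" using C[OF that] by linarith
    also have "\<dots> \<le> \<bar>C\<bar> * S_norm \<Omega> \<gamma>1 \<delta> v" using p by (intro mult_right_mono) auto
    finally show ?thesis using p by (simp add: divide_le_eq)
  qed simp
  have bdd: "bdd_above ((\<lambda>v. f v / S_norm \<Omega> \<gamma>1 \<delta> v) ` X)"
    by (rule bdd_aboveI2[where M="\<bar>C\<bar>"]) (use le in \<open>auto simp: X_def\<close>)
  have up: "f v / S_norm \<Omega> \<gamma>1 \<delta> v \<le> S_dual_norm \<Omega> \<gamma>1 \<delta> f" if "v \<in> X" for v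
    unfolding S_dual_norm_def X_def[symmetric] by (rule cSUP_upper[OF that bdd])
  show nn: "0 \<le> S_dual_norm \<Omega> \<gamma>1 \<delta> f"
  proof -
    obtain \<phi> where \<phi>: "\<phi> \<in> test_functions \<Omega>" "\<not> (AE x in lebesgue_on (extended_domain \<Omega> \<delta>). \<phi> x = 0)"
      by (rule S_space_nontrivial[OF \<delta>])
    have m: "(\<lambda>x. - 1 * \<phi> x) \<in> test_functions \<Omega>" by (rule test_functions_scale[OF \<phi>(1)])
    have 1: "\<phi> \<in> X" using \<phi> test_function_energy(2)[OF \<delta> \<phi>(1)] by (simp add: X_def)
    have 2: "(\<lambda>x. - 1 * \<phi> x) \<in> X" using \<phi>(2) test_function_energy(2)[OF \<delta> m] by (simp add: X_def)
    have e: "S_norm \<Omega> \<gamma>1 \<delta> (\<lambda>x. - 1 * \<phi> x) = S_norm \<Omega> \<gamma>1 \<delta> \<phi>"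
    proof -
      have "S_norm \<Omega> \<gamma>1 \<delta> (\<lambda>x. - 1 * \<phi> x) = Sn \<gamma>1 \<delta> (\<lambda>x. - 1 * \<phi> x)"
        by (rule S_norm_eq_Sn[OF domain_facts(1)[OF dom] K \<delta> test_function_supported(1)[OF m]])
      also have "\<dots> = Sn \<gamma>1 \<delta> \<phi>" unfolding incr_simps(3) by (simp add: l2norm_def)
      also have "\<dots> = S_norm \<Omega> \<gamma>1 \<delta> \<phi>"
        by (rule S_norm_eq_Sn[OF domain_facts(1)[OF dom] K \<delta> test_function_supported(1)[OF \<phi>(1)], symmetric])
      finally show ?thesis .
    qed
    have "f (\<lambda>x. - 1 * \<phi> x) = - f \<phi>" using fc[OF test_function_energy(2)[OF \<delta> \<phi>(1)], of "- 1"] by simp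
    then show ?thesis using up[OF 1] up[OF 2] unfolding e by (simp add: minus_divide_left[symmetric])
  qed
  assume v: "v \<in> S_space \<Omega> \<gamma>1 \<delta>"
  show "f v \<le> S_dual_norm \<Omega> \<gamma>1 \<delta> f * S_norm \<Omega> \<gamma>1 \<delta> v"
  proof (cases "S_norm \<Omega> \<gamma>1 \<delta> v = 0")
    case True
    then show ?thesis using C[OF v] by simp
  next
    case False
    then have p: "0 < S_norm \<Omega> \<gamma>1 \<delta> v" using S_norm_nonneg[of \<Omega> \<gamma>1 \<delta> v] by linarith
    have "v \<in> X"
    proof (rule ccontr)
      assume "v \<notin> X"
      then have "AE x in lebesgue_on (extended_domain \<Omega> \<delta>). v x = 0" using v by (simp add: X_def)
      from S_norm_cong[OF \<delta> this] have "S_norm \<Omega> \<gamma>1 \<delta> v = 0" by (simp add: S_norm_def energy_def)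
      then show False using False by simp
    qed
    from up[OF this] show ?thesis using p by (simp add: divide_le_eq)
  qed
qed

text \<open>The last clause tests the equation with the original \<open>u\<close>, so the energy
  identity carries \<open>f u\<close> while its left side is computed with the Borel
  representative.\<close>

lemma weak_solution_representative:
  assumes \<delta>: "0 < \<delta>" and u: "nonlocal_weak_solution \<Omega> \<gamma>1 A \<delta> f u"
  obtains v where "L2_supported \<Omega> v" "En \<gamma>1 \<delta> v < \<infinity>" "nonlocal_weak_solution \<Omega> \<gamma>1 A \<delta> f v"
    "AE x in lebesgue_on (extended_domain \<Omega> \<delta>). u x = v x" "T_form \<Omega> \<gamma>1 A \<delta> v v = f u"
proof -
  have uS: "u \<in> S_space \<Omega> \<gamma>1 \<delta>" using u by (simp add: nonlocal_weak_solution_def)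
  obtain v where v: "L2_supported \<Omega> v" "En \<gamma>1 \<delta> v < \<infinity>" "v \<in> S_space \<Omega> \<gamma>1 \<delta>"
    "AE x in lebesgue_on (extended_domain \<Omega> \<delta>). u x = v x"
    by (rule S_space_representative[OF domain_facts(1)[OF dom] K \<delta> uS])
  have eq: "T_form \<Omega> \<gamma>1 A \<delta> u w = T_form \<Omega> \<gamma>1 A \<delta> v w" for w
    by (rule T_form_cong[OF domain_facts(1)[OF dom] v(4)]) simp
  have "nonlocal_weak_solution \<Omega> \<gamma>1 A \<delta> f v" using u v(3) by (simp add: nonlocal_weak_solution_def eq)
  moreover have "T_form \<Omega> \<gamma>1 A \<delta> v v = f u"
    using u uS T_form_cong[OF domain_facts(1)[OF dom] v(4) v(4), of \<gamma>1 A] by (simp add: nonlocal_weak_solution_def)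
  ultimately show ?thesis using that v by blast
qed

lemma T_form_coercive:
  assumes \<delta>: "0 < \<delta>" and A: "coefficient_conditions \<Omega> r R A \<delta>" and r: "0 < r"
    and v: "L2_supported \<Omega> v" "En \<gamma>1 \<delta> v < \<infinity>"
  shows "r * (Sn \<gamma>1 \<delta> v)\<^sup>2 \<le> T_form \<Omega> \<gamma>1 A \<delta> v v"
proof -
  obtain B where rep: "form_density A r R \<delta> B" using form_density_exists[OF \<delta> A] by blast
  note B = form_densityD(1-3)[OF rep] and T = form_densityD(5)[OF rep]
  have s: "sqint (kmeas \<gamma>1 \<delta>) (incr v)" using sqint_incr_iff[OF K \<delta> L2_supportedD(2)[OF v(1)]] v(2) by simp
  have mB: "B \<in> borel_measurable (kmeas \<gamma>1 \<delta>)" using B(1) by measurable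
  have bB: "AE p in kmeas \<gamma>1 \<delta>. \<bar>B p\<bar> \<le> R"
  proof (rule AE_I2)
    fix p show "\<bar>B p\<bar> \<le> R" using B(2)[of p] B(3)[of p] r by linarith
  qed
  have i: "integrable (kmeas \<gamma>1 \<delta>) (\<lambda>p. B p * (incr v p * incr v p))"
    using integrable_coeff_inner[OF s s mB bB] by simp
  have i2: "integrable (kmeas \<gamma>1 \<delta>) (\<lambda>p. r * (norm (incr v p))\<^sup>2)" using s by (simp add: sqint_def)
  have "r * (Sn \<gamma>1 \<delta> v)\<^sup>2 = (LINT p|kmeas \<gamma>1 \<delta>. r * (norm (incr v p))\<^sup>2)" by (simp add: l2norm_sq)
  also have "\<dots> \<le> (LINT p|kmeas \<gamma>1 \<delta>. B p * (incr v p * incr v p))"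
  proof (rule integral_mono[OF i2 i])
    fix p show "r * (norm (incr v p))\<^sup>2 \<le> B p * (incr v p * incr v p)"
      using mult_right_mono[OF B(2)[of p], of "incr v p * incr v p"] by (simp add: power2_eq_square)
  qed
  also have "\<dots> = T_form \<Omega> \<gamma>1 A \<delta> v v" using T[OF v(1) v(1) v(2) v(2)] by simp
  finally show ?thesis .
qed

lemma stability:
  assumes \<delta>: "0 < \<delta>" and A: "coefficient_conditions \<Omega> r R A \<delta>" and r: "0 < r"
    and f: "f \<in> S_dual \<Omega> \<gamma>1 \<delta>" and u: "nonlocal_weak_solution \<Omega> \<gamma>1 A \<delta> f u"
  shows "S_norm \<Omega> \<gamma>1 \<delta> u \<le> S_dual_norm \<Omega> \<gamma>1 \<delta> f / r"
proof -
  obtain v where v: "L2_supported \<Omega> v" "En \<gamma>1 \<delta> v < \<infinity>" "AE x in lebesgue_on (extended_domain \<Omega> \<delta>). u x = v x"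
    "T_form \<Omega> \<gamma>1 A \<delta> v v = f u"
    by (rule weak_solution_representative[OF \<delta> u])
  define N where "N = S_norm \<Omega> \<gamma>1 \<delta> u"
  have N: "N = Sn \<gamma>1 \<delta> v"
    unfolding N_def S_norm_cong[OF \<delta> v(3)] by (rule S_norm_eq_Sn[OF domain_facts(1)[OF dom] K \<delta> v(1)])
  have N0: "0 \<le> N" by (simp add: N)
  have uS: "u \<in> S_space \<Omega> \<gamma>1 \<delta>" using u by (simp add: nonlocal_weak_solution_def)
  have "r * N\<^sup>2 \<le> S_dual_norm \<Omega> \<gamma>1 \<delta> f * N"
    using T_form_coercive[OF \<delta> A r v(1,2)] S_dual_norm_bound(2)[OF \<delta> f uS] unfolding v(4) N[symmetric] N_def[symmetric] by linarith
  then have le: "(r * N) * N \<le> S_dual_norm \<Omega> \<gamma>1 \<delta> f * N" by (simp add: power2_eq_square mult.assoc)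
  have "r * N \<le> S_dual_norm \<Omega> \<gamma>1 \<delta> f"
  \<comment> \<open>Dividing by \<open>N\<close> is impossible when it is 0; the claim is then
    nonnegativity of the dual norm.\<close>
  proof (cases "N = 0")
    case True
    then show ?thesis using S_dual_norm_bound(1)[OF \<delta> f] by simp
  next
    case False
    then show ?thesis using le N0 by (metis mult_le_cancel_right_pos order_le_less)
  qed
  then show ?thesis using r by (simp add: N_def pos_le_divide_eq mult.commute)
qed

text \<open>The functional is the form against the fixed \<open>v\<close>, so
  \<open>form_small_in_L2\<close> applies. It is stated for differences because linearity is read
  off from that representation.\<close>

lemma solution_small_in_L2:
  assumes \<delta>: "0 < \<delta>" and A: "coefficient_conditions \<Omega> r R A \<delta>" and r: "0 < r"
    and v: "L2_supported \<Omega> v" "En \<gamma>1 \<delta> v < \<infinity>" "nonlocal_weak_solution \<Omega> \<gamma>1 A \<delta> f v" and e: "0 < e"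
  obtains C where "0 \<le> C" "\<And>z w. L2_supported \<Omega> z \<Longrightarrow> En \<gamma>1 \<delta> z < \<infinity> \<Longrightarrow> L2_supported \<Omega> w \<Longrightarrow> En \<gamma>1 \<delta> w < \<infinity> \<Longrightarrow>
    \<bar>f z - f w\<bar> \<le> e * Sn \<gamma>1 \<delta> (\<lambda>x. z x - w x) + C * l2norm lborel (\<lambda>x. z x - w x)"
proof -
  obtain B where rep: "form_density A r R \<delta> B" using form_density_exists[OF \<delta> A] by blast
  note B = form_densityD(1-3)[OF rep] and T = form_densityD(5)[OF rep]
  have aB: "\<bar>B p\<bar> \<le> R" for p using B(2)[of p] B(3)[of p] r by linarith
  have R: "0 \<le> R" using B(2,3) r by (meson less_imp_le order_trans)
  have mB: "B \<in> borel_measurable (kmeas \<gamma>1 \<delta>)" using B(1) by measurable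
  have bB: "AE p in kmeas \<gamma>1 \<delta>. \<bar>B p\<bar> \<le> R" by (rule AE_I2) (rule aB)
  have sq: "sqint (kmeas \<gamma>1 \<delta>) (incr z)" if "L2_supported \<Omega> z" "En \<gamma>1 \<delta> z < \<infinity>" for z
    using sqint_incr_iff[OF K \<delta> L2_supportedD(2)[OF that(1)]] that(2) by simp
  show ?thesis
  proof (rule form_small_in_L2[OF K \<delta> L2_supportedD(2)[OF v(1)] v(2) R e])
    fix C assume C: "0 \<le> C" and le: "\<And>B z. B \<in> borel_measurable (borel \<Otimes>\<^sub>M borel) \<Longrightarrow> AE p in kmeas \<gamma>1 \<delta>. \<bar>B p\<bar> \<le> R \<Longrightarrow>
      sqint lborel z \<Longrightarrow> En \<gamma>1 \<delta> z < \<infinity> \<Longrightarrow>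
      \<bar>LINT p|kmeas \<gamma>1 \<delta>. B p * (incr v p * incr z p)\<bar> \<le> e * Sn \<gamma>1 \<delta> z + C * l2norm lborel z"
    show ?thesis
    proof (rule that[OF C])
      fix z w assume z: "L2_supported \<Omega> z" "En \<gamma>1 \<delta> z < \<infinity>" and w: "L2_supported \<Omega> w" "En \<gamma>1 \<delta> w < \<infinity>"
      have f: "f y = (LINT p|kmeas \<gamma>1 \<delta>. B p * (incr v p \<bullet> incr y p))" if y: "L2_supported \<Omega> y" "En \<gamma>1 \<delta> y < \<infinity>" for y
        using v(3) T[OF v(1) y(1) v(2) y(2)] S_space_iff[OF domain_facts(1)[OF dom] K \<delta> y(1)] y(2) by (simp add: nonlocal_weak_solution_def)
      have "f z - f w = (LINT p|kmeas \<gamma>1 \<delta>. B p * (incr v p \<bullet> incr z p) - B p * (incr v p \<bullet> incr w p))"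
        unfolding f[OF z] f[OF w]
        by (rule Bochner_Integration.integral_diff[symmetric])
          (rule integrable_coeff_inner[OF sq[OF v(1,2)] sq[OF z] mB bB], rule integrable_coeff_inner[OF sq[OF v(1,2)] sq[OF w] mB bB])
      also have "\<dots> = (LINT p|kmeas \<gamma>1 \<delta>. B p * (incr v p * incr (\<lambda>x. z x - w x) p))"
        unfolding incr_simps(2) by (simp add: right_diff_distrib)
      finally show "\<bar>f z - f w\<bar> \<le> e * Sn \<gamma>1 \<delta> (\<lambda>x. z x - w x) + C * l2norm lborel (\<lambda>x. z x - w x)"
        using le[OF B(1) bB sqint_diff(1)[OF L2_supportedD(1)[OF z(1)] L2_supportedD(1)[OF w(1)]] En_diff(1)[OF \<delta> z w]] by simp
    qed
  qed
qed

text \<open>Near the diagonal \<open>A x y\<close> is replaced by \<open>A x x\<close> through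
  uniform continuity, and that by a polynomial \<open>\<beta>\<close> through Stone-Weierstrass.
  Smoothness of \<open>\<beta>\<close> lets \<open>form_consistency\<close> differentiate it,
  although \<open>A\<close> is only continuous.\<close>

lemma T_form_approx:
  fixes \<phi> :: "'a \<Rightarrow> real" and A :: "'a \<Rightarrow> 'a \<Rightarrow> real"
  assumes \<delta>0: "0 < \<delta>0" and A: "\<And>\<delta>. 0 < \<delta> \<Longrightarrow> \<delta> < \<delta>0 \<Longrightarrow> coefficient_conditions \<Omega> r R A \<delta>" and r: "0 < r"
    and cont: "\<And>\<delta>. 0 < \<delta> \<Longrightarrow> \<delta> < \<delta>0 \<Longrightarrow> continuous_on (closure (extended_domain \<Omega> \<delta> \<times> extended_domain \<Omega> \<delta>)) (\<lambda>(x, y). A x y)"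
    and \<phi>: "\<phi> \<in> test_functions \<Omega>" and \<kappa>: "0 < \<kappa>"
  obtains \<beta> \<eta> C where "\<And>k. Ck k \<beta>" "\<And>x. x \<in> \<Omega> \<Longrightarrow> \<bar>A x x - \<beta> x\<bar> \<le> \<kappa>" "0 < \<eta>" "\<eta> \<le> \<delta>0" "0 \<le> C"
    "\<And>\<delta> v. 0 < \<delta> \<Longrightarrow> \<delta> < \<eta> \<Longrightarrow> L2_supported \<Omega> v \<Longrightarrow> En \<gamma>1 \<delta> v < \<infinity> \<Longrightarrow>
      \<bar>T_form \<Omega> \<gamma>1 A \<delta> \<phi> v + (LINT x|lborel. (\<Sum>b\<in>Basis. pd b (\<lambda>x. \<beta> x * pd b \<phi> x) x) * v x)\<bar>
        \<le> \<kappa> * Sn \<gamma>1 \<delta> v + C * \<delta> * (Sn \<gamma>1 \<delta> v + l2norm lborel v)"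
proof -
  \<comment> \<open>One compact set must serve all small horizons: the closure of the extended
    domain at this fixed horizon contains the smaller ones.\<close>
  define \<delta>1 where "\<delta>1 = \<delta>0 / 2"
  have \<delta>1: "0 < \<delta>1" "\<delta>1 < \<delta>0" using \<delta>0 by (auto simp: \<delta>1_def)
  define D where "D = extended_domain \<Omega> \<delta>1"
  have cD: "compact (closure D)" unfolding D_def using bounded_extended_domain[OF domain_facts(2,3)[OF dom]] by (simp add: compact_closure)
  define E where "E = closure D \<times> closure D"
  have E: "compact E" unfolding E_def by (rule compact_Times[OF cD cD])
  have cA: "continuous_on E (\<lambda>(x, y). A x y)"
    using cont[OF \<delta>1] by (simp add: E_def D_def closure_Times)
  obtain C0 where C0: "0 \<le> C0" "\<And>\<delta>. 0 < \<delta> \<Longrightarrow> En \<gamma>1 \<delta> \<phi> \<le> ennreal C0"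
    using En_test_function[OF K \<phi>] by blast
  have mb: "\<phi> \<in> borel_measurable borel" by (rule test_functionsD(4)[OF \<phi>])
  define N where "N = sqrt C0"
  have N: "0 \<le> N" "\<And>\<delta>. 0 < \<delta> \<Longrightarrow> Sn \<gamma>1 \<delta> \<phi> \<le> N"
    unfolding N_def using C0(1) real_le_rsqrt[OF Sn_sq_le(2)[OF K _ mb C0(2) C0(1)]] by auto
  \<comment> \<open>Two errors of size \<open>\<kappa>'\<close> are multiplied by the energy norm of
    \<open>\<phi>\<close>, which \<open>N\<close> bounds uniformly in the horizon.\<close>
  define \<kappa>' where "\<kappa>' = min \<kappa> (\<kappa> / (2 * (N + 1)))"
  have \<kappa>': "0 < \<kappa>'" "\<kappa>' \<le> \<kappa>" "2 * \<kappa>' * N \<le> \<kappa>"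
  proof -
    show "0 < \<kappa>'" "\<kappa>' \<le> \<kappa>" using \<kappa> N(1) by (auto simp: \<kappa>'_def)
    have "2 * \<kappa>' * N \<le> 2 * (\<kappa> / (2 * (N + 1))) * (N + 1)"
      using N(1) \<kappa> by (intro mult_mono) (auto simp: \<kappa>'_def)
    also have "\<dots> = \<kappa>" using N(1) by (simp add: field_simps)
    finally show "2 * \<kappa>' * N \<le> \<kappa>" .
  qed
  have "uniformly_continuous_on E (\<lambda>(x, y). A x y)" by (rule compact_uniformly_continuous[OF cA E])
  then obtain d where d: "0 < d" "\<And>p q. p \<in> E \<Longrightarrow> q \<in> E \<Longrightarrow> dist q p < d \<Longrightarrow> dist ((\<lambda>(x, y). A x y) q) ((\<lambda>(x, y). A x y) p) < \<kappa>'"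
    unfolding uniformly_continuous_on_def using \<kappa>'(1) by metis
  have "continuous_on (closure D) (\<lambda>x. (\<lambda>(x, y). A x y) (x, x))"
    by (rule continuous_on_compose2[OF cA, of _ "\<lambda>x. (x, x)"]) (auto simp: E_def intro!: continuous_intros)
  then have ca: "continuous_on (closure D) (\<lambda>x. A x x)" by simp
  obtain \<beta> where \<beta>: "real_polynomial_function \<beta>" "\<And>x. x \<in> closure D \<Longrightarrow> \<bar>A x x - \<beta> x\<bar> < \<kappa>'"
    by (rule Stone_Weierstrass_real_polynomial_function[OF cD ca \<kappa>'(1)]) (rule that, assumption, blast)
  have C\<beta>: "Ck k \<beta>" for k by (rule Ck_real_polynomial[OF \<beta>(1)])
  obtain \<rho> where \<rho>: "0 < \<rho>" "\<And>x. \<rho> \<le> norm x \<Longrightarrow> \<phi> x = 0" using test_functions_ball[OF \<phi>] by blast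
  have m\<beta>: "\<beta> \<in> borel_measurable borel" by (rule borel_measurable_continuous_onI[OF Ck_continuous[OF C\<beta>[of 0]]])
  have \<Omega>D: "\<Omega> \<subseteq> D" by (auto simp: D_def extended_domain_eq)
  have DD: "D \<subseteq> closure D" by (rule closure_subset)
  show ?thesis
  proof (rule form_consistency[OF K test_functionsD(5)[OF \<phi>] C\<beta> \<rho>])
    fix C assume C: "0 \<le> C" and le: "\<And>\<delta> v. 0 < \<delta> \<Longrightarrow> \<delta> \<le> 1 \<Longrightarrow> sqint lborel v \<Longrightarrow> En \<gamma>1 \<delta> v < \<infinity> \<Longrightarrow>
      \<bar>(LINT p|kmeas \<gamma>1 \<delta>. (indicator (cball 0 (\<rho> + 1)) (fst p) * \<beta> (fst p)) * (incr \<phi> p * incr v p))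
      + (LINT x|lborel. (\<Sum>b\<in>Basis. pd b (\<lambda>x. \<beta> x * pd b \<phi> x) x) * v x)\<bar> \<le> C * \<delta> * (Sn \<gamma>1 \<delta> v + l2norm lborel v)"
    show ?thesis
    \<comment> \<open>The 1 is for \<open>form_consistency\<close>, \<open>d\<close> for uniform
      continuity, and \<open>\<delta>1\<close> keeps the extended domains inside
      \<open>D\<close>.\<close>
    proof (rule that[OF C\<beta> _ _ _ C, of "min 1 (min d \<delta>1)"])
      show "\<bar>A x x - \<beta> x\<bar> \<le> \<kappa>" if "x \<in> \<Omega>" for x
        using \<beta>(2)[of x] that \<Omega>D DD \<kappa>'(2) by force
      show "0 < min 1 (min d \<delta>1)" "min 1 (min d \<delta>1) \<le> \<delta>0" using d(1) \<delta>1 by auto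
      fix \<delta> v assume \<delta>: "0 < \<delta>" "\<delta> < min 1 (min d \<delta>1)" and v: "L2_supported \<Omega> v" and fv: "En \<gamma>1 \<delta> v < \<infinity>"
      have \<delta>': "\<delta> \<le> 1" "\<delta> < d" "\<delta> < \<delta>1" "\<delta> < \<delta>0" using \<delta>(2) \<delta>1 by auto
      obtain B where rep: "form_density A r R \<delta> B" using form_density_exists[OF \<delta>(1) A[OF \<delta>(1) \<delta>'(4)]] by blast
      note B = form_densityD(1-3)[OF rep] and BA = form_densityD(4)[OF rep] and T = form_densityD(5)[OF rep]
      let ?\<mu> = "kmeas \<gamma>1 \<delta> :: ('a \<times> 'a) measure"
      note fp = test_function_energy(1)[OF \<delta>(1) \<phi>]
      have s\<phi>: "sqint ?\<mu> (incr \<phi>)" using sqint_incr_iff[OF K \<delta>(1) mb] fp by simp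
      have sv: "sqint ?\<mu> (incr v)" using sqint_incr_iff[OF K \<delta>(1) L2_supportedD(2)[OF v]] fv by simp
      define \<beta>U where "\<beta>U x = indicator (cball 0 (\<rho> + 1)) x * \<beta> x" for x
      have mU[measurable]: "\<beta>U \<in> borel_measurable borel" unfolding \<beta>U_def[abs_def]
        by (intro borel_measurable_times borel_measurable_indicator m\<beta>) simp
      \<comment> \<open>Set to 0 where \<open>\<phi>\<close> has no increment. Elsewhere one of the
        two points is in the domain, so both are in the extended domain and \<open>B\<close> agrees
        there with \<open>A\<close>.\<close>
      define G where "G p = (if incr \<phi> p = 0 then 0 else B p - \<beta>U (fst p))" for p
      note [measurable] = B(1) mb
      have mG: "G \<in> borel_measurable ?\<mu>" unfolding G_def[abs_def] by measurable
      have mB: "B \<in> borel_measurable ?\<mu>" by measurable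
      have bB: "AE p in ?\<mu>. \<bar>B p\<bar> \<le> R"
      proof (rule AE_I2)
        fix p show "\<bar>B p\<bar> \<le> R" using B(2)[of p] B(3)[of p] r by linarith
      qed
      have bG: "AE p in ?\<mu>. \<bar>G p\<bar> \<le> 2 * \<kappa>'"
        using BA AE_kmeas_near[OF K \<delta>(1)]
      proof eventually_elim
        case (elim p)
        show ?case
        proof (cases "incr \<phi> p = 0")
          case False
          define x where "x = fst p"
          define h where "h = snd p"
          have nz: "\<phi> x \<noteq> 0 \<or> \<phi> (x + h) \<noteq> 0" using False by (auto simp: incr_def x_def h_def)
          have h: "norm h < \<delta>" using elim(2) by (simp add: h_def)
          have "x \<in> \<Omega> \<or> x + h \<in> \<Omega>" using nz test_function_supported(2)[OF \<phi>] by blast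
          then have ext: "x \<in> extended_domain \<Omega> \<delta>" "x + h \<in> extended_domain \<Omega> \<delta>"
            using near_in_extended_domain[OF domain_facts(1)[OF dom], of x "x + h" \<delta>] near_in_extended_domain[OF domain_facts(1)[OF dom], of "x + h" x \<delta>] h
            by (auto simp: extended_domain_eq)
          have BAx: "B p = A x (x + h)" using elim(1) ext by (simp add: x_def h_def)
          have inD: "x \<in> closure D" "x + h \<in> closure D"
            using ext \<delta>'(3) DD by (force simp: D_def extended_domain_eq)+
          have "dist (x, x + h) (x, x) = norm h" by (simp add: dist_Pair_Pair dist_norm)
          then have "dist ((\<lambda>(x, y). A x y) (x, x + h)) ((\<lambda>(x, y). A x y) (x, x)) < \<kappa>'"
            using inD h \<delta>'(2) by (intro d(2)) (auto simp: E_def)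
          then have 1: "\<bar>A x (x + h) - A x x\<bar> < \<kappa>'" by (simp add: dist_real_def)
          have "norm x < \<rho> + 1"
          proof (rule ccontr)
            assume "\<not> norm x < \<rho> + 1"
            then have "\<rho> \<le> norm x" "\<rho> \<le> norm (x + h)"
              using h \<delta>'(1) norm_triangle_ineq4[of "x + h" h] by auto
            then show False using nz \<rho>(2) by blast
          qed
          then have "\<beta>U x = \<beta> x" by (simp add: \<beta>U_def)
          moreover have "\<bar>A x x - \<beta> x\<bar> < \<kappa>'" by (rule \<beta>(2)[OF inD(1)])
          ultimately show ?thesis using 1 False BAx by (simp add: G_def x_def)
        qed (use \<kappa>'(1) in \<open>simp add: G_def\<close>)
      qed
      have i1: "integrable ?\<mu> (\<lambda>p. B p * (incr \<phi> p * incr v p))" using integrable_coeff_inner[OF s\<phi> sv mB bB] by simp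
      have i2: "integrable ?\<mu> (\<lambda>p. G p * (incr \<phi> p * incr v p))" using integrable_coeff_inner[OF s\<phi> sv mG bG] by simp
      have pt: "\<beta>U (fst p) * (incr \<phi> p * incr v p) = B p * (incr \<phi> p * incr v p) - G p * (incr \<phi> p * incr v p)" for p
        by (simp add: G_def algebra_simps)
      have eq: "(LINT p|?\<mu>. \<beta>U (fst p) * (incr \<phi> p * incr v p)) = T_form \<Omega> \<gamma>1 A \<delta> \<phi> v - (LINT p|?\<mu>. G p * (incr \<phi> p * incr v p))"
        unfolding pt Bochner_Integration.integral_diff[OF i1 i2] T[OF test_function_supported(1)[OF \<phi>] v fp fv] by simp
      have Gle: "\<bar>LINT p|?\<mu>. G p * (incr \<phi> p * incr v p)\<bar> \<le> \<kappa> * Sn \<gamma>1 \<delta> v"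
      proof -
        have "\<bar>LINT p|?\<mu>. G p * (incr \<phi> p * incr v p)\<bar> \<le> 2 * \<kappa>' * (Sn \<gamma>1 \<delta> \<phi> * Sn \<gamma>1 \<delta> v)"
          using integral_coeff_inner_le[OF s\<phi> sv mG bG] \<kappa>'(1) by simp
        also have "\<dots> \<le> 2 * \<kappa>' * (N * Sn \<gamma>1 \<delta> v)"
          using N(2)[OF \<delta>(1)] \<kappa>'(1) by (intro mult_left_mono mult_right_mono) auto
        also have "\<dots> = (2 * \<kappa>' * N) * Sn \<gamma>1 \<delta> v" by (simp only: mult.assoc)
        also have "\<dots> \<le> \<kappa> * Sn \<gamma>1 \<delta> v" by (rule mult_right_mono[OF \<kappa>'(3)]) simp
        finally show ?thesis .
      qed
      have "\<bar>(LINT p|?\<mu>. \<beta>U (fst p) * (incr \<phi> p * incr v p)) + (LINT x|lborel. (\<Sum>b\<in>Basis. pd b (\<lambda>x. \<beta> x * pd b \<phi> x) x) * v x)\<bar> \<le> C * \<delta> * (Sn \<gamma>1 \<delta> v + l2norm lborel v)"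
        unfolding \<beta>U_def by (rule le[OF \<delta>(1) \<delta>'(1) L2_supportedD(1)[OF v] fv])
      then show "\<bar>T_form \<Omega> \<gamma>1 A \<delta> \<phi> v + (LINT x|lborel. (\<Sum>b\<in>Basis. pd b (\<lambda>x. \<beta> x * pd b \<phi> x) x) * v x)\<bar>
        \<le> \<kappa> * Sn \<gamma>1 \<delta> v + C * \<delta> * (Sn \<gamma>1 \<delta> v + l2norm lborel v)"
        using Gle unfolding eq by linarith
    qed
  qed
qed

text \<open>Hides the partition of unity behind the five properties used later, with
  \<open>C\<close> independent of function, scale and horizon. The energy bound leaves scale and
  horizon unrelated; the rate and the gradient bound tie the scale to \<delta>/4.\<close>

definition smoothing :: "(real \<Rightarrow> ('a \<Rightarrow> real) \<Rightarrow> 'a \<Rightarrow> real) \<Rightarrow> real \<Rightarrow> real \<Rightarrow> bool" where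
  "smoothing W t0 C \<longleftrightarrow> 0 < t0 \<and> 0 \<le> C \<and>
    (\<forall>t v. L2_supported \<Omega> v \<longrightarrow> 0 < t \<longrightarrow> t < t0 \<longrightarrow> W t v \<in> test_functions \<Omega>) \<and>
    (\<forall>v \<epsilon>. L2_supported \<Omega> v \<longrightarrow> 0 < \<epsilon> \<longrightarrow>
      (\<exists>\<tau>>0. \<forall>t. 0 < t \<longrightarrow> t < \<tau> \<longrightarrow> l2norm lborel (\<lambda>x. W t v x - v x) \<le> \<epsilon>)) \<and>
    (\<forall>t v \<delta>. L2_supported \<Omega> v \<longrightarrow> 0 < \<delta> \<longrightarrow> En \<gamma>1 \<delta> v < \<infinity> \<longrightarrow> 0 < t \<longrightarrow>
      Sn \<gamma>1 \<delta> (W t v) \<le> C * (Sn \<gamma>1 \<delta> v + l2norm lborel v)) \<and>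
    (\<forall>v \<delta>. L2_supported \<Omega> v \<longrightarrow> 0 < \<delta> \<longrightarrow> En \<gamma>1 \<delta> v < \<infinity> \<longrightarrow>
      l2norm lborel (\<lambda>x. W (\<delta> / 4) v x - v x) \<le> C * (Sn \<gamma>1 \<delta> v + l2norm lborel v) * \<delta>) \<and>
    (\<forall>v \<delta>. L2_supported \<Omega> v \<longrightarrow> 0 < \<delta> \<longrightarrow> En \<gamma>1 \<delta> v < \<infinity> \<longrightarrow> \<delta> / 4 < t0 \<longrightarrow>
      l2norm lborel (gradf (W (\<delta> / 4) v)) \<le> C * (Sn \<gamma>1 \<delta> v + l2norm lborel v))"

lemma smoothingD:
  assumes "smoothing W t0 C"
  shows "0 < t0" "0 \<le> C"
    "L2_supported \<Omega> v \<Longrightarrow> 0 < t \<Longrightarrow> t < t0 \<Longrightarrow> W t v \<in> test_functions \<Omega>"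
    "L2_supported \<Omega> v \<Longrightarrow> 0 < \<epsilon> \<Longrightarrow> \<exists>\<tau>>0. \<forall>t. 0 < t \<longrightarrow> t < \<tau> \<longrightarrow> l2norm lborel (\<lambda>x. W t v x - v x) \<le> \<epsilon>"
    "L2_supported \<Omega> v \<Longrightarrow> 0 < \<delta> \<Longrightarrow> En \<gamma>1 \<delta> v < \<infinity> \<Longrightarrow> 0 < t \<Longrightarrow>
      Sn \<gamma>1 \<delta> (W t v) \<le> C * (Sn \<gamma>1 \<delta> v + l2norm lborel v)"
    "L2_supported \<Omega> v \<Longrightarrow> 0 < \<delta> \<Longrightarrow> En \<gamma>1 \<delta> v < \<infinity> \<Longrightarrow>
      l2norm lborel (\<lambda>x. W (\<delta> / 4) v x - v x) \<le> C * (Sn \<gamma>1 \<delta> v + l2norm lborel v) * \<delta>"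
    "L2_supported \<Omega> v \<Longrightarrow> 0 < \<delta> \<Longrightarrow> En \<gamma>1 \<delta> v < \<infinity> \<Longrightarrow> \<delta> / 4 < t0 \<Longrightarrow>
      l2norm lborel (gradf (W (\<delta> / 4) v)) \<le> C * (Sn \<gamma>1 \<delta> v + l2norm lborel v)"
proof -
  note a1 = assms[unfolded smoothing_def]
  note a2 = conjunct2[OF a1]
  note a3 = conjunct2[OF a2]
  note a4 = conjunct2[OF a3]
  note a5 = conjunct2[OF a4]
  note a6 = conjunct2[OF a5]
  show "0 < t0" by (rule conjunct1[OF a1])
  show "0 \<le> C" by (rule conjunct1[OF a2])
  show "L2_supported \<Omega> v \<Longrightarrow> 0 < t \<Longrightarrow> t < t0 \<Longrightarrow> W t v \<in> test_functions \<Omega>"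
    by (rule conjunct1[OF a3, rule_format])
  show "L2_supported \<Omega> v \<Longrightarrow> 0 < \<epsilon> \<Longrightarrow> \<exists>\<tau>>0. \<forall>t. 0 < t \<longrightarrow> t < \<tau> \<longrightarrow> l2norm lborel (\<lambda>x. W t v x - v x) \<le> \<epsilon>"
    by (rule conjunct1[OF a4, rule_format])
  show "L2_supported \<Omega> v \<Longrightarrow> 0 < \<delta> \<Longrightarrow> En \<gamma>1 \<delta> v < \<infinity> \<Longrightarrow> 0 < t \<Longrightarrow>
      Sn \<gamma>1 \<delta> (W t v) \<le> C * (Sn \<gamma>1 \<delta> v + l2norm lborel v)"
    by (rule conjunct1[OF a5, rule_format])
  show "L2_supported \<Omega> v \<Longrightarrow> 0 < \<delta> \<Longrightarrow> En \<gamma>1 \<delta> v < \<infinity> \<Longrightarrow>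
      l2norm lborel (\<lambda>x. W (\<delta> / 4) v x - v x) \<le> C * (Sn \<gamma>1 \<delta> v + l2norm lborel v) * \<delta>"
    by (rule conjunct1[OF a6, rule_format])
  show "L2_supported \<Omega> v \<Longrightarrow> 0 < \<delta> \<Longrightarrow> En \<gamma>1 \<delta> v < \<infinity> \<Longrightarrow> \<delta> / 4 < t0 \<Longrightarrow>
      l2norm lborel (gradf (W (\<delta> / 4) v)) \<le> C * (Sn \<gamma>1 \<delta> v + l2norm lborel v)"
    by (rule conjunct2[OF a6, rule_format])
qed

lemma smoothing_exists: "\<exists>W t0 C. smoothing W t0 C"
proof -
  obtain P e c t0 \<theta> L where part: "inward_partition \<Omega> P e c t0 \<theta> L"
    using inward_partition_exists[OF dom] by blast
  note bdd = domain_facts(2)[OF dom]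
  note pf = partition_facts[OF part bdd]
  obtain B0 where B0: "\<And>x::'a. \<bar>bump x\<bar> \<le> B0" using test_functions_bounded[OF bump(1)] by blast
  have B0': "bump x \<le> B0" for x :: 'a using B0[of x] by linarith
  have "\<forall>b\<in>Basis. \<exists>B. \<forall>x::'a. \<bar>pd b bump x\<bar> \<le> B"
  proof
    fix b :: 'a assume b: "b \<in> Basis"
    show "\<exists>B. \<forall>x::'a. \<bar>pd b bump x\<bar> \<le> B" using test_functions_bounded[OF test_functions_pd[OF bump(1) b]] by blast
  qed
  from bchoice[OF this] obtain B where B: "\<And>b x. b \<in> Basis \<Longrightarrow> \<bar>pd b bump (x::'a)\<bar> \<le> B b" by blast
  define N where "N b = (LINT x|lborel. \<bar>pd b bump (x::'a)\<bar>)" for b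
  have N: "(\<integral>\<^sup>+x. ennreal \<bar>pd b bump (x::'a)\<bar> \<partial>lborel) \<le> ennreal (N b)" "0 \<le> N b" if b: "b \<in> Basis" for b
  proof -
    have i: "integrable lborel (\<lambda>x::'a. \<bar>pd b bump x\<bar>)"
      using test_functions_integrable(1)[OF test_functions_pd[OF bump(1) b]] by simp
    show "(\<integral>\<^sup>+x. ennreal \<bar>pd b bump (x::'a)\<bar> \<partial>lborel) \<le> ennreal (N b)" unfolding N_def
      by (subst nn_integral_eq_integral[OF i]) simp_all
    show "0 \<le> N b" unfolding N_def by simp
  qed
  define q where "q = 2 + 2 * L\<^sup>2 * real DIM('a)"
  define C1 where "C1 = real (card P) * sqrt q"
  define C2 where "C2 = real (card P) * sqrt ((8 / c) ^ DIM('a) * B0 / \<gamma>1 (1/2) * q)"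
  define C3 where "C3 b = real (card P) * sqrt ((8 / c) ^ (DIM('a) + 2) * N b * B b / \<gamma>1 (1/2) * q)" for b
  define C where "C = \<bar>C1\<bar> + \<bar>C2\<bar> + (\<Sum>b\<in>Basis. \<bar>C3 b\<bar>)"
  have Csum: "0 \<le> (\<Sum>b\<in>Basis. \<bar>C3 b\<bar>)" by (rule sum_nonneg) simp
  have C: "0 \<le> C" "C1 \<le> C" "C2 \<le> C" "(\<Sum>b\<in>Basis. \<bar>C3 b\<bar>) \<le> C" unfolding C_def using Csum by linarith+
  \<comment> \<open>Replaces a root of a sum of squares by the sum, so that all bounds become linear
    in the same quantity.\<close>
  have sq: "sqrt (k * ((Sn \<gamma>1 \<delta> v)\<^sup>2 + (l2norm lborel v)\<^sup>2)) \<le> \<bar>sqrt k\<bar> * (Sn \<gamma>1 \<delta> v + l2norm lborel v)" for k \<delta> and v :: "'a \<Rightarrow> real"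
  proof -
    have "sqrt ((Sn \<gamma>1 \<delta> v)\<^sup>2 + (l2norm lborel v)\<^sup>2) \<le> Sn \<gamma>1 \<delta> v + l2norm lborel v"
      by (rule sqrt_sum_squares_le_sum) simp_all
    then have "\<bar>sqrt k\<bar> * sqrt ((Sn \<gamma>1 \<delta> v)\<^sup>2 + (l2norm lborel v)\<^sup>2) \<le> \<bar>sqrt k\<bar> * (Sn \<gamma>1 \<delta> v + l2norm lborel v)"
      by (rule mult_left_mono) simp
    moreover have "sqrt k * sqrt ((Sn \<gamma>1 \<delta> v)\<^sup>2 + (l2norm lborel v)\<^sup>2) \<le> \<bar>sqrt k\<bar> * sqrt ((Sn \<gamma>1 \<delta> v)\<^sup>2 + (l2norm lborel v)\<^sup>2)"
      by (rule mult_right_mono) simp_all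
    ultimately show ?thesis by (simp only: real_sqrt_mult)
  qed
  have "smoothing (smooth_op P e c \<theta>) t0 C" unfolding smoothing_def
  proof (intro conjI allI impI)
    show "0 < t0" "0 \<le> C" by (rule pf(4), rule C(1))
  next
    fix t v assume v: "L2_supported \<Omega> v" and t: "0 < t" "t < t0"
    show "smooth_op P e c \<theta> t v \<in> test_functions \<Omega>"
      by (rule smooth_op_test_function[OF part bdd L2_supportedD(1)[OF v] L2_supportedD(3)[OF v] t])
  next
    fix v and \<epsilon> :: real assume v: "L2_supported \<Omega> v" and \<epsilon>: "0 < \<epsilon>"
    show "\<exists>\<tau>>0. \<forall>t. 0 < t \<longrightarrow> t < \<tau> \<longrightarrow> l2norm lborel (\<lambda>x. smooth_op P e c \<theta> t v x - v x) \<le> \<epsilon>"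
      by (rule smooth_op_tendsto[OF part bdd L2_supportedD(1)[OF v] L2_supportedD(3)[OF v] \<epsilon>])
  next
    fix t :: real and v \<delta> assume v: "L2_supported \<Omega> v" and \<delta>: "0 < \<delta>" and fin: "En \<gamma>1 \<delta> v < \<infinity>" and t: "0 < t"
    note L = L2_supportedD(1)[OF v] L2_supportedD(3)[OF v]
    have x: "0 \<le> Sn \<gamma>1 \<delta> v + l2norm lborel v" by simp
    have "Sn \<gamma>1 \<delta> (smooth_op P e c \<theta> t v) \<le> real (card P) * (\<bar>sqrt q\<bar> * (Sn \<gamma>1 \<delta> v + l2norm lborel v))"
    proof (rule order_trans)
      show "Sn \<gamma>1 \<delta> (smooth_op P e c \<theta> t v) \<le> real (card P) * sqrt (q * ((Sn \<gamma>1 \<delta> v)\<^sup>2 + (l2norm lborel v)\<^sup>2))"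
        unfolding q_def by (rule smooth_op_energy(2)[OF part bdd L K \<delta> fin t])
    qed (rule mult_left_mono[OF sq], simp)
    also have "\<dots> \<le> C * (Sn \<gamma>1 \<delta> v + l2norm lborel v)"
      using mult_right_mono[OF C(2) x] by (simp add: C1_def q_def mult.assoc)
    finally show "Sn \<gamma>1 \<delta> (smooth_op P e c \<theta> t v) \<le> C * (Sn \<gamma>1 \<delta> v + l2norm lborel v)" .
  next
    fix v \<delta> assume v: "L2_supported \<Omega> v" and \<delta>: "0 < \<delta>" and fin: "En \<gamma>1 \<delta> v < \<infinity>"
    note L = L2_supportedD(1)[OF v] L2_supportedD(3)[OF v]
    define k where "k = (8 / c) ^ DIM('a) * B0 / \<gamma>1 (1/2) * q"
    have x: "0 \<le> (Sn \<gamma>1 \<delta> v + l2norm lborel v) * \<delta>" using \<delta> by simp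
    have B00: "0 \<le> B0" using B0[of 0] by linarith
    have k0: "0 \<le> k" unfolding k_def q_def using pf(2) B00 kernel_profile(4)[OF K] by (intro mult_nonneg_nonneg divide_nonneg_nonneg) auto
    have "l2norm lborel (\<lambda>x. smooth_op P e c \<theta> (\<delta> / 4) v x - v x) \<le> real (card P) * (\<delta> * sqrt (k * ((Sn \<gamma>1 \<delta> v)\<^sup>2 + (l2norm lborel v)\<^sup>2)))"
      unfolding k_def q_def by (rule smooth_op_approx[OF part bdd L K \<delta> fin B0'])
    also have "\<dots> \<le> real (card P) * (\<delta> * (\<bar>sqrt k\<bar> * (Sn \<gamma>1 \<delta> v + l2norm lborel v)))"
      by (intro mult_left_mono sq) (use \<delta> in auto)
    also have "\<dots> = C2 * ((Sn \<gamma>1 \<delta> v + l2norm lborel v) * \<delta>)" unfolding C2_def k_def[symmetric] using k0 by simp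
    also have "\<dots> \<le> C * ((Sn \<gamma>1 \<delta> v + l2norm lborel v) * \<delta>)" by (rule mult_right_mono[OF C(3) x])
    finally show "l2norm lborel (\<lambda>x. smooth_op P e c \<theta> (\<delta> / 4) v x - v x) \<le> C * (Sn \<gamma>1 \<delta> v + l2norm lborel v) * \<delta>"
      by (simp only: mult.assoc)
  next
    fix v \<delta> assume v: "L2_supported \<Omega> v" and \<delta>: "0 < \<delta>" and fin: "En \<gamma>1 \<delta> v < \<infinity>" and t: "\<delta> / 4 < t0"
    note L = L2_supportedD(1)[OF v] L2_supportedD(3)[OF v]
    have d4: "0 < \<delta> / 4" using \<delta> by simp
    have x: "0 \<le> Sn \<gamma>1 \<delta> v + l2norm lborel v" by simp
    have le: "l2norm lborel (pd b (smooth_op P e c \<theta> (\<delta> / 4) v)) \<le> \<bar>C3 b\<bar> * (Sn \<gamma>1 \<delta> v + l2norm lborel v)" if b: "b \<in> Basis" for b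
    proof -
      define k where "k = (8 / c) ^ (DIM('a) + 2) * N b * B b / \<gamma>1 (1/2) * q"
      have "l2norm lborel (pd b (smooth_op P e c \<theta> (\<delta> / 4) v)) \<le> real (card P) * sqrt (k * ((Sn \<gamma>1 \<delta> v)\<^sup>2 + (l2norm lborel v)\<^sup>2))"
        unfolding k_def q_def by (rule smooth_op_gradient[OF part bdd L K \<delta> fin b B[OF b] N(1)[OF b] N(2)[OF b]])
      also have "\<dots> \<le> real (card P) * (\<bar>sqrt k\<bar> * (Sn \<gamma>1 \<delta> v + l2norm lborel v))"
        by (intro mult_left_mono sq) auto
      also have "\<dots> = \<bar>C3 b\<bar> * (Sn \<gamma>1 \<delta> v + l2norm lborel v)" unfolding C3_def k_def[symmetric] by (simp add: abs_mult)
      finally show ?thesis .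
    qed
    have "l2norm lborel (gradf (smooth_op P e c \<theta> (\<delta> / 4) v)) \<le> (\<Sum>b\<in>Basis. l2norm lborel (pd b (smooth_op P e c \<theta> (\<delta> / 4) v)))"
      by (rule gradf_facts(4)[OF smooth_op_test_function[OF part bdd L d4 t]])
    also have "\<dots> \<le> (\<Sum>b\<in>Basis. \<bar>C3 b\<bar> * (Sn \<gamma>1 \<delta> v + l2norm lborel v))" by (rule sum_mono[OF le])
    also have "\<dots> = (\<Sum>b\<in>Basis. \<bar>C3 b\<bar>) * (Sn \<gamma>1 \<delta> v + l2norm lborel v)" by (rule sum_distrib_right[symmetric])
    also have "\<dots> \<le> C * (Sn \<gamma>1 \<delta> v + l2norm lborel v)" by (rule mult_right_mono[OF C(4) x])
    finally show "l2norm lborel (gradf (smooth_op P e c \<theta> (\<delta> / 4) v)) \<le> C * (Sn \<gamma>1 \<delta> v + l2norm lborel v)" .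
  qed
  then show ?thesis by blast
qed

text \<open>As an iterated integral the form cannot be expanded without integrability; the
  representation by one bounded density supplies it and makes the symmetry visible.\<close>

lemma T_form_algebra:
  assumes \<delta>: "0 < \<delta>" and A: "coefficient_conditions \<Omega> r R A \<delta>" and r: "0 < r"
    and v: "L2_supported \<Omega> v" "En \<gamma>1 \<delta> v < \<infinity>" and w: "L2_supported \<Omega> w" "En \<gamma>1 \<delta> w < \<infinity>"
  shows "T_form \<Omega> \<gamma>1 A \<delta> w v = T_form \<Omega> \<gamma>1 A \<delta> v w"
    "T_form \<Omega> \<gamma>1 A \<delta> (\<lambda>x. v x - w x) (\<lambda>x. v x - w x)
      = T_form \<Omega> \<gamma>1 A \<delta> v v - 2 * T_form \<Omega> \<gamma>1 A \<delta> v w + T_form \<Omega> \<gamma>1 A \<delta> w w"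
proof -
  obtain B where rep: "form_density A r R \<delta> B" using form_density_exists[OF \<delta> A] by blast
  note B = form_densityD(1-3)[OF rep] and T = form_densityD(5)[OF rep]
  have mB: "B \<in> borel_measurable (kmeas \<gamma>1 \<delta>)" using B(1) by measurable
  have bB: "AE p in kmeas \<gamma>1 \<delta>. \<bar>B p\<bar> \<le> R"
  proof (rule AE_I2)
    fix p show "\<bar>B p\<bar> \<le> R" using B(2)[of p] B(3)[of p] r by linarith
  qed
  have s: "sqint (kmeas \<gamma>1 \<delta>) (incr v)" "sqint (kmeas \<gamma>1 \<delta>) (incr w)"
    using sqint_incr_iff[OF K \<delta> L2_supportedD(2)[OF v(1)]] sqint_incr_iff[OF K \<delta> L2_supportedD(2)[OF w(1)]] v(2) w(2) by auto
  have i: "integrable (kmeas \<gamma>1 \<delta>) (\<lambda>p. B p * (incr v p * incr v p))"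
    "integrable (kmeas \<gamma>1 \<delta>) (\<lambda>p. B p * (incr v p * incr w p))"
    "integrable (kmeas \<gamma>1 \<delta>) (\<lambda>p. B p * (incr w p * incr w p))"
    using integrable_coeff_inner[OF s(1) s(1) mB bB] integrable_coeff_inner[OF s(1) s(2) mB bB]
      integrable_coeff_inner[OF s(2) s(2) mB bB] by simp_all
  show "T_form \<Omega> \<gamma>1 A \<delta> w v = T_form \<Omega> \<gamma>1 A \<delta> v w"
    unfolding T[OF w(1) v(1) w(2) v(2)] T[OF v(1) w(1) v(2) w(2)] by (simp only: mult.commute)
  have d: "L2_supported \<Omega> (\<lambda>x. v x - w x)" "En \<gamma>1 \<delta> (\<lambda>x. v x - w x) < \<infinity>"
    by (rule L2_supported_diff[OF v(1) w(1)], rule En_diff(1)[OF \<delta> v w])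
  have "T_form \<Omega> \<gamma>1 A \<delta> (\<lambda>x. v x - w x) (\<lambda>x. v x - w x)
    = (LINT p|kmeas \<gamma>1 \<delta>. B p * (incr v p * incr v p) - 2 * (B p * (incr v p * incr w p)) + B p * (incr w p * incr w p))"
    unfolding T[OF d(1) d(1) d(2) d(2)] incr_simps(2) by (rule Bochner_Integration.integral_cong) (simp_all add: algebra_simps)
  also have "\<dots> = T_form \<Omega> \<gamma>1 A \<delta> v v - 2 * T_form \<Omega> \<gamma>1 A \<delta> v w + T_form \<Omega> \<gamma>1 A \<delta> w w"
    unfolding T[OF v(1) v(1) v(2) v(2)] T[OF v(1) w(1) v(2) w(2)] T[OF w(1) w(1) w(2) w(2)] using i by simp
  finally show "T_form \<Omega> \<gamma>1 A \<delta> (\<lambda>x. v x - w x) (\<lambda>x. v x - w x)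
      = T_form \<Omega> \<gamma>1 A \<delta> v v - 2 * T_form \<Omega> \<gamma>1 A \<delta> v w + T_form \<Omega> \<gamma>1 A \<delta> w w" .
qed

text \<open>The diagonal is a null set of the product, so membership in \<open>Linf\<close> says
  nothing there: measurability comes from continuity, and the bound from the pointwise
  inequalities.\<close>

lemma diagonal_coefficient:
  assumes \<delta>: "0 < \<delta>" and A: "coefficient_conditions \<Omega> r R A \<delta>" and r: "0 < r"
    and cont: "continuous_on (closure (extended_domain \<Omega> \<delta> \<times> extended_domain \<Omega> \<delta>)) (\<lambda>(x, y). A x y)"
  shows "(\<lambda>x. A x x) \<in> borel_measurable (lebesgue_on \<Omega>)" "x \<in> \<Omega> \<Longrightarrow> \<bar>A x x\<bar> \<le> R" "0 \<le> R"
proof -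
  have sub: "\<Omega> \<subseteq> extended_domain \<Omega> \<delta>" by (auto simp: extended_domain_def)
  have "continuous_on \<Omega> ((\<lambda>(x, y). A x y) \<circ> (\<lambda>x. (x, x)))"
  proof (rule continuous_on_compose)
    show "continuous_on \<Omega> (\<lambda>x. (x, x))" by (intro continuous_on_Pair continuous_on_id)
    show "continuous_on ((\<lambda>x. (x, x)) ` \<Omega>) (\<lambda>(x, y). A x y)"
    proof (rule continuous_on_subset[OF cont])
      have "(\<lambda>x. (x, x)) ` \<Omega> \<subseteq> extended_domain \<Omega> \<delta> \<times> extended_domain \<Omega> \<delta>" using sub by auto
      then show "(\<lambda>x. (x, x)) ` \<Omega> \<subseteq> closure (extended_domain \<Omega> \<delta> \<times> extended_domain \<Omega> \<delta>)"
        by (rule order_trans[OF _ closure_subset])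
    qed
  qed
  then have "continuous_on \<Omega> (\<lambda>x. A x x)" by (simp add: o_def)
  then show "(\<lambda>x. A x x) \<in> borel_measurable (lebesgue_on \<Omega>)"
    by (rule continuous_imp_measurable_on_sets_lebesgue) (simp add: domain_facts(4)[OF dom])
  have b: "\<bar>A x x\<bar> \<le> R" if x: "x \<in> \<Omega>" for x
  proof -
    have "r \<le> A x x \<and> A x x \<le> R" using A subsetD[OF sub x] by (simp add: coefficient_conditions_def)
    then show ?thesis using r by linarith
  qed
  then show "x \<in> \<Omega> \<Longrightarrow> \<bar>A x x\<bar> \<le> R" .
  obtain x where "x \<in> \<Omega>" using domain_facts(3)[OF dom] by blast
  then show "0 \<le> R" using b[of x] by linarith
qed

text \<open>After \<open>T_form_approx\<close>, \<open>v\<close> is paired with a test function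
  built from derivatives of \<open>\<phi>\<close>. Exchanging \<open>v\<close> for its smooth
  companion \<open>w\<close> costs O(\<delta>); then one integrates by parts back to gradients and
  restores the diagonal of \<open>A\<close>. The threshold is uniform in \<open>v\<close> and
  \<open>w\<close>.\<close>

lemma T_form_consistent:
  assumes \<delta>0: "0 < \<delta>0" and A: "\<And>\<delta>. 0 < \<delta> \<Longrightarrow> \<delta> < \<delta>0 \<Longrightarrow> coefficient_conditions \<Omega> r R A \<delta>" and r: "0 < r"
    and cont: "\<And>\<delta>. 0 < \<delta> \<Longrightarrow> \<delta> < \<delta>0 \<Longrightarrow> continuous_on (closure (extended_domain \<Omega> \<delta> \<times> extended_domain \<Omega> \<delta>)) (\<lambda>(x, y). A x y)"
    and \<phi>: "\<phi> \<in> test_functions \<Omega>" and e: "0 < e" and m: "0 \<le> m"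
  obtains \<eta> where "0 < \<eta>" "\<eta> \<le> \<delta>0"
    "\<And>\<delta> v w. 0 < \<delta> \<Longrightarrow> \<delta> < \<eta> \<Longrightarrow> L2_supported \<Omega> v \<Longrightarrow> En \<gamma>1 \<delta> v < \<infinity> \<Longrightarrow> Sn \<gamma>1 \<delta> v \<le> m \<Longrightarrow> l2norm lborel v \<le> m \<Longrightarrow>
      w \<in> test_functions \<Omega> \<Longrightarrow> l2norm lborel (\<lambda>x. w x - v x) \<le> m * \<delta> \<Longrightarrow> l2norm lborel (gradf w) \<le> m \<Longrightarrow>
      \<bar>T_form \<Omega> \<gamma>1 A \<delta> \<phi> v - (LINT x|lebesgue_on \<Omega>. A x x * (gradf \<phi> x \<bullet> gradf w x))\<bar> \<le> e"
proof -
  define g where "g = l2norm lborel (gradf \<phi>)"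
  have g0: "0 \<le> g" by (simp add: g_def)
  \<comment> \<open>The approximation of the coefficient is paid for twice: against the energy of
    \<open>v\<close>, bounded by \<open>m\<close>, and against the gradients, bounded by
    \<open>g * m\<close>.\<close>
  define \<kappa> where "\<kappa> = e / (2 * (g * m + m + 1))"
  have gm: "0 < g * m + m + 1" using g0 m by (intro add_nonneg_pos add_nonneg_nonneg mult_nonneg_nonneg) auto
  have \<kappa>: "0 < \<kappa>" using e gm by (simp add: \<kappa>_def)
  have \<kappa>e: "\<kappa> * (g * m + m) \<le> e / 2"
  proof -
    have "\<kappa> * (g * m + m) \<le> \<kappa> * (g * m + m + 1)" using \<kappa> by (intro mult_left_mono) auto
    also have "\<dots> = e / 2" unfolding \<kappa>_def using gm by (simp add: field_simps)
    finally show ?thesis .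
  qed
  show ?thesis
  proof (rule T_form_approx[OF \<delta>0 A r cont \<phi> \<kappa>])
    fix \<beta> :: "'a \<Rightarrow> real" and \<eta> C :: real
    assume \<beta>: "\<And>k. Ck k \<beta>" "\<And>x. x \<in> \<Omega> \<Longrightarrow> \<bar>A x x - \<beta> x\<bar> \<le> \<kappa>" and \<eta>: "0 < \<eta>" "\<eta> \<le> \<delta>0" and C: "0 \<le> C"
      and T: "\<And>\<delta> v. 0 < \<delta> \<Longrightarrow> \<delta> < \<eta> \<Longrightarrow> L2_supported \<Omega> v \<Longrightarrow> En \<gamma>1 \<delta> v < \<infinity> \<Longrightarrow>
        \<bar>T_form \<Omega> \<gamma>1 A \<delta> \<phi> v + (LINT x|lborel. (\<Sum>b\<in>Basis. pd b (\<lambda>x. \<beta> x * pd b \<phi> x) x) * v x)\<bar>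
          \<le> \<kappa> * Sn \<gamma>1 \<delta> v + C * \<delta> * (Sn \<gamma>1 \<delta> v + l2norm lborel v)"
    define D where "D x = (\<Sum>b\<in>Basis. pd b (\<lambda>x. \<beta> x * pd b \<phi> x) x)" for x
    have CF: "Ck k (\<lambda>x. \<beta> x * pd b \<phi> x)" if b: "b \<in> Basis" for b k
      by (rule Ck_mult[OF \<beta>(1) test_functionsD(1)[OF test_functions_pd[OF \<phi> b]]])
    have Ft: "(\<lambda>x. \<beta> x * pd b \<phi> x) \<in> test_functions \<Omega>" if b: "b \<in> Basis" for b
      by (rule test_functions_Ck_mult[OF test_functions_pd[OF \<phi> b] \<beta>(1)])
    have Dt: "D \<in> test_functions \<Omega>" unfolding D_def[abs_def]
      by (rule test_functions_sum[OF finite_Basis test_functions_pd[OF Ft]])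
    have sD: "sqint lborel D" by (rule test_functions_integrable(2)[OF Dt])
    \<comment> \<open>Collects what is multiplied by \<delta>: the consistency error and the cost of
      exchanging \<open>v\<close> for \<open>w\<close>.\<close>
    define k where "k = C * (2 * m) + l2norm lborel D * m"
    have k0: "0 \<le> k" using C m by (simp add: k_def)
    define \<eta>' where "\<eta>' = min \<eta> (e / (2 * (k + 1)))"
    have \<eta>': "0 < \<eta>'" "\<eta>' \<le> \<eta>" "\<eta>' \<le> e / (2 * (k + 1))" using \<eta> e k0 by (auto simp: \<eta>'_def)
    show thesis
    proof (rule that)
      show "0 < \<eta>'" "\<eta>' \<le> \<delta>0" using \<eta>' \<eta> by auto
      fix \<delta> v w assume \<delta>: "0 < \<delta>" "\<delta> < \<eta>'" and v: "L2_supported \<Omega> v" and fv: "En \<gamma>1 \<delta> v < \<infinity>"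
        and Sv: "Sn \<gamma>1 \<delta> v \<le> m" and lv: "l2norm lborel v \<le> m" and w: "w \<in> test_functions \<Omega>"
        and wv: "l2norm lborel (\<lambda>x. w x - v x) \<le> m * \<delta>" and gw: "l2norm lborel (gradf w) \<le> m"
      have \<delta>\<eta>: "\<delta> < \<eta>" "\<delta> < \<delta>0" using \<delta> \<eta>' \<eta> by auto
      have \<delta>k: "\<delta> * k \<le> e / 2"
      proof -
        have "\<delta> * k \<le> \<delta> * (k + 1)" using \<delta> by (intro mult_left_mono) auto
        also have "\<dots> \<le> e / (2 * (k + 1)) * (k + 1)" using \<delta> \<eta>' k0 by (intro mult_right_mono) auto
        also have "\<dots> = e / 2" using k0 by (simp add: field_simps)
        finally show ?thesis .
      qed
      have sv: "sqint lborel v" and sw: "sqint lborel w"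
        by (rule L2_supportedD(1)[OF v], rule test_functions_integrable(2)[OF w])
      let ?M = "lebesgue_on \<Omega>"
      note a = diagonal_coefficient[OF \<delta>(1) A[OF \<delta>(1) \<delta>\<eta>(2)] r cont[OF \<delta>(1) \<delta>\<eta>(2)]]
      note t\<phi> = test_sqint[OF dom \<phi>] and tw = test_sqint[OF dom w]
      have m\<beta>b: "\<beta> \<in> borel_measurable borel" by (rule borel_measurable_continuous_onI[OF Ck_continuous[OF \<beta>(1)[of 0]]])
      have m\<beta>: "\<beta> \<in> borel_measurable ?M"
        by (rule measurable_restrict_space1[OF measurable_completion]) (use m\<beta>b in simp)
      have in\<Omega>: "AE x in ?M. x \<in> \<Omega>" by (rule AE_I2) (simp add: space_restrict_space)
      have aa: "AE x in ?M. \<bar>A x x\<bar> \<le> R" using in\<Omega> by eventually_elim (rule a(2))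
      have ab: "AE x in ?M. \<bar>A x x - \<beta> x\<bar> \<le> \<kappa>" using in\<Omega> by eventually_elim (rule \<beta>(2))
      have mab: "(\<lambda>x. A x x - \<beta> x) \<in> borel_measurable ?M" by (rule borel_measurable_diff[OF a(1) m\<beta>])
      have bb: "AE x in ?M. \<bar>\<beta> x\<bar> \<le> R + \<kappa>" using aa ab by eventually_elim linarith
      have ia: "integrable ?M (\<lambda>x. (A x x - \<beta> x) * (gradf \<phi> x \<bullet> gradf w x))"
        by (rule integrable_coeff_inner[OF t\<phi>(2) tw(2) mab ab])
      have ib: "integrable ?M (\<lambda>x. \<beta> x * (gradf \<phi> x \<bullet> gradf w x))"
        by (rule integrable_coeff_inner[OF t\<phi>(2) tw(2) m\<beta> bb])
      have I: "(LINT x|?M. A x x * (gradf \<phi> x \<bullet> gradf w x))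
        = (LINT x|?M. (A x x - \<beta> x) * (gradf \<phi> x \<bullet> gradf w x)) + (LINT x|?M. \<beta> x * (gradf \<phi> x \<bullet> gradf w x))"
        by (subst Bochner_Integration.integral_add[OF ia ib, symmetric]) (simp add: algebra_simps)
      have "\<bar>LINT x|?M. (A x x - \<beta> x) * (gradf \<phi> x \<bullet> gradf w x)\<bar> \<le> \<kappa> * (g * l2norm lborel (gradf w))"
        using integral_coeff_inner_le[OF t\<phi>(2) tw(2) mab ab less_imp_le[OF \<kappa>]] by (simp add: g_def t\<phi>(4) tw(4))
      also have "\<dots> \<le> \<kappa> * (g * m)" using \<kappa> g0 gw by (intro mult_left_mono) auto
      finally have I1: "\<bar>LINT x|?M. (A x x - \<beta> x) * (gradf \<phi> x \<bullet> gradf w x)\<bar> \<le> \<kappa> * (g * m)" .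
      have mF: "(\<lambda>x. \<beta> x * (gradf \<phi> x \<bullet> gradf w x)) \<in> borel_measurable borel"
        using m\<beta>b gradf_facts(1)[OF \<phi>] gradf_facts(1)[OF w] by measurable
      have "(LINT x|?M. \<beta> x * (gradf \<phi> x \<bullet> gradf w x)) = (LINT x|lborel. \<beta> x * (gradf \<phi> x \<bullet> gradf w x))"
        by (rule lebesgue_on_eq_lborel(2)[OF domain_facts(4)[OF dom] mF]) (simp_all add: gradf_facts(3)[OF \<phi>])
      also have "\<dots> = (LINT x|lborel. (\<Sum>b\<in>Basis. (\<beta> x * pd b \<phi> x) * pd b w x))"
        by (rule Bochner_Integration.integral_cong) (simp_all add: gradf_inner_gradf sum_distrib_left mult.assoc)
      also have "\<dots> = (\<Sum>b\<in>Basis. (LINT x|lborel. (\<beta> x * pd b \<phi> x) * pd b w x))"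
      proof (rule Bochner_Integration.integral_sum)
        fix b :: 'a assume b: "b \<in> Basis"
        show "integrable lborel (\<lambda>x. (\<beta> x * pd b \<phi> x) * pd b w x)"
          by (rule test_functions_integrable(1)[OF test_functions_Ck_mult[OF test_functions_pd[OF w b] CF[OF b]]])
      qed
      also have "\<dots> = (\<Sum>b\<in>Basis. - (LINT x|lborel. pd b (\<lambda>x. \<beta> x * pd b \<phi> x) x * w x))"
        by (intro sum.cong refl integral_pd_by_parts[OF w _ CF])
      also have "\<dots> = - (LINT x|lborel. (\<Sum>b\<in>Basis. pd b (\<lambda>x. \<beta> x * pd b \<phi> x) x * w x))"
        unfolding sum_negf
      proof (rule arg_cong[of _ _ uminus], rule Bochner_Integration.integral_sum[symmetric])
        fix b :: 'a assume b: "b \<in> Basis"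
        show "integrable lborel (\<lambda>x. pd b (\<lambda>x. \<beta> x * pd b \<phi> x) x * w x)"
          by (rule test_functions_integrable(1)[OF test_functions_Ck_mult[OF w test_functionsD(1)[OF test_functions_pd[OF Ft[OF b] b]]]])
      qed
      also have "\<dots> = - (LINT x|lborel. D x * w x)" by (simp add: D_def sum_distrib_right)
      finally have I2: "(LINT x|?M. \<beta> x * (gradf \<phi> x \<bullet> gradf w x)) = - (LINT x|lborel. D x * w x)" .
      \<comment> \<open>All derivatives sit in \<open>D\<close> at this point, so closeness of
        \<open>w\<close> and \<open>v\<close> in L2 is enough.\<close>
      have "\<bar>LINT x|lborel. D x \<bullet> (w x - v x)\<bar> \<le> l2norm lborel D * l2norm lborel (\<lambda>x. w x - v x)"
        by (rule integral_inner_le[OF sD sqint_diff(1)[OF sw sv]])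
      also have "\<dots> \<le> l2norm lborel D * (m * \<delta>)" by (rule mult_left_mono[OF wv]) simp
      also have "(LINT x|lborel. D x \<bullet> (w x - v x)) = (LINT x|lborel. D x * w x) - (LINT x|lborel. D x * v x)"
        using integrable_inner_sqint(2)[OF sD sw] integrable_inner_sqint(2)[OF sD sv] by (simp add: right_diff_distrib)
      finally have I3: "\<bar>(LINT x|lborel. D x * w x) - (LINT x|lborel. D x * v x)\<bar> \<le> l2norm lborel D * (m * \<delta>)" .
      have "\<bar>T_form \<Omega> \<gamma>1 A \<delta> \<phi> v + (LINT x|lborel. D x * v x)\<bar> \<le> \<kappa> * Sn \<gamma>1 \<delta> v + C * \<delta> * (Sn \<gamma>1 \<delta> v + l2norm lborel v)"
        unfolding D_def by (rule T[OF \<delta>(1) \<delta>\<eta>(1) v fv])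
      also have "\<dots> \<le> \<kappa> * m + C * \<delta> * (2 * m)"
        using Sv lv \<kappa> C \<delta> by (intro add_mono mult_left_mono) auto
      finally have I4: "\<bar>T_form \<Omega> \<gamma>1 A \<delta> \<phi> v + (LINT x|lborel. D x * v x)\<bar> \<le> \<kappa> * m + C * \<delta> * (2 * m)" .
      have "\<bar>T_form \<Omega> \<gamma>1 A \<delta> \<phi> v - (LINT x|?M. A x x * (gradf \<phi> x \<bullet> gradf w x))\<bar>
        \<le> (\<kappa> * m + C * \<delta> * (2 * m)) + l2norm lborel D * (m * \<delta>) + \<kappa> * (g * m)"
        unfolding I I2 using I1 I3 I4 by linarith
      also have "\<dots> = \<kappa> * (g * m + m) + \<delta> * k" by (simp add: k_def algebra_simps)
      also have "\<dots> \<le> e" using \<kappa>e \<delta>k by linarith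
      finally show "\<bar>T_form \<Omega> \<gamma>1 A \<delta> \<phi> v - (LINT x|?M. A x x * (gradf \<phi> x \<bullet> gradf w x))\<bar> \<le> e" .
    qed
  qed
qed

text \<open>The smoothed functions need not converge in the energy norm. Their energy stays bounded
  and is weighted by a small factor, while the L2 part of the estimate tends to 0.\<close>

lemma datum_by_smoothing:
  assumes \<delta>: "0 < \<delta>" and A: "coefficient_conditions \<Omega> r R A \<delta>" and r: "0 < r"
    and v: "L2_supported \<Omega> v" "En \<gamma>1 \<delta> v < \<infinity>" "nonlocal_weak_solution \<Omega> \<gamma>1 A \<delta> f v"
    and W: "smoothing W t0 C" and f: "\<And>\<phi>. \<phi> \<in> test_functions \<Omega> \<Longrightarrow> f \<phi> = f0 \<phi>"
    and w: "L2_supported \<Omega> w" "En \<gamma>1 \<delta> w < \<infinity>" and e: "0 < e"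
  shows "\<exists>\<tau>>0. \<forall>t. 0 < t \<longrightarrow> t < \<tau> \<longrightarrow> \<bar>f w - f0 (W t w)\<bar> \<le> e"
proof -
  note WD = smoothingD[OF W]
  define k where "k = Sn \<gamma>1 \<delta> w + C * (Sn \<gamma>1 \<delta> w + l2norm lborel w)"
  have k0: "0 \<le> k" unfolding k_def using WD(2) by (intro add_nonneg_nonneg mult_nonneg_nonneg) auto
  define e1 where "e1 = e / (2 * (k + 1))"
  have e1: "0 < e1" using e k0 by (simp add: e1_def)
  have e1k: "e1 * k \<le> e / 2"
  proof -
    have "e1 * k \<le> e1 * (k + 1)" using e1 by (intro mult_left_mono) auto
    also have "\<dots> = e / 2" unfolding e1_def using k0 by (simp add: field_simps)
    finally show ?thesis .
  qed
  show ?thesis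
  proof (rule solution_small_in_L2[OF \<delta> A r v e1])
    fix Cf assume Cf: "0 \<le> Cf" and le: "\<And>z w. L2_supported \<Omega> z \<Longrightarrow> En \<gamma>1 \<delta> z < \<infinity> \<Longrightarrow> L2_supported \<Omega> w \<Longrightarrow> En \<gamma>1 \<delta> w < \<infinity> \<Longrightarrow>
      \<bar>f z - f w\<bar> \<le> e1 * Sn \<gamma>1 \<delta> (\<lambda>x. z x - w x) + Cf * l2norm lborel (\<lambda>x. z x - w x)"
    define e2 where "e2 = e / (2 * (Cf + 1))"
    have e2: "0 < e2" using e Cf by (simp add: e2_def)
    have e2C: "Cf * e2 \<le> e / 2"
    proof -
      have "Cf * e2 \<le> (Cf + 1) * e2" using e2 by (intro mult_right_mono) auto
      also have "\<dots> = e / 2" unfolding e2_def using Cf by (simp add: field_simps)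
      finally show ?thesis .
    qed
    obtain \<tau> where \<tau>: "0 < \<tau>" "\<forall>t. 0 < t \<longrightarrow> t < \<tau> \<longrightarrow> l2norm lborel (\<lambda>x. W t w x - w x) \<le> e2"
      using WD(4)[OF w(1) e2] by (elim exE conjE)
    show ?thesis
    proof (intro exI[of _ "min \<tau> t0"] conjI allI impI)
      show "0 < min \<tau> t0" using \<tau>(1) WD(1) by simp
      fix t assume t: "0 < t" "t < min \<tau> t0"
      have Wt: "W t w \<in> test_functions \<Omega>" using WD(3)[OF w(1) t(1)] t(2) by simp
      note Ws = test_function_supported(1)[OF Wt] and We = test_function_energy(1)[OF \<delta> Wt]
      have "\<bar>f w - f (W t w)\<bar> \<le> e1 * Sn \<gamma>1 \<delta> (\<lambda>x. w x - W t w x) + Cf * l2norm lborel (\<lambda>x. w x - W t w x)"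
        by (rule le[OF w Ws We])
      also have "\<dots> \<le> e1 * k + Cf * e2"
      proof (intro add_mono mult_left_mono)
        show "Sn \<gamma>1 \<delta> (\<lambda>x. w x - W t w x) \<le> k"
          using En_diff(2)[OF \<delta> w Ws We] WD(5)[OF w(1) \<delta> w(2) t(1)] by (simp add: k_def)
        show "l2norm lborel (\<lambda>x. w x - W t w x) \<le> e2" using \<tau>(2) t l2norm_minus_commute[of lborel w "W t w"] by simp
      qed (use e1 Cf in auto)
      also have "\<dots> \<le> e" using e1k e2C by linarith
      finally show "\<bar>f w - f0 (W t w)\<bar> \<le> e" by (simp only: f[OF Wt])
    qed
  qed
qed

text \<open>Both values are limits of the common values on the same smoothed functions, which are
  test functions.\<close>

lemma datum_independent_of_horizon:
  assumes \<delta>: "0 < \<delta>" "0 < \<delta>'" and A: "coefficient_conditions \<Omega> r R A \<delta>" "coefficient_conditions \<Omega> r R A \<delta>'" and r: "0 < r"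
    and v: "L2_supported \<Omega> v" "En \<gamma>1 \<delta> v < \<infinity>" "nonlocal_weak_solution \<Omega> \<gamma>1 A \<delta> f v"
    and v': "L2_supported \<Omega> v'" "En \<gamma>1 \<delta>' v' < \<infinity>" "nonlocal_weak_solution \<Omega> \<gamma>1 A \<delta>' f' v'"
    and f: "\<And>\<phi>. \<phi> \<in> test_functions \<Omega> \<Longrightarrow> f \<phi> = f' \<phi>"
    and w: "L2_supported \<Omega> w" "En \<gamma>1 \<delta> w < \<infinity>" "En \<gamma>1 \<delta>' w < \<infinity>"
  shows "f w = f' w"
proof -
  obtain W t0 C where W: "smoothing W t0 C" using smoothing_exists by (elim exE)
  have "\<bar>f w - f' w\<bar> \<le> 0 + e" if e: "0 < e" for e
  proof -
    have e2: "0 < e / 2" using e by simp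
    have "\<exists>\<tau>>0. \<forall>t. 0 < t \<longrightarrow> t < \<tau> \<longrightarrow> \<bar>f w - f' (W t w)\<bar> \<le> e / 2"
      by (rule datum_by_smoothing[OF \<delta>(1) A(1) r v W f w(1,2) e2])
    then obtain \<tau> where \<tau>: "0 < \<tau>" "\<forall>t. 0 < t \<longrightarrow> t < \<tau> \<longrightarrow> \<bar>f w - f' (W t w)\<bar> \<le> e / 2"
      by (elim exE conjE)
    obtain \<tau>' where \<tau>': "0 < \<tau>'" "\<forall>t. 0 < t \<longrightarrow> t < \<tau>' \<longrightarrow> \<bar>f' w - f' (W t w)\<bar> \<le> e / 2"
      using datum_by_smoothing[OF \<delta>(2) A(2) r v' W refl w(1,3) e2] by (elim exE conjE)
    define t where "t = min \<tau> \<tau>' / 2"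
    have t: "0 < t" "t < \<tau>" "t < \<tau>'" using \<tau>(1) \<tau>'(1) by (auto simp: t_def)
    show ?thesis using \<tau>(2)[rule_format, OF t(1,2)] \<tau>'(2)[rule_format, OF t(1,3)] by linarith
  qed
  then have "\<bar>f w - f' w\<bar> \<le> 0" by (rule field_le_epsilon)
  then show ?thesis by simp
qed

section \<open>A uniformly bounded family of nonlocal solutions\<close>

context
  fixes A :: "'a \<Rightarrow> 'a \<Rightarrow> real" and r R \<delta>0 m Cp :: real
    and f :: "real \<Rightarrow> ('a \<Rightarrow> real) \<Rightarrow> real" and f0 :: "('a \<Rightarrow> real) \<Rightarrow> real" and v :: "real \<Rightarrow> 'a \<Rightarrow> real"
  assumes \<delta>0: "0 < \<delta>0" and r: "0 < r"
    and A: "\<And>\<delta>. 0 < \<delta> \<Longrightarrow> \<delta> < \<delta>0 \<Longrightarrow> coefficient_conditions \<Omega> r R A \<delta>"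
    and f: "\<And>\<delta> \<phi>. 0 < \<delta> \<Longrightarrow> \<delta> < \<delta>0 \<Longrightarrow> \<phi> \<in> test_functions \<Omega> \<Longrightarrow> f \<delta> \<phi> = f0 \<phi>"
    and v: "\<And>\<delta>. 0 < \<delta> \<Longrightarrow> \<delta> < \<delta>0 \<Longrightarrow> L2_supported \<Omega> (v \<delta>)"
      "\<And>\<delta>. 0 < \<delta> \<Longrightarrow> \<delta> < \<delta>0 \<Longrightarrow> En \<gamma>1 \<delta> (v \<delta>) < \<infinity>"
      "\<And>\<delta>. 0 < \<delta> \<Longrightarrow> \<delta> < \<delta>0 \<Longrightarrow> nonlocal_weak_solution \<Omega> \<gamma>1 A \<delta> (f \<delta>) (v \<delta>)"
    and m: "\<And>\<delta>. 0 < \<delta> \<Longrightarrow> \<delta> < \<delta>0 \<Longrightarrow> Sn \<gamma>1 \<delta> (v \<delta>) \<le> m" "\<And>\<delta>. 0 < \<delta> \<Longrightarrow> \<delta> < \<delta>0 \<Longrightarrow> l2norm lborel (v \<delta>) \<le> m"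
begin

lemma solution_bound_nonneg: "0 \<le> m"
proof -
  have "0 \<le> l2norm lborel (v (\<delta>0 / 2))" by simp
  also have "\<dots> \<le> m" using \<delta>0 by (intro m(2)) auto
  finally show ?thesis .
qed

text \<open>Applied at the own horizon of each solution, \<open>solution_small_in_L2\<close> would
  give a constant depending on \<delta>. Passing to one fixed horizon fixes the constant, and the L2
  error of order \<delta> then beats it.\<close>

lemma datum_on_solutions:
  assumes W: "smoothing W t0 C" and e: "0 < e"
  shows "\<forall>\<^sub>F \<delta> in at_right 0. \<bar>f \<delta> (v \<delta>) - f0 (W (\<delta> / 4) (v \<delta>))\<bar> \<le> e"
proof -
  note WD = smoothingD[OF W] and m0 = solution_bound_nonneg
  define \<delta>1 where "\<delta>1 = \<delta>0 / 2"
  have \<delta>1: "0 < \<delta>1" "\<delta>1 < \<delta>0" using \<delta>0 by (auto simp: \<delta>1_def)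
  \<comment> \<open>The factor of \<open>Sn_larger_horizon\<close> concerns squares; as it is at
    least 1, it also serves for the norms.\<close>
  define c where "c = (2::real) ^ (DIM('a) + 2)"
  have c1: "1 \<le> c" unfolding c_def by (rule one_le_power) simp
  define k where "k = c * m + C * (c * m + m)"
  have k0: "0 \<le> k" unfolding k_def using WD(2) c1 m0 by (intro add_nonneg_nonneg mult_nonneg_nonneg) auto
  define e1 where "e1 = e / (2 * (k + 1))"
  have e1: "0 < e1" using e k0 by (simp add: e1_def)
  have e1k: "e1 * k \<le> e / 2"
  proof -
    have "e1 * k \<le> e1 * (k + 1)" using e1 by (intro mult_left_mono) auto
    also have "\<dots> = e / 2" unfolding e1_def using k0 by (simp add: field_simps)
    finally show ?thesis .
  qed
  show ?thesis
  proof (rule solution_small_in_L2[OF \<delta>1(1) A[OF \<delta>1] r v(1)[OF \<delta>1] v(2)[OF \<delta>1] v(3)[OF \<delta>1] e1])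
    fix Cf assume Cf: "0 \<le> Cf" and le: "\<And>z w. L2_supported \<Omega> z \<Longrightarrow> En \<gamma>1 \<delta>1 z < \<infinity> \<Longrightarrow> L2_supported \<Omega> w \<Longrightarrow> En \<gamma>1 \<delta>1 w < \<infinity> \<Longrightarrow>
      \<bar>f \<delta>1 z - f \<delta>1 w\<bar> \<le> e1 * Sn \<gamma>1 \<delta>1 (\<lambda>x. z x - w x) + Cf * l2norm lborel (\<lambda>x. z x - w x)"
    define q where "q = Cf * (C * (m + m))"
    have q0: "0 \<le> q" unfolding q_def using Cf WD(2) m0 by simp
    \<comment> \<open>\<open>\<delta>1\<close> allows the change of horizon, \<open>4 * t0\<close>
      makes the smoothing a test function, and the third term absorbs the error of order
      \<delta>.\<close>
    define \<eta> where "\<eta> = min \<delta>1 (min (4 * t0) (e / (2 * (q + 1))))"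
    have \<eta>: "0 < \<eta>" "\<eta> \<le> \<delta>1" "\<eta> \<le> 4 * t0" "\<eta> \<le> e / (2 * (q + 1))"
      using \<delta>1 WD(1) e q0 by (auto simp: \<eta>_def)
    show ?thesis
    proof (rule eventually_at_rightI[OF _ \<eta>(1)])
      fix \<delta> assume "\<delta> \<in> {0<..<\<eta>}"
      then have \<delta>: "0 < \<delta>" "\<delta> < \<eta>" by auto
      have \<delta>': "\<delta> \<le> \<delta>1" "\<delta> < \<delta>0" "0 < \<delta> / 4" "\<delta> / 4 < t0" using \<delta> \<eta> \<delta>1 by auto
      note vs = v(1)[OF \<delta>(1) \<delta>'(2)] and ve = v(2)[OF \<delta>(1) \<delta>'(2)] and m' = m[OF \<delta>(1) \<delta>'(2)]
      note lh = Sn_larger_horizon[OF K \<delta>(1) \<delta>'(1) L2_supportedD(2)[OF vs] ve]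
      have "(Sn \<gamma>1 \<delta>1 (v \<delta>))\<^sup>2 \<le> c * m\<^sup>2"
      proof (rule order_trans)
        show "(Sn \<gamma>1 \<delta>1 (v \<delta>))\<^sup>2 \<le> c * (Sn \<gamma>1 \<delta> (v \<delta>))\<^sup>2" unfolding c_def by (rule lh(2))
      qed (intro mult_left_mono power_mono m'(1), use c1 in simp_all)
      also have "\<dots> \<le> (c * m)\<^sup>2"
        using mult_right_mono[OF c1, of "c * m\<^sup>2"] c1 by (simp add: power2_eq_square mult.assoc mult.left_commute)
      finally have Sv: "Sn \<gamma>1 \<delta>1 (v \<delta>) \<le> c * m" by (rule power2_le_imp_le) (use c1 m0 in simp)
      let ?w = "W (\<delta> / 4) (v \<delta>)"
      have w: "?w \<in> test_functions \<Omega>" by (rule WD(3)[OF vs \<delta>'(3,4)])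
      note ws = test_function_supported(1)[OF w] and we = test_function_energy(1)[OF \<delta>1(1) w]
      have fe: "f \<delta> \<phi> = f \<delta>1 \<phi>" if "\<phi> \<in> test_functions \<Omega>" for \<phi>
        using f[OF \<delta>(1) \<delta>'(2) that] f[OF \<delta>1 that] by simp
      \<comment> \<open>Legitimate because \<open>v \<delta>\<close> has finite energy at both
        horizons; afterwards only the fixed functional \<open>f \<delta>1\<close> is
        estimated.\<close>
      have "f \<delta> (v \<delta>) = f \<delta>1 (v \<delta>)"
        by (rule datum_independent_of_horizon[OF \<delta>(1) \<delta>1(1) A[OF \<delta>(1) \<delta>'(2)] A[OF \<delta>1] r vs ve
          v(3)[OF \<delta>(1) \<delta>'(2)] v(1)[OF \<delta>1] v(2)[OF \<delta>1] v(3)[OF \<delta>1] fe vs ve lh(1)])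
      then have "\<bar>f \<delta> (v \<delta>) - f0 ?w\<bar> = \<bar>f \<delta>1 (v \<delta>) - f \<delta>1 ?w\<bar>" by (simp only: f[OF \<delta>1 w])
      also have "\<dots> \<le> e1 * Sn \<gamma>1 \<delta>1 (\<lambda>x. v \<delta> x - ?w x) + Cf * l2norm lborel (\<lambda>x. v \<delta> x - ?w x)"
        by (rule le[OF vs lh(1) ws we])
      also have "\<dots> \<le> e1 * k + Cf * (C * (m + m) * \<delta>)"
      proof (intro add_mono mult_left_mono)
        have "Sn \<gamma>1 \<delta>1 ?w \<le> C * (Sn \<gamma>1 \<delta>1 (v \<delta>) + l2norm lborel (v \<delta>))" by (rule WD(5)[OF vs \<delta>1(1) lh(1) \<delta>'(3)])
        also have "\<dots> \<le> C * (c * m + m)" using WD(2) Sv m'(2) by (intro mult_left_mono add_mono) auto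
        finally show "Sn \<gamma>1 \<delta>1 (\<lambda>x. v \<delta> x - ?w x) \<le> k"
          using En_diff(2)[OF \<delta>1(1) vs lh(1) ws we] Sv by (simp add: k_def)
        have "l2norm lborel (\<lambda>x. v \<delta> x - ?w x) \<le> C * (Sn \<gamma>1 \<delta> (v \<delta>) + l2norm lborel (v \<delta>)) * \<delta>"
          unfolding l2norm_minus_commute[of lborel "v \<delta>" ?w] by (rule WD(6)[OF vs \<delta>(1) ve])
        also have "\<dots> \<le> C * (m + m) * \<delta>" using WD(2) \<delta> m' by (intro mult_right_mono mult_left_mono add_mono) auto
        finally show "l2norm lborel (\<lambda>x. v \<delta> x - ?w x) \<le> C * (m + m) * \<delta>" .
      qed (use e1 Cf in auto)
      also have "Cf * (C * (m + m) * \<delta>) = \<delta> * q" by (simp add: q_def)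
      also have "e1 * k + \<delta> * q \<le> e"
      proof -
        have "\<delta> * q \<le> \<delta> * (q + 1)" using \<delta> by (intro mult_left_mono) auto
        also have "\<dots> \<le> e / (2 * (q + 1)) * (q + 1)" using \<delta> \<eta> q0 by (intro mult_right_mono) auto
        also have "\<dots> = e / 2" using q0 by (simp add: field_simps)
        finally show ?thesis using e1k by linarith
      qed
      finally show "\<bar>f \<delta> (v \<delta>) - f0 ?w\<bar> \<le> e" .
    qed
  qed
qed

section \<open>Passage to the limit\<close>

context
  fixes u0 :: "'a \<Rightarrow> real" and G :: "'a \<Rightarrow> 'a"
  assumes cont: "\<And>\<delta>. 0 < \<delta> \<Longrightarrow> \<delta> < \<delta>0 \<Longrightarrow> continuous_on (closure (extended_domain \<Omega> \<delta> \<times> extended_domain \<Omega> \<delta>)) (\<lambda>(x, y). A x y)"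
    and Cp: "0 \<le> Cp" "\<And>\<delta> w. 0 < \<delta> \<Longrightarrow> \<delta> < \<delta>0 \<Longrightarrow> L2_supported \<Omega> w \<Longrightarrow> En \<gamma>1 \<delta> w < \<infinity> \<Longrightarrow>
      (l2norm lborel w)\<^sup>2 \<le> Cp * (Sn \<gamma>1 \<delta> w)\<^sup>2"
    and u0: "sqint (lebesgue_on \<Omega>) u0" "sqint (lebesgue_on \<Omega>) G"
    and G: "\<And>\<phi>. \<phi> \<in> test_functions \<Omega> \<Longrightarrow> (LINT x|lebesgue_on \<Omega>. A x x * (G x \<bullet> gradf \<phi> x)) = f0 \<phi>"
begin

text \<open>With \<open>I w\<close> the local form of \<open>\<phi>\<close> against
  \<open>w\<close>, the datum at \<open>v \<delta>\<close> is close to \<open>f0 ?w\<close>, then to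
  \<open>I ?w\<close>, then to the form of \<open>\<phi>\<close> and \<open>v \<delta>\<close>,
  which is \<open>f0 \<phi>\<close>. The form of \<open>\<phi>\<close> with itself is close to
  \<open>I \<phi>\<close> and so to \<open>f0 \<phi>\<close>.\<close>

lemma energy_distance_to_test_function:
  assumes W: "smoothing W t0 C" and \<phi>: "\<phi> \<in> test_functions \<Omega>" and e: "0 < e" "e \<le> 1"
    and G\<phi>: "l2norm (lebesgue_on \<Omega>) (\<lambda>x. G x - gradf \<phi> x) < e"
  shows "\<forall>\<^sub>F \<delta> in at_right 0. r * (Sn \<gamma>1 \<delta> (\<lambda>x. v \<delta> x - \<phi> x))\<^sup>2
    \<le> (3 + R * (C * (m + m)) + R * (l2norm (lebesgue_on \<Omega>) G + 1)) * e"
proof -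
  note WD = smoothingD[OF W] and m0 = solution_bound_nonneg
  let ?M = "lebesgue_on \<Omega>"
  have h: "0 < \<delta>0 / 2" "\<delta>0 / 2 < \<delta>0" using \<delta>0 by auto
  note a = diagonal_coefficient[OF h(1) A[OF h] r cont[OF h]]
  have aa: "AE x in ?M. \<bar>A x x\<bar> \<le> R"
  proof (rule AE_I2)
    fix x assume "x \<in> space ?M"
    then show "\<bar>A x x\<bar> \<le> R" by (intro a(2)) (simp add: space_restrict_space)
  qed
  note t\<phi> = test_sqint[OF dom \<phi>]
  define I where "I w = (LINT x|?M. A x x * (gradf \<phi> x \<bullet> gradf w x))" for w
  have fI: "\<bar>f0 w - I w\<bar> \<le> R * (e * l2norm lborel (gradf w))" if w: "w \<in> test_functions \<Omega>" for w
  proof -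
    note tw = test_sqint[OF dom w]
    have "f0 w - I w = (LINT x|?M. A x x * (G x \<bullet> gradf w x) - A x x * (gradf \<phi> x \<bullet> gradf w x))"
      unfolding I_def G[OF w, symmetric]
      by (rule Bochner_Integration.integral_diff[symmetric])
        (rule integrable_coeff_inner[OF u0(2) tw(2) a(1) aa], rule integrable_coeff_inner[OF t\<phi>(2) tw(2) a(1) aa])
    also have "\<dots> = (LINT x|?M. A x x * ((G x - gradf \<phi> x) \<bullet> gradf w x))"
      by (simp add: inner_diff_left right_diff_distrib)
    finally have "\<bar>f0 w - I w\<bar> \<le> R * (l2norm ?M (\<lambda>x. G x - gradf \<phi> x) * l2norm ?M (gradf w))"
      using integral_coeff_inner_le[OF sqint_diff(1)[OF u0(2) t\<phi>(2)] tw(2) a(1) aa a(3)] by simp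
    also have "\<dots> \<le> R * (e * l2norm ?M (gradf w))"
      using a(3) G\<phi> by (intro mult_left_mono mult_right_mono) auto
    finally show ?thesis by (simp only: tw(4))
  qed
  have gG: "l2norm lborel (gradf \<phi>) \<le> l2norm ?M G + 1"
  proof -
    have "l2norm ?M (\<lambda>x. G x - (G x - gradf \<phi> x)) \<le> l2norm ?M G + l2norm ?M (\<lambda>x. G x - gradf \<phi> x)"
      by (rule sqint_diff(2)[OF u0(2) sqint_diff(1)[OF u0(2) t\<phi>(2)]])
    then show ?thesis using G\<phi> e(2) by (simp add: t\<phi>(4))
  qed
  obtain C\<phi> where C\<phi>: "0 \<le> C\<phi>" "\<And>\<delta>. 0 < \<delta> \<Longrightarrow> En \<gamma>1 \<delta> \<phi> \<le> ennreal C\<phi>" using En_test_function[OF K \<phi>] by metis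
  have S\<phi>: "Sn \<gamma>1 \<delta> \<phi> \<le> sqrt C\<phi>" if \<delta>: "0 < \<delta>" for \<delta>
    using Sn_sq_le(2)[OF K \<delta> test_functionsD(4)[OF \<phi>] C\<phi>(2)[OF \<delta>] C\<phi>(1)] by (simp add: real_le_rsqrt)
  define m1 where "m1 = m + C * (m + m)"
  define m2 where "m2 = sqrt C\<phi> + l2norm lborel \<phi> + l2norm lborel (gradf \<phi>)"
  have Cm: "0 \<le> C * (m + m)" using WD(2) m0 by simp
  have m1: "0 \<le> m1" "m \<le> m1" "C * (m + m) \<le> m1" using Cm m0 by (auto simp: m1_def)
  have m2: "0 \<le> m2" "sqrt C\<phi> \<le> m2" "l2norm lborel \<phi> \<le> m2" "l2norm lborel (gradf \<phi>) \<le> m2"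
    unfolding m2_def using C\<phi>(1) by auto
  show ?thesis
  proof (rule T_form_consistent[OF \<delta>0 A r cont \<phi> e(1) m1(1)])
    fix \<eta>1 assume \<eta>1: "0 < \<eta>1" "\<eta>1 \<le> \<delta>0"
      and T1: "\<And>\<delta> v w. 0 < \<delta> \<Longrightarrow> \<delta> < \<eta>1 \<Longrightarrow> L2_supported \<Omega> v \<Longrightarrow> En \<gamma>1 \<delta> v < \<infinity> \<Longrightarrow> Sn \<gamma>1 \<delta> v \<le> m1 \<Longrightarrow> l2norm lborel v \<le> m1 \<Longrightarrow>
      w \<in> test_functions \<Omega> \<Longrightarrow> l2norm lborel (\<lambda>x. w x - v x) \<le> m1 * \<delta> \<Longrightarrow> l2norm lborel (gradf w) \<le> m1 \<Longrightarrow>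
      \<bar>T_form \<Omega> \<gamma>1 A \<delta> \<phi> v - (LINT x|?M. A x x * (gradf \<phi> x \<bullet> gradf w x))\<bar> \<le> e"
    show ?thesis
    \<comment> \<open>The second use has \<open>\<phi>\<close> in the roles of both \<open>v\<close>
      and \<open>w\<close>, hence a different common bound, to evaluate the form of
      \<open>\<phi>\<close> with itself.\<close>
    proof (rule T_form_consistent[OF \<delta>0 A r cont \<phi> e(1) m2(1)])
      fix \<eta>2 assume \<eta>2: "0 < \<eta>2" "\<eta>2 \<le> \<delta>0"
        and T2: "\<And>\<delta> v w. 0 < \<delta> \<Longrightarrow> \<delta> < \<eta>2 \<Longrightarrow> L2_supported \<Omega> v \<Longrightarrow> En \<gamma>1 \<delta> v < \<infinity> \<Longrightarrow> Sn \<gamma>1 \<delta> v \<le> m2 \<Longrightarrow> l2norm lborel v \<le> m2 \<Longrightarrow>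
        w \<in> test_functions \<Omega> \<Longrightarrow> l2norm lborel (\<lambda>x. w x - v x) \<le> m2 * \<delta> \<Longrightarrow> l2norm lborel (gradf w) \<le> m2 \<Longrightarrow>
        \<bar>T_form \<Omega> \<gamma>1 A \<delta> \<phi> v - (LINT x|?M. A x x * (gradf \<phi> x \<bullet> gradf w x))\<bar> \<le> e"
      define \<eta> where "\<eta> = min (4 * t0) (min \<eta>1 \<eta>2)"
      have \<eta>: "0 < \<eta>" using WD(1) \<eta>1 \<eta>2 by (simp add: \<eta>_def)
      have "\<forall>\<^sub>F \<delta> in at_right 0. 0 < \<delta> \<and> \<delta> < \<eta>" by (rule eventually_at_rightI[OF _ \<eta>]) simp
      with datum_on_solutions[OF W e(1)] show ?thesis
      proof eventually_elim
        fix \<delta> assume E1: "\<bar>f \<delta> (v \<delta>) - f0 (W (\<delta> / 4) (v \<delta>))\<bar> \<le> e" and "0 < \<delta> \<and> \<delta> < \<eta>"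
        then have \<delta>: "0 < \<delta>" "\<delta> < \<delta>0" "\<delta> < \<eta>1" "\<delta> < \<eta>2" "\<delta> / 4 < t0" "0 < \<delta> / 4"
          using \<eta>1 by (auto simp: \<eta>_def)
        note vs = v(1)[OF \<delta>(1,2)] and ve = v(2)[OF \<delta>(1,2)] and m' = m[OF \<delta>(1,2)]
        note \<phi>s = test_function_supported(1)[OF \<phi>] and \<phi>e = test_function_energy(1)[OF \<delta>(1) \<phi>]
        let ?w = "W (\<delta> / 4) (v \<delta>)"
        have w: "?w \<in> test_functions \<Omega>" by (rule WD(3)[OF vs \<delta>(6,5)])
        have mm: "C * (Sn \<gamma>1 \<delta> (v \<delta>) + l2norm lborel (v \<delta>)) \<le> C * (m + m)"
          by (rule mult_left_mono[OF add_mono[OF m'] WD(2)])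
        have gw: "l2norm lborel (gradf ?w) \<le> C * (m + m)" by (rule order_trans[OF WD(7)[OF vs \<delta>(1) ve \<delta>(5)] mm])
        have "l2norm lborel (\<lambda>x. ?w x - v \<delta> x) \<le> C * (m + m) * \<delta>"
          by (rule order_trans[OF WD(6)[OF vs \<delta>(1) ve] mult_right_mono[OF mm]]) (use \<delta> in simp)
        also have "\<dots> \<le> m1 * \<delta>" by (rule mult_right_mono[OF m1(3)]) (use \<delta> in simp)
        finally have wv: "l2norm lborel (\<lambda>x. ?w x - v \<delta> x) \<le> m1 * \<delta>" .
        have E3: "\<bar>T_form \<Omega> \<gamma>1 A \<delta> \<phi> (v \<delta>) - I ?w\<bar> \<le> e"
          unfolding I_def
          by (rule T1[OF \<delta>(1,3) vs ve order_trans[OF m'(1) m1(2)] order_trans[OF m'(2) m1(2)] w wv order_trans[OF gw m1(3)]])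
        have E4: "\<bar>T_form \<Omega> \<gamma>1 A \<delta> \<phi> \<phi> - I \<phi>\<bar> \<le> e"
          unfolding I_def
        proof (rule T2[OF \<delta>(1,4) \<phi>s \<phi>e order_trans[OF S\<phi>[OF \<delta>(1)] m2(2)] m2(3) \<phi> _ m2(4)])
          show "l2norm lborel (\<lambda>x. \<phi> x - \<phi> x) \<le> m2 * \<delta>" using m2(1) \<delta>(1) by simp
        qed
        have E2: "\<bar>f0 ?w - I ?w\<bar> \<le> R * (e * (C * (m + m)))"
          by (rule order_trans[OF fI[OF w]]) (intro mult_left_mono gw a(3), use e in simp)
        have E5: "\<bar>f0 \<phi> - I \<phi>\<bar> \<le> R * (e * (l2norm ?M G + 1))"
          by (rule order_trans[OF fI[OF \<phi>]]) (intro mult_left_mono gG a(3), use e in simp)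
        have vS: "v \<delta> \<in> S_space \<Omega> \<gamma>1 \<delta>" and \<phi>S: "\<phi> \<in> S_space \<Omega> \<gamma>1 \<delta>"
          using S_space_iff[OF domain_facts(1)[OF dom] K \<delta>(1) vs] ve test_function_energy(2)[OF \<delta>(1) \<phi>] by auto
        have Tv: "T_form \<Omega> \<gamma>1 A \<delta> (v \<delta>) (v \<delta>) = f \<delta> (v \<delta>)" "T_form \<Omega> \<gamma>1 A \<delta> (v \<delta>) \<phi> = f0 \<phi>"
          using v(3)[OF \<delta>(1,2)] vS \<phi>S f[OF \<delta>(1,2) \<phi>] by (auto simp: nonlocal_weak_solution_def)
        note alg = T_form_algebra[OF \<delta>(1) A[OF \<delta>(1,2)] r vs ve \<phi>s \<phi>e]
        have "r * (Sn \<gamma>1 \<delta> (\<lambda>x. v \<delta> x - \<phi> x))\<^sup>2 \<le> f \<delta> (v \<delta>) - 2 * f0 \<phi> + T_form \<Omega> \<gamma>1 A \<delta> \<phi> \<phi>"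
          using T_form_coercive[OF \<delta>(1) A[OF \<delta>(1,2)] r L2_supported_diff[OF vs \<phi>s] En_diff(1)[OF \<delta>(1) vs ve \<phi>s \<phi>e]]
          unfolding alg(2) Tv .
        \<comment> \<open>\<open>E1\<close>, \<open>E3\<close> and \<open>E4\<close> contribute
          \<open>e\<close> each, \<open>E2\<close> and \<open>E5\<close> the two gradient terms; the
          values \<open>f0 \<phi>\<close> cancel with weights 1, -2 and 1.\<close>
        also have "\<dots> \<le> 3 * e + R * (e * (C * (m + m))) + R * (e * (l2norm ?M G + 1))"
          using E1 E2 E3 E4 E5 unfolding alg(1) Tv by linarith
        also have "\<dots> = (3 + R * (C * (m + m)) + R * (l2norm ?M G + 1)) * e" by (simp add: algebra_simps)
        finally show "r * (Sn \<gamma>1 \<delta> (\<lambda>x. v \<delta> x - \<phi> x))\<^sup>2 \<le> (3 + R * (C * (m + m)) + R * (l2norm ?M G + 1)) * e" .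
      qed
    qed
  qed
qed

lemma solutions_converge:
  assumes dense: "\<And>\<epsilon>. 0 < \<epsilon> \<Longrightarrow> \<exists>\<phi>\<in>test_functions \<Omega>. l2norm (lebesgue_on \<Omega>) (\<lambda>x. u0 x - \<phi> x) < \<epsilon> \<and>
        l2norm (lebesgue_on \<Omega>) (\<lambda>x. G x - gradf \<phi> x) < \<epsilon>"
  shows "((\<lambda>\<delta>. l2norm (lebesgue_on \<Omega>) (\<lambda>x. v \<delta> x - u0 x)) \<longlongrightarrow> 0) (at_right 0)"
proof (rule tendstoI)
  fix \<epsilon> :: real assume \<epsilon>: "0 < \<epsilon>"
  let ?M = "lebesgue_on \<Omega>"
  obtain W t0 C where W: "smoothing W t0 C" using smoothing_exists by (elim exE)
  have h: "0 < \<delta>0 / 2" "\<delta>0 / 2 < \<delta>0" using \<delta>0 by auto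
  note R0 = diagonal_coefficient(3)[OF h(1) A[OF h] r cont[OF h]]
  \<comment> \<open>Must be fixed before \<open>\<phi>\<close> is chosen, which is why it contains
    the norm of \<open>G\<close> plus 1 instead of that of the gradient of
    \<open>\<phi>\<close>.\<close>
  define Q where "Q = 3 + R * (C * (m + m)) + R * (l2norm ?M G + 1)"
  have Q: "0 \<le> Q" unfolding Q_def using R0 smoothingD(2)[OF W] solution_bound_nonneg by simp
  define Z where "Z = Cp * Q / r"
  have Z: "0 \<le> Z" using Cp(1) Q r by (simp add: Z_def)
  \<comment> \<open>The 1 validates the bound behind \<open>Q\<close>, the second entry controls
    \<open>u0 - \<phi>\<close>, and the third makes the distance of \<open>v \<delta>\<close> to
    \<open>\<phi>\<close> small after coercivity and the Poincare inequality.\<close>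
  define e where "e = min 1 (min (\<epsilon> / 3) ((\<epsilon> / 3)\<^sup>2 / (Z + 1)))"
  have e: "0 < e" "e \<le> 1" "e \<le> \<epsilon> / 3" "e \<le> (\<epsilon> / 3)\<^sup>2 / (Z + 1)"
    unfolding e_def using \<epsilon> Z by (simp, linarith+)
  have Ze: "Z * e \<le> (\<epsilon> / 3)\<^sup>2"
  proof -
    have "Z * e \<le> (Z + 1) * e" using e by (intro mult_right_mono) auto
    also have "\<dots> \<le> (Z + 1) * ((\<epsilon> / 3)\<^sup>2 / (Z + 1))" using e(4) Z by (intro mult_left_mono) auto
    also have "\<dots> = (\<epsilon> / 3)\<^sup>2" using Z by simp
    finally show ?thesis .
  qed
  obtain \<phi> where \<phi>: "\<phi> \<in> test_functions \<Omega>" "l2norm ?M (\<lambda>x. u0 x - \<phi> x) < e" "l2norm ?M (\<lambda>x. G x - gradf \<phi> x) < e"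
    using dense[OF e(1)] by (elim bexE conjE)
  have "\<forall>\<^sub>F \<delta> in at_right 0. 0 < \<delta> \<and> \<delta> < \<delta>0" by (rule eventually_at_rightI[OF _ \<delta>0]) simp
  with energy_distance_to_test_function[OF W \<phi>(1) e(1,2) \<phi>(3), folded Q_def]
  show "\<forall>\<^sub>F \<delta> in at_right 0. dist (l2norm ?M (\<lambda>x. v \<delta> x - u0 x)) 0 < \<epsilon>"
  proof eventually_elim
    fix \<delta> assume le: "r * (Sn \<gamma>1 \<delta> (\<lambda>x. v \<delta> x - \<phi> x))\<^sup>2 \<le> Q * e" and "0 < \<delta> \<and> \<delta> < \<delta>0"
    then have \<delta>: "0 < \<delta>" "\<delta> < \<delta>0" by auto
    note vs = v(1)[OF \<delta>] and ve = v(2)[OF \<delta>]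
    note \<phi>s = test_function_supported(1)[OF \<phi>(1)] and \<phi>e = test_function_energy(1)[OF \<delta>(1) \<phi>(1)]
    note ds = L2_supported_diff[OF vs \<phi>s] and de = En_diff(1)[OF \<delta>(1) vs ve \<phi>s \<phi>e]
    have "(l2norm lborel (\<lambda>x. v \<delta> x - \<phi> x))\<^sup>2 \<le> Cp * (Sn \<gamma>1 \<delta> (\<lambda>x. v \<delta> x - \<phi> x))\<^sup>2" by (rule Cp(2)[OF \<delta> ds de])
    also have "\<dots> \<le> Cp * (Q * e / r)"
      using le r by (intro mult_left_mono Cp(1)) (simp add: field_simps)
    also have "\<dots> \<le> (\<epsilon> / 3)\<^sup>2" using Ze by (simp add: Z_def)
    finally have "l2norm lborel (\<lambda>x. v \<delta> x - \<phi> x) \<le> \<epsilon> / 3" by (rule power2_le_imp_le) (use \<epsilon> in simp)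
    then have l1: "l2norm ?M (\<lambda>x. v \<delta> x - \<phi> x) \<le> \<epsilon> / 3"
      using L2_norm_supported[OF domain_facts(4)[OF dom] ds] by (simp add: L2_norm_eq)
    have sd: "sqint ?M (\<lambda>x. v \<delta> x - \<phi> x)" by (rule l2norm_lebesgue_on(1)[OF domain_facts(4)[OF dom] ds]) simp
    have "l2norm ?M (\<lambda>x. (v \<delta> x - \<phi> x) - (u0 x - \<phi> x)) \<le> l2norm ?M (\<lambda>x. v \<delta> x - \<phi> x) + l2norm ?M (\<lambda>x. u0 x - \<phi> x)"
      by (rule sqint_diff(2)[OF sd sqint_diff(1)[OF u0(1) test_sqint(1)[OF dom \<phi>(1)]]])
    then have "l2norm ?M (\<lambda>x. v \<delta> x - u0 x) < \<epsilon>" using l1 \<phi>(2) e(3) \<epsilon> by simp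
    then show "dist (l2norm ?M (\<lambda>x. v \<delta> x - u0 x)) 0 < \<epsilon>" by simp
  qed
qed

end

end

end

theorem theorem2p2:
  fixes \<Omega> :: "'a::euclidean_space set"
    and \<gamma>1 :: "real \<Rightarrow> real"
    and A :: "'a \<Rightarrow> 'a \<Rightarrow> real"
    and D0 s r R \<delta>0 :: real
  assumes "bounded_Lipschitz_domain \<Omega>"
    and "kernel_conditions TYPE('a) D0 s \<gamma>1"
    and "0 < \<delta>0" and "uniform_Poincare \<Omega> \<gamma>1 \<delta>0"
    and "0 < r"
  shows
    "(\<forall>\<delta>\<in>{0<..<\<delta>0}. \<forall>f u.
        coefficient_conditions \<Omega> r R A \<delta> \<longrightarrow>
        f \<in> S_dual \<Omega> \<gamma>1 \<delta> \<longrightarrow>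
        nonlocal_weak_solution \<Omega> \<gamma>1 A \<delta> f u \<longrightarrow>
        S_norm \<Omega> \<gamma>1 \<delta> u \<le> S_dual_norm \<Omega> \<gamma>1 \<delta> f / r)
     \<and>
     (\<forall>(f :: real \<Rightarrow> ('a \<Rightarrow> real) \<Rightarrow> real) (f0 :: ('a \<Rightarrow> real) \<Rightarrow> real)
       (u :: real \<Rightarrow> 'a \<Rightarrow> real) (u0 :: 'a \<Rightarrow> real).
        (\<forall>\<delta>\<in>{0<..<\<delta>0}. coefficient_conditions \<Omega> r R A \<delta>) \<longrightarrow>
        consistent_datum \<Omega> \<gamma>1 \<delta>0 f f0 \<longrightarrow>
        (\<forall>\<delta>\<in>{0<..<\<delta>0}. nonlocal_weak_solution \<Omega> \<gamma>1 A \<delta> (f \<delta>) (u \<delta>)) \<longrightarrow>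
        (\<exists>M. \<forall>\<delta>\<in>{0<..<\<delta>0}. S_dual_norm \<Omega> \<gamma>1 \<delta> (f \<delta>) \<le> M) \<longrightarrow>
        (\<forall>\<delta>\<in>{0<..<\<delta>0}.
           continuous_on (closure (extended_domain \<Omega> \<delta> \<times> extended_domain \<Omega> \<delta>))
             (\<lambda>(x, y). A x y)) \<longrightarrow>
        local_weak_solution \<Omega> (\<lambda>x. A x x) f0 u0 \<longrightarrow>
        ((\<lambda>\<delta>. L2_norm \<Omega> (\<lambda>x. u \<delta> x - u0 x)) \<longlongrightarrow> 0) (at_right 0))"
proof (intro conjI ballI allI impI)
  fix \<delta> f u assume "\<delta> \<in> {0<..<\<delta>0}" and h: "coefficient_conditions \<Omega> r R A \<delta>" "f \<in> S_dual \<Omega> \<gamma>1 \<delta>"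
    "nonlocal_weak_solution \<Omega> \<gamma>1 A \<delta> f u"
  then have \<delta>: "0 < \<delta>" by simp
  show "S_norm \<Omega> \<gamma>1 \<delta> u \<le> S_dual_norm \<Omega> \<gamma>1 \<delta> f / r" by (rule stability[OF assms(1,2) \<delta> h(1) assms(5) h(2,3)])
next
  fix f :: "real \<Rightarrow> ('a \<Rightarrow> real) \<Rightarrow> real" and f0 :: "('a \<Rightarrow> real) \<Rightarrow> real"
    and u :: "real \<Rightarrow> 'a \<Rightarrow> real" and u0 :: "'a \<Rightarrow> real"
  assume A: "\<forall>\<delta>\<in>{0<..<\<delta>0}. coefficient_conditions \<Omega> r R A \<delta>" and f: "consistent_datum \<Omega> \<gamma>1 \<delta>0 f f0"
    and u: "\<forall>\<delta>\<in>{0<..<\<delta>0}. nonlocal_weak_solution \<Omega> \<gamma>1 A \<delta> (f \<delta>) (u \<delta>)"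
    and M: "\<exists>M. \<forall>\<delta>\<in>{0<..<\<delta>0}. S_dual_norm \<Omega> \<gamma>1 \<delta> (f \<delta>) \<le> M"
    and cont: "\<forall>\<delta>\<in>{0<..<\<delta>0}. continuous_on (closure (extended_domain \<Omega> \<delta> \<times> extended_domain \<Omega> \<delta>)) (\<lambda>(x, y). A x y)"
    and u0: "local_weak_solution \<Omega> (\<lambda>x. A x x) f0 u0"
  note dom = assms(1) and K = assms(2) and r = assms(5)
  have A': "coefficient_conditions \<Omega> r R A \<delta>" if "0 < \<delta>" "\<delta> < \<delta>0" for \<delta> using bspec[OF A, of \<delta>] that by simp
  have u': "nonlocal_weak_solution \<Omega> \<gamma>1 A \<delta> (f \<delta>) (u \<delta>)" if "0 < \<delta>" "\<delta> < \<delta>0" for \<delta> using bspec[OF u, of \<delta>] that by simp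
  have cont': "continuous_on (closure (extended_domain \<Omega> \<delta> \<times> extended_domain \<Omega> \<delta>)) (\<lambda>(x, y). A x y)"
    if "0 < \<delta>" "\<delta> < \<delta>0" for \<delta> using bspec[OF cont, of \<delta>] that by simp
  have fd: "f \<delta> \<in> S_dual \<Omega> \<gamma>1 \<delta>" "\<phi> \<in> test_functions \<Omega> \<Longrightarrow> f \<delta> \<phi> = f0 \<phi>" if "0 < \<delta>" "\<delta> < \<delta>0" for \<delta> \<phi>
    using f that by (auto simp: consistent_datum_def)
  obtain M where M: "\<forall>\<delta>\<in>{0<..<\<delta>0}. S_dual_norm \<Omega> \<gamma>1 \<delta> (f \<delta>) \<le> M" using M by (elim exE)
  obtain C where C: "\<forall>\<delta>\<in>{0<..<\<delta>0}. \<forall>v\<in>S_space \<Omega> \<gamma>1 \<delta>. (L2_norm \<Omega> v)\<^sup>2 \<le> C * (S_norm \<Omega> \<gamma>1 \<delta> v)\<^sup>2"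
    using assms(4)[unfolded uniform_Poincare_def] by (elim exE)
  \<comment> \<open>The Poincare constant comes without a sign; its absolute value is safe in
    monotonicity arguments.\<close>
  have Cp: "(l2norm lborel w)\<^sup>2 \<le> \<bar>C\<bar> * (Sn \<gamma>1 \<delta> w)\<^sup>2"
    if \<delta>: "0 < \<delta>" "\<delta> < \<delta>0" and w: "L2_supported \<Omega> w" "En \<gamma>1 \<delta> w < \<infinity>" for \<delta> w
  proof -
    have wS: "w \<in> S_space \<Omega> \<gamma>1 \<delta>" using S_space_iff[OF domain_facts(1)[OF dom] K \<delta>(1) w(1)] w(2) by simp
    have "(L2_norm \<Omega> w)\<^sup>2 \<le> C * (S_norm \<Omega> \<gamma>1 \<delta> w)\<^sup>2" by (rule bspec[OF bspec[OF C] wS]) (use \<delta> in simp)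
    also have "\<dots> \<le> \<bar>C\<bar> * (S_norm \<Omega> \<gamma>1 \<delta> w)\<^sup>2" by (rule mult_right_mono) simp_all
    finally show ?thesis
      unfolding L2_norm_supported[OF domain_facts(4)[OF dom] w(1)] S_norm_eq_Sn[OF domain_facts(1)[OF dom] K \<delta>(1) w(1)] .
  qed
  \<comment> \<open>Borel representatives are selected for all horizons at once, so that the limit
    concerns a single family.\<close>
  define Q where "Q \<delta> v \<longleftrightarrow> L2_supported \<Omega> v \<and> En \<gamma>1 \<delta> v < \<infinity> \<and> nonlocal_weak_solution \<Omega> \<gamma>1 A \<delta> (f \<delta>) v \<and>
    (AE x in lebesgue_on (extended_domain \<Omega> \<delta>). u \<delta> x = v x)" for \<delta> v
  have "\<forall>\<delta>\<in>{0<..<\<delta>0}. \<exists>v. Q \<delta> v"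
  proof
    fix \<delta> assume "\<delta> \<in> {0<..<\<delta>0}"
    then have \<delta>: "0 < \<delta>" "\<delta> < \<delta>0" by auto
    show "\<exists>v. Q \<delta> v"
    proof (rule weak_solution_representative[OF dom K \<delta>(1) u'[OF \<delta>]])
      fix v assume "L2_supported \<Omega> v" "En \<gamma>1 \<delta> v < \<infinity>" "nonlocal_weak_solution \<Omega> \<gamma>1 A \<delta> (f \<delta>) v"
        "AE x in lebesgue_on (extended_domain \<Omega> \<delta>). u \<delta> x = v x"
      then show "\<exists>v. Q \<delta> v" unfolding Q_def by (intro exI[of _ v] conjI)
    qed
  qed
  from bchoice[OF this] obtain v where v: "\<forall>\<delta>\<in>{0<..<\<delta>0}. Q \<delta> (v \<delta>)" by (elim exE)
  have Qv: "Q \<delta> (v \<delta>)" if "0 < \<delta>" "\<delta> < \<delta>0" for \<delta> using bspec[OF v, of \<delta>] that by simp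
  have v': "L2_supported \<Omega> (v \<delta>)" "En \<gamma>1 \<delta> (v \<delta>) < \<infinity>" "nonlocal_weak_solution \<Omega> \<gamma>1 A \<delta> (f \<delta>) (v \<delta>)"
    "AE x in lebesgue_on (extended_domain \<Omega> \<delta>). u \<delta> x = v \<delta> x" if "0 < \<delta>" "\<delta> < \<delta>0" for \<delta>
    using Qv[OF that] unfolding Q_def by simp_all
  define m0 where "m0 = \<bar>M\<bar> / r"
  \<comment> \<open>\<open>m0\<close> is the stability bound on the energy norm and the second
    summand its Poincare consequence; the sum bounds both norms, as the convergence argument
    expects.\<close>
  define m where "m = m0 + sqrt \<bar>C\<bar> * m0"
  have m0: "0 \<le> m0" "m0 \<le> m" "sqrt \<bar>C\<bar> * m0 \<le> m" using r by (auto simp: m0_def m_def)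
  have Sv: "Sn \<gamma>1 \<delta> (v \<delta>) \<le> m0" if \<delta>: "0 < \<delta>" "\<delta> < \<delta>0" for \<delta>
  proof -
    have "Sn \<gamma>1 \<delta> (v \<delta>) \<le> S_dual_norm \<Omega> \<gamma>1 \<delta> (f \<delta>) / r"
      using stability[OF dom K \<delta>(1) A'[OF \<delta>] r fd(1)[OF \<delta>] v'(3)[OF \<delta>]]
      unfolding S_norm_eq_Sn[OF domain_facts(1)[OF dom] K \<delta>(1) v'(1)[OF \<delta>]] .
    also have "\<dots> \<le> \<bar>M\<bar> / r" using bspec[OF M, of \<delta>] \<delta> r by (intro divide_right_mono) auto
    finally show ?thesis by (simp add: m0_def)
  qed
  have lv: "l2norm lborel (v \<delta>) \<le> m" if \<delta>: "0 < \<delta>" "\<delta> < \<delta>0" for \<delta>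
  proof -
    have "(l2norm lborel (v \<delta>))\<^sup>2 \<le> \<bar>C\<bar> * (Sn \<gamma>1 \<delta> (v \<delta>))\<^sup>2" by (rule Cp[OF \<delta> v'(1,2)[OF \<delta>]])
    also have "\<dots> \<le> \<bar>C\<bar> * m0\<^sup>2" using Sv[OF \<delta>] by (intro mult_left_mono power_mono) auto
    also have "\<dots> = (sqrt \<bar>C\<bar> * m0)\<^sup>2" by (simp add: power_mult_distrib)
    finally have "l2norm lborel (v \<delta>) \<le> sqrt \<bar>C\<bar> * m0" by (rule power2_le_imp_le) (use m0(1) in simp)
    then show ?thesis using m0(3) by linarith
  qed
  have conv: "((\<lambda>\<delta>. l2norm (lebesgue_on \<Omega>) (\<lambda>x. v \<delta> x - u0 x)) \<longlongrightarrow> 0) (at_right 0)"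
  proof (rule local_weak_solution_test[OF dom u0])
    fix G assume G: "sqint (lebesgue_on \<Omega>) u0" "sqint (lebesgue_on \<Omega>) G"
      "\<And>\<phi>. \<phi> \<in> test_functions \<Omega> \<Longrightarrow> (LINT x|lebesgue_on \<Omega>. A x x * (G x \<bullet> gradf \<phi> x)) = f0 \<phi>"
      "\<And>\<epsilon>. 0 < \<epsilon> \<Longrightarrow> \<exists>\<phi>\<in>test_functions \<Omega>. l2norm (lebesgue_on \<Omega>) (\<lambda>x. u0 x - \<phi> x) < \<epsilon> \<and>
          l2norm (lebesgue_on \<Omega>) (\<lambda>x. G x - gradf \<phi> x) < \<epsilon>"
    show ?thesis
    proof (rule solutions_converge[where A = A and R = R and ?\<gamma>1.0 = \<gamma>1 and f = f and ?f0.0 = f0 and G = G and m = m and Cp = "\<bar>C\<bar>" and ?\<delta>0.0 = \<delta>0, OF dom K assms(3) r])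
      show "Sn \<gamma>1 \<delta> (v \<delta>) \<le> m" if "0 < \<delta>" "\<delta> < \<delta>0" for \<delta> using Sv[OF that] m0(2) by linarith
    qed (fact A' fd(2) v' lv cont' abs_ge_zero Cp G)+
  qed
  note open_\<Omega> = domain_facts(1)[OF dom] and D = domain_facts(4)[OF dom]
  have "L2_norm \<Omega> (\<lambda>x. u \<delta> x - u0 x) = l2norm (lebesgue_on \<Omega>) (\<lambda>x. v \<delta> x - u0 x)" if \<delta>: "0 < \<delta>" "\<delta> < \<delta>0" for \<delta>
  proof -
    have "AE x in lborel. x \<in> extended_domain \<Omega> \<delta> \<longrightarrow> u \<delta> x = v \<delta> x"
      using v'(4)[OF \<delta>] unfolding AE_lebesgue_on[OF extended_domain_borel(1)[OF open_\<Omega>]] .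
    then have ae: "AE x in lborel. x \<in> \<Omega> \<longrightarrow> u \<delta> x = v \<delta> x" by eventually_elim (simp add: extended_domain_def)
    show ?thesis unfolding L2_norm_eq
    proof (rule l2norm_cong_AE)
      have u0m: "u0 \<in> borel_measurable (lebesgue_on \<Omega>)"
        by (rule local_weak_solution_test[OF dom u0]) (erule sqint_measurable)
      show "(\<lambda>x. u \<delta> x - u0 x) \<in> borel_measurable (lebesgue_on \<Omega>)"
        by (rule borel_measurable_diff[OF sqint_measurable[OF l2norm_lebesgue_on(1)[OF D v'(1)[OF \<delta>] ae]] u0m])
      show "(\<lambda>x. v \<delta> x - u0 x) \<in> borel_measurable (lebesgue_on \<Omega>)"
        by (rule borel_measurable_diff[OF sqint_measurable[OF l2norm_lebesgue_on(1)[OF D v'(1)[OF \<delta>]]] u0m]) simp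
      show "AE x in lebesgue_on \<Omega>. u \<delta> x - u0 x = v \<delta> x - u0 x"
        unfolding AE_lebesgue_on[OF D] using ae by eventually_elim simp
    qed
  qed
  then have "\<forall>\<^sub>F \<delta> in at_right 0. L2_norm \<Omega> (\<lambda>x. u \<delta> x - u0 x) = l2norm (lebesgue_on \<Omega>) (\<lambda>x. v \<delta> x - u0 x)"
    by (intro eventually_at_rightI[OF _ assms(3)]) simp
  then show "((\<lambda>\<delta>. L2_norm \<Omega> (\<lambda>x. u \<delta> x - u0 x)) \<longlongrightarrow> 0) (at_right 0)"
    using conv by (subst tendsto_cong)
qed

end
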